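(* Let $d\ge 1$, $\alpha\ge 1$, and let $\Gamma=\{1,\dots,J\}$ with $J\in\mathbb N\cup\{\infty\}$ (where $\{1,\dots,\infty\}$ means $\mathbb N$). Let $k_j\in\mathbb R^d$, $j\in\Gamma$, be pairwise distinct and assume $$\inf\{|k_\ell-k_m|:\ \ell,m\in\Gamma,\ \ell\ne m\}>0 .$$ Let $a_j:\mathbb R^d\to\mathbb C$, $j\in\Gamma$, be independent of $\varepsilon$, with $a_j\in L^2(\mathbb R^d)$ for every $j$, $a=(a_j)_{j\in\Gamma}\in\mathcal A(\mathbb R^d)$, and $(\partial_x^p a_j)_{j\in\Gamma}\in\mathcal A(\mathbb R^d)$ for all multi-indices $|p|\le 2$. Let $K$ be a real-valued interaction kernel on $\mathbb R^d$ with $(1+|\xi|)\widehat K(\xi)\in L^\infty(\mathbb R^d)$. For $\varepsilon>0$ consider the Cauchy problem $$ i\varepsilon\,\partial_t u^\varepsilon=-\frac{\varepsilon^2}{2}\Delta u^\varepsilon+\varepsilon^\alpha\,\big(K\ast|u^\varepsilon|^2\big)u^\varepsilon,\qquad u^\varepsilon\big|_{t=0}=u_0^\varepsilon,\qquad u_0^\varepsilon(x)=\sum_{j=1}^J a_j(x)e^{ik_j\cdot x/\varepsilon}.$$ Then for every $T>0$ there exist $C>0$ and $\varepsilon_0>0$ such that for every $\varepsilon\in(0,\varepsilon_0)$ the exact solution $u^\varepsilon$ of this Cauchy problem exists on $[0,T]$ and satisfies $$\|u^\varepsilon-u^\varepsilon_{\rm app}\|_{L^\infty([0,T]\times\mathbb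 R^d)}\le C\varepsilon^\beta,\qquad \beta=\begin{cases}1&\text{if }\alpha\in\{1\}\cup[2,\infty),\\ \alpha-1&\text{if }\alpha\in(1,2),\end{cases}$$ where $$u^\varepsilon_{\rm app}(t,x)=\sum_{j=1}^J a_j(x-tk_j)\,e^{iS_j(t,x)}\,e^{ik_j\cdot x/\varepsilon-it|k_j|^2/(2\varepsilon)},$$ with $S_j\equiv 0$ if $\alpha>1$, and, if $\alpha=1$, $$S_j(t,\cdot)=-\int_0^t\Big(K\ast\sum_{\ell=1}^J\big|a_\ell\big(\cdot+(\tau-t)k_j-\tau k_\ell\big)\big|^2\Big)\,d\tau\ \in\mathbb R .$$
   Context: Fourier transform: $\widehat f(\xi)=(2\pi)^{-d/2}\int_{\mathbb R^d}f(x)e^{-ix\cdot\xi}\,dx$, extended to tempered distributions. Wiener algebra: $W(\mathbb R^d)=\{f\in\mathcal S'(\mathbb R^d;\mathbb C):\ \|f\|_W:=\|\widehat f\|_{L^1(\mathbb R^d)}<\infty\}$, a Banach algebra continuously embedded in $L^\infty(\mathbb R^d)$. The amplitude space is $\mathcal A(\mathbb R^d)=\{a=(a_j)_{j\in\Gamma}:\ (\widehat a_j)_{j\in\Gamma}\in\ell^1(\Gamma;L^1(\mathbb R^d))\}$ with norm $\|a\|_{\mathcal A}=\sum_{j=1}^J\|\widehat a_j\|_{L^1(\mathbb R^d)}$. $\ast$ is convolution in $x\in\mathbb R^d$; for $\widehat K\in L^\infty$ and $f\in W(\mathbb R^d)$, $K\ast f\in W(\mathbb R^d)$ is the function with Fourier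 transform $(2\pi)^{d/2}\widehat K\,\widehat f$. The Cauchy problem is posed in $W(\mathbb R^d)$: a solution on $[0,T]$ is $u^\varepsilon\in C([0,T];W(\mathbb R^d))$ satisfying Duhamel's formula $u^\varepsilon(t)=U^\varepsilon(t)u_0^\varepsilon-i\varepsilon^{\alpha-1}\int_0^tU^\varepsilon(t-\tau)\big((K\ast|u^\varepsilon|^2)u^\varepsilon\big)(\tau)\,d\tau$ with $U^\varepsilon(t)=e^{i\varepsilon\frac t2\Delta}$. The infimum over the empty set (case $J=1$) is $+\infty$. *)

theory Defs
  imports
    "HOL-Analysis.Analysis"
    "HOL-Library.Extended_Nat"
    "HOL-Probability.Essential_Supremum"
begin

text \<open>
  The space \<open>\<real>\<^sup>d\<close> is a type \<open>'a::euclidean_space\<close> with \<open>d = DIM('a)\<close>.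
\<close>

section \<open>Schwartz functions and tempered distributions\<close>

definition pderiv_dir :: "'a::euclidean_space \<Rightarrow> ('a \<Rightarrow> complex) \<Rightarrow> 'a \<Rightarrow> complex"
  where "pderiv_dir b f = (\<lambda>x. frechet_derivative f (at x) b)"

text \<open>
  A multi-index of order \<open>n\<close> is encoded as a list of \<open>n\<close> coordinate directions:
  \<open>[b\<^sub>1, \<dots>, b\<^sub>n]\<close> stands for \<open>\<partial>\<^bsub>b\<^sub>1\<^esub> \<dots> \<partial>\<^bsub>b\<^sub>n\<^esub>\<close>.  Different orderings of a list give the same
  derivative of a Schwartz function or of a tempered distribution.
\<close>

definition pderiv_multi :: "'a::euclidean_space list \<Rightarrow> ('a \<Rightarrow> complex) \<Rightarrow> 'a \<Rightarrow> complex"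
  where "pderiv_multi p f = foldr pderiv_dir p f"

definition schwartz :: "('a::euclidean_space \<Rightarrow> complex) set"
  where "schwartz =
    {\<phi>. \<forall>p\<in>lists Basis. (\<forall>x. pderiv_multi p \<phi> differentiable (at x)) \<and>
          (\<forall>n::nat. bounded (range (\<lambda>x. norm x ^ n *\<^sub>R pderiv_multi p \<phi> x)))}"

definition schwartz_norm :: "nat \<Rightarrow> ('a::euclidean_space \<Rightarrow> complex) \<Rightarrow> real"
  where "schwartz_norm N \<phi> =
    (SUP (p, x) \<in> {p \<in> lists Basis. length p \<le> N} \<times> UNIV.
       (1 + norm x) ^ N * norm (pderiv_multi p \<phi> x))"

text \<open>
  Distributions are functionals on all functions, of which only the values on
  \<^const>\<open>schwartz\<close> matter.
\<close>

type_synonym 'a functional = "('a \<Rightarrow> complex) \<Rightarrow> complex"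

definition tempered :: "'a::euclidean_space functional \<Rightarrow> bool"
  where "tempered F \<longleftrightarrow>
    (\<forall>\<phi>\<in>schwartz. \<forall>\<psi>\<in>schwartz. F (\<lambda>x. \<phi> x + \<psi> x) = F \<phi> + F \<psi>) \<and>
    (\<forall>c. \<forall>\<phi>\<in>schwartz. F (\<lambda>x. c * \<phi> x) = c * F \<phi>) \<and>
    (\<exists>C N. \<forall>\<phi>\<in>schwartz. norm (F \<phi>) \<le> C * schwartz_norm N \<phi>)"

definition real_distribution :: "'a::euclidean_space functional \<Rightarrow> bool"
  where "real_distribution F \<longleftrightarrow> (\<forall>\<phi>\<in>schwartz. range \<phi> \<subseteq> \<real> \<longrightarrow> F \<phi> \<in> \<real>)"

definition dist_of :: "('a::euclidean_space \<Rightarrow> complex) \<Rightarrow> 'a functional"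
  where "dist_of f = (\<lambda>\<phi>. LINT x|lborel. f x * \<phi> x)"

definition pairs_with_schwartz :: "('a::euclidean_space \<Rightarrow> complex) \<Rightarrow> bool"
  where "pairs_with_schwartz f \<longleftrightarrow>
    f \<in> borel_measurable lborel \<and> (\<forall>\<phi>\<in>schwartz. integrable lborel (\<lambda>x. f x * \<phi> x))"

definition represents :: "('a::euclidean_space \<Rightarrow> complex) \<Rightarrow> 'a functional \<Rightarrow> bool"
  where "represents f F \<longleftrightarrow> pairs_with_schwartz f \<and> (\<forall>\<phi>\<in>schwartz. F \<phi> = dist_of f \<phi>)"

definition dist_pderiv_dir :: "'a::euclidean_space \<Rightarrow> 'a functional \<Rightarrow> 'a functional"
  where "dist_pderiv_dir b F = (\<lambda>\<phi>. - F (pderiv_dir b \<phi>))"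

definition dist_pderiv :: "'a::euclidean_space list \<Rightarrow> 'a functional \<Rightarrow> 'a functional"
  where "dist_pderiv p F = foldr dist_pderiv_dir p F"


section \<open>Fourier transform\<close>

definition fourier :: "('a::euclidean_space \<Rightarrow> complex) \<Rightarrow> 'a \<Rightarrow> complex"
  where "fourier f = (\<lambda>\<xi>. complex_of_real ((2 * pi) powr (- (real DIM('a) / 2))) *
           (LINT x|lborel. f x * exp (- (\<i> * complex_of_real (x \<bullet> \<xi>)))))"

definition dist_fourier :: "'a::euclidean_space functional \<Rightarrow> 'a functional"
  where "dist_fourier F = (\<lambda>\<phi>. F (fourier \<phi>))"

text \<open>
  When the Fourier transform of \<open>F\<close> is a function, \<open>hat F\<close> is a Borel representative of it
  (unique up to null sets); otherwise it is unspecified.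
\<close>

definition hat :: "'a::euclidean_space functional \<Rightarrow> 'a \<Rightarrow> complex"
  where "hat F = (SOME g. represents g (dist_fourier F))"


section \<open>Function spaces\<close>

definition L2_fun :: "('a::euclidean_space \<Rightarrow> complex) \<Rightarrow> bool"
  where "L2_fun f \<longleftrightarrow> f \<in> borel_measurable lborel \<and> integrable lborel (\<lambda>x. (norm (f x))\<^sup>2)"

definition Linfty_fun :: "('a::euclidean_space \<Rightarrow> complex) \<Rightarrow> bool"
  where "Linfty_fun f \<longleftrightarrow> f \<in> borel_measurable lborel \<and> (\<exists>M. AE x in lborel. norm (f x) \<le> M)"

definition wiener :: "'a::euclidean_space functional \<Rightarrow> bool"
  where "wiener F \<longleftrightarrow>
    tempered F \<and> (\<exists>g. integrable lborel g \<and> represents g (dist_fourier F))"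

definition wiener_norm :: "'a::euclidean_space functional \<Rightarrow> real"
  where "wiener_norm F = (LINT \<xi>|lborel. norm (hat F \<xi>))"

text \<open>
  Every element of the Wiener algebra is given by exactly one continuous function;
  \<open>wiener_fun\<close> is the set of these continuous representatives.
\<close>

definition wiener_fun :: "('a::euclidean_space \<Rightarrow> complex) set"
  where "wiener_fun =
    {f. continuous_on UNIV f \<and> pairs_with_schwartz f \<and> wiener (dist_of f)}"

definition amplitude :: "nat set \<Rightarrow> (nat \<Rightarrow> 'a::euclidean_space functional) \<Rightarrow> bool"
  where "amplitude \<Gamma> A \<longleftrightarrow>
    (\<forall>j\<in>\<Gamma>. wiener (A j)) \<and> (\<lambda>j. wiener_norm (A j)) summable_on \<Gamma>"

definition wiener_continuous_on :: "real set \<Rightarrow> (real \<Rightarrow> 'a::euclidean_space \<Rightarrow> complex) \<Rightarrow> bool"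
  where "wiener_continuous_on I u \<longleftrightarrow>
    (\<forall>t\<in>I. u t \<in> wiener_fun) \<and>
    (\<forall>t\<in>I. ((\<lambda>s. wiener_norm (dist_of (\<lambda>x. u s x - u t x))) \<longlongrightarrow> 0) (at t within I))"


section \<open>Fourier multipliers, convolution with the kernel, Schroedinger group\<close>

text \<open>The element of the Wiener algebra with Fourier transform \<open>m * hat f\<close>, for \<open>m\<close> in \<open>L\<^sup>\<infinity>\<close>.\<close>

definition fourier_multiplier ::
    "('a::euclidean_space \<Rightarrow> complex) \<Rightarrow> ('a \<Rightarrow> complex) \<Rightarrow> 'a \<Rightarrow> complex"
  where "fourier_multiplier m f =
    (THE h. h \<in> wiener_fun \<and>
       (AE \<xi> in lborel. hat (dist_of h) \<xi> = m \<xi> * hat (dist_of f) \<xi>))"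

definition kernel_conv ::
    "'a::euclidean_space functional \<Rightarrow> ('a \<Rightarrow> complex) \<Rightarrow> 'a \<Rightarrow> complex"
  where "kernel_conv K =
    fourier_multiplier (\<lambda>\<xi>. complex_of_real ((2 * pi) powr (real DIM('a) / 2)) * hat K \<xi>)"

definition schroedinger_group ::
    "real \<Rightarrow> real \<Rightarrow> ('a::euclidean_space \<Rightarrow> complex) \<Rightarrow> 'a \<Rightarrow> complex"
  where "schroedinger_group \<epsilon> t =
    fourier_multiplier (\<lambda>\<xi>. exp (- (\<i> * complex_of_real (\<epsilon> * t / 2 * (norm \<xi>)\<^sup>2))))"


section \<open>The Cauchy problem\<close>

text \<open>
  The integrand of Duhamel's formula is a continuous function of \<open>\<tau>\<close> with values in the Wiener
  algebra, on which evaluation at \<open>x\<close> is a continuous functional; the integral is therefore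
  written pointwise in \<open>x\<close>.
\<close>

definition hartree_solution ::
    "'a::euclidean_space functional \<Rightarrow> real \<Rightarrow> real \<Rightarrow> ('a \<Rightarrow> complex) \<Rightarrow> real \<Rightarrow>
     (real \<Rightarrow> 'a \<Rightarrow> complex) \<Rightarrow> bool"
  where "hartree_solution K \<alpha> \<epsilon> u0 T u \<longleftrightarrow>
    wiener_continuous_on {0..T} u \<and>
    (\<forall>t\<in>{0..T}. \<forall>x.
       u t x = schroedinger_group \<epsilon> t u0 x
         - \<i> * complex_of_real (\<epsilon> powr (\<alpha> - 1)) *
           (LINT \<tau>:{0..t}|lborel.
              schroedinger_group \<epsilon> (t - \<tau>)
                (\<lambda>y. kernel_conv K (\<lambda>z. complex_of_real ((norm (u \<tau> z))\<^sup>2)) y * u \<tau> y) x))"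

definition initial_data ::
    "nat set \<Rightarrow> (nat \<Rightarrow> 'a::euclidean_space) \<Rightarrow> (nat \<Rightarrow> 'a \<Rightarrow> complex) \<Rightarrow> real \<Rightarrow> 'a \<Rightarrow> complex"
  where "initial_data \<Gamma> k a \<epsilon> =
    (\<lambda>x. \<Sum>\<^sub>\<infinity>j\<in>\<Gamma>. a j x * exp (\<i> * complex_of_real ((k j \<bullet> x) / \<epsilon>)))"


section \<open>The approximate solution\<close>

definition phase_shift ::
    "'a::euclidean_space functional \<Rightarrow> real \<Rightarrow> nat set \<Rightarrow> (nat \<Rightarrow> 'a) \<Rightarrow> (nat \<Rightarrow> 'a \<Rightarrow> complex) \<Rightarrow>
     nat \<Rightarrow> real \<Rightarrow> 'a \<Rightarrow> complex"
  where "phase_shift K \<alpha> \<Gamma> k a j t x =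
    (if \<alpha> = 1
     then - (LINT \<tau>:{0..t}|lborel.
               kernel_conv K
                 (\<lambda>y. \<Sum>\<^sub>\<infinity>l\<in>\<Gamma>. complex_of_real
                        ((norm (a l (y + (\<tau> - t) *\<^sub>R k j - \<tau> *\<^sub>R k l)))\<^sup>2)) x)
     else 0)"

definition approx_solution ::
    "'a::euclidean_space functional \<Rightarrow> real \<Rightarrow> nat set \<Rightarrow> (nat \<Rightarrow> 'a) \<Rightarrow> (nat \<Rightarrow> 'a \<Rightarrow> complex) \<Rightarrow>
     real \<Rightarrow> real \<Rightarrow> 'a \<Rightarrow> complex"
  where "approx_solution K \<alpha> \<Gamma> k a \<epsilon> t x =
    (\<Sum>\<^sub>\<infinity>j\<in>\<Gamma>. a j (x - t *\<^sub>R k j) * exp (\<i> * phase_shift K \<alpha> \<Gamma> k a j t x) *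
       exp (\<i> * complex_of_real ((k j \<bullet> x) / \<epsilon> - t * (norm (k j))\<^sup>2 / (2 * \<epsilon>))))"

definition error_exponent :: "real \<Rightarrow> real"
  where "error_exponent \<alpha> = (if \<alpha> = 1 \<or> 2 \<le> \<alpha> then 1 else \<alpha> - 1)"

text \<open>The norm of \<open>L\<^sup>\<infinity>([0,T] \<times> \<real>\<^sup>d)\<close>, which is \<open>\<infinity>\<close> for a non-measurable function.\<close>

definition Linfty_norm_slab :: "real \<Rightarrow> (real \<Rightarrow> 'a::euclidean_space \<Rightarrow> complex) \<Rightarrow> ereal"
  where "Linfty_norm_slab T f =
    esssup (restrict_space lborel ({0..T} \<times> UNIV)) (\<lambda>(t, x). ereal (norm (f t x)))"

end

theory Submission
  imports "HOL-Probability.Characteristic_Functions" "HOL-Probability.Sinc_Integral" "HOL-Real_Asymp.Real_Asymp" Defs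
begin

text \<open>
  On the Fourier side the Wiener algebra is \<open>L\<^sup>1\<close> under convolution, and \<open>K \<ast> (-)\<close>, the Schroedinger
  group \<open>U\<close> and translations are multiplications by bounded symbols.  In the interaction picture
  \<open>v(t) = U(-t) u(t)\<close> the equation is an ordinary differential equation with a locally Lipschitz vector
  field.  Such an equation has an exact solution in a tube around any approximate solution whose
  defect is small enough, so existence on \<open>[0, T]\<close> and the error bound come together, without
  continuation or conservation laws.

  Let \<open>E\<^sub>j\<close> be multiplication by \<open>e\<^bsup>i k\<^sub>j \<cdot> x / \<epsilon>\<^esup>\<close> and let \<open>A\<^sub>j(t)\<close> be \<open>a\<^sub>j e\<^bsup>i S\<^sub>j\<^esup>\<close> in the frame moving
  with velocity \<open>k\<^sub>j\<close>.  By Galilean invariance \<open>U(-t) u\<^sub>a\<^sub>p\<^sub>p(t) = \<Sum>\<^sub>j E\<^sub>j U(-t) A\<^sub>j(t)\<close>.  Its defect has two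
  sources.  Replacing \<open>U(-t)\<close> by the identity on an amplitude costs \<open>O(\<epsilon>)\<close> times two derivatives, and
  the amplitudes keep two derivatives because the weight \<open>(1 + |\<xi>|)\<^sup>2\<close> again defines a Banach algebra.
  The cross terms of \<open>|u\<^sub>a\<^sub>p\<^sub>p|\<^sup>2\<close> oscillate with frequency \<open>(k\<^sub>l - k\<^sub>m) / \<epsilon>\<close> bounded below by a multiple of
  \<open>1 / \<epsilon>\<close>, where the decay of the symbol of \<open>K\<close> gains a factor \<open>\<epsilon>\<close> at the price of one derivative.
  The diagonal terms are cancelled exactly by the phases \<open>S\<^sub>j\<close> if \<open>\<alpha> = 1\<close>; if \<open>\<alpha> > 1\<close> the whole
  nonlinearity is \<open>O(\<epsilon>\<^bsup>\<alpha> - 1\<^esup>)\<close>.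
\<close>

section \<open>Gaussian integrals and uniqueness of the Fourier transform\<close>

text \<open>The equation is solved in the plain algebra although the amplitudes live in the weighted
  one: multiplication by \<open>E_j\<close> shifts the spectrum by \<open>k_j / \<epsilon>\<close>
  and is an isometry only for weight 1. Derivatives are therefore always spent on the unmodulated
  amplitudes, whose norms do not see \<epsilon>. The third factor of the nonlinearity adds no
  resonance condition: a product of two different modes is already of size \<epsilon> in norm after
  convolution with the kernel, so no oscillating phase is integrated in time. One gap for all pairs
  gives one constant, and the double series is bounded by a square of the sum of the norms. The
  algebra has no unit in which to form \<open>exp (i S_j)\<close>; the amplitudes are solutions of
  linear equations and are identified pointwise afterwards. A separate obstacle is the language of
  the statement: \<open>hat\<close> is an arbitrary choice up to null sets,
  \<open>fourier_multiplier\<close> a definite description, and the amplitudes are fixed only almost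
  everywhere. Gaussians translate between these notions and the concrete algebra, because translated
  Gaussians are the Fourier transforms of modulated ones.\<close>

lemma
  fixes f :: "'a::euclidean_space \<Rightarrow> 'b::{banach, second_countable_topology}"
  assumes "c \<noteq> 0"
  shows integrable_lborel_affine_iff: "integrable lborel (\<lambda>x. f (t + c *\<^sub>R x)) \<longleftrightarrow> integrable lborel f"
    and integral_lborel_affine: "(LINT x|lborel. f x) = \<bar>c\<bar> ^ DIM('a) *\<^sub>R (LINT x|lborel. f (t + c *\<^sub>R x))"
proof -
  have imp: "integrable lborel (\<lambda>x. g (s + b *\<^sub>R x))" if "integrable lborel g" "b \<noteq> 0"
    for g :: "'a \<Rightarrow> 'b" and b s
  proof -
    have g: "integrable (density (distr lborel borel (\<lambda>x. s + b *\<^sub>R x)) (\<lambda>_. \<bar>b\<bar> ^ DIM('a))) g"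
      using that by (simp flip: lborel_affine)
    have [measurable]: "g \<in> borel_measurable borel" using that by auto
    have "integrable (distr lborel borel (\<lambda>x. s + b *\<^sub>R x)) (\<lambda>x. \<bar>b\<bar> ^ DIM('a) *\<^sub>R g x)"
      using g by (subst (asm) integrable_density) (auto simp: )
    then have "integrable lborel (\<lambda>x. \<bar>b\<bar> ^ DIM('a) *\<^sub>R g (s + b *\<^sub>R x))"
      by (subst (asm) integrable_distr_eq) auto
    then have "integrable lborel (\<lambda>x. inverse (\<bar>b\<bar> ^ DIM('a)) *\<^sub>R \<bar>b\<bar> ^ DIM('a) *\<^sub>R g (s + b *\<^sub>R x))"
      by (rule integrable_scaleR_right)
    then show ?thesis using that by simp
  qed
  show iff: "integrable lborel (\<lambda>x. f (t + c *\<^sub>R x)) \<longleftrightarrow> integrable lborel f"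
  proof
    assume "integrable lborel (\<lambda>x. f (t + c *\<^sub>R x))"
    from imp[OF this, of "1/c" "- (1/c) *\<^sub>R t"] assms
    show "integrable lborel f" by (simp add: algebra_simps)
  qed (use imp assms in auto)
  show "(LINT x|lborel. f x) = \<bar>c\<bar> ^ DIM('a) *\<^sub>R (LINT x|lborel. f (t + c *\<^sub>R x))"
  proof (cases "integrable lborel f")
    case True
    then have [measurable]: "f \<in> borel_measurable borel" by auto
    have "(LINT x|lborel. f x) = (LINT x|density (distr lborel borel (\<lambda>x. t + c *\<^sub>R x)) (\<lambda>_. \<bar>c\<bar> ^ DIM('a)). f x)"
      using assms by (subst lborel_affine[symmetric]) auto
    also have "\<dots> = (LINT x|distr lborel borel (\<lambda>x. t + c *\<^sub>R x). \<bar>c\<bar> ^ DIM('a) *\<^sub>R f x)"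
      by (subst integral_density) auto
    also have "\<dots> = (LINT x|lborel. \<bar>c\<bar> ^ DIM('a) *\<^sub>R f (t + c *\<^sub>R x))"
      by (subst integral_distr) auto
    finally show ?thesis by simp
  next
    case False
    then show ?thesis using iff by (simp add: not_integrable_integral_eq)
  qed
qed

lemma
  fixes f :: "'a::euclidean_space \<Rightarrow> 'b::{banach, second_countable_topology}"
  shows integrable_lborel_shift_iff: "integrable lborel (\<lambda>x. f (x - t)) \<longleftrightarrow> integrable lborel f"
    and integral_lborel_shift: "(LINT x|lborel. f (x - t)) = (LINT x|lborel. f x)"
    and integrable_lborel_reflect_iff: "integrable lborel (\<lambda>x. f (t - x)) \<longleftrightarrow> integrable lborel f"
    and integral_lborel_reflect: "(LINT x|lborel. f (t - x)) = (LINT x|lborel. f x)"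
  using integrable_lborel_affine_iff[of 1 f "-t"] integral_lborel_affine[of 1 f "-t"]
    integrable_lborel_affine_iff[of "-1" f t] integral_lborel_affine[of "-1" f t]
  by simp_all

lemma AE_lborel_shift:
  fixes t :: "'a::euclidean_space"
  assumes "AE x in lborel. P x"
  shows "AE x in lborel. P (x - t)"
proof -
  have "lborel = distr lborel borel (\<lambda>x. - t + x)"
    using lborel_affine[of 1 "-t"] by (simp add: density_1)
  then have "AE x in distr lborel borel (\<lambda>x. - t + x). P x" using assms by metis
  then have "AE x in lborel. P (- t + x)" by (rule AE_distrD[rotated]) simp
  then show ?thesis by simp
qed

lemma AE_lborel_uminus:
  assumes "AE x in lborel. P (x::'a::euclidean_space)"
  shows "AE x in lborel. P (- x)"
proof -
  have "lborel = distr lborel borel (\<lambda>x::'a. - x)"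
    using lborel_affine[of "-1" "0::'a"] by (simp add: density_1)
  then have "AE x in distr lborel borel (\<lambda>x::'a. - x). P x" using assms by metis
  then show ?thesis by (rule AE_distrD[rotated]) simp
qed

text \<open>Lebesgue measure on a Euclidean space is the image of the product measure over
  \<open>Basis\<close>, so a product of functions of single coordinates integrates factor by
  factor.\<close>

lemma
  fixes f :: "'a::euclidean_space \<Rightarrow> real \<Rightarrow> 'b::{real_normed_field, banach, second_countable_topology}"
  assumes int: "\<And>b. b \<in> Basis \<Longrightarrow> integrable lborel (f b)"
  shows integrable_lborel_prod_Basis: "integrable lborel (\<lambda>x::'a. \<Prod>b\<in>Basis. f b (x \<bullet> b))"
    and integral_lborel_prod_Basis:
      "(LINT x|lborel. (\<Prod>b\<in>(Basis::'a set). f b (x \<bullet> b))) = (\<Prod>b\<in>Basis. (LINT x|lborel. f b x))"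
proof -
  interpret product_sigma_finite "\<lambda>b::'a. lborel :: real measure" by standard
  have [measurable]: "f b \<in> borel_measurable borel" if "b \<in> Basis" for b
    using int[OF that] by auto
  have m: "(\<lambda>x::'a. \<Prod>b\<in>Basis. f b (x \<bullet> b)) \<in> borel_measurable borel"
    by (intro borel_measurable_prod) (use \<open>\<And>b. b \<in> Basis \<Longrightarrow> f b \<in> borel_measurable borel\<close> in measurable)
  have d: "(\<lambda>g. \<Sum>b\<in>Basis. g b *\<^sub>R b) \<in> (\<Pi>\<^sub>M b\<in>(Basis::'a set). lborel) \<rightarrow>\<^sub>M borel"
    by measurable
  have eq: "(\<Prod>b\<in>Basis. f b ((\<Sum>b\<in>Basis. g b *\<^sub>R b) \<bullet> b)) = (\<Prod>b\<in>Basis. f b (g b))" for g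
    by (intro prod.cong) (auto simp: inner_sum_left inner_Basis if_distrib cong: if_cong)
  have i: "integrable (\<Pi>\<^sub>M b\<in>(Basis::'a set). lborel) (\<lambda>g. \<Prod>b\<in>Basis. f b (g b))"
    by (intro product_integrable_prod int) auto
  show "integrable lborel (\<lambda>x::'a. \<Prod>b\<in>Basis. f b (x \<bullet> b))"
    by (subst lborel_eq, subst integrable_distr_eq[OF d m]) (simp only: eq i)
  show "(LINT x|lborel. (\<Prod>b\<in>(Basis::'a set). f b (x \<bullet> b))) = (\<Prod>b\<in>Basis. (LINT x|lborel. f b x))"
    by (subst lborel_eq, subst integral_distr[OF d m], simp only: eq)
       (rule product_integral_prod, auto intro: int)
qed

lemma borel_measurable_cis [measurable (raw)]:
  "f \<in> borel_measurable M \<Longrightarrow> (\<lambda>x. cis (f x)) \<in> borel_measurable M"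
  by (rule borel_measurable_continuous_on[of cis]) (auto intro: continuous_intros)

text \<open>This is the characteristic function of the standard normal distribution after the
  substitution \<open>x \<mapsto> c * x\<close>, where \<open>c = sqrt (2 * s)\<close> turns the
  exponent \<open>x^2 / 2\<close> into \<open>s * x^2\<close>.\<close>

lemma has_bochner_integral_gaussian_cis_1d:
  fixes s t :: real
  assumes "s > 0"
  shows "has_bochner_integral lborel (\<lambda>x. exp (- s * x\<^sup>2) * cis (x * t)) (of_real (sqrt (pi / s) * exp (- t\<^sup>2 / (4 * s))))"
proof -
  define c where "c = sqrt (2 * s)"
  have c: "c > 0" "c\<^sup>2 = 2 * s" using assms by (auto simp: c_def)
  let ?h = "\<lambda>x. std_normal_density x *\<^sub>R cis (x * (t / c))"
  have "complex_of_real (exp (- ((t / c)\<^sup>2) / 2)) = char std_normal_distribution (t / c)"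
    by (simp add: char_std_normal_distribution)
  also have "\<dots> = (LINT x|lborel. ?h x)"
    unfolding char_def by (subst integral_density)
      (auto simp: cis_conv_exp mult_ac normal_density_nonneg)
  finally have v: "(LINT x|lborel. ?h x) = complex_of_real (exp (- ((t / c)\<^sup>2) / 2))" by simp
  have "integrable lborel (\<lambda>x. std_normal_density x)"
    by (simp add: integrable_normal_density)
  then have "integrable lborel ?h"
    by (rule Bochner_Integration.integrable_bound) auto
  then have "has_bochner_integral lborel ?h (complex_of_real (exp (- ((t / c)\<^sup>2) / 2)))"
    using v by (simp add: has_bochner_integral_iff)
  then have "has_bochner_integral lborel (\<lambda>x. ?h (0 + c * x)) (complex_of_real (exp (- ((t / c)\<^sup>2) / 2)) /\<^sub>R \<bar>c\<bar>)"
    using c by (subst (asm) lborel_has_bochner_integral_real_affine_iff[where c=c and t=0]) auto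
  then have "has_bochner_integral lborel (\<lambda>x. sqrt (2 * pi) *\<^sub>R ?h (0 + c * x))
      (sqrt (2 * pi) *\<^sub>R (complex_of_real (exp (- ((t / c)\<^sup>2) / 2)) /\<^sub>R \<bar>c\<bar>))"
    by (rule has_bochner_integral_scaleR_right)
  moreover have "sqrt (2 * pi) *\<^sub>R ?h (0 + c * x) = exp (- s * x\<^sup>2) * cis (x * t)" for x
    using c by (simp add: std_normal_density_def scaleR_conv_of_real power_mult_distrib)
  moreover have "sqrt (2 * pi) *\<^sub>R (complex_of_real (exp (- ((t / c)\<^sup>2) / 2)) /\<^sub>R \<bar>c\<bar>)
      = of_real (sqrt (pi / s) * exp (- t\<^sup>2 / (4 * s)))"
  proof -
    have "sqrt (2 * pi) / c = sqrt (pi / s)"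
      using assms by (simp add: c_def real_sqrt_divide real_sqrt_mult)
    moreover have "- ((t / c)\<^sup>2) / 2 = - t\<^sup>2 / (4 * s)" using c by (simp add: power_divide)
    ultimately show ?thesis using c by (simp add: scaleR_conv_of_real field_simps flip: of_real_mult)
  qed
  ultimately show ?thesis by simp
qed

lemma norm_sq_eq_sum_Basis: "(norm (x::'a::euclidean_space))\<^sup>2 = (\<Sum>b\<in>Basis. (x \<bullet> b)\<^sup>2)"
  by (subst power2_norm_eq_inner, subst euclidean_inner) (simp add: power2_eq_square)

lemma has_bochner_integral_gaussian_cis:
  fixes y :: "'a::euclidean_space"
  assumes "s > 0"
  shows "has_bochner_integral lborel (\<lambda>x. exp (- s * (norm x)\<^sup>2) * cis (x \<bullet> y))
    (of_real (sqrt (pi / s) ^ DIM('a) * exp (- (norm y)\<^sup>2 / (4 * s))))"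
proof -
  let ?f = "\<lambda>(b::'a) x. complex_of_real (exp (- s * x\<^sup>2)) * cis (x * (y \<bullet> b))"
  have f: "has_bochner_integral lborel (?f b) (of_real (sqrt (pi / s) * exp (- (y \<bullet> b)\<^sup>2 / (4 * s))))" for b
    using has_bochner_integral_gaussian_cis_1d[OF assms] by simp
  have "(\<Prod>b\<in>Basis. ?f b (x \<bullet> b)) = exp (- s * (norm x)\<^sup>2) * cis (x \<bullet> y)" for x :: 'a
  proof -
    have "(\<Prod>b\<in>Basis. cis ((x \<bullet> b) * (y \<bullet> b))) = cis (x \<bullet> y)"
      by (subst euclidean_inner) (simp add: cis_conv_exp sum_distrib_left flip: exp_sum)
    moreover have "(\<Prod>b\<in>(Basis::'a set). exp (- s * (x \<bullet> b)\<^sup>2)) = exp (- s * (norm x)\<^sup>2)"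
      by (simp add: norm_sq_eq_sum_Basis sum_distrib_left sum_negf flip: exp_sum)
    ultimately show ?thesis by (simp add: prod.distrib flip: of_real_prod)
  qed
  moreover have "(\<Prod>b\<in>Basis. (LINT x|lborel. ?f b x)) = of_real (sqrt (pi / s) ^ DIM('a) * exp (- (norm y)\<^sup>2 / (4 * s)))"
  proof -
    have "(\<Prod>b\<in>Basis. (LINT x|lborel. ?f b x)) = (\<Prod>b\<in>Basis. of_real (sqrt (pi / s) * exp (- (y \<bullet> b)\<^sup>2 / (4 * s))))"
      using f by (auto intro!: prod.cong simp: has_bochner_integral_iff simp del: of_real_mult)
    also have "\<dots> = of_real (sqrt (pi / s) ^ DIM('a) * exp (\<Sum>b\<in>Basis. - (y \<bullet> b)\<^sup>2 / (4 * s)))"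
      by (simp add: prod.distrib exp_sum)
    finally show ?thesis by (simp add: norm_sq_eq_sum_Basis sum_negf sum_divide_distrib)
  qed
  ultimately show ?thesis
    using integrable_lborel_prod_Basis[of ?f] integral_lborel_prod_Basis[of ?f] f
    by (simp add: has_bochner_integral_iff)
qed

lemma integrable_gaussian:
  fixes y :: "'a::euclidean_space"
  assumes "s > 0"
  shows "integrable lborel (\<lambda>x. exp (- s * (norm (x - y))\<^sup>2))"
    and "(LINT x|lborel. exp (- s * (norm (x - y))\<^sup>2)) = sqrt (pi / s) ^ DIM('a)"
proof -
  have "has_bochner_integral lborel (\<lambda>x::'a. complex_of_real (exp (- s * (norm x)\<^sup>2)))
    (of_real (sqrt (pi / s) ^ DIM('a)))"
    using has_bochner_integral_gaussian_cis[OF assms, of "0::'a"] by simp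
  then have *: "has_bochner_integral lborel (\<lambda>x::'a. exp (- s * (norm x)\<^sup>2)) (sqrt (pi / s) ^ DIM('a))"
    by (auto simp: has_bochner_integral_iff simp del: of_real_power simp flip: of_real_power dest: integrable_Re)
  then show "integrable lborel (\<lambda>x. exp (- s * (norm (x - y))\<^sup>2))"
    using integrable_lborel_shift_iff[of "\<lambda>x::'a. exp (- s * (norm x)\<^sup>2)" y]
    by (simp add: has_bochner_integral_iff)
  show "(LINT x|lborel. exp (- s * (norm (x - y))\<^sup>2)) = sqrt (pi / s) ^ DIM('a)"
    using * integral_lborel_shift[of "\<lambda>x::'a. exp (- s * (norm x)\<^sup>2)" y]
    by (simp add: has_bochner_integral_iff)
qed


text \<open>Fubini in the form used below: an integrable bound \<open>g\<close> for the inner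
  \<open>L^1\<close> norms supplies integrability on the product.\<close>

lemma
  fixes f :: "'a::euclidean_space \<Rightarrow> 'b::euclidean_space \<Rightarrow> 'c::{banach, second_countable_topology}"
  assumes [measurable]: "(\<lambda>(x, y). f x y) \<in> borel_measurable (lborel \<Otimes>\<^sub>M lborel)"
    and g: "integrable lborel g"
    and f: "\<And>x. integrable lborel (f x)" "\<And>x. (LINT y|lborel. norm (f x y)) \<le> g x"
  shows integrable_pair_lborel: "integrable (lborel \<Otimes>\<^sub>M lborel) (\<lambda>(x, y). f x y)"
    and integral_swap_lborel: "(LINT x|lborel. LINT y|lborel. f x y) = (LINT y|lborel. LINT x|lborel. f x y)"
proof -
  show i: "integrable (lborel \<Otimes>\<^sub>M lborel) (\<lambda>(x, y). f x y)"
  proof (rule lborel_pair.Fubini_integrable)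
    have "integrable lborel (\<lambda>x. LINT y|lborel. norm (f x y))"
      by (rule Bochner_Integration.integrable_bound[OF g]) (auto intro!: AE_I2 order_trans[OF f(2)])
    then show "integrable lborel (\<lambda>x. LINT y|lborel. norm (case (x, y) of (x, y) \<Rightarrow> f x y))" by simp
  qed (use f in auto)
  show "(LINT x|lborel. LINT y|lborel. f x y) = (LINT y|lborel. LINT x|lborel. f x y)"
    using lborel_pair.Fubini_integral[OF i] by simp
qed

text \<open>With a character for \<open>h\<close> this is the multiplication formula, which moves a
  Fourier transform from one factor of a pairing to the other.\<close>

lemma integral_swap_product:
  fixes F :: "'a::euclidean_space \<Rightarrow> complex" and G :: "'b::euclidean_space \<Rightarrow> complex"
  assumes F: "integrable lborel F" and G: "integrable lborel G"
    and h [measurable]: "(\<lambda>(x, y). h x y) \<in> borel_measurable (lborel \<Otimes>\<^sub>M lborel)"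
    and b: "\<And>x y. norm (h x y) \<le> (1::real)"
  shows "(LINT x|lborel. F x * (LINT y|lborel. h x y * G y)) = (LINT y|lborel. G y * (LINT x|lborel. h x y * F x))"
proof -
  have [measurable]: "F \<in> borel_measurable lborel" "G \<in> borel_measurable lborel"
    using F G by auto
  have m1: "h x \<in> borel_measurable lborel" for x
    using measurable_Pair2[OF h, of x] by simp
  have n: "norm (F x * h x y * G y) \<le> norm (F x) * norm (G y)" for x y
    using b[of x y] by (simp add: norm_mult mult_mono mult_left_le_one_le mult_right_mono mult.commute[of "norm (F x)"] mult.assoc)
  have i1: "integrable lborel (\<lambda>y. F x * h x y * G y)" for x
    by (rule Bochner_Integration.integrable_bound[of _ "\<lambda>y. norm (F x) * norm (G y)"])
      (use G m1[of x] n in \<open>auto intro!: AE_I2 simp: norm_mult\<close>)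
  have "(LINT y|lborel. norm (F x * h x y * G y)) \<le> (LINT y|lborel. norm (F x) * norm (G y))" for x
    by (rule integral_mono) (use i1 G n in auto)
  then have e: "(LINT x|lborel. LINT y|lborel. F x * h x y * G y) = (LINT y|lborel. LINT x|lborel. F x * h x y * G y)"
    using F by (intro integral_swap_lborel[where g="\<lambda>x. (LINT y|lborel. norm (F x) * norm (G y))"] i1) auto
  have e1: "(LINT y|lborel. F x * h x y * G y) = F x * (LINT y|lborel. h x y * G y)" for x
    by (simp add: mult.assoc)
  have e2: "(LINT x|lborel. F x * h x y * G y) = G y * (LINT x|lborel. h x y * F x)" for y
    by (simp add: mult_ac flip: integral_mult_right_zero)
  show ?thesis using e by (simp only: e1 e2)
qed

text \<open>The substitution \<open>y = x + z / sqrt (Suc n)\<close> removes \<open>n\<close> from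
  the Gaussian and puts it into the argument of \<psi>, where continuity and dominated convergence
  apply.\<close>

lemma gaussian_approximate_identity:
  fixes \<psi> :: "'a::euclidean_space \<Rightarrow> 'b::{banach, second_countable_topology}"
  assumes c: "continuous_on UNIV \<psi>" and b: "\<And>x. norm (\<psi> x) \<le> B"
  shows "(\<lambda>n. (LINT y|lborel. exp (- real (Suc n) * (norm (y - x))\<^sup>2) *\<^sub>R \<psi> y) /\<^sub>R sqrt (pi / real (Suc n)) ^ DIM('a)) \<longlonglongrightarrow> \<psi> x"
proof -
  have [measurable]: "\<psi> \<in> borel_measurable borel" using c by (rule borel_measurable_continuous_onI)
  let ?g = "\<lambda>z::'a. exp (- (norm z)\<^sup>2)"
  have g: "integrable lborel ?g" "(LINT z|lborel. ?g z) = sqrt pi ^ DIM('a)"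
    using integrable_gaussian[of 1 "0::'a"] by simp_all
  have eq: "(LINT y|lborel. exp (- real (Suc n) * (norm (y - x))\<^sup>2) *\<^sub>R \<psi> y) /\<^sub>R sqrt (pi / real (Suc n)) ^ DIM('a)
    = (LINT z|lborel. ?g z *\<^sub>R \<psi> (x + (1 / sqrt (Suc n)) *\<^sub>R z)) /\<^sub>R sqrt pi ^ DIM('a)" for n
  proof -
    let ?c = "1 / sqrt (Suc n)"
    have "(LINT y|lborel. exp (- real (Suc n) * (norm (y - x))\<^sup>2) *\<^sub>R \<psi> y)
      = \<bar>?c\<bar> ^ DIM('a) *\<^sub>R (LINT z|lborel. exp (- real (Suc n) * (norm (x + ?c *\<^sub>R z - x))\<^sup>2) *\<^sub>R \<psi> (x + ?c *\<^sub>R z))"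
      by (rule integral_lborel_affine) simp
    also have "(\<lambda>z. exp (- real (Suc n) * (norm (x + ?c *\<^sub>R z - x))\<^sup>2) *\<^sub>R \<psi> (x + ?c *\<^sub>R z))
       = (\<lambda>z. ?g z *\<^sub>R \<psi> (x + ?c *\<^sub>R z))"
      by (rule ext) (simp add: power_mult_distrib power_divide del: of_nat_Suc)
    finally have "(LINT y|lborel. exp (- real (Suc n) * (norm (y - x))\<^sup>2) *\<^sub>R \<psi> y)
       = \<bar>?c\<bar> ^ DIM('a) *\<^sub>R (LINT z|lborel. ?g z *\<^sub>R \<psi> (x + ?c *\<^sub>R z))" .
    moreover have "inverse (sqrt (pi / real (Suc n)) ^ DIM('a)) * \<bar>?c\<bar> ^ DIM('a) = inverse (sqrt pi ^ DIM('a))"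
      by (simp add: real_sqrt_divide power_divide field_simps del: of_nat_Suc)
    ultimately show ?thesis by (simp only: scaleR_scaleR)
  qed
  have "(\<lambda>n. LINT z|lborel. ?g z *\<^sub>R \<psi> (x + (1 / sqrt (Suc n)) *\<^sub>R z)) \<longlonglongrightarrow> (LINT z|lborel. ?g z *\<^sub>R \<psi> x)"
  proof (rule integral_dominated_convergence[where w="\<lambda>z. ?g z * B"])
    show "AE z in lborel. (\<lambda>n. ?g z *\<^sub>R \<psi> (x + (1 / sqrt (Suc n)) *\<^sub>R z)) \<longlonglongrightarrow> ?g z *\<^sub>R \<psi> x"
    proof (rule AE_I2)
      fix z :: 'a
      have "(\<lambda>n. 1 / sqrt (real (Suc n))) \<longlonglongrightarrow> 0" by real_asymp
      then have "(\<lambda>n. x + (1 / sqrt (Suc n)) *\<^sub>R z) \<longlonglongrightarrow> x + 0 *\<^sub>R z" by (intro tendsto_intros)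
      then have "(\<lambda>n. \<psi> (x + (1 / sqrt (Suc n)) *\<^sub>R z)) \<longlonglongrightarrow> \<psi> x"
        using c by (intro isCont_tendsto_compose[of _ \<psi>]) (auto simp: continuous_on_eq_continuous_at)
      then show "(\<lambda>n. ?g z *\<^sub>R \<psi> (x + (1 / sqrt (Suc n)) *\<^sub>R z)) \<longlonglongrightarrow> ?g z *\<^sub>R \<psi> x"
        by (intro tendsto_intros)
    qed
  qed (use g b in \<open>auto intro!: AE_I2 mult_left_mono\<close>)
  also have "(LINT z|lborel. ?g z *\<^sub>R \<psi> x) = sqrt pi ^ DIM('a) *\<^sub>R \<psi> x"
    using g by simp
  finally have "(\<lambda>n. (LINT z|lborel. ?g z *\<^sub>R \<psi> (x + (1 / sqrt (Suc n)) *\<^sub>R z)) /\<^sub>R sqrt pi ^ DIM('a))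
      \<longlonglongrightarrow> (sqrt pi ^ DIM('a) *\<^sub>R \<psi> x) /\<^sub>R sqrt pi ^ DIM('a)"
    by (intro tendsto_intros)
  then show ?thesis by (simp only: eq) simp
qed

text \<open>Continuous cutoffs decrease to the indicator of a closed set, so the integrals over
  closed sets vanish; closed sets are stable under intersection and generate the Borel sets, so all
  set integrals vanish.\<close>

lemma AE_zero_if_continuous_tests_zero:
  fixes F :: "'a::euclidean_space \<Rightarrow> complex"
  assumes F: "integrable lborel F"
    and z: "\<And>\<psi> :: 'a \<Rightarrow> real. continuous_on UNIV \<psi> \<Longrightarrow> (\<And>x. \<bar>\<psi> x\<bar> \<le> 1) \<Longrightarrow> (LINT x|lborel. \<psi> x *\<^sub>R F x) = 0"
  shows "AE x in lborel. F x = 0"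
proof -
  have [measurable]: "F \<in> borel_measurable lborel" using F by auto
  have iF: "set_integrable lborel A F" if "A \<in> sets borel" for A
    unfolding set_integrable_def using F that by (intro integrable_mult_indicator) auto
  have cl: "(LINT x:A|lborel. F x) = 0" if "closed A" for A
  \<comment> \<open>The empty set is separate because \<open>infdist x {} = 0\<close>, which would
    make every cutoff equal to 1.\<close>
  proof (cases "A = {}")
    case False
    let ?p = "\<lambda>n x. max 0 (1 - real n * infdist x A)"
    have "(\<lambda>n. LINT x|lborel. ?p n x *\<^sub>R F x) \<longlonglongrightarrow> (LINT x|lborel. indicator A x *\<^sub>R F x)"
    proof (rule integral_dominated_convergence[where w="\<lambda>x. norm (F x)"])
      have [measurable]: "A \<in> sets borel" using that by auto
      show "(\<lambda>x. indicator A x *\<^sub>R F x) \<in> borel_measurable lborel" by measurable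
      have "continuous_on UNIV (?p n)" for n
        by (intro continuous_intros)
      from borel_measurable_continuous_onI[OF this]
      show "(\<lambda>x. ?p n x *\<^sub>R F x) \<in> borel_measurable lborel" for n by measurable
      show "AE x in lborel. norm (?p n x *\<^sub>R F x) \<le> norm (F x)" for n
      proof (rule AE_I2)
        fix x have "\<bar>?p n x\<bar> \<le> 1" using infdist_nonneg[of x A] by (auto simp: max_def)
        then show "norm (?p n x *\<^sub>R F x) \<le> norm (F x)" by (simp add: mult_left_le_one_le)
      qed
      show "AE x in lborel. (\<lambda>n. ?p n x *\<^sub>R F x) \<longlonglongrightarrow> indicator A x *\<^sub>R F x"
      proof (rule AE_I2)
        fix x
        have "(\<lambda>n. ?p n x) \<longlonglongrightarrow> indicator A x"
        proof (cases "x \<in> A")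
          case True then show ?thesis by simp
        next
          case nA: False
          then have pos: "infdist x A > 0" using that False
            by (metis in_closed_iff_infdist_zero infdist_nonneg less_eq_real_def)
          then have "eventually (\<lambda>n. ?p n x = 0) sequentially"
          proof -
            obtain N where N: "1 / infdist x A < real N" using reals_Archimedean2 by blast
            show ?thesis
            proof (rule eventually_sequentiallyI[of N])
              fix n assume "N \<le> n"
              then have "1 / infdist x A \<le> real n" using N by linarith
              then have "1 \<le> real n * infdist x A" using pos by (simp add: field_simps)
              then show "?p n x = 0" by simp
            qed
          qed
          then show ?thesis using nA by (auto intro: tendsto_eventually)
        qed
        then show "(\<lambda>n. ?p n x *\<^sub>R F x) \<longlonglongrightarrow> indicator A x *\<^sub>R F x" by (intro tendsto_intros)
      qed
    qed (use F in auto)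
    moreover have "(LINT x|lborel. ?p n x *\<^sub>R F x) = 0" for n
      by (rule z, intro continuous_intros) (use infdist_nonneg[of _ A] in \<open>auto simp: max_def\<close>)
    ultimately show ?thesis
      by (simp add: set_lebesgue_integral_def LIMSEQ_const_iff)
  qed (simp add: set_lebesgue_integral_def)
  have all: "(LINT x:A|lborel. F x) = 0" if "A \<in> sets borel" for A :: "'a set"
  proof -
    have A: "A \<in> sigma_sets UNIV (Collect closed)" using that by (simp add: borel_eq_closed)
    have sb: "B \<in> sets borel" if "B \<in> sigma_sets UNIV (Collect closed)" for B :: "'a set"
      using that by (simp add: borel_eq_closed)
    show ?thesis
    proof (rule sigma_sets_induct_disjoint[OF _ _ A])
      fix B :: "'a set" assume B: "B \<in> sigma_sets UNIV (Collect closed)" "(LINT x:B|lborel. F x) = 0"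
      have "(LINT x:B \<union> (UNIV - B)|lborel. F x) = (LINT x:B|lborel. F x) + (LINT x:UNIV - B|lborel. F x)"
        by (rule set_integral_Un) (use sb[OF B(1)] iF in auto)
      then show "(LINT x:UNIV - B|lborel. F x) = 0" using B cl[of UNIV] by simp
    next
      fix B :: "nat \<Rightarrow> 'a set"
      assume B: "disjoint_family B" "range B \<subseteq> sigma_sets UNIV (Collect closed)" "\<And>i. (LINT x:B i|lborel. F x) = 0"
      have Bm: "B i \<in> sets borel" for i using B(2) by (intro sb) auto
      then have BU: "(\<Union>i. B i) \<in> sets borel" by blast
      have "(LINT x:(\<Union>i. B i)|lborel. F x) = (\<Sum>i. LINT x:B i|lborel. F x)"
        by (rule lebesgue_integral_countable_add) (use B Bm BU in \<open>auto simp: disjoint_family_on_def intro!: iF\<close>)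
      then show "(LINT x:(\<Union>i. B i)|lborel. F x) = 0" using B by simp
    qed (auto simp: Int_stable_def cl)
  qed
  \<comment> \<open>Uniqueness of densities concerns real functions, so it is applied to the real
    and to the imaginary part of \<open>F\<close>.\<close>
  have "AE x in lborel. h (F x) = 0" if h: "bounded_linear h" for h :: "complex \<Rightarrow> real"
  proof (rule density_unique_real)
    show "integrable lborel (\<lambda>x. h (F x))" by (rule integrable_bounded_linear[OF h F])
    show "(LINT x:A|lborel. h (F x)) = (LINT x:A|lborel. 0)" if "A \<in> sets lborel" for A
    proof -
      have "(LINT x:A|lborel. h (F x)) = (LINT x|lborel. h (indicator A x *\<^sub>R F x))"
        by (simp add: set_lebesgue_integral_def linear_cmul[OF bounded_linear.linear[OF h]])
      also have "\<dots> = h (LINT x:A|lborel. F x)"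
        unfolding set_lebesgue_integral_def
        by (rule integral_bounded_linear[OF h]) (use iF[of A] that in \<open>auto simp: set_integrable_def\<close>)
      finally show ?thesis using all that h by (simp add: linear_simps)
    qed
  qed simp
  from this[OF bounded_linear_Re] this[OF bounded_linear_Im] show ?thesis
    by eventually_elim (simp add: complex_eq_iff)
qed

text \<open>The Gaussian means \<open>P n\<close> of a bounded continuous \<psi> converge to it
  boundedly, and by Fubini the pairing of \<open>P n\<close> with \<open>F\<close> is a
  superposition of the vanishing Gaussian tests.\<close>

lemma AE_zero_if_gaussian_tests_zero:
  fixes F :: "'a::euclidean_space \<Rightarrow> complex"
  assumes F: "integrable lborel F"
    and z: "\<And>s y. s > 0 \<Longrightarrow> (LINT x|lborel. exp (- s * (norm (x - y))\<^sup>2) *\<^sub>R F x) = 0"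
  shows "AE x in lborel. F x = 0"
proof (rule AE_zero_if_continuous_tests_zero[OF F])
  fix \<psi> :: "'a \<Rightarrow> real" assume c: "continuous_on UNIV \<psi>" and b: "\<And>x. \<bar>\<psi> x\<bar> \<le> 1"
  have [measurable]: "F \<in> borel_measurable borel" using F by auto
  have [measurable]: "\<psi> \<in> borel_measurable borel" using c by (rule borel_measurable_continuous_onI)
  define P where "P n x = (LINT y|lborel. exp (- real (Suc n) * (norm (y - x))\<^sup>2) *\<^sub>R \<psi> y) /\<^sub>R sqrt (pi / real (Suc n)) ^ DIM('a)" for n x
  have ig: "integrable lborel (\<lambda>y. exp (- real (Suc n) * (norm (y - x))\<^sup>2) *\<^sub>R \<psi> y)" for n x
    by (rule Bochner_Integration.integrable_bound[OF integrable_gaussian(1)[of "real (Suc n)" x]])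
       (use b in \<open>auto intro!: AE_I2 mult_left_le mult_right_le_one_le simp: abs_mult\<close>)
  have ign: "(LINT y|lborel. norm (exp (- real (Suc n) * (norm (y - x))\<^sup>2) *\<^sub>R \<psi> y)) \<le> sqrt (pi / real (Suc n)) ^ DIM('a)" for n x
  proof -
    have "(LINT y|lborel. norm (exp (- real (Suc n) * (norm (y - x))\<^sup>2) *\<^sub>R \<psi> y)) \<le> (LINT y|lborel. exp (- real (Suc n) * (norm (y - x))\<^sup>2))"
      by (rule integral_mono[OF integrable_norm[OF ig]]) (use b integrable_gaussian(1)[of "real (Suc n)" x] in \<open>auto simp: abs_mult intro!: mult_left_le\<close>)
    then show ?thesis using integrable_gaussian(2)[of "real (Suc n)" x] by simp
  qed
  have Pb: "\<bar>P n x\<bar> \<le> 1" for n x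
  proof -
    have "\<bar>LINT y|lborel. exp (- real (Suc n) * (norm (y - x))\<^sup>2) *\<^sub>R \<psi> y\<bar> \<le> sqrt (pi / real (Suc n)) ^ DIM('a)"
      unfolding real_norm_def[symmetric] by (rule order_trans[OF integral_norm_bound ign])
    then show ?thesis by (simp add: P_def divide_simps abs_mult del: of_nat_Suc)
  qed
  have [measurable]: "P n \<in> borel_measurable borel" for n unfolding P_def by measurable
  have "(\<lambda>n. LINT x|lborel. P n x *\<^sub>R F x) \<longlonglongrightarrow> (LINT x|lborel. \<psi> x *\<^sub>R F x)"
  proof (rule integral_dominated_convergence[where w="\<lambda>x. norm (F x)"])
    show "AE x in lborel. (\<lambda>n. P n x *\<^sub>R F x) \<longlonglongrightarrow> \<psi> x *\<^sub>R F x"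
      unfolding P_def by (intro AE_I2 tendsto_intros gaussian_approximate_identity[where B=1]) (use c b in auto)
    show "AE x in lborel. norm (P n x *\<^sub>R F x) \<le> norm (F x)" for n
      using Pb by (auto intro!: AE_I2 mult_left_le_one_le)
  qed (use F in auto)
  moreover have "(LINT x|lborel. P n x *\<^sub>R F x) = 0" for n
  proof -
    let ?c = "sqrt (pi / real (Suc n)) ^ DIM('a)"
    let ?f = "\<lambda>x y. (exp (- real (Suc n) * (norm (y - x))\<^sup>2) * \<psi> y) *\<^sub>R F x"
    have "(LINT x|lborel. LINT y|lborel. ?f x y) = (LINT y|lborel. LINT x|lborel. ?f x y)"
    proof (rule integral_swap_lborel[where g="\<lambda>x. ?c * norm (F x)"])
      show "integrable lborel (?f x)" for x using ig[of n x] by (auto intro!: integrable_scaleR_left)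
      have "(LINT y|lborel. norm (?f x y)) = (LINT y|lborel. norm (exp (- real (Suc n) * (norm (y - x))\<^sup>2) *\<^sub>R \<psi> y)) * norm (F x)" for x
        by (simp flip: integral_mult_left_zero)
      then show "(LINT y|lborel. norm (?f x y)) \<le> ?c * norm (F x)" for x
        using ign[of n x] by (simp add: mult_right_mono del: of_nat_Suc)
    qed (use F in auto)
    moreover have e2: "(LINT x|lborel. ?f x y) = 0" for y
    proof -
      have "(LINT x|lborel. ?f x y) = \<psi> y *\<^sub>R (LINT x|lborel. exp (- real (Suc n) * (norm (x - y))\<^sup>2) *\<^sub>R F x)"
        by (simp add: norm_minus_commute mult.commute flip: integral_scaleR_right)
      then show ?thesis using z[of "real (Suc n)" y] by (simp del: of_nat_Suc)
    qed
    moreover have e3: "(LINT y|lborel. ?f x y) = ?c *\<^sub>R (P n x *\<^sub>R F x)" for x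
      using ig[of n x] by (subst integral_scaleR_left) (auto simp: P_def)
    ultimately have "(LINT x|lborel. ?c *\<^sub>R (P n x *\<^sub>R F x)) = 0" by (simp only: e2 e3) simp
    then have "?c *\<^sub>R (LINT x|lborel. P n x *\<^sub>R F x) = 0" by (simp only: integral_scaleR_right)
    then show ?thesis by simp
  qed
  ultimately show "(LINT x|lborel. \<psi> x *\<^sub>R F x) = 0" by (simp add: LIMSEQ_const_iff)
qed

text \<open>The inverse Fourier transform without its normalising constant. In this form it turns
  convolution into multiplication with no factor of \<open>2 * pi\<close>.\<close>

definition synth :: "('a::euclidean_space \<Rightarrow> complex) \<Rightarrow> 'a \<Rightarrow> complex"
  where "synth g x = (LINT \<xi>|lborel. g \<xi> * cis (x \<bullet> \<xi>))"

lemma integrable_mult_cis: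
  assumes "integrable lborel g"
  shows "integrable lborel (\<lambda>\<xi>. g \<xi> * cis (x \<bullet> \<xi>))"
  using assms by (rule Bochner_Integration.integrable_bound) (use assms in \<open>auto simp: norm_mult\<close>)

lemma norm_synth_le: "norm (synth g x) \<le> (LINT \<xi>|lborel. norm (g \<xi>))"
  unfolding synth_def using integral_norm_bound[of lborel "\<lambda>\<xi>. g \<xi> * cis (x \<bullet> \<xi>)"] by (simp add: norm_mult)

lemma continuous_on_synth:
  assumes g: "integrable lborel g"
  shows "continuous_on UNIV (synth g)"
  unfolding continuous_on_sequentially
proof safe
  fix X :: "nat \<Rightarrow> 'a" and x assume X: "X \<longlonglongrightarrow> x"
  have "(\<lambda>n. LINT \<xi>|lborel. g \<xi> * cis (X n \<bullet> \<xi>)) \<longlonglongrightarrow> (LINT \<xi>|lborel. g \<xi> * cis (x \<bullet> \<xi>))"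
    by (rule integral_dominated_convergence[where w="\<lambda>\<xi>. norm (g \<xi>)"])
       (use g X in \<open>auto simp: norm_mult intro!: AE_I2 tendsto_intros isCont_tendsto_compose[of _ cis]\<close>)
  then show "(synth g \<circ> X) \<longlonglongrightarrow> synth g x" by (simp add: synth_def o_def)
qed

text \<open>The transform moves onto the Gaussian, which it maps to a Gaussian of dual width. The
  identity serves twice: a vanishing left side gives uniqueness, and the limit of small
  \<open>s\<close> gives inversion.\<close>

lemma gaussian_synth_pairing:
  fixes F :: "'a::euclidean_space \<Rightarrow> complex"
  assumes F: "integrable lborel F" and s: "s > 0"
  shows "(LINT \<xi>|lborel. exp (- s * (norm \<xi>)\<^sup>2) * cis (- (y \<bullet> \<xi>)) * synth F \<xi>)
    = sqrt (pi / s) ^ DIM('a) * (LINT x|lborel. exp (- (norm (x - y))\<^sup>2 / (4 * s)) *\<^sub>R F x)"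
proof -
  let ?G = "\<lambda>\<xi>::'a. complex_of_real (exp (- s * (norm \<xi>)\<^sup>2)) * cis (- (y \<bullet> \<xi>))"
  have iG: "integrable lborel ?G"
    by (rule Bochner_Integration.integrable_bound[OF integrable_gaussian(1)[OF s, of 0]])
       (auto simp: norm_mult)
  have "(LINT \<xi>|lborel. ?G \<xi> * synth F \<xi>) = (LINT \<xi>|lborel. ?G \<xi> * (LINT x|lborel. cis (\<xi> \<bullet> x) * F x))"
    by (simp add: synth_def mult.commute)
  also have "\<dots> = (LINT x|lborel. F x * (LINT \<xi>|lborel. cis (\<xi> \<bullet> x) * ?G \<xi>))"
    by (rule integral_swap_product[OF iG F]) auto
  also have "\<dots> = (LINT x|lborel. F x * of_real (sqrt (pi / s) ^ DIM('a) * exp (- (norm (x - y))\<^sup>2 / (4 * s))))"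
  proof -
    have "(LINT \<xi>|lborel. cis (\<xi> \<bullet> x) * ?G \<xi>) = of_real (sqrt (pi / s) ^ DIM('a) * exp (- (norm (x - y))\<^sup>2 / (4 * s)))" for x
    proof -
      have "cis (\<xi> \<bullet> x) * ?G \<xi> = exp (- s * (norm \<xi>)\<^sup>2) * cis (\<xi> \<bullet> (x - y))" for \<xi>
        by (simp add: inner_diff_right inner_commute cis_mult mult.left_commute add.commute[of "- (y \<bullet> \<xi>)"])
      then show ?thesis using has_bochner_integral_gaussian_cis[OF s, of "x - y"]
        by (simp only: has_bochner_integral_iff)
    qed
    then show ?thesis by presburger
  qed
  finally show ?thesis by (simp add: scaleR_conv_of_real mult_ac flip: integral_mult_right_zero)
qed

lemma AE_zero_if_synth_zero:
  fixes F :: "'a::euclidean_space \<Rightarrow> complex"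
  assumes F: "integrable lborel F" and z: "\<And>x. synth F x = 0"
  shows "AE x in lborel. F x = 0"
proof (rule AE_zero_if_gaussian_tests_zero[OF F])
  fix s :: real and y :: 'a assume s: "s > 0"
  \<comment> \<open>The parameter \<open>1 / (4 * s)\<close> is dual to \<open>s\<close>: on the
    right it leaves the exponent \<open>- s * (norm (x - y))^2\<close>.\<close>
  from gaussian_synth_pairing[OF F, of "1 / (4 * s)" y] s z
  show "(LINT x|lborel. exp (- s * (norm (x - y))\<^sup>2) *\<^sub>R F x) = 0" by (simp add: mult.commute)
qed

text \<open>A Gaussian factor in the outer integral tends to 1 and may be removed by dominated
  convergence; with it the integral is a Gaussian mean of \<open>f\<close> around \<open>x\<close>.
  The widths \<open>1 / (4 * Suc n)\<close> are dual to those of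
  \<open>gaussian_approximate_identity\<close>.\<close>

lemma fourier_inversion:
  fixes f :: "'a::euclidean_space \<Rightarrow> complex"
  assumes f: "integrable lborel f" "continuous_on UNIV f" "\<And>x. norm (f x) \<le> B"
    and i: "integrable lborel (synth f)"
  shows "synth (synth f) (- x) = of_real ((2 * pi) ^ DIM('a)) * f x"
proof -
  have [measurable]: "f \<in> borel_measurable borel" "synth f \<in> borel_measurable borel" using f i by auto
  let ?s = "\<lambda>n. 1 / (4 * real (Suc n))"
  let ?L = "\<lambda>n. LINT \<xi>|lborel. exp (- ?s n * (norm \<xi>)\<^sup>2) * cis (- (x \<bullet> \<xi>)) * synth f \<xi>"
  have "?L \<longlonglongrightarrow> (LINT \<xi>|lborel. cis (- (x \<bullet> \<xi>)) * synth f \<xi>)"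
  proof (rule integral_dominated_convergence[where w="\<lambda>\<xi>. norm (synth f \<xi>)"])
    show "AE \<xi> in lborel. (\<lambda>n. exp (- ?s n * (norm \<xi>)\<^sup>2) * cis (- (x \<bullet> \<xi>)) * synth f \<xi>) \<longlonglongrightarrow> cis (- (x \<bullet> \<xi>)) * synth f \<xi>"
    proof (rule AE_I2)
      fix \<xi> :: 'a
      have "(\<lambda>n. exp (- ?s n * (norm \<xi>)\<^sup>2)) \<longlonglongrightarrow> 1" by real_asymp
      then have "(\<lambda>n. complex_of_real (exp (- ?s n * (norm \<xi>)\<^sup>2)) * cis (- (x \<bullet> \<xi>)) * synth f \<xi>) \<longlonglongrightarrow> complex_of_real 1 * cis (- (x \<bullet> \<xi>)) * synth f \<xi>"
        by (intro tendsto_intros)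
      then show "(\<lambda>n. exp (- ?s n * (norm \<xi>)\<^sup>2) * cis (- (x \<bullet> \<xi>)) * synth f \<xi>) \<longlonglongrightarrow> cis (- (x \<bullet> \<xi>)) * synth f \<xi>"
        by simp
    qed
    show "AE \<xi> in lborel. norm (exp (- ?s n * (norm \<xi>)\<^sup>2) * cis (- (x \<bullet> \<xi>)) * synth f \<xi>) \<le> norm (synth f \<xi>)" for n
      by (auto simp: norm_mult intro!: AE_I2 mult_left_le_one_le)
  qed (use i in auto)
  moreover have "?L n = of_real ((2 * pi) ^ DIM('a)) * ((LINT y|lborel. exp (- real (Suc n) * (norm (y - x))\<^sup>2) *\<^sub>R f y) /\<^sub>R sqrt (pi / real (Suc n)) ^ DIM('a))" for n
  proof -
    have 1: "sqrt (pi / ?s n) * sqrt (pi / real (Suc n)) = 2 * pi"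
      by (simp add: real_sqrt_mult[symmetric] real_sqrt_divide real_sqrt_mult del: of_nat_Suc)
    have 2: "sqrt (pi / ?s n) ^ DIM('a) = (2 * pi) ^ DIM('a) * inverse (sqrt (pi / real (Suc n)) ^ DIM('a))"
      unfolding 1[symmetric] power_mult_distrib by (simp add: field_simps del: of_nat_Suc)
    have 3: "- (norm (y - x))\<^sup>2 / (4 * ?s n) = - real (Suc n) * (norm (y - x))\<^sup>2" for y by (simp add: field_simps)
    show ?thesis
      unfolding gaussian_synth_pairing[OF f(1), of "?s n" x, simplified] 
      using gaussian_synth_pairing[OF f(1), of "?s n" x]
      unfolding 2 3 by (simp add: scaleR_conv_of_real del: of_nat_Suc)
  qed
  moreover have "(\<lambda>n. of_real ((2 * pi) ^ DIM('a)) * ((LINT y|lborel. exp (- real (Suc n) * (norm (y - x))\<^sup>2) *\<^sub>R f y) /\<^sub>R sqrt (pi / real (Suc n)) ^ DIM('a)))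
      \<longlonglongrightarrow> of_real ((2 * pi) ^ DIM('a)) * f x"
    by (intro tendsto_intros gaussian_approximate_identity[where B=B] f)
  ultimately have "(LINT \<xi>|lborel. cis (- (x \<bullet> \<xi>)) * synth f \<xi>) = of_real ((2 * pi) ^ DIM('a)) * f x"
    using LIMSEQ_unique by (metis (no_types, lifting) ext)
  then show ?thesis by (simp add: synth_def mult.commute)
qed


section \<open>Schwartz functions\<close>

text \<open>Each of the \<open>DIM('a)\<close> factors \<open>(1 + norm x)^2\<close> dominates
  \<open>1 + (x \<bullet> b)^2\<close>, so the weight is bounded by a product of one-dimensional
  integrable functions. This is the origin of the decay order \<open>2 * DIM('a)\<close>
  below.\<close>

lemma integrable_inverse_polynomial_weight:
  "integrable lborel (\<lambda>x::'a::euclidean_space. 1 / (1 + norm x) ^ (2 * DIM('a)))"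
proof (rule Bochner_Integration.integrable_bound)
  have "integrable lborel (\<lambda>x::real. inverse (1 + x\<^sup>2))"
    using integrable_inverse_1_plus_square by (simp add: set_integrable_def einterval_def)
  then show "integrable lborel (\<lambda>x::'a. \<Prod>b\<in>Basis. inverse (1 + (x \<bullet> b)\<^sup>2))"
    by (intro integrable_lborel_prod_Basis)
  show "AE x in lborel. norm (1 / (1 + norm x) ^ (2 * DIM('a))) \<le> norm (\<Prod>b\<in>(Basis::'a set). inverse (1 + (x \<bullet> b)\<^sup>2))"
  proof (rule AE_I2)
    fix x :: 'a
    have "(\<Prod>b\<in>(Basis::'a set). inverse ((1 + norm x)\<^sup>2)) \<le> (\<Prod>b\<in>Basis. inverse (1 + (x \<bullet> b)\<^sup>2))"
    proof (rule prod_mono, intro conjI le_imp_inverse_le)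
      fix b :: 'a assume b: "b \<in> Basis"
      have "(x \<bullet> b)\<^sup>2 \<le> (norm x)\<^sup>2" using Basis_le_norm[OF b, of x] by (simp add: abs_le_square_iff[symmetric])
      then show "1 + (x \<bullet> b)\<^sup>2 \<le> (1 + norm x)\<^sup>2" by (simp add: power2_sum add_increasing2)
    qed (auto simp: add_pos_nonneg)
    moreover have "(\<Prod>b\<in>(Basis::'a set). inverse ((1 + norm x)\<^sup>2)) = 1 / (1 + norm x) ^ (2 * DIM('a))"
      by (simp add: power_mult inverse_eq_divide power_one_over)
    ultimately show "norm (1 / (1 + norm x) ^ (2 * DIM('a))) \<le> norm (\<Prod>b\<in>(Basis::'a set). inverse (1 + (x \<bullet> b)\<^sup>2))"
      by simp
  qed
qed measurable

lemma one_plus_power_le: "(1 + r) ^ n \<le> 2 ^ n * (1 + r ^ n)" if "r \<ge> 0" for r :: real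
proof -
  have "(1 + r) ^ n \<le> (2 * max 1 r) ^ n" by (rule power_mono) (use that in auto)
  also have "\<dots> = 2 ^ n * max 1 r ^ n" by (rule power_mult_distrib)
  also have "max 1 r ^ n \<le> 1 + r ^ n" using that by (auto simp: max_def)
  finally show ?thesis by simp
qed

lemma integrable_if_polynomial_decay:
  fixes f :: "'a::euclidean_space \<Rightarrow> complex"
  assumes m: "f \<in> borel_measurable lborel" and d: "\<And>x. (1 + norm x) ^ (2 * DIM('a)) * norm (f x) \<le> C"
  shows "integrable lborel f"
proof (rule Bochner_Integration.integrable_bound)
  show "integrable lborel (\<lambda>x::'a. C * (1 / (1 + norm x) ^ (2 * DIM('a))))"
    by (rule integrable_mult_right) (rule integrable_inverse_polynomial_weight)
  have "norm (f x) \<le> C * (1 / (1 + norm x) ^ (2 * DIM('a)))" for x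
    using d[of x] by (simp add: field_simps add_pos_nonneg)
  then show "AE x in lborel. norm (f x) \<le> norm (C * (1 / (1 + norm x) ^ (2 * DIM('a))))"
    by (intro AE_I2) (metis order_trans abs_ge_self real_norm_def)
qed fact

section \<open>Regularity, decay and seminorms of Schwartz functions\<close>

lemma schwartz_pderiv_dir:
  assumes "\<phi> \<in> schwartz" "b \<in> Basis"
  shows "pderiv_dir b \<phi> \<in> schwartz"
proof -
  have eq: "pderiv_multi p (pderiv_dir b \<phi>) = pderiv_multi (p @ [b]) \<phi>" for p
    by (simp add: pderiv_multi_def)
  have "p @ [b] \<in> lists Basis" if "p \<in> lists Basis" for p using that assms by auto
  then show ?thesis using assms(1) by (simp add: schwartz_def eq)
qed

lemma schwartz_differentiable: "\<phi> differentiable (at x)" if "\<phi> \<in> schwartz"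
proof -
  have "[] \<in> lists (Basis :: 'a set)" by simp
  with that have "pderiv_multi [] \<phi> differentiable (at x)" unfolding schwartz_def by blast
  then show ?thesis by (simp add: pderiv_multi_def)
qed

lemma schwartz_continuous: "continuous_on UNIV \<phi>" if "\<phi> \<in> schwartz"
  using schwartz_differentiable[OF that] by (auto intro!: continuous_at_imp_continuous_on differentiable_imp_continuous_within)

lemma schwartz_measurable: "\<phi> \<in> schwartz \<Longrightarrow> \<phi> \<in> borel_measurable borel"
  by (rule borel_measurable_continuous_onI) (rule schwartz_continuous)

lemma schwartz_weight_bounded:
  assumes "\<phi> \<in> schwartz" "p \<in> lists Basis"
  shows "\<exists>C. \<forall>x. (1 + norm x) ^ N * norm (pderiv_multi p \<phi> x) \<le> C"
proof -
  from assms have b: "bounded (range (\<lambda>x. norm x ^ n *\<^sub>R pderiv_multi p \<phi> x))" for n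
    unfolding schwartz_def by blast
  obtain A where A: "norm (pderiv_multi p \<phi> x) \<le> A" for x
    using b[of 0] by (auto simp: bounded_iff)
  obtain B where B: "norm x ^ N * norm (pderiv_multi p \<phi> x) \<le> B" for x
    using b[of N] by (auto simp: bounded_iff)
  have "(1 + norm x) ^ N * norm (pderiv_multi p \<phi> x) \<le> 2 ^ N * (A + B)" for x
  proof -
    have "(1 + norm x) ^ N * norm (pderiv_multi p \<phi> x) \<le> 2 ^ N * (1 + norm x ^ N) * norm (pderiv_multi p \<phi> x)"
      by (intro mult_right_mono one_plus_power_le) auto
    also have "\<dots> = 2 ^ N * (norm (pderiv_multi p \<phi> x) + norm x ^ N * norm (pderiv_multi p \<phi> x))"
      by (simp add: algebra_simps)
    also have "\<dots> \<le> 2 ^ N * (A + B)" by (intro mult_left_mono add_mono A B) auto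
    finally show ?thesis .
  qed
  then show ?thesis by blast
qed

lemma schwartz_decay: "\<phi> \<in> schwartz \<Longrightarrow> \<exists>C. \<forall>x. (1 + norm x) ^ N * norm (\<phi> x) \<le> C"
  using schwartz_weight_bounded[of \<phi> "[]" N] by (simp add: pderiv_multi_def)

lemma schwartz_bounded: "\<phi> \<in> schwartz \<Longrightarrow> \<exists>C. \<forall>x. norm (\<phi> x) \<le> C"
  using schwartz_decay[of \<phi> 0] by simp

lemma schwartz_integrable:
  fixes \<phi> :: "'a::euclidean_space \<Rightarrow> complex"
  assumes "\<phi> \<in> schwartz"
  shows "integrable lborel \<phi>"
proof -
  obtain C where "(1 + norm x) ^ (2 * DIM('a)) * norm (\<phi> x) \<le> C" for x
    using schwartz_decay[OF assms] by blast
  then show ?thesis using schwartz_measurable[OF assms] by (intro integrable_if_polynomial_decay) auto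
qed

text \<open>A real supremum bounds its members only if they are bounded above. There are finitely
  many lists of directions of length at most \<open>N\<close>, and each derivative has a weighted
  bound.\<close>

lemma schwartz_norm_bound:
  fixes \<phi> :: "'a::euclidean_space \<Rightarrow> complex"
  assumes "\<phi> \<in> schwartz"
  shows "(1 + norm x) ^ N * norm (\<phi> x) \<le> schwartz_norm N \<phi>"
proof -
  let ?P = "{p \<in> lists (Basis::'a set). length p \<le> N}"
  let ?f = "\<lambda>(p, x). (1 + norm x) ^ N * norm (pderiv_multi p \<phi> x)"
  have "finite ?P"
    by (rule finite_subset[OF _ finite_lists_length_le[of "Basis::'a set" N]]) auto
  have "\<forall>p\<in>?P. \<exists>C. \<forall>x. (1 + norm x) ^ N * norm (pderiv_multi p \<phi> x) \<le> C"
  proof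
    fix p assume "p \<in> ?P"
    then have "p \<in> lists Basis" by simp
    then show "\<exists>C. \<forall>x. (1 + norm x) ^ N * norm (pderiv_multi p \<phi> x) \<le> C"
      by (rule schwartz_weight_bounded[OF assms])
  qed
  from bchoice[OF this] obtain C where C: "\<forall>p\<in>?P. \<forall>x. (1 + norm x) ^ N * norm (pderiv_multi p \<phi> x) \<le> C p" ..
  have "bdd_above (?f ` (?P \<times> UNIV))"
  proof (rule bdd_aboveI2)
    fix q assume q: "q \<in> ?P \<times> (UNIV::'a set)"
    obtain p x where px: "q = (p, x)" by (cases q)
    with q have p: "p \<in> ?P" by simp
    have "?f (p, x) \<le> C p" using bspec[OF C p] by simp
    also have "\<dots> \<le> \<bar>C p\<bar>" by (rule abs_ge_self)
    also have "\<dots> \<le> (\<Sum>p\<in>?P. \<bar>C p\<bar>)"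
      by (rule member_le_sum[OF p _ \<open>finite ?P\<close>]) simp
    finally show "?f q \<le> (\<Sum>p\<in>?P. \<bar>C p\<bar>)" unfolding px .
  qed
  moreover have "([], x) \<in> ?P \<times> UNIV" by simp
  ultimately have "?f ([], x) \<le> (SUP q\<in>?P \<times> UNIV. ?f q)" by (rule cSUP_upper[rotated])
  then show ?thesis by (simp only: schwartz_norm_def pderiv_multi_def prod.case foldr.simps id_apply)
qed

section \<open>Fourier transforms of Schwartz functions\<close>

lemma schwartz_has_vector_derivative:
  assumes "\<phi> \<in> schwartz"
  shows "((\<lambda>t. \<phi> (x + t *\<^sub>R b)) has_vector_derivative pderiv_dir b \<phi> (x + t *\<^sub>R b)) (at t)"
proof -
  have "(\<phi> has_derivative frechet_derivative \<phi> (at (x + t *\<^sub>R b))) (at (x + t *\<^sub>R b))"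
    using schwartz_differentiable[OF assms] by (simp add: frechet_derivative_works)
  moreover have "((\<lambda>t. x + t *\<^sub>R b) has_vector_derivative b) (at t)"
    by (auto intro!: derivative_eq_intros)
  ultimately show ?thesis
    unfolding pderiv_dir_def
    using vector_derivative_diff_chain_within[of "\<lambda>t. x + t *\<^sub>R b" b t UNIV \<phi> "frechet_derivative \<phi> (at (x + t *\<^sub>R b))"]
    unfolding o_def by (meson has_derivative_at_withinI)
qed

text \<open>Translation invariance makes the integrals of all difference quotients vanish.\<close>
lemma integral_directional_derivative_zero:
  fixes \<psi> :: "'a::euclidean_space \<Rightarrow> complex"
  assumes i: "integrable lborel \<psi>" and D [measurable]: "D \<in> borel_measurable lborel"
    and d: "\<And>x t. ((\<lambda>t. \<psi> (x + t *\<^sub>R b)) has_vector_derivative D (x + t *\<^sub>R b)) (at t)"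
    and b: "norm b \<le> 1" and bd: "\<And>x. (1 + norm x) ^ (2 * DIM('a)) * norm (D x) \<le> C"
  shows "(LINT x|lborel. D x) = 0"
proof -
  let ?q = "\<lambda>n x. real (Suc n) *\<^sub>R (\<psi> (x + (1 / Suc n) *\<^sub>R b) - \<psi> x)"
  let ?w = "\<lambda>x::'a. (2 ^ (2 * DIM('a)) * C) * (1 / (1 + norm x) ^ (2 * DIM('a)))"
  have [measurable]: "\<psi> \<in> borel_measurable borel" using i by auto
  have C0: "C \<ge> 0" using bd[of 0] by (simp add: order_trans[OF norm_ge_zero])
  \<comment> \<open>A shift of length at most 1 changes \<open>1 + norm x\<close> by a factor of at
    most 2, so a single integrable weight dominates all difference quotients.\<close>
  have Db: "norm (D (x + t *\<^sub>R b)) \<le> ?w x" if "0 \<le> t" "t \<le> 1" for x t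
  proof -
    have "norm x \<le> norm (x + t *\<^sub>R b) + norm (t *\<^sub>R b)"
      using norm_triangle_ineq4[of "x + t *\<^sub>R b" "t *\<^sub>R b"] by simp
    also have "norm (t *\<^sub>R b) \<le> 1" using that b by (simp add: mult_le_one)
    finally have "1 + norm x \<le> 2 * (1 + norm (x + t *\<^sub>R b))" by simp (smt (verit) norm_ge_zero)
    then have "(1 + norm x) ^ (2 * DIM('a)) \<le> (2 * (1 + norm (x + t *\<^sub>R b))) ^ (2 * DIM('a))"
      by (intro power_mono) auto
    then have "(1 + norm x) ^ (2 * DIM('a)) * norm (D (x + t *\<^sub>R b)) \<le> 2 ^ (2 * DIM('a)) * ((1 + norm (x + t *\<^sub>R b)) ^ (2 * DIM('a)) * norm (D (x + t *\<^sub>R b)))"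
      unfolding power_mult_distrib mult.assoc[symmetric] by (rule mult_right_mono) simp
    also have "\<dots> \<le> 2 ^ (2 * DIM('a)) * C" by (intro mult_left_mono bd) auto
    finally show ?thesis by (simp add: field_simps add_pos_nonneg)
  qed
  have "(\<lambda>n. LINT x|lborel. ?q n x) \<longlonglongrightarrow> (LINT x|lborel. D x)"
  proof (rule integral_dominated_convergence[where w="?w"])
    show "integrable lborel ?w"
      by (intro integrable_mult_right integrable_inverse_polynomial_weight)
    show "AE x in lborel. (\<lambda>n. ?q n x) \<longlonglongrightarrow> D x"
    proof (rule AE_I2)
      fix x
      have "((\<lambda>t. (1 / t) *\<^sub>R (\<psi> (x + t *\<^sub>R b) - \<psi> x)) \<longlongrightarrow> D x) (at 0)"
      proof -
        have "((\<lambda>h. norm (\<psi> (x + h *\<^sub>R b) - \<psi> x - h *\<^sub>R D x) / norm h) \<longlongrightarrow> 0) (at 0)"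
          using d[of x 0] by (simp add: has_vector_derivative_def has_derivative_at)
        moreover have "norm (\<psi> (x + h *\<^sub>R b) - \<psi> x - h *\<^sub>R D x) / norm h = norm ((1 / h) *\<^sub>R (\<psi> (x + h *\<^sub>R b) - \<psi> x) - D x)"
          if "h \<noteq> 0" for h
        proof -
          have "(1 / h) *\<^sub>R (\<psi> (x + h *\<^sub>R b) - \<psi> x) - D x = (1 / h) *\<^sub>R (\<psi> (x + h *\<^sub>R b) - \<psi> x - h *\<^sub>R D x)"
            using that by (simp add: scaleR_diff_right)
          then show ?thesis by simp
        qed
        ultimately have "((\<lambda>h. norm ((1 / h) *\<^sub>R (\<psi> (x + h *\<^sub>R b) - \<psi> x) - D x)) \<longlongrightarrow> 0) (at 0)"
          by (subst (asm) filterlim_cong[OF refl refl]) (auto simp: eventually_at_filter)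
        then show ?thesis by (simp only: tendsto_norm_zero_iff Lim_null[symmetric])
      qed
      moreover have "filterlim (\<lambda>n. 1 / real (Suc n)) (at 0) sequentially"
        by real_asymp
      ultimately have "(\<lambda>n. (1 / (1 / real (Suc n))) *\<^sub>R (\<psi> (x + (1 / real (Suc n)) *\<^sub>R b) - \<psi> x)) \<longlonglongrightarrow> D x"
        by (rule filterlim_compose)
      then show "(\<lambda>n. ?q n x) \<longlonglongrightarrow> D x" by simp
    qed
    show "AE x in lborel. norm (?q n x) \<le> ?w x" for n
    proof (rule AE_I2)
      fix x
      let ?h = "\<lambda>t. \<psi> (x + t *\<^sub>R b)"
      have "norm (?h (0 + 1 / Suc n) - ?h 0) \<le> norm (1 / real (Suc n)) * ?w x"
      proof (rule differentiable_bound_segment[where G="{0..1}"])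
        show "(?h has_derivative (\<lambda>s. s *\<^sub>R D (x + t *\<^sub>R b))) (at t within {0..1})" for t
          using d[of x t] by (auto simp: has_vector_derivative_def intro: has_derivative_at_withinI)
        show "onorm (\<lambda>s. s *\<^sub>R D (x + (0 + t *\<^sub>R (1 / real (Suc n))) *\<^sub>R b)) \<le> ?w x" if "t \<in> {0..1}" for t
        proof (rule onorm_le)
          fix s :: real
          have "t / real (Suc n) \<le> 1" using that by (simp add: field_simps)
          then have "norm (D (x + (t / real (Suc n)) *\<^sub>R b)) \<le> ?w x" by (intro Db) (use that in auto)
          from mult_left_mono[OF this abs_ge_zero[of s]]
          show "norm (s *\<^sub>R D (x + (0 + t *\<^sub>R (1 / real (Suc n))) *\<^sub>R b)) \<le> ?w x * norm s"
            by (simp add: mult_ac del: of_nat_Suc)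
        qed
        show "0 + t *\<^sub>R (1 / real (Suc n)) \<in> {0..1}" if "t \<in> {0..1}" for t
          using that by (auto simp: field_simps)
      qed
      then have "real (Suc n) * norm (?h (1 / Suc n) - ?h 0) \<le> real (Suc n) * (norm (1 / real (Suc n)) * ?w x)"
        by (intro mult_left_mono) auto
      then have "real (Suc n) * norm (?h (1 / Suc n) - ?h 0) \<le> ?w x"
        by (simp del: of_nat_Suc)
      then show "norm (?q n x) \<le> ?w x" by simp
    qed
  qed auto
  moreover have "(LINT x|lborel. ?q n x) = 0" for n
    using integral_lborel_shift[of \<psi> "- ((1 / Suc n) *\<^sub>R b)"] integrable_lborel_shift_iff[of \<psi> "- ((1 / Suc n) *\<^sub>R b)"] i
    by (subst integral_scaleR_right) auto
  ultimately show ?thesis by (simp add: LIMSEQ_const_iff)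
qed

text \<open>Integration by parts: \<open>?D\<close> is the derivative of the product of \<phi> with
  a character, and its integral vanishes.\<close>

lemma synth_pderiv_dir:
  fixes \<phi> :: "'a::euclidean_space \<Rightarrow> complex"
  assumes \<phi>: "\<phi> \<in> schwartz" and b: "b \<in> Basis"
  shows "synth (pderiv_dir b \<phi>) x = - (\<i> * of_real (x \<bullet> b)) * synth \<phi> x"
proof -
  note \<phi>' = schwartz_pderiv_dir[OF assms]
  let ?D = "\<lambda>\<xi>. pderiv_dir b \<phi> \<xi> * cis (x \<bullet> \<xi>) + \<phi> \<xi> * (\<i> * of_real (x \<bullet> b) * cis (x \<bullet> \<xi>))"
  obtain C1 where C1: "(1 + norm y) ^ (2 * DIM('a)) * norm (\<phi> y) \<le> C1" for y
    using schwartz_decay[OF \<phi>] by blast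
  obtain C2 where C2: "(1 + norm y) ^ (2 * DIM('a)) * norm (pderiv_dir b \<phi> y) \<le> C2" for y
    using schwartz_decay[OF \<phi>'] by blast
  have "(LINT \<xi>|lborel. ?D \<xi>) = 0"
  proof (rule integral_directional_derivative_zero)
    show "integrable lborel (\<lambda>\<xi>. \<phi> \<xi> * cis (x \<bullet> \<xi>))" by (rule integrable_mult_cis[OF schwartz_integrable[OF \<phi>]])
    show "norm b \<le> 1" using b by simp
    show "?D \<in> borel_measurable lborel" using schwartz_measurable[OF \<phi>] schwartz_measurable[OF \<phi>'] by measurable
    show "((\<lambda>t. \<phi> (y + t *\<^sub>R b) * cis (x \<bullet> (y + t *\<^sub>R b))) has_vector_derivative ?D (y + t *\<^sub>R b)) (at t)" for y t
    proof -
      have "((\<lambda>t. x \<bullet> (y + t *\<^sub>R b)) has_derivative (\<lambda>s. x \<bullet> (s *\<^sub>R b))) (at t)"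
        by (intro derivative_eq_intros) auto
      then have "((\<lambda>t. cis (x \<bullet> (y + t *\<^sub>R b))) has_vector_derivative \<i> * of_real (x \<bullet> b) * cis (x \<bullet> (y + t *\<^sub>R b))) (at t)"
        unfolding has_vector_derivative_def
        by (auto dest!: has_derivative_cis simp: scaleR_conv_of_real mult_ac)
      from has_vector_derivative_mult[OF schwartz_has_vector_derivative[OF \<phi>] this]
      show ?thesis by (simp only: add.commute)
    qed
    show "(1 + norm y) ^ (2 * DIM('a)) * norm (?D y) \<le> C2 + \<bar>x \<bullet> b\<bar> * C1" for y
    proof -
      have "norm (?D y) \<le> norm (pderiv_dir b \<phi> y) + \<bar>x \<bullet> b\<bar> * norm (\<phi> y)"
        by (rule order_trans[OF norm_triangle_ineq]) (simp add: norm_mult)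
      then have "(1 + norm y) ^ (2 * DIM('a)) * norm (?D y) \<le> (1 + norm y) ^ (2 * DIM('a)) * (norm (pderiv_dir b \<phi> y) + \<bar>x \<bullet> b\<bar> * norm (\<phi> y))"
        by (intro mult_left_mono) auto
      also have "\<dots> = (1 + norm y) ^ (2 * DIM('a)) * norm (pderiv_dir b \<phi> y) + \<bar>x \<bullet> b\<bar> * ((1 + norm y) ^ (2 * DIM('a)) * norm (\<phi> y))"
        by (simp add: algebra_simps)
      also have "\<dots> \<le> C2 + \<bar>x \<bullet> b\<bar> * C1" by (intro add_mono mult_left_mono C1 C2) auto
      finally show ?thesis .
    qed
  qed
  moreover have "(LINT \<xi>|lborel. ?D \<xi>) = synth (pderiv_dir b \<phi>) x + (LINT \<xi>|lborel. \<i> * of_real (x \<bullet> b) * (\<phi> \<xi> * cis (x \<bullet> \<xi>)))"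
    unfolding synth_def
    by (subst Bochner_Integration.integral_add[symmetric])
       (intro integrable_mult_cis integrable_mult_right schwartz_integrable \<phi> \<phi>',
        intro integrable_mult_cis integrable_mult_right schwartz_integrable \<phi> \<phi>', simp add: mult_ac)
  ultimately show ?thesis by (simp add: synth_def eq_neg_iff_add_eq_0 mult.assoc)
qed

lemma synth_pderiv_dir_funpow:
  fixes \<phi> :: "'a::euclidean_space \<Rightarrow> complex"
  assumes b: "b \<in> Basis" and \<phi>: "\<phi> \<in> schwartz"
  shows "(pderiv_dir b ^^ n) \<phi> \<in> schwartz \<and>
    synth ((pderiv_dir b ^^ n) \<phi>) x = (- (\<i> * of_real (x \<bullet> b))) ^ n * synth \<phi> x"
  by (induction n) (auto simp: \<phi> schwartz_pderiv_dir b synth_pderiv_dir)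

text \<open>Differentiating \<open>n\<close> times along the direction \<open>m\<close> of the
  largest coordinate of \<open>x\<close> gains the factor
  \<open>\<bar>x \<bullet> m\<bar> ^ n\<close>, and \<open>norm x\<close> is at most
  \<open>DIM('a)\<close> times that coordinate.\<close>

lemma synth_schwartz_decay:
  fixes \<phi> :: "'a::euclidean_space \<Rightarrow> complex"
  assumes \<phi>: "\<phi> \<in> schwartz"
  shows "\<exists>C. \<forall>x. (1 + norm x) ^ n * norm (synth \<phi> x) \<le> C"
proof -
  have "\<exists>C. \<forall>x. \<bar>x \<bullet> b\<bar> ^ n * norm (synth \<phi> x) \<le> C" if b: "b \<in> Basis" for b
  proof (intro exI allI)
    fix x
    have "\<bar>x \<bullet> b\<bar> ^ n * norm (synth \<phi> x) = norm (synth ((pderiv_dir b ^^ n) \<phi>) x)"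
      using synth_pderiv_dir_funpow[OF b \<phi>, of n x] by (simp add: norm_mult norm_power)
    also have "\<dots> \<le> (LINT \<xi>|lborel. norm ((pderiv_dir b ^^ n) \<phi> \<xi>))" by (rule norm_synth_le)
    finally show "\<bar>x \<bullet> b\<bar> ^ n * norm (synth \<phi> x) \<le> (LINT \<xi>|lborel. norm ((pderiv_dir b ^^ n) \<phi> \<xi>))" .
  qed
  then obtain C where C: "\<bar>x \<bullet> b\<bar> ^ n * norm (synth \<phi> x) \<le> C b" if "b \<in> Basis" for b x by metis
  define A where "A = (LINT \<xi>|lborel. norm (\<phi> \<xi>))"
  let ?d = "real DIM('a)"
  have "(1 + norm x) ^ n * norm (synth \<phi> x) \<le> 2 ^ n * (A + ?d ^ n * (\<Sum>b\<in>Basis. C b))" for x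
  proof -
    let ?S = "(\<lambda>b. \<bar>x \<bullet> b\<bar>) ` Basis"
    have "Max ?S \<in> ?S" by (rule Max_in) auto
    then obtain m where m1: "Max ?S = \<bar>x \<bullet> m\<bar>" and m0: "m \<in> Basis" by (rule imageE)
    have m: "m \<in> Basis" "\<And>b. b \<in> Basis \<Longrightarrow> \<bar>x \<bullet> b\<bar> \<le> \<bar>x \<bullet> m\<bar>"
      using m0 unfolding m1[symmetric] by (auto intro: Max_ge)
    have "norm x \<le> (\<Sum>b\<in>Basis. \<bar>x \<bullet> b\<bar>)" by (rule norm_le_l1)
    also have "\<dots> \<le> ?d * \<bar>x \<bullet> m\<bar>" using sum_bounded_above[of Basis "\<lambda>b. \<bar>x \<bullet> b\<bar>"] m by simp
    finally have "norm x ^ n \<le> ?d ^ n * \<bar>x \<bullet> m\<bar> ^ n" unfolding power_mult_distrib[symmetric] by (rule power_mono) simp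
    then have "norm x ^ n * norm (synth \<phi> x) \<le> ?d ^ n * (\<bar>x \<bullet> m\<bar> ^ n * norm (synth \<phi> x))"
      unfolding mult.assoc[symmetric] by (rule mult_right_mono) simp
    also have "\<bar>x \<bullet> m\<bar> ^ n * norm (synth \<phi> x) \<le> (\<Sum>b\<in>Basis. C b)"
    proof -
      have "C m \<le> (\<Sum>b\<in>Basis. C b)" 
      proof (rule member_le_sum)
        show "0 \<le> C b" if "b \<in> Basis - {m}" for b
          using that by (intro order_trans[OF _ C[of b 0]]) auto
      qed (use m in auto)
      then show ?thesis using C[OF m(1), of x] by simp
    qed
    finally have 1: "norm x ^ n * norm (synth \<phi> x) \<le> ?d ^ n * (\<Sum>b\<in>Basis. C b)" by (simp add: mult_left_mono)
    have "(1 + norm x) ^ n * norm (synth \<phi> x) \<le> 2 ^ n * (1 + norm x ^ n) * norm (synth \<phi> x)"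
      by (intro mult_right_mono one_plus_power_le) auto
    also have "\<dots> = 2 ^ n * (norm (synth \<phi> x) + norm x ^ n * norm (synth \<phi> x))" by (simp add: algebra_simps)
    also have "\<dots> \<le> 2 ^ n * (A + ?d ^ n * (\<Sum>b\<in>Basis. C b))"
      by (intro mult_left_mono add_mono 1) (auto simp: A_def norm_synth_le)
    finally show ?thesis .
  qed
  then show ?thesis by blast
qed

lemma integrable_synth_schwartz:
  fixes \<phi> :: "'a::euclidean_space \<Rightarrow> complex"
  assumes \<phi>: "\<phi> \<in> schwartz"
  shows "integrable lborel (synth \<phi>)"
proof -
  obtain C where "(1 + norm x) ^ (2 * DIM('a)) * norm (synth \<phi> x) \<le> C" for x
    using synth_schwartz_decay[OF assms] by blast
  moreover have "synth \<phi> \<in> borel_measurable lborel"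
    using borel_measurable_continuous_onI[OF continuous_on_synth[OF schwartz_integrable[OF \<phi>]]] by simp
  ultimately show ?thesis by (intro integrable_if_polynomial_decay)
qed

lemma synth_synth_schwartz:
  fixes \<phi> :: "'a::euclidean_space \<Rightarrow> complex"
  assumes \<phi>: "\<phi> \<in> schwartz"
  shows "synth (synth \<phi>) (- x) = of_real ((2 * pi) ^ DIM('a)) * \<phi> x"
proof -
  obtain B where "norm (\<phi> x) \<le> B" for x using schwartz_bounded[OF \<phi>] by blast
  then show ?thesis
    by (intro fourier_inversion[where B=B] schwartz_integrable schwartz_continuous integrable_synth_schwartz \<phi>)
qed

definition fnorm :: "'a::euclidean_space itself \<Rightarrow> real"
  where "fnorm _ = (2 * pi) powr (real DIM('a) / 2)"

lemma fnorm_pos [simp]: "fnorm (TYPE('a::euclidean_space)) > 0"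
  by (simp add: fnorm_def)

lemma fnorm_sq: "fnorm (TYPE('a::euclidean_space)) * fnorm (TYPE('a)) = (2 * pi) ^ DIM('a)"
  by (simp add: fnorm_def powr_realpow del: powr_mult power_mult_distrib flip: powr_add)

lemma fourier_eq_synth:
  fixes f :: "'a::euclidean_space \<Rightarrow> complex"
  shows "fourier f \<xi> = of_real (1 / fnorm TYPE('a)) * synth f (- \<xi>)"
  unfolding fourier_def synth_def fnorm_def
  by (simp add: powr_minus_divide cis_conv_exp inner_commute)

text \<open>The factor comes from the normalisations of \<^const>\<open>synth\<close> (none) and \<^const>\<open>fourier\<close> (symmetric).\<close>
lemma integral_synth_times_fourier:
  fixes g :: "'a::euclidean_space \<Rightarrow> complex"
  assumes g: "integrable lborel g" and \<phi>: "\<phi> \<in> schwartz"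
  shows "(LINT x|lborel. synth g x * fourier \<phi> x) = of_real (fnorm TYPE('a)) * (LINT \<xi>|lborel. g \<xi> * \<phi> \<xi>)"
proof -
  note i = integrable_synth_schwartz[OF \<phi>]
  have [measurable]: "synth g \<in> borel_measurable borel"
    by (rule borel_measurable_continuous_onI[OF continuous_on_synth[OF g]])
  have i1: "integrable lborel (\<lambda>x. synth \<phi> (- x))"
    using integrable_lborel_reflect_iff[of "synth \<phi>" 0] i by simp
  have "integrable lborel (\<lambda>x. (LINT \<xi>|lborel. norm (g \<xi>)) * norm (synth \<phi> (- x)))"
    using i1 by (intro integrable_mult_right integrable_norm)
  then have i2: "integrable lborel (\<lambda>x. synth g x * synth \<phi> (- x))"
    by (rule Bochner_Integration.integrable_bound)
       (use i1 in \<open>auto simp: norm_mult intro!: AE_I2 mult_right_mono order_trans[OF norm_synth_le]\<close>)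
  have eq: "synth g x * fourier \<phi> x = of_real (1 / fnorm TYPE('a)) * (synth g x * synth \<phi> (- x))" for x
    by (simp add: fourier_eq_synth mult_ac)
  have "(LINT x|lborel. synth g x * synth \<phi> (- x)) = (LINT x|lborel. synth \<phi> x * synth g (- x))"
    using integral_lborel_reflect[of "\<lambda>x. synth g x * synth \<phi> (- x)" 0] by (simp add: mult.commute)
  also have "\<dots> = (LINT x|lborel. synth \<phi> x * (LINT \<xi>|lborel. cis (- (x \<bullet> \<xi>)) * g \<xi>))"
    by (simp add: synth_def[of g] mult.commute)
  also have "\<dots> = (LINT \<xi>|lborel. g \<xi> * (LINT x|lborel. cis (- (x \<bullet> \<xi>)) * synth \<phi> x))"
    by (rule integral_swap_product[OF i g]) auto
  also have "\<dots> = (LINT \<xi>|lborel. g \<xi> * synth (synth \<phi>) (- \<xi>))"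
    by (simp add: synth_def[of "synth \<phi>"] mult.commute inner_commute)
  also have "\<dots> = of_real ((2 * pi) ^ DIM('a)) * (LINT \<xi>|lborel. g \<xi> * \<phi> \<xi>)"
    unfolding synth_synth_schwartz[OF \<phi>] integral_mult_right_zero[symmetric] by (simp add: mult_ac)
  finally have "(LINT x|lborel. synth g x * synth \<phi> (- x)) = of_real (fnorm TYPE('a) * fnorm TYPE('a)) * (LINT \<xi>|lborel. g \<xi> * \<phi> \<xi>)"
    by (simp only: fnorm_sq)
  moreover have "fnorm TYPE('a) \<noteq> 0" using fnorm_pos[where 'a='a] by (metis less_irrefl)
  ultimately show "(LINT x|lborel. synth g x * fourier \<phi> x) = of_real (fnorm TYPE('a)) * (LINT \<xi>|lborel. g \<xi> * \<phi> \<xi>)"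
    unfolding eq integral_mult_right_zero by simp
qed


text \<open>Polynomials, generated by rules along which derivatives and growth bounds follow by
  induction. Times a Gaussian they are explicit Schwartz functions, which also cover the factors
  produced by differentiating a Fourier transform.\<close>

inductive cpoly :: "('a::euclidean_space \<Rightarrow> complex) \<Rightarrow> bool" where
  const: "cpoly (\<lambda>x. c)"
| inner: "cpoly (\<lambda>x. of_real (x \<bullet> v))"
| add: "cpoly f \<Longrightarrow> cpoly g \<Longrightarrow> cpoly (\<lambda>x. f x + g x)"
| mult: "cpoly f \<Longrightarrow> cpoly g \<Longrightarrow> cpoly (\<lambda>x. f x * g x)"

lemma cpoly_has_derivative:
  "cpoly f \<Longrightarrow> \<exists>f'. (\<forall>x. (f has_derivative f' x) (at x)) \<and> (\<forall>b. cpoly (\<lambda>x. f' x b))"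
proof (induction rule: cpoly.induct)
  case (const c)
  show ?case by (rule exI[of _ "\<lambda>x h. 0"]) (auto intro: cpoly.const)
next
  case (inner v)
  have "((\<lambda>x. complex_of_real (x \<bullet> v)) has_derivative (\<lambda>h. of_real (h \<bullet> v))) (at x)" for x
    by (intro derivative_eq_intros) auto
  then show ?case by (intro exI[of _ "\<lambda>x h. of_real (h \<bullet> v)"]) (auto intro: cpoly.const)
next
  case (add f g)
  then obtain f' g' where "\<And>x. (f has_derivative f' x) (at x)" "\<And>b. cpoly (\<lambda>x. f' x b)"
    "\<And>x. (g has_derivative g' x) (at x)" "\<And>b. cpoly (\<lambda>x. g' x b)" by blast
  then show ?case
    by (intro exI[of _ "\<lambda>x h. f' x h + g' x h"]) (auto intro: has_derivative_add cpoly.add)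
next
  case (mult f g)
  then obtain f' g' where "\<And>x. (f has_derivative f' x) (at x)" "\<And>b. cpoly (\<lambda>x. f' x b)"
    "\<And>x. (g has_derivative g' x) (at x)" "\<And>b. cpoly (\<lambda>x. g' x b)" by blast
  then show ?case
    by (intro exI[of _ "\<lambda>x h. f x * g' x h + f' x h * g x"])
      (intro conjI allI has_derivative_mult cpoly.add cpoly.mult mult.hyps, auto)
qed

lemma cpoly_growth: "cpoly f \<Longrightarrow> \<exists>C N. \<forall>x. norm (f x) \<le> C * (1 + norm x) ^ N"
proof (induction rule: cpoly.induct)
  case (const c)
  show ?case by (rule exI[of _ "norm c"], rule exI[of _ 0]) simp
next
  case (inner v)
  have "norm (complex_of_real (x \<bullet> v)) \<le> norm v * (1 + norm x) ^ 1" for x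
  proof -
    have "\<bar>x \<bullet> v\<bar> \<le> norm x * norm v" by (rule Cauchy_Schwarz_ineq2)
    then show ?thesis by (simp add: algebra_simps) (smt (verit) norm_ge_zero)
  qed
  then show ?case by blast
next
  case (add f g)
  then obtain C N C' N' where f: "\<And>x. norm (f x) \<le> C * (1 + norm x) ^ N" and g: "\<And>x. norm (g x) \<le> C' * (1 + norm x) ^ N'"
    by blast
  have "norm (f x + g x) \<le> (\<bar>C\<bar> + \<bar>C'\<bar>) * (1 + norm x) ^ (N + N')" for x
  proof -
    have "norm (f x) \<le> \<bar>C\<bar> * (1 + norm x) ^ (N + N')"
      by (rule order_trans[OF f]) (intro mult_mono power_increasing, auto)
    moreover have "norm (g x) \<le> \<bar>C'\<bar> * (1 + norm x) ^ (N + N')"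
      by (rule order_trans[OF g]) (intro mult_mono power_increasing, auto)
    ultimately show ?thesis by (intro order_trans[OF norm_triangle_ineq]) (simp add: algebra_simps)
  qed
  then show ?case by blast
next
  case (mult f g)
  then obtain C N C' N' where f: "\<And>x. norm (f x) \<le> C * (1 + norm x) ^ N" and g: "\<And>x. norm (g x) \<le> C' * (1 + norm x) ^ N'"
    by blast
  have "norm (f x * g x) \<le> (C * C') * (1 + norm x) ^ (N + N')" for x
  proof -
    have "norm (f x * g x) \<le> (C * (1 + norm x) ^ N) * (C' * (1 + norm x) ^ N')"
      unfolding norm_mult by (intro mult_mono f g order_trans[OF norm_ge_zero f]) auto
    then show ?thesis by (simp add: power_add mult_ac)
  qed
  then show ?case by blast
qed

text \<open>One family for translated and modulated Gaussians: up to a constant the real linear term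
  \<open>x \<bullet> v\<close> is a translation, by completing the square, and \<open>w\<close> is a
  frequency.\<close>

definition cgauss :: "real \<Rightarrow> 'a::euclidean_space \<Rightarrow> 'a \<Rightarrow> 'a \<Rightarrow> complex"
  where "cgauss s v w x = exp (of_real (- s * (x \<bullet> x) + x \<bullet> v) + \<i> * of_real (x \<bullet> w))"

lemma cgauss_has_derivative:
  "(cgauss s v w has_derivative (\<lambda>h. (of_real (- s * (2 * (x \<bullet> h)) + h \<bullet> v) + \<i> * of_real (h \<bullet> w)) * cgauss s v w x)) (at x)"
proof -
  have "((\<lambda>x. of_real (- s * (x \<bullet> x) + x \<bullet> v) + \<i> * of_real (x \<bullet> w)) has_derivative
     (\<lambda>h. of_real (- s * (2 * (x \<bullet> h)) + h \<bullet> v) + \<i> * of_real (h \<bullet> w))) (at x)"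
    by (auto intro!: derivative_eq_intros simp: inner_commute algebra_simps)
  from has_derivative_compose[OF this DERIV_exp[THEN has_field_derivative_imp_has_derivative]] show ?thesis
    unfolding cgauss_def by (simp add: mult.commute)
qed

text \<open>The power is at most \<open>fact N * exp (1 + norm x)\<close>; completing the square
  then bounds the total exponent, whose quadratic term has a negative coefficient.\<close>

lemma cgauss_decay:
  fixes v w :: "'a::euclidean_space"
  assumes s: "s > 0"
  shows "\<exists>C. \<forall>x. (1 + norm x) ^ N * norm (cgauss s v w x) \<le> C"
proof (intro exI allI)
  fix x :: 'a
  let ?r = "norm x" and ?a = "norm v"
  have n: "norm (cgauss s v w x) = exp (- s * ?r\<^sup>2 + x \<bullet> v)"
    by (simp add: cgauss_def norm_exp_eq_Re power2_norm_eq_inner)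
  have "(1 + ?r) ^ N / fact N \<le> exp (1 + ?r)"
  proof -
    have "(1 + ?r) ^ N / fact N = (\<Sum>n\<in>{N}. (1 + ?r) ^ n /\<^sub>R fact n)" by (simp add: divide_inverse mult.commute)
    also have "\<dots> \<le> (\<Sum>n. (1 + ?r) ^ n /\<^sub>R fact n)"
      by (rule sum_le_suminf[OF summable_exp_generic]) auto
    finally show ?thesis by (simp add: exp_def)
  qed
  then have "(1 + ?r) ^ N \<le> fact N * exp (1 + ?r)" by (simp add: field_simps)
  then have "(1 + ?r) ^ N * norm (cgauss s v w x) \<le> fact N * exp (1 + ?r) * exp (- s * ?r\<^sup>2 + x \<bullet> v)"
    unfolding n by (intro mult_right_mono) auto
  also have "\<dots> = fact N * exp (1 + ?r - s * ?r\<^sup>2 + x \<bullet> v)" by (simp add: exp_add[symmetric] algebra_simps)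
  also have "\<dots> \<le> fact N * exp (1 + (?a + 1)\<^sup>2 / (4 * s))"
  proof -
    have "x \<bullet> v \<le> ?r * ?a" by (metis Cauchy_Schwarz_ineq2 abs_le_D1)
    moreover have "(?a + 1) * ?r - s * ?r\<^sup>2 \<le> (?a + 1)\<^sup>2 / (4 * s)"
    proof -
      have "0 \<le> (2 * s * ?r - (?a + 1))\<^sup>2 / (4 * s)" using s by simp
      also have "\<dots> = s * ?r\<^sup>2 - (?a + 1) * ?r + (?a + 1)\<^sup>2 / (4 * s)"
        using s by (simp add: power2_eq_square field_simps)
      finally show ?thesis by simp
    qed
    ultimately have "1 + ?r - s * ?r\<^sup>2 + x \<bullet> v \<le> 1 + (?a + 1)\<^sup>2 / (4 * s)" by (simp add: algebra_simps)
    then show ?thesis by simp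
  qed
  finally show "(1 + norm x) ^ N * norm (cgauss s v w x) \<le> fact N * exp (1 + (?a + 1)\<^sup>2 / (4 * s))" .
qed

text \<open>The set \<open>G\<close> of polynomials times this fixed Gaussian is closed under
  directional derivatives, so only the decay of its members remains to be checked.\<close>

lemma cpoly_cgauss_schwartz:
  assumes s: "s > 0" and f: "cpoly f"
  shows "(\<lambda>x. f x * cgauss s v w x) \<in> schwartz"
proof -
  define G where "G = {\<phi>. \<exists>f. cpoly f \<and> \<phi> = (\<lambda>x. f x * cgauss s v w x)}"
  have diff: "\<phi> differentiable (at x) \<and> pderiv_dir b \<phi> \<in> G" if \<phi>G: "\<phi> \<in> G" for \<phi> x b
  proof -
    obtain f where f: "cpoly f" "\<phi> = (\<lambda>x. f x * cgauss s v w x)" using \<phi>G unfolding G_def by blast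
    obtain f' where f': "\<And>x. (f has_derivative f' x) (at x)" "\<And>b. cpoly (\<lambda>x. f' x b)"
      using cpoly_has_derivative[OF f(1)] by blast
    let ?E = "\<lambda>x h. of_real (- s * (2 * (x \<bullet> h)) + h \<bullet> v) + \<i> * of_real (h \<bullet> w)"
    have d: "(\<phi> has_derivative (\<lambda>h. f x * (?E x h * cgauss s v w x) + f' x h * cgauss s v w x)) (at x)" for x
      unfolding f(2) by (rule has_derivative_mult[OF f'(1) cgauss_has_derivative])
    have "pderiv_dir b \<phi> = (\<lambda>x. (f x * ?E x b + f' x b) * cgauss s v w x)"
      unfolding pderiv_dir_def frechet_derivative_at[OF d, symmetric] by (simp add: algebra_simps)
    moreover have "cpoly (\<lambda>x. f x * ?E x b + f' x b)"
    proof -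
      have eq: "?E x b = of_real (- 2 * s) * of_real (x \<bullet> b) + (of_real (b \<bullet> v) + \<i> * of_real (b \<bullet> w))" for x
        by simp
      show ?thesis unfolding eq by (intro cpoly.intros f f')
    qed
    ultimately show ?thesis using d by (auto simp: G_def differentiable_def)
  qed
  have multi: "pderiv_multi p \<phi> \<in> G" if "\<phi> \<in> G" for p \<phi>
    using that diff by (induction p) (auto simp: pderiv_multi_def)
  have bd: "bounded (range (\<lambda>x. norm x ^ n *\<^sub>R \<phi> x))" if \<phi>G: "\<phi> \<in> G" for \<phi> n
  proof -
    obtain f where f: "cpoly f" "\<phi> = (\<lambda>x. f x * cgauss s v w x)" using \<phi>G unfolding G_def by blast
    obtain C N where C: "\<And>x. norm (f x) \<le> C * (1 + norm x) ^ N" using cpoly_growth[OF f(1)] by blast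
    obtain D where D: "\<And>x. (1 + norm x) ^ (n + N) * norm (cgauss s v w x) \<le> D" using cgauss_decay[OF s] by blast
    have "norm (norm x ^ n *\<^sub>R \<phi> x) \<le> \<bar>C\<bar> * D" for x
    proof -
      have "norm (norm x ^ n *\<^sub>R \<phi> x) = norm x ^ n * norm (f x) * norm (cgauss s v w x)"
        by (simp add: f norm_mult)
      also have "\<dots> \<le> (1 + norm x) ^ n * (\<bar>C\<bar> * (1 + norm x) ^ N) * norm (cgauss s v w x)"
        by (intro mult_right_mono mult_mono power_mono order_trans[OF C]) auto
      also have "\<dots> = \<bar>C\<bar> * ((1 + norm x) ^ (n + N) * norm (cgauss s v w x))" by (simp add: power_add mult_ac)
      also have "\<dots> \<le> \<bar>C\<bar> * D" by (intro mult_left_mono D) auto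
      finally show ?thesis .
    qed
    then show ?thesis unfolding bounded_iff by blast
  qed
  have "(\<lambda>x. f x * cgauss s v w x) \<in> G" using f by (auto simp: G_def)
  with multi diff bd show ?thesis unfolding schwartz_def by simp
qed

lemma cgauss_schwartz: "s > 0 \<Longrightarrow> cgauss s v w \<in> schwartz"
  using cpoly_cgauss_schwartz[OF _ cpoly.const[of 1]] by simp

lemma cgauss_modulated: "cgauss s 0 w x = of_real (exp (- s * (norm x)\<^sup>2)) * cis (x \<bullet> w)"
  by (simp add: cgauss_def exp_diff exp_minus field_simps cis_conv_exp power2_norm_eq_inner flip: exp_of_real)

lemma translated_gaussian_eq_cgauss:
  "complex_of_real (exp (- s * (norm (x - y))\<^sup>2)) = of_real (exp (- s * (norm y)\<^sup>2)) * cgauss s ((2 * s) *\<^sub>R y) 0 x"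
  unfolding cgauss_def power2_norm_eq_inner
  by (simp add: inner_simps inner_commute algebra_simps flip: exp_of_real of_real_mult exp_add of_real_add)

lemma schwartz_cmult:
  assumes "\<phi> \<in> schwartz" shows "(\<lambda>x. c * \<phi> x) \<in> schwartz"
proof -
  have p: "pderiv_multi p (\<lambda>x. c * \<phi> x) = (\<lambda>x. c * pderiv_multi p \<phi> x)" if "p \<in> lists Basis" for p
    using that
  proof (induction p)
    case (Cons b p)
    have "pderiv_multi p \<phi> differentiable (at x)" for x
      using assms Cons.hyps unfolding schwartz_def by (simp add: Cons)
    then have "((\<lambda>x. c * pderiv_multi p \<phi> x) has_derivative (\<lambda>h. c * frechet_derivative (pderiv_multi p \<phi>) (at x) h)) (at x)" for x
      by (intro has_derivative_mult_right) (simp add: frechet_derivative_works)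
    from frechet_derivative_at[OF this, symmetric]
    have "pderiv_dir b (\<lambda>x. c * pderiv_multi p \<phi> x) = (\<lambda>x. c * pderiv_dir b (pderiv_multi p \<phi>) x)"
      by (simp add: pderiv_dir_def)
    with Cons show ?case by (simp add: pderiv_multi_def)
  qed (simp add: pderiv_multi_def)
  have "bounded (range (\<lambda>x. norm x ^ n *\<^sub>R (c * f x)))" if "bounded (range (\<lambda>x. norm x ^ n *\<^sub>R f x))" for n and f :: "'a \<Rightarrow> complex"
    using bounded_scaling[OF that, of 1] bounded_linear_image[OF that bounded_linear_mult_right[of c]]
    by (simp add: image_image)
  with assms p show ?thesis unfolding schwartz_def by (auto intro!: differentiable_mult)
qed


section \<open>Weighted Wiener algebras\<close>

text \<open>
  The exponent of the weight is carried by the cardinality of a type \<open>'n\<close>, shifted by one because types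
  are nonempty: the numeral types \<open>1\<close> and \<open>3\<close> stand for the weights \<open>1\<close> and \<open>(1 + |\<xi>|)\<^sup>2\<close>.
\<close>
definition wt :: "'n itself \<Rightarrow> 'a::real_normed_vector \<Rightarrow> real"
  where "wt n \<xi> = (1 + norm \<xi>) ^ (CARD('n) - 1)"

lemma wt_ge_1 [simp]: "1 \<le> wt n \<xi>"
  by (simp add: wt_def one_le_power)

lemma wt_nonneg [simp]: "0 \<le> wt n \<xi>"
  using wt_ge_1[of n \<xi>] by linarith

lemma wt_pos [simp]: "0 < wt n \<xi>"
  using wt_ge_1[of n \<xi>] by linarith

lemma wt_uminus [simp]: "wt n (- \<xi>) = wt n \<xi>"
  by (simp add: wt_def)

text \<open>This submultiplicativity is what makes the weighted \<open>L^1\<close> space an algebra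
  under convolution.\<close>

lemma wt_add: "wt n (\<xi> + \<eta>) \<le> wt n \<xi> * wt n \<eta>"
proof -
  have "1 + norm (\<xi> + \<eta>) \<le> 1 + (norm \<xi> + norm \<eta>)" by (simp add: norm_triangle_ineq)
  also have "\<dots> \<le> (1 + norm \<xi>) * (1 + norm \<eta>)" by (simp add: algebra_simps)
  finally show ?thesis unfolding wt_def power_mult_distrib[symmetric] by (rule power_mono) simp
qed

lemma wt_measurable [measurable]: "wt n \<in> borel_measurable (borel :: 'a::euclidean_space measure)"
  unfolding wt_def[abs_def] by measurable

lemma wt_1 [simp]: "wt TYPE(1) \<xi> = 1"
  by (simp add: wt_def)

definition wint :: "'n itself \<Rightarrow> ('a::euclidean_space \<Rightarrow> complex) \<Rightarrow> bool"
  where "wint n g \<longleftrightarrow> g \<in> borel_measurable borel \<and> integrable lborel (\<lambda>\<xi>. wt n \<xi> * norm (g \<xi>))"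

lemma wintD: "wint n g \<Longrightarrow> g \<in> borel_measurable borel" "wint n g \<Longrightarrow> integrable lborel (\<lambda>\<xi>. wt n \<xi> * norm (g \<xi>))"
  by (simp_all add: wint_def)

lemma wint_bound:
  assumes "integrable lborel h" "g \<in> borel_measurable borel" "\<And>\<xi>. wt n \<xi> * norm (g \<xi>) \<le> h \<xi>"
  shows "wint n g"
  unfolding wint_def
proof (intro conjI assms Bochner_Integration.integrable_bound[OF assms(1)] AE_I2)
  have [measurable]: "g \<in> borel_measurable borel" by fact
  show "(\<lambda>\<xi>. wt n \<xi> * norm (g \<xi>)) \<in> borel_measurable lborel" by measurable
  show "norm (wt n \<xi> * norm (g \<xi>)) \<le> norm (h \<xi>)" for \<xi>
    using assms(3)[of \<xi>] by (simp add: abs_mult)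
qed

lemma wint_integrable: "integrable lborel g" if "wint n g"
proof (rule Bochner_Integration.integrable_bound[OF wintD(2)[OF that]])
  show "AE x in lborel. norm (g x) \<le> norm (wt n x * norm (g x))"
    by (intro AE_I2) (simp add: abs_mult mult_le_cancel_right1)
qed (use wintD(1)[OF that] in simp)

lemma wint_zero [simp]: "wint n (\<lambda>\<xi>. 0)"
  by (simp add: wint_def)

lemma wint_add: "wint n (\<lambda>\<xi>. f \<xi> + g \<xi>)" if "wint n f" "wint n g"
proof (rule wint_bound)
  show "integrable lborel (\<lambda>\<xi>. wt n \<xi> * norm (f \<xi>) + wt n \<xi> * norm (g \<xi>))"
    using that by (intro Bochner_Integration.integrable_add wintD)
  show "wt n \<xi> * norm (f \<xi> + g \<xi>) \<le> wt n \<xi> * norm (f \<xi>) + wt n \<xi> * norm (g \<xi>)" for \<xi>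
    unfolding distrib_left[symmetric] by (intro mult_left_mono norm_triangle_ineq) simp
qed (use that[THEN wintD(1)] in measurable)

lemma wint_mult_bounded:
  assumes [measurable]: "m \<in> borel_measurable borel" and B: "\<And>\<xi>. norm (m \<xi>) \<le> B" and g: "wint n g"
  shows "wint n (\<lambda>\<xi>. m \<xi> * g \<xi>)"
proof (rule wint_bound)
  have [measurable]: "g \<in> borel_measurable borel" using g by (rule wintD)
  show "(\<lambda>\<xi>. m \<xi> * g \<xi>) \<in> borel_measurable borel" by measurable
  show "integrable lborel (\<lambda>\<xi>. B * (wt n \<xi> * norm (g \<xi>)))" using g by (intro integrable_mult_right wintD)
  show "wt n \<xi> * norm (m \<xi> * g \<xi>) \<le> B * (wt n \<xi> * norm (g \<xi>))" for \<xi>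
    using mult_right_mono[OF B[of \<xi>], of "wt n \<xi> * norm (g \<xi>)"] by (simp add: norm_mult mult_ac)
qed

lemma wint_cmult: "wint n (\<lambda>\<xi>. c * g \<xi>)" if "wint n g"
  using wint_mult_bounded[of "\<lambda>_. c" "norm c"] that by simp

lemma wint_diff: "wint n (\<lambda>\<xi>. f \<xi> - g \<xi>)" if "wint n f" "wint n g"
  using wint_add[OF that(1) wint_cmult[OF that(2), of "-1"]] by simp

lemma wint_sum: "(\<And>i. i \<in> A \<Longrightarrow> wint n (f i)) \<Longrightarrow> wint n (\<lambda>\<xi>. \<Sum>i\<in>A. f i \<xi>)"
  by (induction A rule: infinite_finite_induct) (auto intro: wint_add)

lemma wint_cnj_reflect: "wint n (\<lambda>\<xi>. cnj (g (- \<xi>)))" if "wint n g"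
proof -
  have [measurable]: "g \<in> borel_measurable borel" using that by (rule wintD)
  have "(\<lambda>\<xi>. cnj (g (- \<xi>))) \<in> borel_measurable borel"
    by (rule borel_measurable_continuous_on[of cnj]) (auto intro!: continuous_intros)
  then show ?thesis
    using wintD(2)[OF that] integrable_lborel_reflect_iff[of "\<lambda>\<xi>. wt n \<xi> * norm (g \<xi>)" 0]
    by (auto simp: wint_def)
qed

lemma synth_cong_AE:
  assumes "wint n g" "wint m h" "AE \<xi> in lborel. g \<xi> = h \<xi>"
  shows "synth g = synth h"
proof
  fix x
  have [measurable]: "g \<in> borel_measurable borel" "h \<in> borel_measurable borel" using assms by (auto dest: wintD)
  show "synth g x = synth h x"
    unfolding synth_def by (rule integral_cong_AE) (use assms in auto)
qed

lemma synth_add: "synth (\<lambda>\<xi>. f \<xi> + g \<xi>) x = synth f x + synth g x" if "integrable lborel f" "integrable lborel g"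
  unfolding synth_def
  by (subst Bochner_Integration.integral_add[symmetric]) (use that in \<open>auto intro!: integrable_mult_cis simp: algebra_simps\<close>)

lemma synth_cmult: "synth (\<lambda>\<xi>. c * f \<xi>) x = c * synth f x"
  by (simp add: synth_def mult.assoc)

lemma synth_diff: "synth (\<lambda>\<xi>. f \<xi> - g \<xi>) x = synth f x - synth g x" if "integrable lborel f" "integrable lborel g"
  using synth_add[of f "\<lambda>\<xi>. -1 * g \<xi>"] synth_cmult[of "-1" g] that by simp

lemma synth_inj:
  assumes "wint n g" "wint m h" "synth g = synth h"
  shows "AE \<xi> in lborel. g \<xi> = h \<xi>"
proof -
  have "AE \<xi> in lborel. g \<xi> - h \<xi> = 0"
  proof (rule AE_zero_if_synth_zero)
    show "synth (\<lambda>\<xi>. g \<xi> - h \<xi>) x = 0" for x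
      using assms by (subst synth_diff) (auto dest: wint_integrable)
  qed (intro Bochner_Integration.integrable_diff wint_integrable[OF assms(1)] wint_integrable[OF assms(2)])
  then show ?thesis by simp
qed

text \<open>Two uses of Fubini: on \<open>?F\<close>, with absolute values and weight, for Young's
  inequality, and on \<open>?G\<close>, with the character, for the product formula.\<close>

lemma
  fixes a b :: "'a::euclidean_space \<Rightarrow> complex"
  assumes a: "wint n a" and b: "wint n b"
  defines "c \<equiv> \<lambda>\<xi>. LINT \<eta>|lborel. a (\<xi> - \<eta>) * b \<eta>"
  shows wint_convolution: "wint n c"
    and synth_convolution: "synth c x = synth a x * synth b x"
    and norm_convolution: "(LINT \<xi>|lborel. wt n \<xi> * norm (c \<xi>)) \<le> (LINT \<xi>|lborel. wt n \<xi> * norm (a \<xi>)) * (LINT \<xi>|lborel. wt n \<xi> * norm (b \<xi>))"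
proof -
  have [measurable]: "a \<in> borel_measurable borel" "b \<in> borel_measurable borel" using a b by (auto dest: wintD)
  let ?A = "LINT \<xi>|lborel. wt n \<xi> * norm (a \<xi>)"
  let ?F = "\<lambda>\<eta> \<xi>. wt n \<xi> * norm (a (\<xi> - \<eta>)) * norm (b \<eta>)"
  have Fle: "?F \<eta> \<xi> \<le> wt n (\<xi> - \<eta>) * norm (a (\<xi> - \<eta>)) * (wt n \<eta> * norm (b \<eta>))" for \<xi> \<eta>
    using mult_right_mono[OF wt_add[of n "\<xi> - \<eta>" \<eta>], of "norm (a (\<xi> - \<eta>)) * norm (b \<eta>)"] by (simp add: mult_ac)
  have ia: "integrable lborel (\<lambda>\<xi>. wt n (\<xi> - \<eta>) * norm (a (\<xi> - \<eta>)))" "(LINT \<xi>|lborel. wt n (\<xi> - \<eta>) * norm (a (\<xi> - \<eta>))) = ?A" for \<eta>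
    using integrable_lborel_shift_iff[of "\<lambda>\<xi>. wt n \<xi> * norm (a \<xi>)" \<eta>] integral_lborel_shift[of "\<lambda>\<xi>. wt n \<xi> * norm (a \<xi>)" \<eta>] wintD(2)[OF a]
    by auto
  have iF: "integrable lborel (?F \<eta>)" for \<eta>
  proof (rule Bochner_Integration.integrable_bound)
    show "integrable lborel (\<lambda>\<xi>. wt n (\<xi> - \<eta>) * norm (a (\<xi> - \<eta>)) * (wt n \<eta> * norm (b \<eta>)))"
      by (intro integrable_mult_left ia)
    show "AE \<xi> in lborel. norm (?F \<eta> \<xi>) \<le> norm (wt n (\<xi> - \<eta>) * norm (a (\<xi> - \<eta>)) * (wt n \<eta> * norm (b \<eta>)))"
      using Fle[of _ \<eta>] by (intro AE_I2) (simp add: abs_mult)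
  qed measurable
  have Fint: "(LINT \<xi>|lborel. ?F \<eta> \<xi>) \<le> ?A * (wt n \<eta> * norm (b \<eta>))" for \<eta>
  proof -
    have "(LINT \<xi>|lborel. ?F \<eta> \<xi>) \<le> (LINT \<xi>|lborel. wt n (\<xi> - \<eta>) * norm (a (\<xi> - \<eta>)) * (wt n \<eta> * norm (b \<eta>)))"
      by (intro integral_mono iF integrable_mult_left ia Fle)
    then show ?thesis by (simp add: ia)
  qed
  have Fm: "(\<lambda>(\<eta>, \<xi>). ?F \<eta> \<xi>) \<in> borel_measurable (lborel \<Otimes>\<^sub>M lborel)" by measurable
  have gi: "integrable lborel (\<lambda>\<eta>. ?A * (wt n \<eta> * norm (b \<eta>)))" by (intro integrable_mult_right wintD b)
  have Fint': "(LINT \<xi>|lborel. norm (?F \<eta> \<xi>)) \<le> ?A * (wt n \<eta> * norm (b \<eta>))" for \<eta>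
    using Fint[of \<eta>] by (simp add: abs_mult)
  note pF = integrable_pair_lborel[OF Fm gi iF Fint'] and sF = integral_swap_lborel[OF Fm gi iF Fint']
  have HI: "integrable lborel (\<lambda>\<xi>. LINT \<eta>|lborel. ?F \<eta> \<xi>)"
    using lborel_pair.integrable_snd[OF pF] .
  have AEF: "AE \<xi> in lborel. integrable lborel (\<lambda>\<eta>. ?F \<eta> \<xi>)"
    using lborel_pair.AE_integrable_snd[OF pF] .
  have cm [measurable]: "c \<in> borel_measurable borel" unfolding c_def by measurable
  \<comment> \<open>This includes the null set of \<xi> on which the convolution integral diverges:
    there both sides are 0 by convention.\<close>
  have cle: "wt n \<xi> * norm (c \<xi>) \<le> (LINT \<eta>|lborel. ?F \<eta> \<xi>)" for \<xi>
  proof -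
    have "norm (c \<xi>) \<le> (LINT \<eta>|lborel. norm (a (\<xi> - \<eta>) * b \<eta>))" unfolding c_def by (rule integral_norm_bound)
    then have "wt n \<xi> * norm (c \<xi>) \<le> wt n \<xi> * (LINT \<eta>|lborel. norm (a (\<xi> - \<eta>) * b \<eta>))" by (rule mult_left_mono) simp
    also have "\<dots> = (LINT \<eta>|lborel. ?F \<eta> \<xi>)" by (simp add: norm_mult mult.assoc flip: integral_mult_right_zero)
    finally show ?thesis .
  qed
  show wc: "wint n c" by (rule wint_bound[OF HI cm cle])
  have "(LINT \<xi>|lborel. wt n \<xi> * norm (c \<xi>)) \<le> (LINT \<xi>|lborel. LINT \<eta>|lborel. ?F \<eta> \<xi>)"
    by (intro integral_mono wintD wc HI cle)
  also have "\<dots> = (LINT \<eta>|lborel. LINT \<xi>|lborel. ?F \<eta> \<xi>)" using sF by simp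
  also have "\<dots> \<le> (LINT \<eta>|lborel. ?A * (wt n \<eta> * norm (b \<eta>)))"
    by (intro integral_mono gi Fint lborel_pair.integrable_fst[OF pF])
  finally show "(LINT \<xi>|lborel. wt n \<xi> * norm (c \<xi>)) \<le> ?A * (LINT \<xi>|lborel. wt n \<xi> * norm (b \<xi>))" by simp
  let ?G = "\<lambda>\<eta> \<xi>. a (\<xi> - \<eta>) * b \<eta> * cis (x \<bullet> \<xi>)"
  have Gm: "(\<lambda>(\<eta>, \<xi>). ?G \<eta> \<xi>) \<in> borel_measurable (lborel \<Otimes>\<^sub>M lborel)" by measurable
  have ia': "integrable lborel (\<lambda>\<xi>. a (\<xi> - \<eta>))" for \<eta>
    using integrable_lborel_shift_iff[of a \<eta>] wint_integrable[OF a] by simp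
  have iG: "integrable lborel (?G \<eta>)" for \<eta>
    by (intro integrable_mult_cis integrable_mult_left ia')
  have "(LINT \<xi>|lborel. norm (?G \<eta> \<xi>)) \<le> (LINT \<xi>|lborel. norm (a \<xi>)) * norm (b \<eta>)" for \<eta>
    using integral_lborel_shift[of "\<lambda>\<xi>. norm (a \<xi>)" \<eta>] by (simp add: norm_mult)
  then have "(LINT \<eta>|lborel. LINT \<xi>|lborel. ?G \<eta> \<xi>) = (LINT \<xi>|lborel. LINT \<eta>|lborel. ?G \<eta> \<xi>)"
    by (rule integral_swap_lborel[OF Gm _ iG, rotated]) (intro integrable_mult_right integrable_norm wint_integrable[OF b])
  moreover have "(LINT \<xi>|lborel. ?G \<eta> \<xi>) = synth a x * (b \<eta> * cis (x \<bullet> \<eta>))" for \<eta>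
  proof -
    have "(LINT \<xi>|lborel. ?G \<eta> \<xi>) = (LINT \<xi>|lborel. a (\<xi> - \<eta>) * cis (x \<bullet> (\<xi> - \<eta>)) * (b \<eta> * cis (x \<bullet> \<eta>)))"
      by (simp add: inner_diff_right mult_ac cis_mult)
    also have "\<dots> = (LINT \<xi>|lborel. a (\<xi> - \<eta>) * cis (x \<bullet> (\<xi> - \<eta>))) * (b \<eta> * cis (x \<bullet> \<eta>))" by simp
    also have "(LINT \<xi>|lborel. a (\<xi> - \<eta>) * cis (x \<bullet> (\<xi> - \<eta>))) = synth a x"
      unfolding synth_def using integral_lborel_shift[of "\<lambda>\<xi>. a \<xi> * cis (x \<bullet> \<xi>)" \<eta>] by simp
    finally show ?thesis .
  qed
  moreover have "(LINT \<eta>|lborel. ?G \<eta> \<xi>) = c \<xi> * cis (x \<bullet> \<xi>)" for \<xi> unfolding c_def by simp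
  ultimately show "synth c x = synth a x * synth b x" by (simp add: synth_def[of c] synth_def[of b])
qed

text \<open>
  Elements are honest functions, so that the algebra structure is pointwise; the spectrum is
  recovered up to null sets by uniqueness of the Fourier transform.
\<close>
typedef (overloaded) ('a::euclidean_space, 'n) W =
  "{f :: 'a \<Rightarrow> complex. \<exists>g. wint TYPE('n) g \<and> f = synth g}"
  morphisms wfun mkW
  using wint_zero by blast

definition spec :: "('a::euclidean_space, 'n) W \<Rightarrow> 'a \<Rightarrow> complex"
  where "spec f = (SOME g. wint TYPE('n) g \<and> wfun f = synth g)"

definition of_spec :: "('a::euclidean_space \<Rightarrow> complex) \<Rightarrow> ('a, 'n) W"
  where "of_spec g = mkW (synth g)"

lemma spec: "wint TYPE('n) (spec (f :: ('a::euclidean_space, 'n) W))" "wfun f = synth (spec f)"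
proof -
  have "\<exists>g. wint TYPE('n) g \<and> wfun f = synth g" using wfun[of f] by auto
  from someI_ex[OF this] show "wint TYPE('n) (spec f)" "wfun f = synth (spec f)"
    unfolding spec_def by auto
qed

lemma spec_measurable [measurable]: "spec f \<in> borel_measurable borel"
  using spec(1) by (rule wintD)

lemma integrable_spec: "integrable lborel (spec f)"
  using spec(1) by (rule wint_integrable)

lemma wfun_of_spec: "wint TYPE('n) g \<Longrightarrow> wfun (of_spec g :: ('a::euclidean_space, 'n) W) = synth g"
  unfolding of_spec_def by (subst mkW_inverse) auto

lemma W_eqI: "(\<And>x. wfun f x = wfun g x) \<Longrightarrow> f = g"
  by (simp add: wfun_inject[symmetric] fun_eq_iff)

lemma spec_AE_eq: "wint m g \<Longrightarrow> wfun f = synth g \<Longrightarrow> AE \<xi> in lborel. spec f \<xi> = g \<xi>"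
  using synth_inj[OF spec(1)] spec(2) by metis

lemma spec_of_spec: "wint TYPE('n) g \<Longrightarrow> AE \<xi> in lborel. spec (of_spec g :: ('a::euclidean_space, 'n) W) \<xi> = g \<xi>"
  by (rule spec_AE_eq) (auto simp: wfun_of_spec)

lemma continuous_on_wfun: "continuous_on UNIV (wfun f)"
  unfolding spec(2) by (rule continuous_on_synth[OF integrable_spec])

lemma wfun_measurable [measurable]: "wfun f \<in> borel_measurable borel"
  by (rule borel_measurable_continuous_onI[OF continuous_on_wfun])

text \<open>Only classes without a unit are possible: the constant function 1 is not the transform
  of an integrable function.\<close>

instantiation W :: (euclidean_space, type) "{comm_ring, real_algebra}"
begin

definition zero_W :: "('a, 'b) W" where "zero_W = mkW (\<lambda>x. 0)"
definition plus_W :: "('a, 'b) W \<Rightarrow> ('a, 'b) W \<Rightarrow> ('a, 'b) W" where "plus_W f g = mkW (\<lambda>x. wfun f x + wfun g x)"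
definition minus_W :: "('a, 'b) W \<Rightarrow> ('a, 'b) W \<Rightarrow> ('a, 'b) W" where "minus_W f g = mkW (\<lambda>x. wfun f x - wfun g x)"
definition uminus_W :: "('a, 'b) W \<Rightarrow> ('a, 'b) W" where "uminus_W f = mkW (\<lambda>x. - wfun f x)"
definition times_W :: "('a, 'b) W \<Rightarrow> ('a, 'b) W \<Rightarrow> ('a, 'b) W" where "times_W f g = mkW (\<lambda>x. wfun f x * wfun g x)"
definition scaleR_W :: "real \<Rightarrow> ('a, 'b) W \<Rightarrow> ('a, 'b) W" where "scaleR_W r f = mkW (\<lambda>x. r *\<^sub>R wfun f x)"

lemma wfun_rules:
  fixes f g :: "('a, 'b) W"
  shows wfun_zero: "wfun (0 :: ('a, 'b) W) = (\<lambda>x. 0)"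
    and wfun_add: "wfun (f + g) = (\<lambda>x. wfun f x + wfun g x)"
    and wfun_diff: "wfun (f - g) = (\<lambda>x. wfun f x - wfun g x)"
    and wfun_uminus: "wfun (- f) = (\<lambda>x. - wfun f x)"
    and wfun_mult: "wfun (f * g) = (\<lambda>x. wfun f x * wfun g x)"
    and wfun_scaleR: "wfun (r *\<^sub>R f) = (\<lambda>x. r *\<^sub>R wfun f x)"
proof -
  have mk: "wfun (mkW h :: ('a, 'b) W) = h" if "wint TYPE('b) u" "\<And>x. synth u x = h x" for h u
    using that by (subst mkW_inverse) (auto simp: fun_eq_iff)
  note s = spec(1)[of f] spec(1)[of g] spec(2)[of f] spec(2)[of g] integrable_spec[of f] integrable_spec[of g]
  show "wfun (0 :: ('a, 'b) W) = (\<lambda>x. 0)"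
    unfolding zero_W_def by (rule mk[of "\<lambda>_. 0"]) (auto simp: synth_def)
  show "wfun (f + g) = (\<lambda>x. wfun f x + wfun g x)"
    unfolding plus_W_def by (rule mk[OF wint_add[OF s(1,2)]]) (simp add: s synth_add)
  show "wfun (f - g) = (\<lambda>x. wfun f x - wfun g x)"
    unfolding minus_W_def by (rule mk[OF wint_diff[OF s(1,2)]]) (simp add: s synth_diff)
  show "wfun (- f) = (\<lambda>x. - wfun f x)"
    unfolding uminus_W_def by (rule mk[OF wint_cmult[OF s(1), of "-1"]]) (simp add: s synth_cmult[of "-1", simplified])
  show "wfun (f * g) = (\<lambda>x. wfun f x * wfun g x)"
    unfolding times_W_def by (rule mk[OF wint_convolution[OF s(1,2)]]) (simp add: s synth_convolution[OF s(1,2)])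
  show "wfun (r *\<^sub>R f) = (\<lambda>x. r *\<^sub>R wfun f x)"
    unfolding scaleR_W_def by (rule mk[OF wint_cmult[OF s(1), of "of_real r"]]) (simp add: s synth_cmult scaleR_conv_of_real)
qed

instance
proof
  fix f g h :: "('a, 'b) W" and r s :: real
  show "f * g * h = f * (g * h)" "f * g = g * f" "(f + g) * h = f * h + g * h" "f * (g + h) = f * g + f * h"
    "f + g + h = f + (g + h)" "f + g = g + f" "0 + f = f" "- f + f = 0" "f - g = f + - g"
    "r *\<^sub>R (f + g) = r *\<^sub>R f + r *\<^sub>R g" "(r + s) *\<^sub>R f = r *\<^sub>R f + s *\<^sub>R f" "r *\<^sub>R s *\<^sub>R f = (r * s) *\<^sub>R f"
    "1 *\<^sub>R f = f" "r *\<^sub>R f * g = r *\<^sub>R (f * g)" "f * r *\<^sub>R g = r *\<^sub>R (f * g)"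
    by (rule W_eqI; simp add: wfun_rules algebra_simps)+
qed

end

instantiation W :: (euclidean_space, type) real_normed_algebra
begin

text \<open>Built on the spectrum for the unnormalised \<open>synth\<close>, so that the norm is
  submultiplicative with constant 1 and dominates the supremum of the function. For weight 1 it is
  \<open>wiener_norm\<close> up to the factor \<open>fnorm\<close>.\<close>

definition norm_W :: "('a, 'b) W \<Rightarrow> real" where "norm_W f = (LINT \<xi>|lborel. wt TYPE('b) \<xi> * norm (spec f \<xi>))"
definition dist_W :: "('a, 'b) W \<Rightarrow> ('a, 'b) W \<Rightarrow> real" where "dist_W f g = norm (f - g)"
definition uniformity_W :: "(('a, 'b) W \<times> ('a, 'b) W) filter"
  where "uniformity_W = (INF e\<in>{0 <..}. principal {(x, y). dist x y < e})"
definition open_W :: "('a, 'b) W set \<Rightarrow> bool"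
  where "open_W U \<longleftrightarrow> (\<forall>x\<in>U. eventually (\<lambda>(x', y :: ('a, 'b) W). x' = x \<longrightarrow> y \<in> U) uniformity)"
definition sgn_W :: "('a, 'b) W \<Rightarrow> ('a, 'b) W" where "sgn_W f = f /\<^sub>R norm f"

lemma norm_eq_integral:
  assumes "wint TYPE('b) g" "wfun (f :: ('a, 'b) W) = synth g"
  shows "norm f = (LINT \<xi>|lborel. wt TYPE('b) \<xi> * norm (g \<xi>))"
  unfolding norm_W_def
proof (rule integral_cong_AE)
  have [measurable]: "g \<in> borel_measurable borel" using assms by (auto dest: wintD)
  show "(\<lambda>\<xi>. wt TYPE('b) \<xi> * norm (g \<xi>)) \<in> borel_measurable lborel" by measurable
  show "AE \<xi> in lborel. wt TYPE('b) \<xi> * norm (spec f \<xi>) = wt TYPE('b) \<xi> * norm (g \<xi>)"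
    using spec_AE_eq[OF assms] by eventually_elim simp
qed measurable

instance
proof
  fix f g :: "('a, 'b) W" and r :: real
  let ?w = "wt TYPE('b)"
  show "dist f g = norm (f - g)" by (simp add: dist_W_def)
  show "sgn f = f /\<^sub>R norm f" by (simp add: sgn_W_def)
  show "(uniformity :: (('a, 'b) W \<times> ('a, 'b) W) filter) = (INF e\<in>{0 <..}. principal {(x, y). dist x y < e})"
    by (simp add: uniformity_W_def)
  show "open U \<longleftrightarrow> (\<forall>x\<in>U. eventually (\<lambda>(x', y). x' = x \<longrightarrow> y \<in> U) uniformity)" for U :: "('a, 'b) W set"
    by (simp add: open_W_def)
  show "norm f = 0 \<longleftrightarrow> f = 0"
  proof
    assume "norm f = 0"
    then have "AE \<xi> in lborel. ?w \<xi> * norm (spec f \<xi>) = 0"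
      unfolding norm_W_def by (subst (asm) integral_nonneg_eq_0_iff_AE) (auto intro: wintD spec)
    then have "AE \<xi> in lborel. spec f \<xi> = 0"
      by eventually_elim (metis mult_eq_0_iff norm_eq_zero wt_pos less_irrefl)
    then have "synth (spec f) = synth (\<lambda>_. 0)" by (intro synth_cong_AE[OF spec(1) wint_zero]) auto
    then show "f = 0" by (intro W_eqI) (simp only: wfun_zero spec(2)[of f], simp add: synth_def)
  next
    assume "f = 0"
    then show "norm f = 0"
      by (subst norm_eq_integral[of "\<lambda>_. 0"]) (auto simp: wfun_zero synth_def)
  qed
  show "norm (f + g) \<le> norm f + norm g"
  proof -
    have "norm (f + g) = (LINT \<xi>|lborel. ?w \<xi> * norm (spec f \<xi> + spec g \<xi>))"
      by (rule norm_eq_integral[OF wint_add[OF spec(1) spec(1)]])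
         (simp add: wfun_add spec(2)[of f] spec(2)[of g] synth_add integrable_spec fun_eq_iff)
    also have "\<dots> \<le> (LINT \<xi>|lborel. ?w \<xi> * norm (spec f \<xi>) + ?w \<xi> * norm (spec g \<xi>))"
      by (intro integral_mono wintD wint_add spec(1) Bochner_Integration.integrable_add)
         (simp flip: distrib_left add: mult_left_mono norm_triangle_ineq)
    also have "\<dots> = norm f + norm g"
      unfolding norm_W_def by (intro Bochner_Integration.integral_add wintD spec(1))
    finally show ?thesis .
  qed
  show "norm (r *\<^sub>R f) = \<bar>r\<bar> * norm f"
  proof -
    have "norm (r *\<^sub>R f) = (LINT \<xi>|lborel. ?w \<xi> * norm (of_real r * spec f \<xi>))"
      by (rule norm_eq_integral[OF wint_cmult[OF spec(1)]])
         (simp add: wfun_scaleR spec(2)[of f] synth_cmult scaleR_conv_of_real fun_eq_iff)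
    then show ?thesis by (simp add: norm_mult norm_W_def mult.left_commute flip: integral_mult_right_zero)
  qed
  show "norm (f * g) \<le> norm f * norm g"
  proof -
    have "norm (f * g) = (LINT \<xi>|lborel. ?w \<xi> * norm (LINT \<eta>|lborel. spec f (\<xi> - \<eta>) * spec g \<eta>))"
      by (rule norm_eq_integral[OF wint_convolution[OF spec(1) spec(1)]]) 
        (simp add: wfun_mult spec(2)[of f] spec(2)[of g] fun_eq_iff synth_convolution[OF spec(1) spec(1)])
    then show ?thesis using norm_convolution[OF spec(1)[of f] spec(1)[of g]] by (simp add: norm_W_def)
  qed
qed

end


section \<open>Evaluation and completeness of the weighted algebras\<close>

lemma norm_of_spec:
  "wint TYPE('n) g \<Longrightarrow> norm (of_spec g :: ('a::euclidean_space, 'n) W) = (LINT \<xi>|lborel. wt TYPE('n) \<xi> * norm (g \<xi>))"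
  by (rule norm_eq_integral) (auto simp: wfun_of_spec)

lemma norm_wfun_le: "norm (wfun f x) \<le> norm f"
proof -
  have "norm (wfun f x) \<le> (LINT \<xi>|lborel. norm (spec f \<xi>))" unfolding spec(2) by (rule norm_synth_le)
  also have "\<dots> \<le> norm f"
    unfolding norm_W_def by (intro integral_mono integrable_norm integrable_spec wintD spec(1)) (simp add: mult_le_cancel_right1)
  finally show ?thesis .
qed

lemma bounded_linear_wfun: "bounded_linear (\<lambda>f. wfun f x)"
  by (rule bounded_linear_intro[of _ 1]) (auto simp: wfun_rules norm_wfun_le)

text \<open>A Cauchy sequence has a subsequence with increments below \<open>(1/2)^k\<close>, which
  is a telescoping absolutely convergent series. For series of spectra a limit can be written down
  directly, which is why completeness is reduced to them.\<close>

lemma convergent_if_series_converge: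
  fixes X :: "nat \<Rightarrow> 'a::real_normed_vector"
  assumes series: "\<And>f :: nat \<Rightarrow> 'a. summable (\<lambda>n. norm (f n)) \<Longrightarrow> \<exists>l. (\<lambda>n. \<Sum>i<n. f i) \<longlonglongrightarrow> l"
    and X: "Cauchy X"
  shows "convergent X"
proof -
  have "\<forall>k. \<exists>N. \<forall>m\<ge>N. \<forall>n\<ge>N. norm (X m - X n) < (1/2) ^ k"
    using X by (auto simp: Cauchy_iff)
  then obtain N where N: "\<And>k m n. m \<ge> N k \<Longrightarrow> n \<ge> N k \<Longrightarrow> norm (X m - X n) < (1/2) ^ k" by metis
  \<comment> \<open>Summing the \<open>N i\<close> keeps \<open>r (Suc k)\<close> above
    \<open>N k\<close> as well, and adding \<open>k\<close> makes \<open>r\<close>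
    unbounded.\<close>
  define r where "r k = (\<Sum>i\<le>k. N i) + k" for k
  have "N k \<le> (\<Sum>i\<le>k. N i)" for k by (rule member_le_sum) auto
  then have rN: "r k \<ge> N k" "r (Suc k) \<ge> N k" "r k \<ge> k" for k
    unfolding r_def by (auto intro: trans_le_add1 le_SucI)
  have "summable (\<lambda>k. norm (X (r (Suc k)) - X (r k)))"
    by (rule summable_comparison_test'[where g="\<lambda>k. (1/2::real) ^ k" and N=0])
       (auto simp: N rN less_imp_le)
  from series[OF this] obtain l where "(\<lambda>n. \<Sum>i<n. X (r (Suc i)) - X (r i)) \<longlonglongrightarrow> l" ..
  then have "(\<lambda>n. X (r n) - X (r 0)) \<longlonglongrightarrow> l" using sum_lessThan_telescope[of "\<lambda>i. X (r i)"] by simp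
  then have l: "(\<lambda>n. X (r n)) \<longlonglongrightarrow> l + X (r 0)" using tendsto_add[OF _ tendsto_const[of "X (r 0)"]] by fastforce
  have "X \<longlonglongrightarrow> l + X (r 0)"
  proof (rule LIMSEQ_I)
    fix e :: real assume e: "e > 0"
    obtain k where k: "(1/2::real) ^ k < e / 2" using real_arch_pow_inv[of "e/2" "1/2"] e by auto
    obtain M where M: "\<And>n. n \<ge> M \<Longrightarrow> norm (X (r n) - (l + X (r 0))) < e / 2"
      using LIMSEQ_D[OF l, of "e/2"] e by auto
    show "\<exists>no. \<forall>n\<ge>no. norm (X n - (l + X (r 0))) < e"
    proof (intro exI allI impI)
      fix n assume n: "n \<ge> N k"
      let ?p = "max M (N k)"
      have "norm (X n - (l + X (r 0))) \<le> norm (X n - X (r ?p)) + norm (X (r ?p) - (l + X (r 0)))"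
        by (metis norm_triangle_ineq diff_add_cancel add_diff_eq)
      moreover have "r ?p \<ge> N k" using rN(3)[of ?p] by linarith
      then have "norm (X n - X (r ?p)) < (1/2) ^ k" using n by (intro N)
      ultimately show "norm (X n - (l + X (r 0))) < e" using M[of ?p] k by simp
    qed
  qed
  then show ?thesis by (auto simp: convergent_def)
qed

text \<open>Finite total norm makes the series of spectra absolutely convergent at almost every
  \<xi>. Its sum \<open>G\<close> is the spectrum of the limit, and the integrable \<open>H\<close>
  dominates the weighted partial sums.\<close>

lemma W_series_converges:
  fixes f :: "nat \<Rightarrow> ('a::euclidean_space, 'n) W"
  assumes s: "summable (\<lambda>n. norm (f n))"
  shows "\<exists>l. (\<lambda>n. \<Sum>i<n. f i) \<longlonglongrightarrow> l"
proof -
  let ?w = "wt TYPE('n)"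
  have i: "integrable lborel (\<lambda>\<xi>. ?w \<xi> * norm (spec (f k) \<xi>))" for k by (intro wintD spec(1))
  have ae: "AE \<xi> in lborel. summable (\<lambda>k. ?w \<xi> * norm (spec (f k) \<xi>))"
  proof -
    have "(\<integral>\<^sup>+\<xi>. (\<Sum>k. ennreal (?w \<xi> * norm (spec (f k) \<xi>))) \<partial>lborel) = (\<Sum>k. (\<integral>\<^sup>+\<xi>. ennreal (?w \<xi> * norm (spec (f k) \<xi>)) \<partial>lborel))"
      by (intro nn_integral_suminf) auto
    also have "\<dots> = (\<Sum>k. ennreal (norm (f k)))"
      using i by (subst nn_integral_eq_integral) (auto simp: norm_W_def)
    also have "\<dots> \<noteq> top" by (subst suminf_ennreal2[OF _ s]) auto
    finally have "AE \<xi> in lborel. (\<Sum>k. ennreal (?w \<xi> * norm (spec (f k) \<xi>))) \<noteq> \<infinity>"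
      by (intro nn_integral_PInf_AE) auto
    then show ?thesis
    proof eventually_elim
      case (elim \<xi>)
      show ?case by (rule summable_suminf_not_top) (use elim in simp_all)
    qed
  qed
  define H where "H \<xi> = (\<Sum>k. ?w \<xi> * norm (spec (f k) \<xi>))" for \<xi>
  define G where "G \<xi> = (\<Sum>k. spec (f k) \<xi>)" for \<xi>
  have [measurable]: "G \<in> borel_measurable borel" unfolding G_def by measurable
  have iH: "integrable lborel H"
    unfolding H_def
  proof (rule integrable_suminf[OF i])
    show "AE \<xi> in lborel. summable (\<lambda>k. norm (?w \<xi> * norm (spec (f k) \<xi>)))"
      using ae by (simp add: abs_mult)
    show "summable (\<lambda>k. LINT \<xi>|lborel. norm (?w \<xi> * norm (spec (f k) \<xi>)))"
      using s by (simp add: norm_W_def abs_mult)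
  qed
  have aesum: "AE \<xi> in lborel. summable (\<lambda>k. norm (spec (f k) \<xi>)) \<and> (\<forall>n. ?w \<xi> * norm (\<Sum>k<n. spec (f k) \<xi>) \<le> H \<xi>) \<and> ?w \<xi> * norm (G \<xi>) \<le> H \<xi>"
    using ae
  proof eventually_elim
    fix \<xi> assume a: "summable (\<lambda>k. ?w \<xi> * norm (spec (f k) \<xi>))"
    have "?w \<xi> \<noteq> 0" using wt_pos[of "TYPE('n)" \<xi>] by (rule less_imp_neq[symmetric])
    then have b: "summable (\<lambda>k. norm (spec (f k) \<xi>))"
      using a by (simp only: summable_cmult_iff simp_thms)
    have H: "H \<xi> = ?w \<xi> * (\<Sum>k. norm (spec (f k) \<xi>))" unfolding H_def by (rule suminf_mult[OF b])
    have "norm (\<Sum>k<n. spec (f k) \<xi>) \<le> (\<Sum>k. norm (spec (f k) \<xi>))" for n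
      by (rule order_trans[OF norm_sum sum_le_suminf[OF b]]) auto
    moreover have "norm (G \<xi>) \<le> (\<Sum>k. norm (spec (f k) \<xi>))" unfolding G_def by (rule summable_norm[OF b])
    ultimately show "summable (\<lambda>k. norm (spec (f k) \<xi>)) \<and> (\<forall>n. ?w \<xi> * norm (\<Sum>k<n. spec (f k) \<xi>) \<le> H \<xi>) \<and> ?w \<xi> * norm (G \<xi>) \<le> H \<xi>"
      unfolding H using b by (intro conjI allI mult_left_mono) auto
  qed
  have wG: "wint TYPE('n) G"
    unfolding wint_def
  proof (intro conjI Bochner_Integration.integrable_bound[OF iH])
    show "AE \<xi> in lborel. norm (?w \<xi> * norm (G \<xi>)) \<le> norm (H \<xi>)"
      using aesum by eventually_elim (auto simp: abs_mult)
  qed measurable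
  have ws: "wint TYPE('n) (\<lambda>\<xi>. \<Sum>k<n. spec (f k) \<xi>)" for n by (intro wint_sum spec(1))
  have syn: "wfun (\<Sum>k<n. f k) = synth (\<lambda>\<xi>. \<Sum>k<n. spec (f k) \<xi>)" for n
  proof (induction n)
    case (Suc n)
    show ?case unfolding sum.lessThan_Suc
      by (rule ext) (simp add: wfun_rules Suc spec(2)[of "f n"] synth_add[OF wint_integrable[OF ws] integrable_spec])
  qed (simp add: wfun_rules synth_def)
  have "(\<lambda>n. (\<Sum>k<n. f k) - of_spec G) \<longlonglongrightarrow> 0"
  proof (rule tendsto_norm_zero_cancel)
    have eq: "norm ((\<Sum>k<n. f k) - of_spec G) = (LINT \<xi>|lborel. ?w \<xi> * norm ((\<Sum>k<n. spec (f k) \<xi>) - G \<xi>))" for n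
      by (rule norm_eq_integral[OF wint_diff[OF ws wG]])
         (simp only: wfun_diff syn wfun_of_spec[OF wG] synth_diff[OF wint_integrable[OF ws] wint_integrable[OF wG], abs_def, symmetric])
    have "(\<lambda>n. LINT \<xi>|lborel. ?w \<xi> * norm ((\<Sum>k<n. spec (f k) \<xi>) - G \<xi>)) \<longlonglongrightarrow> (LINT \<xi>|(lborel :: 'a measure). 0)"
    proof (rule integral_dominated_convergence[where w="\<lambda>\<xi>. 2 * H \<xi>"])
      show "AE \<xi> in lborel. (\<lambda>n. ?w \<xi> * norm ((\<Sum>k<n. spec (f k) \<xi>) - G \<xi>)) \<longlonglongrightarrow> 0"
        using aesum
      proof eventually_elim
        case (elim \<xi>)
        then have "summable (\<lambda>k. spec (f k) \<xi>)" using summable_norm_cancel[of "\<lambda>k. spec (f k) \<xi>"] by blast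
        then have "(\<lambda>n. \<Sum>k<n. spec (f k) \<xi>) \<longlonglongrightarrow> G \<xi>"
          unfolding G_def by (rule summable_LIMSEQ)
        then have "(\<lambda>n. ?w \<xi> * norm ((\<Sum>k<n. spec (f k) \<xi>) - G \<xi>)) \<longlonglongrightarrow> ?w \<xi> * norm (G \<xi> - G \<xi>)"
          by (intro tendsto_intros)
        then show ?case by simp
      qed
      show "AE \<xi> in lborel. norm (?w \<xi> * norm ((\<Sum>k<n. spec (f k) \<xi>) - G \<xi>)) \<le> 2 * H \<xi>" for n
        using aesum
      proof eventually_elim
        case (elim \<xi>)
        have "?w \<xi> * norm ((\<Sum>k<n. spec (f k) \<xi>) - G \<xi>) \<le> ?w \<xi> * (norm (\<Sum>k<n. spec (f k) \<xi>) + norm (G \<xi>))"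
          by (intro mult_left_mono norm_triangle_ineq4) simp
        also have "\<dots> \<le> H \<xi> + H \<xi>" unfolding distrib_left using elim by (intro add_mono) blast+
        finally show ?case by (simp add: abs_mult)
      qed
      show "integrable lborel (\<lambda>\<xi>. 2 * H \<xi>)" using iH by simp
    qed measurable
    then show "(\<lambda>n. norm ((\<Sum>k<n. f k) - of_spec G)) \<longlonglongrightarrow> 0" by (simp add: eq)
  qed
  then have "(\<lambda>n. \<Sum>k<n. f k) \<longlonglongrightarrow> of_spec G" by (rule LIM_zero_cancel)
  then show ?thesis ..
qed

instance W :: (euclidean_space, type) banach
proof
  fix X :: "nat \<Rightarrow> ('a, 'b) W" assume "Cauchy X"
  then show "convergent X" by (rule convergent_if_series_converge[rotated]) (rule W_series_converges)
qed


section \<open>Fourier multipliers, conjugation and modulation\<close>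

text \<open>The bound holds everywhere, not only almost everywhere, so that estimates and shifts of
  a symbol carry no exceptional sets; an essentially bounded function is first modified on a null
  set.\<close>

definition symbol :: "('a::euclidean_space \<Rightarrow> complex) \<Rightarrow> real \<Rightarrow> bool"
  where "symbol m B \<longleftrightarrow> m \<in> borel_measurable borel \<and> (\<forall>\<xi>. norm (m \<xi>) \<le> B)"

lemma symbolD: "symbol m B \<Longrightarrow> m \<in> borel_measurable borel" "symbol m B \<Longrightarrow> norm (m \<xi>) \<le> B"
  by (simp_all add: symbol_def)

lemma symbol_nonneg: "symbol m B \<Longrightarrow> 0 \<le> B"
  using symbolD(2)[of m B 0] norm_ge_zero order_trans by blast

lemma symbol_const: "symbol (\<lambda>_. c) (norm c)"
  by (simp add: symbol_def)

lemma symbol_mult: "symbol m A \<Longrightarrow> symbol m' B \<Longrightarrow> symbol (\<lambda>\<xi>. m \<xi> * m' \<xi>) (A * B)"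
  unfolding symbol_def by (auto simp: norm_mult intro!: mult_mono order_trans[OF norm_ge_zero])

lemma symbol_diff: "symbol m A \<Longrightarrow> symbol m' B \<Longrightarrow> symbol (\<lambda>\<xi>. m \<xi> - m' \<xi>) (A + B)"
  unfolding symbol_def by (auto intro: order_trans[OF norm_triangle_ineq4] add_mono)

definition mulop :: "('a::euclidean_space \<Rightarrow> complex) \<Rightarrow> ('a, 'n) W \<Rightarrow> ('a, 'n) W"
  where "mulop m f = of_spec (\<lambda>\<xi>. m \<xi> * spec f \<xi>)"

lemma wint_symbol_mult: "symbol m B \<Longrightarrow> wint n g \<Longrightarrow> wint n (\<lambda>\<xi>. m \<xi> * g \<xi>)"
  by (rule wint_mult_bounded) (auto dest: symbolD)

lemma wfun_mulop: "symbol m B \<Longrightarrow> wfun (mulop m f) = synth (\<lambda>\<xi>. m \<xi> * spec f \<xi>)"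
  unfolding mulop_def by (rule wfun_of_spec[OF wint_symbol_mult[OF _ spec(1)]])

lemma spec_mulop: "symbol m B \<Longrightarrow> AE \<xi> in lborel. spec (mulop m f) \<xi> = m \<xi> * spec f \<xi>"
  unfolding mulop_def by (rule spec_of_spec[OF wint_symbol_mult[OF _ spec(1)]])

text \<open>The spectrum chosen by \<open>spec\<close> agrees almost everywhere with any other
  spectrum of \<open>f\<close>, so the operator may be computed from whichever is at hand.\<close>

lemma wfun_mulop':
  fixes f :: "('a::euclidean_space, 'n) W"
  assumes m: "symbol m B" and f: "wint TYPE('n) g" "wfun f = synth g"
  shows "wfun (mulop m f) = synth (\<lambda>\<xi>. m \<xi> * g \<xi>)"
  unfolding wfun_mulop[OF m]
proof (rule synth_cong_AE[OF wint_symbol_mult[OF m spec(1)] wint_symbol_mult[OF m f(1)]])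
  show "AE \<xi> in lborel. m \<xi> * spec f \<xi> = m \<xi> * g \<xi>"
    using spec_AE_eq[OF f] by eventually_elim simp
qed

lemma norm_mulop: "symbol m B \<Longrightarrow> norm (mulop m f) = (LINT \<xi>|lborel. wt TYPE('n) \<xi> * norm (m \<xi> * spec f \<xi>))"
  for f :: "('a::euclidean_space, 'n) W"
  unfolding mulop_def by (rule norm_of_spec[OF wint_symbol_mult[OF _ spec(1)]])

lemma norm_mulop_le:
  fixes f :: "('a::euclidean_space, 'n) W"
  assumes m: "symbol m B"
  shows "norm (mulop m f) \<le> B * norm f"
proof -
  have "wt TYPE('n) \<xi> * norm (m \<xi> * spec f \<xi>) \<le> B * (wt TYPE('n) \<xi> * norm (spec f \<xi>))" for \<xi>
    using mult_right_mono[OF symbolD(2)[OF m, of \<xi>], of "wt TYPE('n) \<xi> * norm (spec f \<xi>)"] by (simp add: norm_mult mult_ac)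
  then have "norm (mulop m f) \<le> (LINT \<xi>|lborel. B * (wt TYPE('n) \<xi> * norm (spec f \<xi>)))"
    unfolding norm_mulop[OF m]
    by (intro integral_mono wintD(2) wint_symbol_mult[OF m] integrable_mult_right spec(1))
  then show ?thesis by (simp add: norm_W_def)
qed

lemma wfun_mulop_const: "wfun (mulop (\<lambda>_. c) f) x = c * wfun f x"
  unfolding wfun_mulop[OF symbol_const] by (simp only: synth_cmult spec(2)[of f])

lemma mulop_one: "mulop (\<lambda>_. 1) f = f"
  by (rule W_eqI) (simp add: wfun_mulop_const)

lemma mulop_mulop: "symbol m A \<Longrightarrow> symbol m' B \<Longrightarrow> mulop m (mulop m' f) = mulop (\<lambda>\<xi>. m \<xi> * m' \<xi>) f"
  by (rule W_eqI) (simp add: wfun_mulop'[OF _ wint_symbol_mult[OF _ spec(1)] wfun_mulop] wfun_mulop[OF symbol_mult] mult.assoc)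

lemma mulop_cong: "(\<And>\<xi>. m \<xi> = m' \<xi>) \<Longrightarrow> mulop m f = mulop m' f"
  by (simp add: mulop_def)

lemma mulop_add:
  assumes m: "symbol m B"
  shows "mulop m (f + g) = mulop m f + mulop m g"
proof (rule W_eqI)
  fix x
  have "wfun (f + g) = synth (\<lambda>\<xi>. spec f \<xi> + spec g \<xi>)"
    by (simp add: wfun_rules spec(2)[of f] spec(2)[of g] synth_add integrable_spec fun_eq_iff)
  from wfun_mulop'[OF m wint_add[OF spec(1) spec(1)] this]
  show "wfun (mulop m (f + g)) x = wfun (mulop m f + mulop m g) x"
    by (simp add: wfun_rules wfun_mulop[OF m] distrib_left synth_add wint_integrable[OF wint_symbol_mult[OF m spec(1)]])
qed

lemma mulop_scaleR: "symbol m B \<Longrightarrow> mulop m (r *\<^sub>R f) = r *\<^sub>R mulop m f"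
proof (rule W_eqI)
  fix x assume m: "symbol m B"
  have "wfun (r *\<^sub>R f) = synth (\<lambda>\<xi>. of_real r * spec f \<xi>)"
    by (simp add: wfun_rules spec(2)[of f] synth_cmult scaleR_conv_of_real fun_eq_iff)
  from wfun_mulop'[OF m wint_cmult[OF spec(1)] this]
  show "wfun (mulop m (r *\<^sub>R f)) x = wfun (r *\<^sub>R mulop m f) x"
    by (simp add: wfun_rules wfun_mulop[OF m] mult.left_commute[of _ "of_real r"] synth_cmult scaleR_conv_of_real)
qed

lemma bounded_linear_mulop: "symbol m B \<Longrightarrow> bounded_linear (mulop m)"
  by (rule bounded_linear_intro[of _ B]) (auto simp: mulop_add mulop_scaleR norm_mulop_le mult.commute)

lemma mulop_diff_symbol:
  assumes m: "symbol m A" and m': "symbol m' B"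
  shows "mulop m f - mulop m' f = mulop (\<lambda>\<xi>. m \<xi> - m' \<xi>) f"
proof (rule W_eqI)
  fix x
  have "symbol (\<lambda>\<xi>. m \<xi> - m' \<xi>) (A + B)" using m m' by (rule symbol_diff)
  then show "wfun (mulop m f - mulop m' f) x = wfun (mulop (\<lambda>\<xi>. m \<xi> - m' \<xi>) f) x"
    by (simp add: wfun_rules wfun_mulop wfun_mulop[OF m] wfun_mulop[OF m'] left_diff_distrib synth_diff
        wint_integrable[OF wint_symbol_mult[OF _ spec(1)]] wint_integrable[OF wint_symbol_mult[OF m spec(1)]] wint_integrable[OF wint_symbol_mult[OF m' spec(1)]])
qed

text \<open>Only strong convergence can be expected: symbols such as those of the Schroedinger group
  converge pointwise but not uniformly in \<xi>. For a fixed \<open>f\<close> its own spectrum is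
  the dominating function.\<close>

lemma tendsto_mulop:
  fixes f :: "('a::euclidean_space, 'n) W" and m :: "'b::first_countable_topology \<Rightarrow> 'a \<Rightarrow> complex"
  assumes m: "\<And>t. symbol (m t) B" and l: "\<And>\<xi>. ((\<lambda>t. m t \<xi>) \<longlongrightarrow> m s \<xi>) (at s within S)"
  shows "((\<lambda>t. mulop (m t) f) \<longlongrightarrow> mulop (m s) f) (at s within S)"
  unfolding tendsto_at_iff_sequentially
proof (intro allI impI)
  fix X assume X: "\<forall>i. X i \<in> S - {s}" "X \<longlonglongrightarrow> s"
  have mX: "(\<lambda>i. m (X i) \<xi>) \<longlonglongrightarrow> m s \<xi>" for \<xi>
    using l[of \<xi>, unfolded tendsto_at_iff_sequentially, rule_format, of X] X by (simp add: o_def)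
  let ?w = "wt TYPE('n)"
  have sd: "symbol (\<lambda>\<xi>. m t \<xi> - m s \<xi>) (B + B)" for t
    by (intro symbol_diff m)
  have [measurable]: "m t \<in> borel_measurable borel" for t using m by (rule symbolD)
  have "(\<lambda>i. LINT \<xi>|lborel. ?w \<xi> * norm ((m (X i) \<xi> - m s \<xi>) * spec f \<xi>)) \<longlonglongrightarrow> (LINT \<xi>|(lborel :: 'a measure). 0)"
  proof (rule integral_dominated_convergence[where w="\<lambda>\<xi>. (B + B) * (?w \<xi> * norm (spec f \<xi>))"])
    show "AE \<xi> in lborel. (\<lambda>i. ?w \<xi> * norm ((m (X i) \<xi> - m s \<xi>) * spec f \<xi>)) \<longlonglongrightarrow> 0"
    proof (rule AE_I2)
      fix \<xi>
      have "(\<lambda>i. ?w \<xi> * norm ((m (X i) \<xi> - m s \<xi>) * spec f \<xi>)) \<longlonglongrightarrow> ?w \<xi> * norm ((m s \<xi> - m s \<xi>) * spec f \<xi>)"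
        by (intro tendsto_intros mX)
      then show "(\<lambda>i. ?w \<xi> * norm ((m (X i) \<xi> - m s \<xi>) * spec f \<xi>)) \<longlonglongrightarrow> 0" by simp
    qed
    show "AE \<xi> in lborel. norm (?w \<xi> * norm ((m (X i) \<xi> - m s \<xi>) * spec f \<xi>)) \<le> (B + B) * (?w \<xi> * norm (spec f \<xi>))" for i
    proof (rule AE_I2)
      fix \<xi>
      show "norm (?w \<xi> * norm ((m (X i) \<xi> - m s \<xi>) * spec f \<xi>)) \<le> (B + B) * (?w \<xi> * norm (spec f \<xi>))"
        using mult_right_mono[OF symbolD(2)[OF sd[of "X i"], of \<xi>], of "?w \<xi> * norm (spec f \<xi>)"]
        by (simp add: norm_mult abs_mult mult_ac)
    qed
    show "integrable lborel (\<lambda>\<xi>. (B + B) * (?w \<xi> * norm (spec f \<xi>)))"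
      by (intro integrable_mult_right wintD spec(1))
  qed measurable
  then have "(\<lambda>i. norm (mulop (m (X i)) f - mulop (m s) f)) \<longlonglongrightarrow> 0"
    unfolding mulop_diff_symbol[OF m m] norm_mulop[OF sd] by simp
  from LIM_zero_cancel[OF tendsto_norm_zero_cancel[OF this]]
  show "((\<lambda>t. mulop (m t) f) \<circ> X) \<longlonglongrightarrow> mulop (m s) f"
    unfolding o_def .
qed

lemma continuous_on_mulop:
  fixes u :: "'b::first_countable_topology \<Rightarrow> ('a::euclidean_space, 'n) W"
  assumes m: "\<And>t. symbol (m t) B" and c: "\<And>\<xi>. continuous_on S (\<lambda>t. m t \<xi>)" and u: "continuous_on S u"
  shows "continuous_on S (\<lambda>t. mulop (m t) (u t))"
  unfolding continuous_on_def
proof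
  fix s assume s: "s \<in> S"
  have "((\<lambda>t. mulop (m t) (u t - u s)) \<longlongrightarrow> 0) (at s within S)"
  proof (rule Lim_null_comparison)
    show "\<forall>\<^sub>F t in at s within S. norm (mulop (m t) (u t - u s)) \<le> B * norm (u t - u s)"
      by (intro always_eventually allI norm_mulop_le m)
    have "((\<lambda>t. B * norm (u t - u s)) \<longlongrightarrow> B * norm (u s - u s)) (at s within S)"
      using u s by (intro tendsto_intros) (auto simp: continuous_on_def)
    then show "((\<lambda>t. B * norm (u t - u s)) \<longlongrightarrow> 0) (at s within S)" by simp
  qed
  moreover have "((\<lambda>t. mulop (m t) (u s)) \<longlongrightarrow> mulop (m s) (u s)) (at s within S)"
    by (rule tendsto_mulop[OF m]) (use c s in \<open>auto simp: continuous_on_def\<close>)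
  ultimately have "((\<lambda>t. mulop (m t) (u t - u s) + mulop (m t) (u s)) \<longlongrightarrow> 0 + mulop (m s) (u s)) (at s within S)"
    by (rule tendsto_add)
  then show "((\<lambda>t. mulop (m t) (u t)) \<longlongrightarrow> mulop (m s) (u s)) (at s within S)"
    by (simp flip: mulop_add[OF m])
qed

text \<open>The type classes give \<open>W\<close> real scalars only; complex ones act as constant
  multipliers.\<close>

definition cscale :: "complex \<Rightarrow> ('a::euclidean_space, 'n) W \<Rightarrow> ('a, 'n) W"
  where "cscale c = mulop (\<lambda>_. c)"

lemma wfun_cscale [simp]: "wfun (cscale c f) = (\<lambda>x. c * wfun f x)"
  by (simp add: cscale_def wfun_mulop_const fun_eq_iff)

lemma norm_cscale: "norm (cscale c f) = norm c * norm f"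
  unfolding cscale_def norm_mulop[OF symbol_const] by (simp add: norm_mult norm_W_def mult.left_commute flip: integral_mult_right_zero)

lemma bounded_linear_cscale: "bounded_linear (cscale c)"
  unfolding cscale_def by (rule bounded_linear_mulop[OF symbol_const])

lemma cscale_mulop: "symbol m B \<Longrightarrow> cscale c (mulop m f) = mulop m (cscale c f)"
  unfolding cscale_def by (simp add: mulop_mulop[OF symbol_const] mulop_mulop[OF _ symbol_const] mult.commute)

section \<open>Isometries: unimodular symbols, translations, conjugation\<close>

lemma symbol_unimodular: "f \<in> borel_measurable borel \<Longrightarrow> symbol (\<lambda>\<xi>. cis (f \<xi>)) 1"
  by (simp add: symbol_def)

lemma norm_mulop_unimodular:
  assumes "f \<in> borel_measurable borel" shows "norm (mulop (\<lambda>\<xi>. cis (f \<xi>)) g) = norm g"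
  unfolding norm_mulop[OF symbol_unimodular[OF assms]] by (simp add: norm_mult norm_W_def)

definition transl :: "'a \<Rightarrow> ('a::euclidean_space, 'n) W \<Rightarrow> ('a, 'n) W"
  where "transl h = mulop (\<lambda>\<xi>. cis (- (h \<bullet> \<xi>)))"

lemma symbol_transl: "symbol (\<lambda>\<xi>::'a::euclidean_space. cis (- (h \<bullet> \<xi>))) 1"
  by (rule symbol_unimodular) measurable

lemma wfun_transl: "wfun (transl h f) = (\<lambda>x. wfun f (x - h))"
proof
  fix x
  have "wfun (transl h f) x = synth (\<lambda>\<xi>. cis (- (h \<bullet> \<xi>)) * spec f \<xi>) x"
    unfolding transl_def wfun_mulop[OF symbol_transl] ..
  also have "\<dots> = synth (spec f) (x - h)"
    unfolding synth_def by (simp add: inner_diff_left mult.assoc mult.left_commute cis_mult)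
  finally show "wfun (transl h f) x = wfun f (x - h)" by (simp only: spec(2)[of f])
qed

lemma norm_transl [simp]: "norm (transl h f) = norm f"
  unfolding transl_def by (rule norm_mulop_unimodular) measurable

lemma transl_mulop: "symbol m B \<Longrightarrow> transl h (mulop m f) = mulop m (transl h f)"
  unfolding transl_def by (simp add: mulop_mulop[OF symbol_transl] mulop_mulop[OF _ symbol_transl] mult.commute)

lemma continuous_on_transl:
  fixes h :: "'b::first_countable_topology \<Rightarrow> 'a::euclidean_space"
  assumes "continuous_on S h" "continuous_on S u"
  shows "continuous_on S (\<lambda>t. transl (h t) (u t))"
  unfolding transl_def
proof (rule continuous_on_mulop)
  show "symbol (\<lambda>\<xi>. cis (- (h t \<bullet> \<xi>))) 1" for t by (rule symbol_transl)
  show "continuous_on S (\<lambda>t. cis (- (h t \<bullet> \<xi>)))" for \<xi>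
    by (intro continuous_intros assms(1))
qed (rule assms(2))

definition conjW :: "('a::euclidean_space, 'n) W \<Rightarrow> ('a, 'n) W"
  where "conjW f = of_spec (\<lambda>\<xi>. cnj (spec f (- \<xi>)))"

lemma wfun_conjW: "wfun (conjW f) = (\<lambda>x. cnj (wfun f x))"
proof
  fix x
  have "wfun (conjW f) x = (LINT \<xi>|lborel. cnj (spec f (- \<xi>)) * cis (x \<bullet> \<xi>))"
    unfolding conjW_def wfun_of_spec[OF wint_cnj_reflect[OF spec(1)]] synth_def ..
  also have "\<dots> = (LINT \<xi>|lborel. cnj (spec f \<xi> * cis (x \<bullet> \<xi>)))"
    using integral_lborel_reflect[of "\<lambda>\<xi>. cnj (spec f \<xi> * cis (x \<bullet> \<xi>))" 0] by (simp add: cis_cnj)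
  also have "\<dots> = cnj (synth (spec f) x)" unfolding synth_def by (rule Bochner_Integration.integral_cnj)
  finally show "wfun (conjW f) x = cnj (wfun f x)" by (simp only: spec(2)[of f])
qed

lemma norm_conjW [simp]: "norm (conjW f) = norm f"
  for f :: "('a::euclidean_space, 'n) W"
  unfolding conjW_def norm_of_spec[OF wint_cnj_reflect[OF spec(1)]]
  using integral_lborel_reflect[of "\<lambda>\<xi>. wt TYPE('n) \<xi> * norm (spec f \<xi>)" 0] by (simp add: norm_W_def)

lemma bounded_linear_conjW: "bounded_linear conjW"
  by (rule bounded_linear_intro[of _ 1])
    (auto intro!: W_eqI simp: wfun_conjW wfun_rules)

lemma conjW_transl: "conjW (transl h f) = transl h (conjW f)"
  by (rule W_eqI) (simp add: wfun_conjW wfun_transl)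

lemma conjW_mult: "conjW (f * g) = conjW f * conjW g"
  by (rule W_eqI) (simp add: wfun_conjW wfun_rules)

lemma conjW_conjW [simp]: "conjW (conjW f) = f"
  by (rule W_eqI) (simp add: wfun_conjW)

text \<open>Conjugation reflects and conjugates the spectrum, which leaves a Hermitian symbol
  unchanged almost everywhere. Through this the reality of the kernel makes the potential, and with
  it the phases, real.\<close>

lemma conjW_mulop:
  assumes m: "symbol m B" and sym: "AE \<xi> in lborel. m (- \<xi>) = cnj (m \<xi>)"
  shows "conjW (mulop m f) = mulop m (conjW f)"
proof (rule W_eqI)
  fix x
  have "wfun (conjW f) = synth (\<lambda>\<xi>. cnj (spec f (- \<xi>)))"
    unfolding conjW_def by (rule wfun_of_spec[OF wint_cnj_reflect[OF spec(1)]])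
  note 1 = wfun_mulop'[OF m wint_cnj_reflect[OF spec(1)] this]
  have "wfun (conjW (mulop m f)) = synth (\<lambda>\<xi>. cnj (spec (mulop m f) (- \<xi>)))"
    unfolding conjW_def by (rule wfun_of_spec[OF wint_cnj_reflect[OF spec(1)]])
  also have "\<dots> = synth (\<lambda>\<xi>. m \<xi> * cnj (spec f (- \<xi>)))"
  proof (rule synth_cong_AE[OF wint_cnj_reflect[OF spec(1)] wint_symbol_mult[OF m wint_cnj_reflect[OF spec(1)]]])
    show "AE \<xi> in lborel. cnj (spec (mulop m f) (- \<xi>)) = m \<xi> * cnj (spec f (- \<xi>))"
      using AE_lborel_uminus[OF spec_mulop[OF m, of f]] sym by eventually_elim simp
  qed
  finally show "wfun (conjW (mulop m f)) x = wfun (mulop m (conjW f)) x" by (simp add: 1)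
qed

text \<open>Restricted to weight 1, where a shift of the spectrum is isometric. In the weight
  \<open>(1 + norm \<xi>)^2\<close> a shift by \<kappa> may cost a factor
  \<open>(1 + norm \<kappa>)^2\<close>, which is of order \<open>\<epsilon>^(-2)\<close> for the
  frequencies used here.\<close>

definition modul :: "'a \<Rightarrow> ('a::euclidean_space, 1) W \<Rightarrow> ('a, 1) W"
  where "modul \<kappa> f = of_spec (\<lambda>\<xi>. spec f (\<xi> - \<kappa>))"

lemma wint_shift: "wint TYPE(1) (\<lambda>\<xi>. g (\<xi> - \<kappa>))" if "wint TYPE(1) g"
proof -
  have [measurable]: "g \<in> borel_measurable borel" using that by (rule wintD)
  show ?thesis
    using wintD(2)[OF that] integrable_lborel_shift_iff[of "\<lambda>\<xi>. norm (g \<xi>)" \<kappa>]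
    by (simp add: wint_def)
qed

lemma wfun_modul: "wfun (modul \<kappa> f) = (\<lambda>x. cis (\<kappa> \<bullet> x) * wfun f x)"
proof
  fix x
  have "wfun (modul \<kappa> f) x = (LINT \<xi>|lborel. spec f (\<xi> - \<kappa>) * cis (x \<bullet> \<xi>))"
    unfolding modul_def wfun_of_spec[OF wint_shift[OF spec(1)]] synth_def ..
  also have "\<dots> = (LINT \<xi>|lborel. cis (x \<bullet> \<kappa>) * (spec f (\<xi> - \<kappa>) * cis (x \<bullet> (\<xi> - \<kappa>))))"
  proof -
    have "spec f (\<xi> - \<kappa>) * cis (x \<bullet> \<xi>) = cis (x \<bullet> \<kappa>) * (spec f (\<xi> - \<kappa>) * cis (x \<bullet> (\<xi> - \<kappa>)))" for \<xi>
      by (simp add: mult.left_commute[of "cis (x \<bullet> \<kappa>)"] cis_mult inner_diff_right)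
    then show ?thesis by (intro Bochner_Integration.integral_cong refl)
  qed
  also have "\<dots> = cis (x \<bullet> \<kappa>) * (LINT \<xi>|lborel. spec f (\<xi> - \<kappa>) * cis (x \<bullet> (\<xi> - \<kappa>)))"
    by (rule integral_mult_right_zero)
  also have "(LINT \<xi>|lborel. spec f (\<xi> - \<kappa>) * cis (x \<bullet> (\<xi> - \<kappa>))) = synth (spec f) x"
    unfolding synth_def using integral_lborel_shift[of "\<lambda>\<xi>. spec f \<xi> * cis (x \<bullet> \<xi>)" \<kappa>] by simp
  finally show "wfun (modul \<kappa> f) x = cis (\<kappa> \<bullet> x) * wfun f x" by (simp only: spec(2)[of f] inner_commute)
qed

lemma norm_modul [simp]: "norm (modul \<kappa> f) = norm f"
  unfolding modul_def norm_of_spec[OF wint_shift[OF spec(1)]]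
  using integral_lborel_shift[of "\<lambda>\<xi>. norm (spec f \<xi>)" \<kappa>] by (simp add: norm_W_def)

lemma bounded_linear_modul: "bounded_linear (modul \<kappa>)"
  by (rule bounded_linear_intro[of _ 1])
    (auto intro!: W_eqI simp: wfun_modul wfun_rules algebra_simps)

lemma mulop_modul:
  assumes m: "symbol m B"
  shows "mulop m (modul \<kappa> f) = modul \<kappa> (mulop (\<lambda>\<xi>. m (\<xi> + \<kappa>)) f)"
proof (rule W_eqI)
  fix x
  have m': "symbol (\<lambda>\<xi>. m (\<xi> + \<kappa>)) B" using m by (auto simp: symbol_def)
  have "wfun (modul \<kappa> f) = synth (\<lambda>\<xi>. spec f (\<xi> - \<kappa>))"
    unfolding modul_def by (rule wfun_of_spec[OF wint_shift[OF spec(1)]])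
  note 1 = wfun_mulop'[OF m wint_shift[OF spec(1)] this]
  have "wfun (modul \<kappa> (mulop (\<lambda>\<xi>. m (\<xi> + \<kappa>)) f)) = synth (\<lambda>\<xi>. spec (mulop (\<lambda>\<xi>. m (\<xi> + \<kappa>)) f) (\<xi> - \<kappa>))"
    unfolding modul_def by (rule wfun_of_spec[OF wint_shift[OF spec(1)]])
  also have "\<dots> = synth (\<lambda>\<xi>. m \<xi> * spec f (\<xi> - \<kappa>))"
  proof (rule synth_cong_AE[OF wint_shift[OF spec(1)] wint_symbol_mult[OF m wint_shift[OF spec(1)]]])
    show "AE \<xi> in lborel. spec (mulop (\<lambda>\<xi>. m (\<xi> + \<kappa>)) f) (\<xi> - \<kappa>) = m \<xi> * spec f (\<xi> - \<kappa>)"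
      using AE_lborel_shift[OF spec_mulop[OF m', of f], of \<kappa>] by simp
  qed
  finally show "wfun (mulop m (modul \<kappa> f)) x = wfun (modul \<kappa> (mulop (\<lambda>\<xi>. m (\<xi> + \<kappa>)) f)) x" by (simp add: 1)
qed

definition incl :: "('a::euclidean_space, 'n) W \<Rightarrow> ('a, 1) W"
  where "incl f = of_spec (spec f)"

lemma wint_wint_1: "wint TYPE(1) g" if "wint n g"
  using wint_integrable[OF that] wintD(1)[OF that] by (simp add: wint_def)

lemma wfun_incl [simp]: "wfun (incl f) = wfun f"
  unfolding incl_def wfun_of_spec[OF wint_wint_1[OF spec(1)]] by (simp only: spec(2)[of f])

lemma norm_incl_eq: "norm (incl f) = (LINT \<xi>|lborel. norm (spec f \<xi>))"
  unfolding incl_def norm_of_spec[OF wint_wint_1[OF spec(1)]] by simp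

lemma norm_incl_le: "norm (incl f) \<le> norm f"
  unfolding norm_incl_eq unfolding norm_W_def
  by (intro integral_mono integrable_norm integrable_spec wintD spec(1)) (simp add: mult_le_cancel_right1)

lemma bounded_linear_incl: "bounded_linear incl"
  by (rule bounded_linear_intro[of _ 1])
    (auto intro!: W_eqI simp: wfun_rules norm_incl_le)

lemma incl_mulop: "symbol m B \<Longrightarrow> incl (mulop m f) = mulop m (incl f)"
proof (rule W_eqI)
  fix x assume m: "symbol m B"
  have "wfun (incl f) = synth (spec f)" unfolding wfun_incl by (rule spec(2))
  from wfun_mulop'[OF m wint_wint_1[OF spec(1)[of f]] this]
  show "wfun (incl (mulop m f)) x = wfun (mulop m (incl f)) x"
    unfolding wfun_incl wfun_mulop[OF m] by simp
qed

text \<open>Here derivatives are spent: growth of the symbol is absorbed by the weight of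
  \<open>f\<close>, and the resulting constant is \<open>C\<close> in place of \<open>B\<close>. All
  powers of \<epsilon> are gained through a small \<open>C\<close>.\<close>

lemma norm_mulop_incl_le:
  fixes f :: "('a::euclidean_space, 'n) W"
  assumes m: "symbol m B" and C: "\<And>\<xi>. norm (m \<xi>) \<le> C * wt TYPE('n) \<xi>"
  shows "norm (mulop m (incl f)) \<le> C * norm f"
proof -
  have "norm (mulop m (incl f)) = norm (incl (mulop m f))" by (simp add: incl_mulop[OF m])
  also have "\<dots> = (LINT \<xi>|lborel. norm (spec (mulop m f) \<xi>))" by (rule norm_incl_eq)
  also have "\<dots> = (LINT \<xi>|lborel. norm (m \<xi> * spec f \<xi>))"
  proof (rule integral_cong_AE)
    have [measurable]: "m \<in> borel_measurable borel" using m by (rule symbolD)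
    show "(\<lambda>\<xi>. norm (m \<xi> * spec f \<xi>)) \<in> borel_measurable lborel" by measurable
    show "AE \<xi> in lborel. norm (spec (mulop m f) \<xi>) = norm (m \<xi> * spec f \<xi>)"
      using spec_mulop[OF m, of f] by eventually_elim simp
  qed measurable
  also have "\<dots> \<le> (LINT \<xi>|lborel. C * (wt TYPE('n) \<xi> * norm (spec f \<xi>)))"
  proof (intro integral_mono integrable_norm wint_integrable[OF wint_symbol_mult[OF m spec(1)]] integrable_mult_right wintD spec(1))
    fix \<xi> show "norm (m \<xi> * spec f \<xi>) \<le> C * (wt TYPE('n) \<xi> * norm (spec f \<xi>))"
      using mult_right_mono[OF C[of \<xi>], of "norm (spec f \<xi>)"] by (simp add: norm_mult mult_ac)
  qed
  also have "\<dots> = C * norm f" by (simp add: norm_W_def)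
  finally show ?thesis .
qed


section \<open>Distributions with integrable Fourier transform\<close>

text \<open>The tests are the values of \<open>synth\<close> on \<open>f\<close> times a fixed
  Gaussian, which is integrable, so uniqueness applies to the product. Modulated Gaussians are the
  tests on the Fourier side.\<close>

lemma AE_zero_if_modulated_tests_zero:
  assumes i: "integrable lborel (\<lambda>x. f x * cgauss 1 0 0 x)"
    and z: "\<And>w. (LINT x|lborel. f x * cgauss 1 0 w x) = 0"
  shows "AE x in lborel. f x = 0"
proof -
  have "synth (\<lambda>x. f x * cgauss 1 0 0 x) w = 0" for w
  proof -
    have "f x * cgauss 1 0 0 x * cis (w \<bullet> x) = f x * cgauss 1 0 w x" for x
      by (simp add: cgauss_modulated inner_commute mult.assoc)
    then show ?thesis using z[of w] by (simp only: synth_def)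
  qed
  from AE_zero_if_synth_zero[OF i this] have "AE x in lborel. f x * cgauss 1 0 0 x = 0" .
  then show ?thesis by eventually_elim (simp add: cgauss_def)
qed

text \<open>A fixed Gaussian factor makes \<open>f\<close> integrable. By completing the square,
  testing the product with a Gaussian is testing \<open>f\<close> with one of exponent
  \<open>s + 1\<close> and centre \<open>y'\<close>, up to the factor \<open>c\<close>. Translated
  Gaussians are the tests on the physical side.\<close>

lemma AE_zero_if_translated_tests_zero:
  fixes f :: "'a::euclidean_space \<Rightarrow> complex"
  assumes i: "integrable lborel (\<lambda>x. f x * cgauss 1 0 0 x)"
    and z: "\<And>s y. s > 0 \<Longrightarrow> (LINT x|lborel. f x * exp (- s * (norm (x - y))\<^sup>2)) = 0"
  shows "AE x in lborel. f x = 0"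
proof -
  have "AE x in lborel. f x * cgauss 1 0 0 x = 0"
  proof (rule AE_zero_if_gaussian_tests_zero[OF i])
    fix s :: real and y :: 'a assume s: "s > 0"
    define y' where "y' = (s / (s + 1)) *\<^sub>R y"
    define c where "c = exp ((s + 1) * (norm y')\<^sup>2 - s * (norm y)\<^sup>2)"
    have "exp (- s * (norm (x - y))\<^sup>2) *\<^sub>R (f x * cgauss 1 0 0 x) = complex_of_real c * (f x * exp (- (s + 1) * (norm (x - y'))\<^sup>2))" for x
    proof -
      have "- s * (norm (x - y))\<^sup>2 + - 1 * (norm x)\<^sup>2 = ((s + 1) * (norm y')\<^sup>2 - s * (norm y)\<^sup>2) + - (s + 1) * (norm (x - y'))\<^sup>2"
      proof -
        have "(s + 1) * (x \<bullet> y') = s * (x \<bullet> y)" using s by (simp add: y'_def)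
        have "(norm (x - z))\<^sup>2 = (norm x)\<^sup>2 - 2 * (x \<bullet> z) + (norm z)\<^sup>2" for z
          unfolding power2_norm_eq_inner by (simp add: inner_simps inner_commute)
        note n = this
        show ?thesis unfolding n using \<open>(s + 1) * (x \<bullet> y') = s * (x \<bullet> y)\<close> by (simp add: algebra_simps)
      qed
      then have "exp (- s * (norm (x - y))\<^sup>2) * exp (- 1 * (norm x)\<^sup>2) = c * exp (- (s + 1) * (norm (x - y'))\<^sup>2)"
        unfolding c_def exp_add[symmetric] by simp
      then have "complex_of_real (exp (- s * (norm (x - y))\<^sup>2)) * complex_of_real (exp (- 1 * (norm x)\<^sup>2)) = complex_of_real c * complex_of_real (exp (- (s + 1) * (norm (x - y'))\<^sup>2))"
        unfolding of_real_mult[symmetric] by (rule arg_cong)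
      then show ?thesis by (simp add: cgauss_modulated scaleR_conv_of_real mult_ac)
    qed
    then show "(LINT x|lborel. exp (- s * (norm (x - y))\<^sup>2) *\<^sub>R (f x * cgauss 1 0 0 x)) = 0"
      using z[of "s + 1" y'] s by simp
  qed
  then show ?thesis by eventually_elim (simp add: cgauss_def)
qed

section \<open>Functions as distributions and uniqueness of their representatives\<close>

lemma pairs_with_schwartzD:
  "pairs_with_schwartz f \<Longrightarrow> f \<in> borel_measurable borel"
  "pairs_with_schwartz f \<Longrightarrow> \<phi> \<in> schwartz \<Longrightarrow> integrable lborel (\<lambda>x. f x * \<phi> x)"
  by (simp_all add: pairs_with_schwartz_def)

lemma pairs_with_schwartz_diff:
  assumes f: "pairs_with_schwartz f" and g: "pairs_with_schwartz g"
  shows "pairs_with_schwartz (\<lambda>x. f x - g x)"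
  unfolding pairs_with_schwartz_def
proof (intro conjI ballI)
  show "(\<lambda>x. f x - g x) \<in> borel_measurable lborel"
    using pairs_with_schwartzD(1)[OF f] pairs_with_schwartzD(1)[OF g] by simp
  show "integrable lborel (\<lambda>x. (f x - g x) * \<phi> x)" if "\<phi> \<in> schwartz" for \<phi>
    unfolding left_diff_distrib using f g that by (intro Bochner_Integration.integrable_diff pairs_with_schwartzD(2))
qed

lemma pairs_with_schwartz_bounded:
  fixes f :: "'a::euclidean_space \<Rightarrow> complex"
  assumes m: "f \<in> borel_measurable borel" and B: "\<And>x. norm (f x) \<le> B"
  shows "pairs_with_schwartz f"
  unfolding pairs_with_schwartz_def
proof (intro conjI ballI)
  show "f \<in> borel_measurable lborel" using m by simp
  fix \<phi> :: "'a \<Rightarrow> complex" assume \<phi>: "\<phi> \<in> schwartz"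
  show "integrable lborel (\<lambda>x. f x * \<phi> x)"
  proof (rule Bochner_Integration.integrable_bound)
    show "integrable lborel (\<lambda>x. B * norm (\<phi> x))" using schwartz_integrable[OF \<phi>] by simp
    show "(\<lambda>x. f x * \<phi> x) \<in> borel_measurable lborel" using m schwartz_measurable[OF \<phi>] by simp
    have "norm (f x * \<phi> x) \<le> norm (B * norm (\<phi> x))" for x
      using mult_right_mono[OF order_trans[OF B[of x] abs_ge_self], of "norm (\<phi> x)"] by (simp add: norm_mult abs_mult)
    then show "AE x in lborel. norm (f x * \<phi> x) \<le> norm (B * norm (\<phi> x))" by simp
  qed
qed

lemma pairs_with_schwartz_integrable:
  fixes f :: "'a::euclidean_space \<Rightarrow> complex"
  assumes f: "integrable lborel f" shows "pairs_with_schwartz f"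
  unfolding pairs_with_schwartz_def
proof (intro conjI ballI)
  fix \<phi> :: "'a \<Rightarrow> complex" assume \<phi>: "\<phi> \<in> schwartz"
  obtain B where B: "norm (\<phi> x) \<le> B" for x using schwartz_bounded[OF \<phi>] by blast
  show "integrable lborel (\<lambda>x. f x * \<phi> x)"
  proof (rule Bochner_Integration.integrable_bound)
    show "integrable lborel (\<lambda>x. B * norm (f x))" using f by simp
    show "(\<lambda>x. f x * \<phi> x) \<in> borel_measurable lborel" using f schwartz_measurable[OF \<phi>] by simp
    have "norm (f x * \<phi> x) \<le> norm (B * norm (f x))" for x
      using mult_right_mono[OF order_trans[OF B[of x] abs_ge_self], of "norm (f x)"] by (simp add: norm_mult abs_mult mult.commute)
    then show "AE x in lborel. norm (f x * \<phi> x) \<le> norm (B * norm (f x))" by simp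
  qed
qed (use f in auto)

lemma pairs_with_schwartz_L2:
  fixes f :: "'a::euclidean_space \<Rightarrow> complex"
  assumes f: "L2_fun f" shows "pairs_with_schwartz f"
  unfolding pairs_with_schwartz_def
proof (intro conjI ballI)
  show m: "f \<in> borel_measurable lborel" using f by (simp add: L2_fun_def)
  fix \<phi> :: "'a \<Rightarrow> complex" assume \<phi>: "\<phi> \<in> schwartz"
  obtain B where B: "norm (\<phi> x) \<le> B" for x using schwartz_bounded[OF \<phi>] by blast
  show "integrable lborel (\<lambda>x. f x * \<phi> x)"
  proof (rule Bochner_Integration.integrable_bound)
    show "integrable lborel (\<lambda>x. (norm (f x))\<^sup>2 + B * norm (\<phi> x))"
      using f schwartz_integrable[OF \<phi>] by (auto simp: L2_fun_def)
    show "(\<lambda>x. f x * \<phi> x) \<in> borel_measurable lborel" using m schwartz_measurable[OF \<phi>] by simp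
    have "norm (f x * \<phi> x) \<le> norm ((norm (f x))\<^sup>2 + B * norm (\<phi> x))" for x
    proof -
      have "0 \<le> (norm (f x) - norm (\<phi> x))\<^sup>2" by simp
      also have "\<dots> = (norm (f x))\<^sup>2 + (norm (\<phi> x))\<^sup>2 - 2 * (norm (f x) * norm (\<phi> x))" by (simp add: power2_diff)
      finally have "2 * (norm (f x) * norm (\<phi> x)) \<le> (norm (f x))\<^sup>2 + (norm (\<phi> x))\<^sup>2" by simp
      moreover have "(norm (\<phi> x))\<^sup>2 \<le> B * norm (\<phi> x)"
        unfolding power2_eq_square by (intro mult_right_mono B) simp
      moreover have "0 \<le> norm (f x) * norm (\<phi> x)" by simp
      ultimately show ?thesis unfolding norm_mult real_norm_def by linarith
    qed
    then show "AE x in lborel. norm (f x * \<phi> x) \<le> norm ((norm (f x))\<^sup>2 + B * norm (\<phi> x))" by simp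
  qed
qed

lemma represents_unique:
  fixes f g :: "'a::euclidean_space \<Rightarrow> complex"
  assumes "represents f F" "represents g F"
  shows "AE x in lborel. f x = g x"
proof -
  have p: "pairs_with_schwartz f" "pairs_with_schwartz g" using assms by (auto simp: represents_def)
  have "AE x in lborel. f x - g x = 0"
  proof (rule AE_zero_if_modulated_tests_zero)
    show "integrable lborel (\<lambda>x. (f x - g x) * cgauss 1 0 0 x)"
      using pairs_with_schwartzD(2)[OF pairs_with_schwartz_diff[OF p] cgauss_schwartz[of 1]] by simp
    fix w :: 'a
    have s: "cgauss 1 0 w \<in> schwartz" by (simp add: cgauss_schwartz)
    then have "dist_of f (cgauss 1 0 w) = dist_of g (cgauss 1 0 w)" using assms by (metis represents_def)
    then show "(LINT x|lborel. (f x - g x) * cgauss 1 0 w x) = 0"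
      unfolding left_diff_distrib
      by (subst Bochner_Integration.integral_diff) (simp_all add: pairs_with_schwartzD(2)[OF _ s] p dist_of_def)
  qed
  then show ?thesis by simp
qed

lemma represents_hat: "represents g (dist_fourier F) \<Longrightarrow> represents (hat F) (dist_fourier F)"
  unfolding hat_def by (rule someI[where P="\<lambda>g. represents g (dist_fourier F)"])

lemma hat_AE_eq: "represents g (dist_fourier F) \<Longrightarrow> AE x in lborel. hat F x = g x"
  by (rule represents_unique[OF represents_hat])

lemma synth_modulated_gaussian:
  fixes w :: "'a::euclidean_space"
  assumes s: "s > 0"
  shows "synth (cgauss s 0 w) x = of_real (sqrt (pi / s) ^ DIM('a) * exp (- (norm (x + w))\<^sup>2 / (4 * s)))"
proof -
  have "cgauss s 0 w \<xi> * cis (x \<bullet> \<xi>) = exp (- s * (norm \<xi>)\<^sup>2) * cis (\<xi> \<bullet> (x + w))" for \<xi>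
    by (simp add: cgauss_modulated inner_add_right inner_commute cis_mult mult.assoc add.commute)
  then show ?thesis
    using has_bochner_integral_integral_eq[OF has_bochner_integral_gaussian_cis[OF s, of "x + w"]]
    by (simp only: synth_def)
qed

text \<open>It gives access to \<open>dist_fourier\<close>, which sees a distribution only through
  Fourier transforms of Schwartz functions: all translated Gaussians are among these.\<close>

lemma translated_gaussian_eq_fourier:
  fixes y :: "'a::euclidean_space"
  assumes s: "s > 0"
  defines "t \<equiv> 1 / (4 * s)"
  shows "complex_of_real (exp (- s * (norm (x - y))\<^sup>2)) = of_real (fnorm TYPE('a) / sqrt (pi / t) ^ DIM('a)) * fourier (cgauss t 0 y) x"
proof -
  have t: "t > 0" using s by (simp add: t_def)
  have "fnorm TYPE('a) \<noteq> 0" using fnorm_pos[where 'a='a] by (metis less_irrefl)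
  moreover have "- (norm (- x + y))\<^sup>2 / (4 * t) = - s * (norm (x - y))\<^sup>2"
    using s by (simp add: t_def norm_minus_commute[of x y])
  moreover have "sqrt (pi / t) ^ DIM('a) \<noteq> 0" using t by simp
  ultimately show ?thesis
    unfolding fourier_eq_synth synth_modulated_gaussian[OF t] by simp
qed

lemma fnorm_ne_0 [simp]: "fnorm TYPE('a::euclidean_space) \<noteq> 0"
  using fnorm_pos[where 'a='a] by (metis less_irrefl)

text \<open>Fourier inversion for an integrable transform: \<open>h\<close> and the synthesised
  function have the same pairing with every \<open>fourier \<phi>\<close>, hence with every
  translated Gaussian.\<close>

lemma AE_eq_synth_if_represents:
  fixes h :: "'a::euclidean_space \<Rightarrow> complex"
  assumes h: "pairs_with_schwartz h" and g: "integrable lborel g" and r: "represents g (dist_fourier (dist_of h))"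
  shows "AE x in lborel. h x = synth (\<lambda>\<xi>. of_real (1 / fnorm TYPE('a)) * g \<xi>) x"
proof -
  let ?g = "\<lambda>\<xi>. of_real (1 / fnorm TYPE('a)) * g \<xi>"
  have g': "integrable lborel ?g" using g by (rule integrable_mult_right)
  have p: "pairs_with_schwartz (synth ?g)"
    by (rule pairs_with_schwartz_bounded[OF borel_measurable_continuous_onI[OF continuous_on_synth[OF g']] norm_synth_le])
  have "AE x in lborel. h x - synth ?g x = 0"
  proof (rule AE_zero_if_translated_tests_zero)
    show "integrable lborel (\<lambda>x. (h x - synth ?g x) * cgauss 1 0 0 x)"
      by (rule pairs_with_schwartzD(2)[OF pairs_with_schwartz_diff[OF h p] cgauss_schwartz]) simp
    fix s :: real and y :: 'a assume s: "s > 0"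
    \<comment> \<open>The width is the dual one, so that \<open>fourier \<phi>\<close> times
      \<open>c\<close> is exactly the Gaussian test with parameter \<open>s\<close> centred at
      \<open>y\<close>.\<close>
    define \<phi> where "\<phi> = cgauss (1 / (4 * s)) 0 y"
    define c where "c = complex_of_real (fnorm TYPE('a) / sqrt (pi / (1 / (4 * s))) ^ DIM('a))"
    have \<phi>: "\<phi> \<in> schwartz" unfolding \<phi>_def by (rule cgauss_schwartz) (use s in simp)
    have e: "complex_of_real (exp (- s * (norm (x - y))\<^sup>2)) = c * fourier \<phi> x" for x
      unfolding c_def \<phi>_def by (rule translated_gaussian_eq_fourier[OF s])
    have "c * (LINT x|lborel. h x * fourier \<phi> x) = c * (LINT \<xi>|lborel. g \<xi> * \<phi> \<xi>)"
      using r \<phi> by (simp add: represents_def dist_fourier_def dist_of_def)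
    also have "(LINT \<xi>|lborel. g \<xi> * \<phi> \<xi>) = (LINT x|lborel. synth ?g x * fourier \<phi> x)"
      unfolding integral_synth_times_fourier[OF g' \<phi>] by (simp add: mult.assoc)
    finally have eq: "(LINT x|lborel. h x * (c * fourier \<phi> x)) = (LINT x|lborel. synth ?g x * (c * fourier \<phi> x))"
      unfolding mult.left_commute[of _ c] integral_mult_right_zero .
    have i: "integrable lborel (\<lambda>x. f x * (c * fourier \<phi> x))" if f: "pairs_with_schwartz f" for f
      unfolding e[symmetric] translated_gaussian_eq_cgauss mult.left_commute[of "f _"]
      by (intro integrable_mult_right pairs_with_schwartzD(2)[OF f] cgauss_schwartz s)
    show "(LINT x|lborel. (h x - synth ?g x) * complex_of_real (exp (- s * (norm (x - y))\<^sup>2))) = 0"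
      unfolding e left_diff_distrib Bochner_Integration.integral_diff[OF i[OF h] i[OF p]] eq by simp
  qed
  then show ?thesis by simp
qed

lemma tempered_dist_of_bounded:
  fixes h :: "'a::euclidean_space \<Rightarrow> complex"
  assumes m: "h \<in> borel_measurable borel" and B: "\<And>x. norm (h x) \<le> B"
  shows "tempered (dist_of h)"
proof -
  note p = pairs_with_schwartz_bounded[OF m B]
  note i = pairs_with_schwartzD(2)[OF p]
  let ?N = "2 * DIM('a)"
  let ?w = "\<lambda>x::'a. 1 / (1 + norm x) ^ ?N"
  have B0: "B \<ge> 0" using B[of 0] norm_ge_zero order_trans by blast
  have bd: "norm (dist_of h \<phi>) \<le> (B * (LINT x|lborel. ?w x)) * schwartz_norm ?N \<phi>" if \<phi>: "\<phi> \<in> schwartz" for \<phi>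
  proof -
    have "norm (dist_of h \<phi>) \<le> (LINT x|lborel. norm (h x * \<phi> x))" unfolding dist_of_def by (rule integral_norm_bound)
    also have "\<dots> \<le> (LINT x|lborel. B * schwartz_norm ?N \<phi> * ?w x)"
    proof (intro integral_mono integrable_norm i[OF \<phi>] integrable_mult_right integrable_inverse_polynomial_weight)
      fix x
      have "norm (\<phi> x) \<le> schwartz_norm ?N \<phi> * ?w x"
        using schwartz_norm_bound[OF \<phi>, of x ?N] by (simp add: field_simps add_pos_nonneg)
      then have "norm (h x) * norm (\<phi> x) \<le> B * (schwartz_norm ?N \<phi> * ?w x)"
        by (intro mult_mono B B0) auto
      then show "norm (h x * \<phi> x) \<le> B * schwartz_norm ?N \<phi> * ?w x" by (simp add: norm_mult)
    qed
    also have "\<dots> = (B * (LINT x|lborel. ?w x)) * schwartz_norm ?N \<phi>"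
      unfolding integral_mult_right_zero by (simp add: mult_ac)
    finally show ?thesis .
  qed
  show ?thesis
    unfolding tempered_def
  proof (intro conjI ballI allI)
    show "dist_of h (\<lambda>x. \<phi> x + \<psi> x) = dist_of h \<phi> + dist_of h \<psi>" if "\<phi> \<in> schwartz" "\<psi> \<in> schwartz" for \<phi> \<psi>
      unfolding dist_of_def distrib_left by (rule Bochner_Integration.integral_add[OF i[OF that(1)] i[OF that(2)]])
    show "dist_of h (\<lambda>x. c * \<phi> x) = c * dist_of h \<phi>" for c \<phi>
      unfolding dist_of_def mult.left_commute[of _ c] by (rule integral_mult_right_zero)
    show "\<exists>C N. \<forall>\<phi>\<in>schwartz. norm (dist_of h \<phi>) \<le> C * schwartz_norm N \<phi>" using bd by blast
  qed
qed

section \<open>Dictionary between \<open>wiener_fun\<close> and the algebra of weight 1\<close>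

lemma represents_wfun:
  fixes f :: "('a::euclidean_space, 'n) W"
  shows "represents (\<lambda>\<xi>. of_real (fnorm TYPE('a)) * spec f \<xi>) (dist_fourier (dist_of (wfun f)))"
  unfolding represents_def
proof (intro conjI ballI)
  show "pairs_with_schwartz (\<lambda>\<xi>. of_real (fnorm TYPE('a)) * spec f \<xi>)"
    by (intro pairs_with_schwartz_integrable integrable_mult_right integrable_spec)
  fix \<phi> :: "'a \<Rightarrow> complex" assume \<phi>: "\<phi> \<in> schwartz"
  have "dist_fourier (dist_of (wfun f)) \<phi> = (LINT x|lborel. synth (spec f) x * fourier \<phi> x)"
    by (simp only: dist_fourier_def dist_of_def spec(2)[of f])
  also have "\<dots> = of_real (fnorm TYPE('a)) * (LINT \<xi>|lborel. spec f \<xi> * \<phi> \<xi>)"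
    by (rule integral_synth_times_fourier[OF integrable_spec \<phi>])
  finally show "dist_fourier (dist_of (wfun f)) \<phi> = dist_of (\<lambda>\<xi>. of_real (fnorm TYPE('a)) * spec f \<xi>) \<phi>"
    by (simp add: dist_of_def mult.assoc)
qed

lemma wfun_wiener_fun: "wfun f \<in> wiener_fun"
  for f :: "('a::euclidean_space, 'n) W"
proof -
  have "pairs_with_schwartz (wfun f)" by (rule pairs_with_schwartz_bounded[OF wfun_measurable norm_wfun_le])
  moreover have "tempered (dist_of (wfun f))" by (rule tempered_dist_of_bounded[OF wfun_measurable norm_wfun_le])
  moreover have "integrable lborel (\<lambda>\<xi>. complex_of_real (fnorm TYPE('a)) * spec f \<xi>)"
    by (intro integrable_mult_right integrable_spec)
  ultimately show ?thesis
    using represents_wfun[of f] continuous_on_wfun[of f] unfolding wiener_fun_def wiener_def by blast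
qed

lemma hat_wfun: "AE \<xi> in lborel. hat (dist_of (wfun f)) \<xi> = of_real (fnorm TYPE('a)) * spec f \<xi>"
  for f :: "('a::euclidean_space, 'n) W"
  by (rule hat_AE_eq[OF represents_wfun])

lemma wiener_norm_wfun: "wiener_norm (dist_of (wfun f)) = fnorm TYPE('a) * norm f"
  for f :: "('a::euclidean_space, 1) W"
proof -
  have [measurable]: "hat (dist_of (wfun f)) \<in> borel_measurable borel"
    using represents_hat[OF represents_wfun[of f]] by (auto simp: represents_def dest: pairs_with_schwartzD(1))
  have "wiener_norm (dist_of (wfun f)) = (LINT \<xi>|lborel. norm (complex_of_real (fnorm TYPE('a)) * spec f \<xi>))"
    unfolding wiener_norm_def
  proof (rule integral_cong_AE)
    show "AE \<xi> in lborel. norm (hat (dist_of (wfun f)) \<xi>) = norm (complex_of_real (fnorm TYPE('a)) * spec f \<xi>)"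
      using hat_wfun[of f] by eventually_elim simp
  qed measurable
  then show ?thesis by (simp add: norm_mult norm_W_def abs_of_pos)
qed

lemma continuous_AE_eq_imp_eq:
  fixes f g :: "'a::euclidean_space \<Rightarrow> complex"
  assumes f: "continuous_on UNIV f" and g: "continuous_on UNIV g" and ae: "AE x in lborel. f x = g x"
  shows "f = g"
proof (rule ccontr)
  assume "f \<noteq> g"
  then obtain x where x: "f x \<noteq> g x" by auto
  have o: "open {x. f x \<noteq> g x}" by (intro open_Collect_neq f g)
  have "{x. f x \<noteq> g x} \<in> null_sets lborel"
    using ae o by (subst AE_iff_null_sets) auto
  then have "negligible {x. f x \<noteq> g x}" by (simp add: negligible_iff_null_sets null_sets_completionI)
  then show False using open_not_negligible[OF o] x by auto
qed

text \<open>Inversion gives equality almost everywhere, and two continuous functions that agree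
  almost everywhere are equal. Together with \<open>wfun_wiener_fun\<close> this identifies
  \<open>wiener_fun\<close> with the range of \<open>wfun\<close>.\<close>

lemma wiener_fun_obtain:
  assumes "h \<in> wiener_fun"
  obtains f :: "('a::euclidean_space, 1) W" where "wfun f = h"
proof -
  from assms obtain g where h: "continuous_on UNIV h" "pairs_with_schwartz h"
    and g: "integrable lborel g" "represents g (dist_fourier (dist_of h))"
    by (auto simp: wiener_fun_def wiener_def)
  let ?g = "\<lambda>\<xi>. of_real (1 / fnorm TYPE('a)) * g \<xi>"
  have w: "wint TYPE(1) ?g" and i: "integrable lborel ?g" using g(1) by (auto simp: wint_def)
  have "h = synth ?g"
    by (rule continuous_AE_eq_imp_eq[OF h(1) continuous_on_synth[OF i] AE_eq_synth_if_represents[OF h(2) g]])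
  then show ?thesis using wfun_of_spec[OF w] that by metis
qed

lemma dist_of_cong_schwartz:
  assumes "f \<in> borel_measurable borel" "g \<in> borel_measurable borel" "AE x in lborel. f x = g x"
    and \<phi>: "\<phi> \<in> borel_measurable borel"
  shows "dist_of f \<phi> = dist_of g \<phi>"
  unfolding dist_of_def
proof (rule integral_cong_AE)
  show "AE x in lborel. f x * \<phi> x = g x * \<phi> x" using assms(3) by eventually_elim simp
qed (use assms in auto)

lemma fourier_schwartz_measurable: "\<phi> \<in> schwartz \<Longrightarrow> fourier \<phi> \<in> borel_measurable borel"
proof -
  assume \<phi>: "\<phi> \<in> schwartz"
  have [measurable]: "synth \<phi> \<in> borel_measurable borel"
    by (rule borel_measurable_continuous_onI[OF continuous_on_synth[OF schwartz_integrable[OF \<phi>]]])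
  show ?thesis unfolding fourier_eq_synth[abs_def] by measurable
qed

text \<open>Functions equal almost everywhere give the same representation predicate, and a choice
  from the same predicate is the same function, not merely one equal to it almost
  everywhere.\<close>

lemma hat_dist_of_cong:
  assumes "f \<in> borel_measurable borel" "g \<in> borel_measurable borel" "AE x in lborel. f x = g x"
  shows "hat (dist_of f) = hat (dist_of g)"
proof -
  have "dist_fourier (dist_of f) \<phi> = dist_fourier (dist_of g) \<phi>" if "\<phi> \<in> schwartz" for \<phi>
    unfolding dist_fourier_def by (rule dist_of_cong_schwartz[OF assms fourier_schwartz_measurable[OF that]])
  then have "represents u (dist_fourier (dist_of f)) = represents u (dist_fourier (dist_of g))" for u
    by (auto simp: represents_def)
  then show ?thesis by (simp add: hat_def)
qed

text \<open>This resolves the definite description: \<open>mulop\<close> supplies a candidate, and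
  uniqueness of the spectrum makes it the only one. Equality almost everywhere is enough for
  \<open>f\<close>, as needed for the data and densities built from the given amplitudes.\<close>

lemma fourier_multiplier_wfun:
  fixes F :: "('a::euclidean_space, 1) W"
  assumes m: "symbol m B" and ae: "AE \<xi> in lborel. m' \<xi> = m \<xi>"
    and f: "f \<in> borel_measurable borel" "AE x in lborel. f x = wfun F x"
  shows "fourier_multiplier m' f = wfun (mulop m F)"
proof -
  have hf: "hat (dist_of f) = hat (dist_of (wfun F))" by (rule hat_dist_of_cong[OF f(1) wfun_measurable f(2)])
  have mf: "AE \<xi> in lborel. hat (dist_of (wfun (mulop m F))) \<xi> = m' \<xi> * hat (dist_of f) \<xi>"
    unfolding hf using hat_wfun[of "mulop m F"] hat_wfun[of F] spec_mulop[OF m, of F] ae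
    by eventually_elim (simp add: mult_ac)
  show ?thesis
    unfolding fourier_multiplier_def
  proof (rule the_equality, intro conjI wfun_wiener_fun mf)
    fix h assume h: "h \<in> wiener_fun \<and> (AE \<xi> in lborel. hat (dist_of h) \<xi> = m' \<xi> * hat (dist_of f) \<xi>)"
    then obtain H :: "('a, 1) W" where H: "h = wfun H" using wiener_fun_obtain by metis
    have "AE \<xi> in lborel. spec H \<xi> = spec (mulop m F) \<xi>"
      using conjunct2[OF h] mf hat_wfun[of H] hat_wfun[of "mulop m F"] unfolding H
    proof eventually_elim
      case (elim \<xi>)
      then have "complex_of_real (fnorm TYPE('a)) * spec H \<xi> = complex_of_real (fnorm TYPE('a)) * spec (mulop m F) \<xi>"
        by metis
      then show ?case by simp
    qed
    then have "synth (spec H) = synth (spec (mulop m F))" by (rule synth_cong_AE[OF spec(1) spec(1)])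
    then show "h = wfun (mulop m F)" unfolding H by (simp only: spec(2)[of H] spec(2)[of "mulop m F"])
  qed
qed


text \<open>The second-order remainder of the character is at most
  \<open>(norm h * norm \<xi>)^2\<close>, and all moments of a Schwartz function are finite.\<close>

lemma synth_schwartz_has_derivative:
  fixes \<phi> :: "'a::euclidean_space \<Rightarrow> complex"
  assumes \<phi>: "\<phi> \<in> schwartz"
  shows "(synth \<phi> has_derivative (\<lambda>h. synth (\<lambda>\<xi>. \<i> * of_real (h \<bullet> \<xi>) * \<phi> \<xi>) x)) (at x)"
proof -
  have [measurable]: "\<phi> \<in> borel_measurable borel" using \<phi> by (rule schwartz_measurable)
  have mom: "integrable lborel (\<lambda>\<xi>. norm \<xi> ^ k * norm (\<phi> \<xi>))" for k
  proof -
    obtain C where C: "(1 + norm \<xi>) ^ (2 * DIM('a) + k) * norm (\<phi> \<xi>) \<le> C" for \<xi> using schwartz_decay[OF \<phi>] by blast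
    have "integrable lborel (\<lambda>\<xi>. complex_of_real (norm \<xi> ^ k * norm (\<phi> \<xi>)))"
    proof (rule integrable_if_polynomial_decay)
      show "(1 + norm \<xi>) ^ (2 * DIM('a)) * norm (complex_of_real (norm \<xi> ^ k * norm (\<phi> \<xi>))) \<le> C" for \<xi>
      proof -
        have "(1 + norm \<xi>) ^ (2 * DIM('a)) * (norm \<xi> ^ k * norm (\<phi> \<xi>)) \<le> (1 + norm \<xi>) ^ (2 * DIM('a)) * ((1 + norm \<xi>) ^ k * norm (\<phi> \<xi>))"
          by (intro mult_left_mono mult_right_mono power_mono) auto
        also have "\<dots> \<le> C" using C[of \<xi>] by (simp add: power_add mult.assoc)
        finally show ?thesis by (simp add: norm_mult norm_power)
      qed
    qed measurable
    from integrable_Re[OF this] show ?thesis by simp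
  qed
  let ?D = "\<lambda>h. synth (\<lambda>\<xi>. \<i> * of_real (h \<bullet> \<xi>) * \<phi> \<xi>) x"
  have i1: "integrable lborel (\<lambda>\<xi>. \<i> * of_real (h \<bullet> \<xi>) * \<phi> \<xi>)" for h
  proof (rule Bochner_Integration.integrable_bound)
    show "integrable lborel (\<lambda>\<xi>. norm h * (norm \<xi> ^ 1 * norm (\<phi> \<xi>)))" using mom by (rule integrable_mult_right)
    have "norm (\<i> * of_real (h \<bullet> \<xi>) * \<phi> \<xi>) \<le> norm (norm h * (norm \<xi> ^ 1 * norm (\<phi> \<xi>)))" for \<xi>
      using mult_right_mono[OF Cauchy_Schwarz_ineq2[of h \<xi>], of "norm (\<phi> \<xi>)"] by (simp add: norm_mult mult.assoc)
    then show "AE \<xi> in lborel. norm (\<i> * of_real (h \<bullet> \<xi>) * \<phi> \<xi>) \<le> norm (norm h * (norm \<xi> ^ 1 * norm (\<phi> \<xi>)))" by simp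
  qed measurable
  have i0: "integrable lborel \<phi>" using \<phi> by (rule schwartz_integrable)
  have lin: "bounded_linear ?D"
  proof (rule bounded_linear_intro)
    show "?D (h + k) = ?D h + ?D k" for h k
      using synth_add[OF i1[of h] i1[of k]] by (simp add: inner_add_left algebra_simps)
    show "?D (r *\<^sub>R h) = r *\<^sub>R ?D h" for r h
      using synth_cmult[of "of_real r" "\<lambda>\<xi>. \<i> * of_real (h \<bullet> \<xi>) * \<phi> \<xi>" x] by (simp add: scaleR_conv_of_real mult_ac)
    show "norm (?D h) \<le> norm h * (LINT \<xi>|lborel. norm \<xi> ^ 1 * norm (\<phi> \<xi>))" for h
    proof -
      have "norm (?D h) \<le> (LINT \<xi>|lborel. norm (\<i> * of_real (h \<bullet> \<xi>) * \<phi> \<xi>))" by (rule norm_synth_le)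
      also have "\<dots> \<le> (LINT \<xi>|lborel. norm h * (norm \<xi> ^ 1 * norm (\<phi> \<xi>)))"
      proof (intro integral_mono integrable_norm i1 integrable_mult_right mom)
        show "norm (\<i> * of_real (h \<bullet> \<xi>) * \<phi> \<xi>) \<le> norm h * (norm \<xi> ^ 1 * norm (\<phi> \<xi>))" for \<xi>
          using mult_right_mono[OF Cauchy_Schwarz_ineq2[of h \<xi>], of "norm (\<phi> \<xi>)"] by (simp add: norm_mult mult.assoc)
      qed
      finally show ?thesis by simp
    qed
  qed
  let ?M = "LINT \<xi>|lborel. norm \<xi> ^ 2 * norm (\<phi> \<xi>)"
  have rem: "norm (synth \<phi> (x + h) - synth \<phi> x - ?D h) \<le> (norm h)\<^sup>2 * ?M" for h
  proof -
    let ?r = "\<lambda>\<xi>. \<phi> \<xi> * cis (x \<bullet> \<xi>) * (cis (h \<bullet> \<xi>) - 1 - \<i> * of_real (h \<bullet> \<xi>))"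
    have "synth \<phi> (x + h) - synth \<phi> x - ?D h = (LINT \<xi>|lborel. \<phi> \<xi> * cis ((x + h) \<bullet> \<xi>) - \<phi> \<xi> * cis (x \<bullet> \<xi>) - \<i> * of_real (h \<bullet> \<xi>) * \<phi> \<xi> * cis (x \<bullet> \<xi>))"
      unfolding synth_def
      by (simp only: Bochner_Integration.integral_diff Bochner_Integration.integrable_diff integrable_mult_cis i0 i1)
    also have "\<dots> = (LINT \<xi>|lborel. ?r \<xi>)"
      by (intro Bochner_Integration.integral_cong refl) (simp add: inner_add_left algebra_simps flip: cis_mult)
    finally have eq: "synth \<phi> (x + h) - synth \<phi> x - ?D h = (LINT \<xi>|lborel. ?r \<xi>)" .
    have b: "norm (?r \<xi>) \<le> (norm h)\<^sup>2 * (norm \<xi> ^ 2 * norm (\<phi> \<xi>))" for \<xi>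
    proof -
      have "norm (cis (h \<bullet> \<xi>) - 1 - \<i> * of_real (h \<bullet> \<xi>)) \<le> \<bar>h \<bullet> \<xi>\<bar>\<^sup>2 / 2"
        using iexp_approx1[of "h \<bullet> \<xi>" 1] by (simp add: cis_conv_exp numeral_2_eq_2 diff_diff_eq)
      also have "\<dots> \<le> \<bar>h \<bullet> \<xi>\<bar>\<^sup>2" by simp
      also have "\<dots> \<le> (norm h * norm \<xi>)\<^sup>2" by (rule power_mono[OF Cauchy_Schwarz_ineq2]) simp
      finally have "norm (\<phi> \<xi>) * norm (cis (h \<bullet> \<xi>) - 1 - \<i> * of_real (h \<bullet> \<xi>)) \<le> norm (\<phi> \<xi>) * (norm h * norm \<xi>)\<^sup>2"
        by (rule mult_left_mono) simp
      then show ?thesis by (simp add: norm_mult power_mult_distrib mult_ac)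
    qed
    have ib: "integrable lborel (\<lambda>\<xi>. (norm h)\<^sup>2 * (norm \<xi> ^ 2 * norm (\<phi> \<xi>)))" using mom by (rule integrable_mult_right)
    have ir: "integrable lborel ?r"
    proof (rule Bochner_Integration.integrable_bound[OF ib])
      show "AE \<xi> in lborel. norm (?r \<xi>) \<le> norm ((norm h)\<^sup>2 * (norm \<xi> ^ 2 * norm (\<phi> \<xi>)))"
        using b by (intro AE_I2) (metis abs_ge_self order_trans real_norm_def)
    qed measurable
    have "norm (LINT \<xi>|lborel. ?r \<xi>) \<le> (LINT \<xi>|lborel. norm (?r \<xi>))" by (rule integral_norm_bound)
    also have "\<dots> \<le> (LINT \<xi>|lborel. (norm h)\<^sup>2 * (norm \<xi> ^ 2 * norm (\<phi> \<xi>)))"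
      by (rule integral_mono[OF integrable_norm[OF ir] ib b])
    also have "\<dots> = (norm h)\<^sup>2 * ?M" by simp
    finally show ?thesis unfolding eq .
  qed
  have "((\<lambda>h. norm (synth \<phi> (x + h) - synth \<phi> x - ?D h) / norm h) \<longlongrightarrow> 0) (at 0)"
  proof (rule Lim_null_comparison)
    show "\<forall>\<^sub>F h in at 0. norm (norm (synth \<phi> (x + h) - synth \<phi> x - ?D h) / norm h) \<le> norm h * ?M"
    proof (rule always_eventually, rule allI)
      fix h
      show "norm (norm (synth \<phi> (x + h) - synth \<phi> x - ?D h) / norm h) \<le> norm h * ?M"
        using rem[of h] by (cases "h = 0") (auto simp: field_simps power2_eq_square)
    qed
    have "((\<lambda>h::'a. norm h * ?M) \<longlongrightarrow> norm (0::'a) * ?M) (at 0)" by (intro tendsto_intros)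
    then show "((\<lambda>h::'a. norm h * ?M) \<longlongrightarrow> 0) (at 0)" by simp
  qed
  with lin show ?thesis by (simp add: has_derivative_at)
qed

lemma pderiv_dir_fourier:
  fixes \<phi> :: "'a::euclidean_space \<Rightarrow> complex"
  assumes \<phi>: "\<phi> \<in> schwartz"
  shows "pderiv_dir b (fourier \<phi>) = fourier (\<lambda>\<xi>. - \<i> * of_real (b \<bullet> \<xi>) * \<phi> \<xi>)"
proof
  fix x
  let ?c = "complex_of_real (1 / fnorm TYPE('a))"
  let ?D = "\<lambda>h. ?c * synth (\<lambda>\<xi>. \<i> * of_real ((- h) \<bullet> \<xi>) * \<phi> \<xi>) (- x)"
  have "((\<lambda>y. ?c * synth \<phi> (- y)) has_derivative ?D) (at x)"
    by (intro has_derivative_mult_right has_derivative_compose[OF _ synth_schwartz_has_derivative[OF \<phi>]] derivative_intros)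
  then have "(fourier \<phi> has_derivative ?D) (at x)" by (simp only: fourier_eq_synth[abs_def])
  from frechet_derivative_at[OF this, symmetric]
  show "pderiv_dir b (fourier \<phi>) x = fourier (\<lambda>\<xi>. - \<i> * of_real (b \<bullet> \<xi>) * \<phi> \<xi>) x"
    by (simp add: pderiv_dir_def fourier_eq_synth)
qed

text \<open>Both statements follow from the symbol identity that the transform of the second
  derivative is \<open>- (\<xi> \<bullet> b)^2\<close> times the transform of \<open>a\<close>
  almost everywhere. It is tested with modulated Gaussians, whose products with this polynomial are
  again Schwartz functions.\<close>

lemma norm_dist_pderiv_bb:
  fixes a :: "'a::euclidean_space \<Rightarrow> complex"
  assumes a: "pairs_with_schwartz a" and w0: "wiener (dist_of a)" and w2: "wiener (dist_pderiv [b, b] (dist_of a))"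
  shows "integrable lborel (\<lambda>\<xi>. (\<xi> \<bullet> b)\<^sup>2 * norm (hat (dist_of a) \<xi>))"
    and "(LINT \<xi>|lborel. (\<xi> \<bullet> b)\<^sup>2 * norm (hat (dist_of a) \<xi>)) = wiener_norm (dist_pderiv [b, b] (dist_of a))"
proof -
  let ?c = "complex_of_real (1 / fnorm TYPE('a))"
  let ?g0 = "hat (dist_of a)" and ?g2 = "hat (dist_pderiv [b, b] (dist_of a))"
  have hat_int: "integrable lborel (hat F) \<and> represents (hat F) (dist_fourier F)" if "wiener F" for F :: "'a functional"
  proof -
    from that obtain g where g: "integrable lborel g" "represents g (dist_fourier F)" by (auto simp: wiener_def)
    have r: "represents (hat F) (dist_fourier F)" using represents_hat[OF g(2)] .
    have "integrable lborel (hat F)"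
    proof (rule integrable_cong_AE_imp[OF g(1)])
      show "AE x in lborel. g x = hat F x" using hat_AE_eq[OF g(2)] by eventually_elim simp
    qed (use r in \<open>auto simp: represents_def pairs_with_schwartz_def\<close>)
    with r show ?thesis by simp
  qed
  note g0 = hat_int[OF w0] and g2 = hat_int[OF w2]
  have [measurable]: "?g0 \<in> borel_measurable borel" "?g2 \<in> borel_measurable borel" using g0 g2 by auto
  have ia: "integrable lborel (\<lambda>\<xi>. ?c * ?g0 \<xi>)" using g0 by simp
  have ae: "AE x in lborel. a x = synth (\<lambda>\<xi>. ?c * ?g0 \<xi>) x"
    using AE_eq_synth_if_represents[OF a] g0 by blast
  define \<phi> where "\<phi> w = cgauss 1 0 w" for w :: 'a
  have s0: "\<phi> w \<in> schwartz" for w unfolding \<phi>_def by (rule cgauss_schwartz) simp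
  have s1: "(\<lambda>\<xi>. - \<i> * of_real (b \<bullet> \<xi>) * \<phi> w \<xi>) \<in> schwartz" for w
    unfolding \<phi>_def inner_commute[of b] by (intro cpoly_cgauss_schwartz cpoly.intros) simp
  have s2: "(\<lambda>\<xi>. - of_real ((\<xi> \<bullet> b)\<^sup>2) * \<phi> w \<xi>) \<in> schwartz" for w
  proof -
    have "(\<lambda>\<xi>. (- 1 * of_real (\<xi> \<bullet> b) * of_real (\<xi> \<bullet> b)) * \<phi> w \<xi>) \<in> schwartz"
      unfolding \<phi>_def by (intro cpoly_cgauss_schwartz cpoly.intros) simp
    then show ?thesis by (simp add: power2_eq_square)
  qed
  have dd: "pderiv_dir b (pderiv_dir b (fourier (\<phi> w))) = fourier (\<lambda>\<xi>. - of_real ((\<xi> \<bullet> b)\<^sup>2) * \<phi> w \<xi>)" for w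
    unfolding pderiv_dir_fourier[OF s0] pderiv_dir_fourier[OF s1]
    by (rule arg_cong[where f=fourier]) (simp add: fun_eq_iff power2_eq_square inner_commute algebra_simps)
  have test: "(LINT \<xi>|lborel. ?g2 \<xi> * \<phi> w \<xi>) = (LINT \<xi>|lborel. ?g0 \<xi> * (- of_real ((\<xi> \<bullet> b)\<^sup>2) * \<phi> w \<xi>))" for w
  proof -
    have "(LINT \<xi>|lborel. ?g2 \<xi> * \<phi> w \<xi>) = dist_of ?g2 (\<phi> w)" by (simp only: dist_of_def)
    also have "\<dots> = dist_fourier (dist_pderiv [b, b] (dist_of a)) (\<phi> w)"
      using g2 s0[of w] unfolding represents_def by metis
    also have "\<dots> = dist_of a (pderiv_dir b (pderiv_dir b (fourier (\<phi> w))))"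
      by (simp add: dist_fourier_def dist_pderiv_def dist_pderiv_dir_def)
    also have "\<dots> = dist_of a (fourier (\<lambda>\<xi>. - of_real ((\<xi> \<bullet> b)\<^sup>2) * \<phi> w \<xi>))" unfolding dd ..
    also have "\<dots> = dist_of (synth (\<lambda>\<xi>. ?c * ?g0 \<xi>)) (fourier (\<lambda>\<xi>. - of_real ((\<xi> \<bullet> b)\<^sup>2) * \<phi> w \<xi>))"
      by (rule dist_of_cong_schwartz[OF pairs_with_schwartzD(1)[OF a] borel_measurable_continuous_onI[OF continuous_on_synth[OF ia]] ae fourier_schwartz_measurable[OF s2]])
    also have "\<dots> = (LINT \<xi>|lborel. ?g0 \<xi> * (- of_real ((\<xi> \<bullet> b)\<^sup>2) * \<phi> w \<xi>))"
    proof -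
      have "dist_of (synth (\<lambda>\<xi>. ?c * ?g0 \<xi>)) (fourier (\<lambda>\<xi>. - of_real ((\<xi> \<bullet> b)\<^sup>2) * \<phi> w \<xi>))
        = of_real (fnorm TYPE('a)) * (LINT \<xi>|lborel. ?c * ?g0 \<xi> * (- of_real ((\<xi> \<bullet> b)\<^sup>2) * \<phi> w \<xi>))"
        unfolding dist_of_def[of "synth _"] by (rule integral_synth_times_fourier[OF ia s2])
      then show ?thesis unfolding mult.assoc[of ?c] integral_mult_right_zero by simp
    qed
    finally show ?thesis .
  qed
  have i0: "integrable lborel (\<lambda>\<xi>. ?g0 \<xi> * (- of_real ((\<xi> \<bullet> b)\<^sup>2) * \<phi> w \<xi>))" for w
    by (rule pairs_with_schwartzD(2)[OF pairs_with_schwartz_integrable[OF conjunct1[OF g0]] s2])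
  have i2: "integrable lborel (\<lambda>\<xi>. ?g2 \<xi> * \<phi> w \<xi>)" for w
    by (rule pairs_with_schwartzD(2)[OF pairs_with_schwartz_integrable[OF conjunct1[OF g2]] s0])
  have e: "(?g2 \<xi> + of_real ((\<xi> \<bullet> b)\<^sup>2) * ?g0 \<xi>) * \<phi> w \<xi> = ?g2 \<xi> * \<phi> w \<xi> - ?g0 \<xi> * (- of_real ((\<xi> \<bullet> b)\<^sup>2) * \<phi> w \<xi>)" for \<xi> w
    by (simp add: algebra_simps)
  have "AE \<xi> in lborel. ?g2 \<xi> + of_real ((\<xi> \<bullet> b)\<^sup>2) * ?g0 \<xi> = 0"
  proof (rule AE_zero_if_modulated_tests_zero)
    show "integrable lborel (\<lambda>\<xi>. (?g2 \<xi> + of_real ((\<xi> \<bullet> b)\<^sup>2) * ?g0 \<xi>) * cgauss 1 0 0 \<xi>)"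
      unfolding e[of _ 0, unfolded \<phi>_def] using i0[of 0] i2[of 0] unfolding \<phi>_def by (rule Bochner_Integration.integrable_diff[rotated])
    show "(LINT \<xi>|lborel. (?g2 \<xi> + of_real ((\<xi> \<bullet> b)\<^sup>2) * ?g0 \<xi>) * cgauss 1 0 w \<xi>) = 0" for w
      unfolding e[of _ w, unfolded \<phi>_def] using Bochner_Integration.integral_diff[OF i2[of w] i0[of w]] test[of w] unfolding \<phi>_def by simp
  qed
  then have ae2: "AE \<xi> in lborel. (\<xi> \<bullet> b)\<^sup>2 * norm (?g0 \<xi>) = norm (?g2 \<xi>)"
  proof eventually_elim
    case (elim \<xi>)
    then have "?g2 \<xi> = - (of_real ((\<xi> \<bullet> b)\<^sup>2) * ?g0 \<xi>)" by (simp add: eq_neg_iff_add_eq_0)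
    then show ?case by (simp add: norm_mult norm_power)
  qed
  show "integrable lborel (\<lambda>\<xi>. (\<xi> \<bullet> b)\<^sup>2 * norm (?g0 \<xi>))"
    by (rule integrable_cong_AE_imp[OF integrable_norm[OF conjunct1[OF g2]]]) (use ae2 in \<open>auto simp: eq_commute\<close>)
  show "(LINT \<xi>|lborel. (\<xi> \<bullet> b)\<^sup>2 * norm (?g0 \<xi>)) = wiener_norm (dist_pderiv [b, b] (dist_of a))"
    unfolding wiener_norm_def by (rule integral_cong_AE) (use ae2 in auto)
qed


text \<open>The weight \<open>(1 + norm \<xi>)^2\<close> is at most
  \<open>2 * (1 + (\<Sum>b\<in>Basis. (\<xi> \<bullet> b)^2))\<close>, so pure second derivatives
  control it. The bound is explicit because the norms of the lifts have to be summed over the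
  modes.\<close>

lemma amplitude_lift:
  fixes a :: "'a::euclidean_space \<Rightarrow> complex"
  assumes a: "L2_fun a" and w0: "wiener (dist_of a)"
    and w2: "\<And>b. b \<in> Basis \<Longrightarrow> wiener (dist_pderiv [b, b] (dist_of a))"
  shows "\<exists>F :: ('a, 3) W. (AE x in lborel. a x = wfun F x) \<and>
    norm F \<le> 2 / fnorm TYPE('a) * (wiener_norm (dist_of a) + (\<Sum>b\<in>Basis. wiener_norm (dist_pderiv [b, b] (dist_of a))))"
proof -
  let ?c = "complex_of_real (1 / fnorm TYPE('a))"
  let ?g = "hat (dist_of a)"
  let ?G = "\<lambda>\<xi>. ?c * ?g \<xi>"
  note p = pairs_with_schwartz_L2[OF a]
  note nb = norm_dist_pderiv_bb[OF p w0 w2]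
  obtain g where g: "integrable lborel g" "represents g (dist_fourier (dist_of a))" using w0 by (auto simp: wiener_def)
  have r: "represents ?g (dist_fourier (dist_of a))" using represents_hat[OF g(2)] .
  have gm [measurable]: "?g \<in> borel_measurable borel" using r by (auto simp: represents_def pairs_with_schwartz_def)
  have ig: "integrable lborel ?g"
  proof (rule integrable_cong_AE_imp[OF g(1)])
    show "AE x in lborel. g x = ?g x" using hat_AE_eq[OF g(2)] by eventually_elim simp
  qed simp
  let ?h = "\<lambda>\<xi>. 1 / fnorm TYPE('a) * (2 * (norm (?g \<xi>) + (\<Sum>b\<in>Basis. (\<xi> \<bullet> b)\<^sup>2 * norm (?g \<xi>))))"
  have ih: "integrable lborel ?h"
    by (intro integrable_mult_right Bochner_Integration.integrable_add integrable_norm ig Bochner_Integration.integrable_sum nb)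
  have le: "wt TYPE(3) \<xi> * norm (?G \<xi>) \<le> ?h \<xi>" for \<xi>
  proof -
    have "0 \<le> (norm \<xi> - 1)\<^sup>2" by simp
    also have "(norm \<xi> - 1)\<^sup>2 = (norm \<xi>)\<^sup>2 - 2 * norm \<xi> + 1" by (simp add: power2_diff)
    finally have "(1 + norm \<xi>)\<^sup>2 \<le> 2 * (1 + (norm \<xi>)\<^sup>2)" by (simp add: power2_sum)
    then have "wt TYPE(3) \<xi> \<le> 2 * (1 + (\<Sum>b\<in>Basis. (\<xi> \<bullet> b)\<^sup>2))" by (simp add: wt_def norm_sq_eq_sum_Basis)
    then have "wt TYPE(3) \<xi> * norm (?G \<xi>) \<le> 2 * (1 + (\<Sum>b\<in>Basis. (\<xi> \<bullet> b)\<^sup>2)) * norm (?G \<xi>)" by (rule mult_right_mono) simp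
    also have "\<dots> = 2 * (1 + (\<Sum>b\<in>Basis. (\<xi> \<bullet> b)\<^sup>2)) * (1 / fnorm TYPE('a) * norm (?g \<xi>))"
      using fnorm_pos[where 'a='a] by (simp add: norm_mult norm_divide abs_of_pos)
    also have "2 * (1 + (\<Sum>b\<in>Basis. (\<xi> \<bullet> b)\<^sup>2)) * (1 / fnorm TYPE('a) * norm (?g \<xi>)) = ?h \<xi>"
      by (simp add: sum_distrib_right[symmetric] distrib_right)
    finally show ?thesis .
  qed
  have wG: "wint TYPE(3) ?G" by (rule wint_bound[OF ih _ le]) measurable
  have "AE x in lborel. a x = wfun (of_spec ?G :: ('a, 3) W) x"
    unfolding wfun_of_spec[OF wG] by (rule AE_eq_synth_if_represents[OF p ig r])
  moreover have "norm (of_spec ?G :: ('a, 3) W) \<le> 2 / fnorm TYPE('a) * (wiener_norm (dist_of a) + (\<Sum>b\<in>Basis. wiener_norm (dist_pderiv [b, b] (dist_of a))))"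
  proof -
    have "norm (of_spec ?G :: ('a, 3) W) = (LINT \<xi>|lborel. wt TYPE(3) \<xi> * norm (?G \<xi>))" by (rule norm_of_spec[OF wG])
    also have "\<dots> \<le> (LINT \<xi>|lborel. ?h \<xi>)" by (intro integral_mono wintD(2)[OF wG] ih le)
    also have "\<dots> = 1 / fnorm TYPE('a) * (2 * ((LINT \<xi>|lborel. norm (?g \<xi>)) + (\<Sum>b\<in>Basis. LINT \<xi>|lborel. (\<xi> \<bullet> b)\<^sup>2 * norm (?g \<xi>))))"
      unfolding integral_mult_right_zero
      by (subst Bochner_Integration.integral_add) (simp_all add: ig nb Bochner_Integration.integral_sum Bochner_Integration.integrable_sum)
    also have "\<dots> = 2 / fnorm TYPE('a) * (wiener_norm (dist_of a) + (\<Sum>b\<in>Basis. wiener_norm (dist_pderiv [b, b] (dist_of a))))"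
      by (simp add: nb wiener_norm_def[of "dist_of a"])
    finally show ?thesis .
  qed
  ultimately show ?thesis by blast
qed

section \<open>The kernel as a bounded Hermitian symbol with decay\<close>

lemma schwartz_real_gaussian: "s > 0 \<Longrightarrow> (\<lambda>x. complex_of_real (c * exp (- s * (norm (x - y))\<^sup>2))) \<in> schwartz"
  for y :: "'a::euclidean_space"
  unfolding of_real_mult translated_gaussian_eq_cgauss by (intro schwartz_cmult cgauss_schwartz)

text \<open>Modulated Gaussians have real Fourier transforms, on which \<open>K\<close> takes real values.\<close>
lemma hat_symmetric_if_real:
  fixes K :: "'a::euclidean_space functional"
  assumes K: "real_distribution K" and g: "represents g (dist_fourier K)"
  shows "AE \<xi> in lborel. g (- \<xi>) = cnj (g \<xi>)"
proof -
  define \<phi> where "\<phi> w = cgauss 1 0 w" for w :: 'a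
  have s0: "\<phi> w \<in> schwartz" for w unfolding \<phi>_def by (rule cgauss_schwartz) simp
  note ig = pairs_with_schwartzD(2)[OF conjunct1[OF g[unfolded represents_def]] s0]
  have gm: "g \<in> borel_measurable borel" using g by (auto simp: represents_def pairs_with_schwartz_def)
  have sym: "cnj (\<phi> w (- \<xi>)) = \<phi> w \<xi>" for w \<xi> by (simp add: \<phi>_def cgauss_modulated cis_cnj)
  have real: "(LINT \<xi>|lborel. g \<xi> * \<phi> w \<xi>) \<in> \<real>" for w
  proof -
    define c where "c = 1 / fnorm TYPE('a) * sqrt (pi / 1) ^ DIM('a)"
    have "norm (- x + w) = norm (x - w)" for x :: 'a by (metis add.commute diff_conv_add_uminus norm_minus_commute)
    then have f: "fourier (\<phi> w) = (\<lambda>x. complex_of_real (c * exp (- (1/4) * (norm (x - w))\<^sup>2)))"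
      unfolding fourier_eq_synth[abs_def] \<phi>_def synth_modulated_gaussian[OF zero_less_one] c_def by (simp add: fun_eq_iff)
    have "fourier (\<phi> w) \<in> schwartz" unfolding f by (rule schwartz_real_gaussian) simp
    moreover have "range (fourier (\<phi> w)) \<subseteq> \<real>" unfolding f by auto
    ultimately have "K (fourier (\<phi> w)) \<in> \<real>" using K by (simp add: real_distribution_def)
    then show ?thesis using g s0[of w] by (simp add: represents_def dist_fourier_def dist_of_def)
  qed
  \<comment> \<open>Since \<open>\<phi> w\<close> is Hermitian, reflecting and conjugating
    \<open>g\<close> conjugates the pairing, and a real number is its own conjugate.\<close>
  have refl: "(LINT \<xi>|lborel. cnj (g (- \<xi>)) * \<phi> w \<xi>) = (LINT \<xi>|lborel. g \<xi> * \<phi> w \<xi>)" for w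
  proof -
    have "(LINT \<xi>|lborel. cnj (g (- \<xi>)) * \<phi> w \<xi>) = (LINT \<xi>|lborel. cnj (g (- \<xi>) * \<phi> w (- \<xi>)))"
      unfolding complex_cnj_mult sym ..
    also have "\<dots> = cnj (LINT \<xi>|lborel. g (- \<xi>) * \<phi> w (- \<xi>))" by (rule Bochner_Integration.integral_cnj)
    also have "(LINT \<xi>|lborel. g (- \<xi>) * \<phi> w (- \<xi>)) = (LINT \<xi>|lborel. g \<xi> * \<phi> w \<xi>)"
      using integral_lborel_reflect[of "\<lambda>\<xi>. g \<xi> * \<phi> w \<xi>" 0] by simp
    finally show ?thesis using real[of w] by (simp add: Reals_cnj_iff)
  qed
  have irefl: "integrable lborel (\<lambda>\<xi>. cnj (g (- \<xi>)) * \<phi> w \<xi>)" for w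
  proof -
    have "integrable lborel (\<lambda>\<xi>. g (- \<xi>) * \<phi> w (- \<xi>))"
      using integrable_lborel_reflect_iff[of "\<lambda>\<xi>. g \<xi> * \<phi> w \<xi>" 0] ig by simp
    then have "integrable lborel (\<lambda>\<xi>. cnj (g (- \<xi>) * \<phi> w (- \<xi>)))" by (rule integrable_bounded_linear[OF bounded_linear_cnj])
    then show ?thesis unfolding complex_cnj_mult sym .
  qed
  have "AE \<xi> in lborel. cnj (g (- \<xi>)) - g \<xi> = 0"
  proof (rule AE_zero_if_modulated_tests_zero)
    show "integrable lborel (\<lambda>\<xi>. (cnj (g (- \<xi>)) - g \<xi>) * cgauss 1 0 0 \<xi>)"
      unfolding left_diff_distrib using irefl[of 0] ig[of 0] unfolding \<phi>_def by (rule Bochner_Integration.integrable_diff)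
    show "(LINT \<xi>|lborel. (cnj (g (- \<xi>)) - g \<xi>) * cgauss 1 0 w \<xi>) = 0" for w
      unfolding left_diff_distrib using Bochner_Integration.integral_diff[OF irefl[of w] ig[of w]] refl[of w] unfolding \<phi>_def by simp
  qed
  then show ?thesis by eventually_elim (metis complex_cnj_cnj eq_iff_diff_eq_0)
qed

lemma kernel_symbol:
  fixes K :: "'a::euclidean_space functional"
  assumes K: "real_distribution K" and g: "represents g (dist_fourier K)"
    and L: "Linfty_fun (\<lambda>\<xi>. complex_of_real (1 + norm \<xi>) * g \<xi>)"
  shows "\<exists>m B. symbol m B \<and> (\<forall>\<xi>. (1 + norm \<xi>) * norm (m \<xi>) \<le> B) \<and>
    (AE \<xi> in lborel. of_real (fnorm TYPE('a)) * hat K \<xi> = m \<xi>) \<and> (AE \<xi> in lborel. m (- \<xi>) = cnj (m \<xi>))"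
proof -
  let ?f = "complex_of_real (fnorm TYPE('a))"
  have [measurable]: "g \<in> borel_measurable borel" using g by (auto simp: represents_def pairs_with_schwartz_def)
  obtain M0 where M0: "AE \<xi> in lborel. norm (complex_of_real (1 + norm \<xi>) * g \<xi>) \<le> M0" using L by (auto simp: Linfty_fun_def)
  define M where "M = max M0 0"
  have M: "AE \<xi> in lborel. (1 + norm \<xi>) * norm (g \<xi>) \<le> M"
    using M0
  proof eventually_elim
    case (elim \<xi>)
    have "norm (complex_of_real (1 + norm \<xi>) * g \<xi>) = (1 + norm \<xi>) * norm (g \<xi>)"
      unfolding norm_mult norm_of_real by simp
    with elim show ?case by (simp add: M_def)
  qed
  \<comment> \<open>Where the essential bound fails the symbol is set to 0, so that the decay holds
    everywhere; there the estimate uses that \<open>M\<close> is nonnegative. The Hermitian symmetry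
    survives only almost everywhere.\<close>
  define m where "m \<xi> = (if (1 + norm \<xi>) * norm (g \<xi>) \<le> M then ?f * g \<xi> else 0)" for \<xi>
  have [measurable]: "m \<in> borel_measurable borel" unfolding m_def by measurable
  have b: "(1 + norm \<xi>) * norm (m \<xi>) \<le> fnorm TYPE('a) * M" for \<xi>
  proof (cases "(1 + norm \<xi>) * norm (g \<xi>) \<le> M")
    case True
    from mult_left_mono[OF this, of "fnorm TYPE('a)"] True show ?thesis
      by (simp add: m_def norm_mult abs_of_pos[OF fnorm_pos] mult.left_commute)
  next
    case False
    then show ?thesis by (simp add: m_def M_def less_imp_le[OF fnorm_pos])
  qed
  have "norm (m \<xi>) \<le> fnorm TYPE('a) * M" for \<xi>
    using b[of \<xi>] mult_right_mono[of 1 "1 + norm \<xi>" "norm (m \<xi>)"] by simp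
  then have s: "symbol m (fnorm TYPE('a) * M)" by (simp add: symbol_def)
  have mg: "AE \<xi> in lborel. m \<xi> = ?f * g \<xi>" using M by eventually_elim (simp add: m_def)
  have mg': "AE \<xi> in lborel. m (- \<xi>) = ?f * g (- \<xi>)" using AE_lborel_uminus[OF mg] .
  have "AE \<xi> in lborel. ?f * hat K \<xi> = m \<xi>" using hat_AE_eq[OF g] mg by eventually_elim simp
  moreover have "AE \<xi> in lborel. m (- \<xi>) = cnj (m \<xi>)"
    using mg mg' hat_symmetric_if_real[OF K g] by eventually_elim simp
  ultimately show ?thesis using s b by blast
qed


section \<open>Differential equations in Banach spaces\<close>

lemma integral_exp_term:
  fixes L \<eta> t :: real
  assumes "0 \<le> t"
  shows "((\<lambda>s. L * (\<eta> * ((L * s) ^ n / fact n))) has_integral \<eta> * ((L * t) ^ Suc n / fact (Suc n))) {0..t}"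
proof -
  have "((\<lambda>s. \<eta> * ((L * s) ^ Suc n / fact (Suc n))) has_vector_derivative L * (\<eta> * ((L * s) ^ n / fact n))) (at s within {0..t})" for s
  proof -
    have "((\<lambda>s. \<eta> * ((L * s) ^ Suc n / fact (Suc n))) has_real_derivative \<eta> * (real (Suc n) * (L * s) ^ n * L / fact (Suc n))) (at s within {0..t})"
      by (auto intro!: derivative_eq_intros simp del: power_Suc of_nat_Suc fact_Suc)
    moreover have "\<eta> * (real (Suc n) * (L * s) ^ n * L / fact (Suc n)) = L * (\<eta> * ((L * s) ^ n / fact n))"
      by (simp add: fact_Suc field_simps del: of_nat_Suc)
    ultimately show ?thesis by (simp only: has_real_derivative_iff_has_vector_derivative)
  qed
  from fundamental_theorem_of_calculus[OF assms this] show ?thesis by simp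
qed

lemma sum_exp_terms_le:
  fixes y :: real assumes "0 \<le> y" shows "(\<Sum>i<n. y ^ i / fact i) \<le> exp y"
proof -
  have "(\<Sum>i<n. y ^ i /\<^sub>R fact i) \<le> (\<Sum>i. y ^ i /\<^sub>R fact i)"
    by (rule sum_le_suminf[OF summable_exp_generic]) (use assms in auto)
  then show ?thesis by (simp add: exp_def divide_inverse mult.commute)
qed

lemma summable_exp_terms: "summable (\<lambda>i. (y::real) ^ i / fact i)"
  using summable_exp_generic[of y] by (simp add: divide_inverse mult.commute)

text \<open>
  Picard iteration started at \<open>p\<close>: the \<open>n\<close>-th increment is at most \<open>\<eta> (L t)\<^sup>n / n!\<close>, so the iterates never
  leave the tube on which \<open>F\<close> is Lipschitz.
\<close>
lemma ode_exists_near_approximation: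
  fixes F :: "real \<Rightarrow> 'x::banach \<Rightarrow> 'x" and p :: "real \<Rightarrow> 'x"
  assumes L: "L \<ge> 0" and \<eta>: "\<eta> \<ge> 0" and T: "T \<ge> 0"
    and cont: "\<And>u. continuous_on {0..T} u \<Longrightarrow> continuous_on {0..T} (\<lambda>t. F t (u t))"
    and p: "continuous_on {0..T} p"
    and lip: "\<And>t u v. t \<in> {0..T} \<Longrightarrow> norm (u - p t) \<le> \<eta> * exp (L * T) \<Longrightarrow> norm (v - p t) \<le> \<eta> * exp (L * T)
      \<Longrightarrow> norm (F t u - F t v) \<le> L * norm (u - v)"
    and defect: "\<And>t. t \<in> {0..T} \<Longrightarrow> norm (p t - (u0 + integral {0..t} (\<lambda>s. F s (p s)))) \<le> \<eta>"
  shows "\<exists>u. continuous_on {0..T} u \<and>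
    (\<forall>t\<in>{0..T}. u t = u0 + integral {0..t} (\<lambda>s. F s (u s)) \<and> norm (u t - p t) \<le> \<eta> * exp (L * T))"
proof -
  define \<Phi> where "\<Phi> u t = u0 + integral {0..t} (\<lambda>s. F s (u s))" for u t
  define U where "U n = (\<Phi> ^^ n) p" for n
  have U0: "U 0 = p" and US: "U (Suc n) = \<Phi> (U n)" for n by (simp_all add: U_def)
  have int: "(\<lambda>s. F s (u s)) integrable_on {0..t}" if "continuous_on {0..T} u" "t \<in> {0..T}" for u t
    by (rule integrable_continuous_interval) (rule continuous_on_subset[OF cont[OF that(1)]], use that in auto)
  have \<Phi>c: "continuous_on {0..T} (\<Phi> u)" if "continuous_on {0..T} u" for u
    unfolding \<Phi>_def using int[OF that, of T] T
    by (intro continuous_intros indefinite_integral_continuous_1) auto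
  have Uc: "continuous_on {0..T} (U n)" for n
    by (induction n) (auto simp: U0 US p \<Phi>c)
  have tube: "\<eta> * (\<Sum>i<n. (L * t) ^ i / fact i) \<le> \<eta> * exp (L * T)" if "t \<in> {0..T}" for n t
  proof -
    have "(\<Sum>i<n. (L * t) ^ i / fact i) \<le> exp (L * t)" by (rule sum_exp_terms_le) (use L that in auto)
    also have "\<dots> \<le> exp (L * T)" using L that by (auto intro!: mult_left_mono)
    finally show ?thesis using \<eta> by (rule mult_left_mono)
  qed
  \<comment> \<open>One induction for both bounds: the increment is estimated by the Lipschitz
    constant, which is available only in the tube, and the sum of the earlier increments is what
    keeps the iterates there.\<close>
  have main: "(\<forall>t\<in>{0..T}. norm (U (Suc n) t - U n t) \<le> \<eta> * ((L * t) ^ n / fact n)) \<and>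
     (\<forall>t\<in>{0..T}. norm (U n t - p t) \<le> \<eta> * (\<Sum>i<n. (L * t) ^ i / fact i))" for n
  proof (induction n)
    case 0
    show ?case using defect by (auto simp: U0 US \<Phi>_def norm_minus_commute)
  next
    case (Suc n)
    have b: "norm (U (Suc n) t - p t) \<le> \<eta> * (\<Sum>i<Suc n. (L * t) ^ i / fact i)" if t: "t \<in> {0..T}" for t
    proof -
      have "norm (U (Suc n) t - p t) \<le> norm (U (Suc n) t - U n t) + norm (U n t - p t)"
        using norm_triangle_ineq[of "U (Suc n) t - U n t" "U n t - p t"] by simp
      also have "\<dots> \<le> \<eta> * ((L * t) ^ n / fact n) + \<eta> * (\<Sum>i<n. (L * t) ^ i / fact i)"
        using Suc t by (intro add_mono) blast+
      finally show ?thesis by (simp add: distrib_left)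
    qed
    have "norm (U (Suc (Suc n)) t - U (Suc n) t) \<le> \<eta> * ((L * t) ^ Suc n / fact (Suc n))" if t: "t \<in> {0..T}" for t
    proof -
      have i: "(\<lambda>s. F s (U (Suc n) s)) integrable_on {0..t}" "(\<lambda>s. F s (U n s)) integrable_on {0..t}"
        using int[OF Uc t] by auto
      have "U (Suc (Suc n)) t - U (Suc n) t = integral {0..t} (\<lambda>s. F s (U (Suc n) s)) - integral {0..t} (\<lambda>s. F s (U n s))"
        unfolding US[of "Suc n"] US[of n] \<Phi>_def by simp
      also have "\<dots> = integral {0..t} (\<lambda>s. F s (U (Suc n) s) - F s (U n s))"
        by (rule Henstock_Kurzweil_Integration.integral_diff[symmetric, OF i])
      also have "norm \<dots> \<le> integral {0..t} (\<lambda>s. L * (\<eta> * ((L * s) ^ n / fact n)))"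
      proof (rule integral_norm_bound_integral)
        show "(\<lambda>s. F s (U (Suc n) s) - F s (U n s)) integrable_on {0..t}" by (intro integrable_diff i)
        show "(\<lambda>s. L * (\<eta> * ((L * s) ^ n / fact n))) integrable_on {0..t}"
          using integral_exp_term[of t L \<eta> n] t by auto
        fix s assume "s \<in> {0..t}"
        then have s: "s \<in> {0..T}" using t by auto
        have "norm (F s (U (Suc n) s) - F s (U n s)) \<le> L * norm (U (Suc n) s - U n s)"
          using Suc s by (intro lip order_trans[OF b tube] order_trans[OF _ tube]) auto
        also have "\<dots> \<le> L * (\<eta> * ((L * s) ^ n / fact n))" using Suc s L by (intro mult_left_mono) blast+
        finally show "norm (F s (U (Suc n) s) - F s (U n s)) \<le> L * (\<eta> * ((L * s) ^ n / fact n))" .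
      qed
      also have "\<dots> = \<eta> * ((L * t) ^ Suc n / fact (Suc n))"
        using integral_exp_term[of t L \<eta> n] t by (intro integral_unique) auto
      finally show ?thesis .
    qed
    with b show ?case by blast
  qed
  define u where "u t = p t + (\<Sum>n. U (Suc n) t - U n t)" for t
  have "uniform_limit {0..T} (\<lambda>n t. \<Sum>i<n. U (Suc i) t - U i t) (\<lambda>t. \<Sum>n. U (Suc n) t - U n t) sequentially"
  proof (rule Weierstrass_m_test)
    show "norm (U (Suc n) t - U n t) \<le> \<eta> * ((L * T) ^ n / fact n)" if t: "t \<in> {0..T}" for n t
    proof -
      have "norm (U (Suc n) t - U n t) \<le> \<eta> * ((L * t) ^ n / fact n)" using main t by blast
      also have "\<dots> \<le> \<eta> * ((L * T) ^ n / fact n)"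
        using t L \<eta> by (intro mult_left_mono divide_right_mono power_mono) auto
      finally show ?thesis .
    qed
    show "summable (\<lambda>n. \<eta> * ((L * T) ^ n / fact n))" by (intro summable_mult summable_exp_terms)
  qed
  then have "uniform_limit {0..T} (\<lambda>n t. p t + (\<Sum>i<n. U (Suc i) t - U i t)) u sequentially"
    unfolding u_def by (intro uniform_limit_add uniform_limit_const) 
  moreover have "p t + (\<Sum>i<n. U (Suc i) t - U i t) = U n t" for n t
    using sum_lessThan_telescope[of "\<lambda>i. U i t" n] by (simp add: U0)
  ultimately have ul: "uniform_limit {0..T} U u sequentially" by simp
  have uc: "continuous_on {0..T} u"
    by (rule uniform_limit_theorem[OF _ ul]) (auto simp: Uc)
  have lim: "(\<lambda>n. U n t) \<longlonglongrightarrow> u t" if "t \<in> {0..T}" for t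
    by (rule tendsto_uniform_limitI[OF ul that])
  have Ub: "norm (U n t - p t) \<le> \<eta> * exp (L * T)" if "t \<in> {0..T}" for n t
    using main[of n] tube[OF that, of n] that by (meson order_trans)
  have ub: "norm (u t - p t) \<le> \<eta> * exp (L * T)" if t: "t \<in> {0..T}" for t
  proof (rule LIMSEQ_le_const2)
    show "(\<lambda>n. norm (U n t - p t)) \<longlonglongrightarrow> norm (u t - p t)" by (intro tendsto_intros lim t)
    show "\<exists>N. \<forall>n\<ge>N. norm (U n t - p t) \<le> \<eta> * exp (L * T)" using Ub[OF t] by blast
  qed
  have eq: "u t = u0 + integral {0..t} (\<lambda>s. F s (u s))" if t: "t \<in> {0..T}" for t
  proof -
    have "uniform_limit {0..t} (\<lambda>n s. F s (U n s)) (\<lambda>s. F s (u s)) sequentially"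
    proof (rule uniform_limitI)
      fix e :: real assume e: "e > 0"
      \<comment> \<open>Dividing by \<open>L + 1\<close> covers the case
        \<open>L = 0\<close>.\<close>
      have "eventually (\<lambda>n. \<forall>s\<in>{0..T}. dist (U n s) (u s) < e / (L + 1)) sequentially"
        using uniform_limitD[OF ul, of "e / (L + 1)"] e L by simp
      then show "eventually (\<lambda>n. \<forall>s\<in>{0..t}. dist (F s (U n s)) (F s (u s)) < e) sequentially"
      proof eventually_elim
        case (elim n)
        show ?case
        proof
          fix s assume "s \<in> {0..t}"
          then have s: "s \<in> {0..T}" using t by auto
          have "dist (F s (U n s)) (F s (u s)) \<le> L * norm (U n s - u s)"
            unfolding dist_norm by (rule lip[OF s Ub[OF s] ub[OF s]])
          also have "\<dots> \<le> L * (e / (L + 1))" using elim s L by (intro mult_left_mono) (auto simp: dist_norm less_imp_le)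
          also have "\<dots> < e" using L e by (simp add: field_simps)
          finally show "dist (F s (U n s)) (F s (u s)) < e" .
        qed
      qed
    qed
    from uniform_limit_integral[OF this continuous_on_subset[OF cont[OF Uc]] trivial_limit_sequentially]
    obtain I J where IJ: "\<And>n. ((\<lambda>s. F s (U n s)) has_integral I n) {0..t}" "((\<lambda>s. F s (u s)) has_integral J) {0..t}" "(I \<longlongrightarrow> J) sequentially"
      using t by auto
    have "(\<lambda>n. u0 + I n) \<longlonglongrightarrow> u0 + J" by (intro tendsto_intros IJ)
    moreover have "U (Suc n) t = u0 + I n" for n unfolding US \<Phi>_def using integral_unique[OF IJ(1)] by simp
    ultimately have "(\<lambda>n. U (Suc n) t) \<longlonglongrightarrow> u0 + J" by simp
    then have "u t = u0 + J" using LIMSEQ_Suc[OF lim[OF t]] by (rule LIMSEQ_unique[rotated])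
    then show ?thesis using integral_unique[OF IJ(2)] by simp
  qed
  from uc eq ub show ?thesis by blast
qed

text \<open>Two continuous solutions on a compact interval stay in one ball, on which the field is
  Lipschitz. Iterating the integral inequality from the trivial bound \<open>2 * R\<close> gives
  \<open>(2 * R) * (L * t)^n / fact n\<close>, which tends to 0.\<close>

lemma ode_unique:
  fixes F :: "real \<Rightarrow> 'x::banach \<Rightarrow> 'x"
  assumes cont: "\<And>u. continuous_on {0..T} u \<Longrightarrow> continuous_on {0..T} (\<lambda>t. F t (u t))"
    and lip: "\<And>R. \<exists>L\<ge>0. \<forall>t\<in>{0..T}. \<forall>u v. norm u \<le> R \<longrightarrow> norm v \<le> R \<longrightarrow> norm (F t u - F t v) \<le> L * norm (u - v)"
    and u: "continuous_on {0..T} u" "\<And>t. t \<in> {0..T} \<Longrightarrow> u t = u0 + integral {0..t} (\<lambda>s. F s (u s))"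
    and v: "continuous_on {0..T} v" "\<And>t. t \<in> {0..T} \<Longrightarrow> v t = u0 + integral {0..t} (\<lambda>s. F s (v s))"
    and t: "t \<in> {0..T}"
  shows "u t = v t"
proof -
  have "bounded (u ` {0..T} \<union> v ` {0..T})"
    by (intro bounded_Un[THEN iffD2] conjI compact_imp_bounded compact_continuous_image u v) auto
  then obtain R where R: "\<And>s. s \<in> {0..T} \<Longrightarrow> norm (u s) \<le> R" "\<And>s. s \<in> {0..T} \<Longrightarrow> norm (v s) \<le> R"
    unfolding bounded_iff by (metis UnI1 UnI2 imageI)
  obtain L where L: "L \<ge> 0" "\<And>s x y. s \<in> {0..T} \<Longrightarrow> norm x \<le> R \<Longrightarrow> norm y \<le> R \<Longrightarrow> norm (F s x - F s y) \<le> L * norm (x - y)"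
    using lip[of R] by blast
  have b: "\<forall>t\<in>{0..T}. norm (u t - v t) \<le> (2 * R) * ((L * t) ^ n / fact n)" for n
  proof (induction n)
    case 0
    have "norm (u t - v t) \<le> R + R" if "t \<in> {0..T}" for t
      using norm_triangle_ineq4[of "u t" "v t"] R[OF that] by linarith
    then show ?case by simp
  next
    case (Suc n)
    show ?case
    proof
      fix t assume t: "t \<in> {0..T}"
      have i: "(\<lambda>s. F s (w s)) integrable_on {0..t}" if "continuous_on {0..T} w" for w
        by (rule integrable_continuous_interval) (rule continuous_on_subset[OF cont[OF that]], use t in auto)
      have "u t - v t = integral {0..t} (\<lambda>s. F s (u s)) - integral {0..t} (\<lambda>s. F s (v s))"
        unfolding u(2)[OF t] v(2)[OF t] by simp
      also have "\<dots> = integral {0..t} (\<lambda>s. F s (u s) - F s (v s))"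
        by (rule Henstock_Kurzweil_Integration.integral_diff[symmetric, OF i[OF u(1)] i[OF v(1)]])
      also have "norm \<dots> \<le> integral {0..t} (\<lambda>s. L * ((2 * R) * ((L * s) ^ n / fact n)))"
      proof (rule integral_norm_bound_integral)
        show "(\<lambda>s. F s (u s) - F s (v s)) integrable_on {0..t}" by (intro integrable_diff i u v)
        show "(\<lambda>s. L * ((2 * R) * ((L * s) ^ n / fact n))) integrable_on {0..t}"
          using integral_exp_term[of t L "2 * R" n] t by auto
        fix s assume "s \<in> {0..t}"
        then have s: "s \<in> {0..T}" using t by auto
        have "norm (F s (u s) - F s (v s)) \<le> L * norm (u s - v s)" by (rule L(2)[OF s R(1)[OF s] R(2)[OF s]])
        also have "\<dots> \<le> L * ((2 * R) * ((L * s) ^ n / fact n))" using Suc s L by (intro mult_left_mono) blast+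
        finally show "norm (F s (u s) - F s (v s)) \<le> L * ((2 * R) * ((L * s) ^ n / fact n))" .
      qed
      also have "\<dots> = (2 * R) * ((L * t) ^ Suc n / fact (Suc n))"
        using integral_exp_term[of t L "2 * R" n] t by (intro integral_unique) auto
      finally show "norm (u t - v t) \<le> (2 * R) * ((L * t) ^ Suc n / fact (Suc n))" .
    qed
  qed
  have "(\<lambda>n. (2 * R) * ((L * t) ^ n / fact n)) \<longlonglongrightarrow> (2 * R) * 0"
    by (intro tendsto_mult_left summable_LIMSEQ_zero summable_exp_terms)
  then have "norm (u t - v t) \<le> 0"
    by (intro LIMSEQ_le_const[of "\<lambda>n. (2 * R) * ((L * t) ^ n / fact n)"]) (use b t in auto)
  then show ?thesis by simp
qed


section \<open>Normally convergent series in Banach spaces\<close>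

lemma norm_suminf_le_suminf:
  fixes f :: "nat \<Rightarrow> 'x::banach"
  assumes "\<And>n. norm (f n) \<le> M n" and "summable M"
  shows "summable f" and "norm (suminf f) \<le> suminf M"
proof -
  have s: "summable (\<lambda>n. norm (f n))"
    by (rule summable_comparison_test'[OF assms(2), of 0]) (use assms(1) in simp)
  then show "summable f" by (rule summable_norm_cancel)
  show "norm (suminf f) \<le> suminf M"
    by (rule order_trans[OF summable_norm[OF s] suminf_le[OF assms(1) s assms(2)]])
qed

lemma
  fixes f :: "nat \<Rightarrow> real \<Rightarrow> 'x::banach"
  assumes c: "\<And>n. continuous_on {0..T} (f n)" and b: "\<And>n t. t \<in> {0..T} \<Longrightarrow> norm (f n t) \<le> M n" and M: "summable M"
  shows continuous_on_series: "continuous_on {0..T} (\<lambda>t. \<Sum>n. f n t)"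
    and integral_series: "t \<in> {0..T} \<Longrightarrow> integral {0..t} (\<lambda>s. \<Sum>n. f n s) = (\<Sum>n. integral {0..t} (f n))"
proof -
  have ul: "uniform_limit {0..T} (\<lambda>n t. \<Sum>i<n. f i t) (\<lambda>t. \<Sum>n. f n t) sequentially"
    by (rule Weierstrass_m_test[OF b M])
  have sc: "continuous_on {0..T} (\<lambda>t. \<Sum>i<n. f i t)" for n by (intro continuous_intros c)
  show "continuous_on {0..T} (\<lambda>t. \<Sum>n. f n t)"
    by (rule uniform_limit_theorem[OF _ ul]) (auto simp: sc)
  assume t: "t \<in> {0..T}"
  then have sub: "{0..t} \<subseteq> {0..T}" by auto
  have fi: "f n integrable_on {0..t}" for n
    by (rule integrable_continuous_interval) (rule continuous_on_subset[OF c sub])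
  obtain I J where IJ: "\<And>n. ((\<lambda>s. \<Sum>i<n. f i s) has_integral I n) {0..t}" "((\<lambda>s. \<Sum>n. f n s) has_integral J) {0..t}" "(I \<longlongrightarrow> J) sequentially"
    using uniform_limit_integral[OF uniform_limit_on_subset[OF ul sub] continuous_on_subset[OF sc sub] trivial_limit_sequentially] by blast
  have "I n = (\<Sum>i<n. integral {0..t} (f i))" for n
    using integral_unique[OF IJ(1)] by (simp add: integral_sum fi)
  then have "I = (\<lambda>n. \<Sum>i<n. integral {0..t} (f i))" by (rule ext)
  with IJ(3) have "(\<lambda>n. integral {0..t} (f n)) sums J" by (simp only: sums_def)
  then show "integral {0..t} (\<lambda>s. \<Sum>n. f n s) = (\<Sum>n. integral {0..t} (f n))"
    using integral_unique[OF IJ(2)] by (simp add: sums_unique)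
qed


section \<open>The Schroedinger group and the Hartree nonlinearity\<close>

lemma symbol_phase: "symbol (\<lambda>\<xi>::'a::euclidean_space. cis (- (s * (norm \<xi>)\<^sup>2))) 1"
  by (rule symbol_unimodular) measurable

definition schr :: "real \<Rightarrow> real \<Rightarrow> ('a::euclidean_space, 'n) W \<Rightarrow> ('a, 'n) W"
  where "schr \<epsilon> t = mulop (\<lambda>\<xi>. cis (- (\<epsilon> * t / 2 * (norm \<xi>)\<^sup>2)))"

lemma bounded_linear_schr: "bounded_linear (schr \<epsilon> t)"
  unfolding schr_def by (rule bounded_linear_mulop[OF symbol_phase])

lemma norm_schr [simp]: "norm (schr \<epsilon> t f) = norm f"
  unfolding schr_def by (rule norm_mulop_unimodular) measurable

lemma schr_schr: "schr \<epsilon> s (schr \<epsilon> t f) = schr \<epsilon> (s + t) f"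
  unfolding schr_def mulop_mulop[OF symbol_phase symbol_phase]
  by (rule mulop_cong) (simp only: cis_mult, rule arg_cong[where f=cis], simp add: field_simps)

lemma schr_0 [simp]: "schr \<epsilon> 0 f = f"
  unfolding schr_def by (simp add: mulop_one)

lemma schr_cscale: "schr \<epsilon> t (cscale c f) = cscale c (schr \<epsilon> t f)"
  unfolding schr_def by (rule cscale_mulop[OF symbol_phase, symmetric])

lemma continuous_on_schr:
  fixes h :: "'b::first_countable_topology \<Rightarrow> real" and u :: "'b \<Rightarrow> ('a::euclidean_space, 'n) W"
  assumes u: "continuous_on S u" and h: "continuous_on S h"
  shows "continuous_on S (\<lambda>t. schr \<epsilon> (h t) (u t))"
  unfolding schr_def
proof (rule continuous_on_mulop)
  show "symbol (\<lambda>\<xi>::'a. cis (- (\<epsilon> * h t / 2 * (norm \<xi>)\<^sup>2))) 1" for t by (rule symbol_phase)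
  show "continuous_on S (\<lambda>t. cis (- (\<epsilon> * h t / 2 * (norm \<xi>)\<^sup>2)))" for \<xi> :: 'a
    by (intro continuous_intros h) auto
qed (rule u)

text \<open>
  Galilean invariance: a wave packet with frequency \<open>k / \<epsilon>\<close> travels with velocity \<open>k\<close>.
\<close>
lemma schr_modul:
  assumes \<epsilon>: "\<epsilon> > 0"
  shows "schr \<epsilon> t (modul (k /\<^sub>R \<epsilon>) f) = cscale (cis (- (t * (norm k)\<^sup>2 / (2 * \<epsilon>)))) (modul (k /\<^sub>R \<epsilon>) (transl (t *\<^sub>R k) (schr \<epsilon> t f)))"
proof -
  let ?\<kappa> = "k /\<^sub>R \<epsilon>"
  let ?c = "cis (- (t * (norm k)\<^sup>2 / (2 * \<epsilon>)))"
  have phase: "cis (- (\<epsilon> * t / 2 * (norm (\<xi> + ?\<kappa>))\<^sup>2)) = ?c * (cis (- ((t *\<^sub>R k) \<bullet> \<xi>)) * cis (- (\<epsilon> * t / 2 * (norm \<xi>)\<^sup>2)))" for \<xi>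
  proof -
    have "\<epsilon> * t / 2 * (norm (\<xi> + ?\<kappa>))\<^sup>2 = t * (norm k)\<^sup>2 / (2 * \<epsilon>) + ((t *\<^sub>R k) \<bullet> \<xi> + \<epsilon> * t / 2 * (norm \<xi>)\<^sup>2)"
      using \<epsilon> unfolding power2_norm_eq_inner by (simp add: inner_simps inner_commute field_simps)
    then have "cis (- (\<epsilon> * t / 2 * (norm (\<xi> + ?\<kappa>))\<^sup>2)) = cis (- (t * (norm k)\<^sup>2 / (2 * \<epsilon>) + ((t *\<^sub>R k) \<bullet> \<xi> + \<epsilon> * t / 2 * (norm \<xi>)\<^sup>2)))"
      by (simp only:)
    then show ?thesis by (simp only: cis_mult minus_add_distrib)
  qed
  have "schr \<epsilon> t (modul ?\<kappa> f) = modul ?\<kappa> (mulop (\<lambda>\<xi>. cis (- (\<epsilon> * t / 2 * (norm (\<xi> + ?\<kappa>))\<^sup>2))) f)"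
    unfolding schr_def by (rule mulop_modul[OF symbol_phase])
  also have "\<dots> = modul ?\<kappa> (cscale ?c (transl (t *\<^sub>R k) (schr \<epsilon> t f)))"
    unfolding schr_def transl_def cscale_def mulop_mulop[OF symbol_transl symbol_phase]
      mulop_mulop[OF symbol_const symbol_mult[OF symbol_transl symbol_phase]] phase ..
  also have "\<dots> = cscale ?c (modul ?\<kappa> (transl (t *\<^sub>R k) (schr \<epsilon> t f)))"
    by (rule W_eqI) (simp add: wfun_modul)
  finally show ?thesis .
qed

lemma norm_cis_minus_one: "norm (cis \<theta> - 1) \<le> \<bar>\<theta>\<bar>"
  using iexp_approx1[of \<theta> 0] by (simp add: cis_conv_exp)

lemma wt_3: "wt TYPE(3) \<xi> = (1 + norm \<xi>)\<^sup>2"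
  by (simp add: wt_def)

text \<open>The phase differs from 1 by at most its argument, and the factor
  \<open>(norm \<xi>)^2\<close> in it is paid by the weight: one power of \<epsilon> for two
  derivatives.\<close>

lemma norm_schr_minus_id:
  fixes f :: "('a::euclidean_space, 3) W"
  assumes \<epsilon>: "\<epsilon> \<ge> 0"
  shows "norm (schr \<epsilon> t (incl f) - incl f) \<le> \<epsilon> * \<bar>t\<bar> / 2 * norm f"
proof -
  let ?m = "\<lambda>\<xi>::'a. cis (- (\<epsilon> * t / 2 * (norm \<xi>)\<^sup>2))"
  have s1: "symbol (\<lambda>\<xi>::'a. 1) 1" by (simp add: symbol_def)
  have "schr \<epsilon> t (incl f) - incl f = mulop ?m (incl f) - mulop (\<lambda>_. 1) (incl f)"
    by (simp add: schr_def mulop_one)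
  also have "\<dots> = mulop (\<lambda>\<xi>. ?m \<xi> - 1) (incl f)" by (rule mulop_diff_symbol[OF symbol_phase s1])
  also have "norm \<dots> \<le> \<epsilon> * \<bar>t\<bar> / 2 * norm f"
  proof (rule norm_mulop_incl_le[OF symbol_diff[OF symbol_phase s1]])
    fix \<xi> :: 'a
    have "norm (?m \<xi> - 1) \<le> \<bar>- (\<epsilon> * t / 2 * (norm \<xi>)\<^sup>2)\<bar>" by (rule norm_cis_minus_one)
    also have "\<dots> = \<epsilon> * \<bar>t\<bar> / 2 * (norm \<xi>)\<^sup>2" using \<epsilon> by (simp add: abs_mult)
    also have "\<dots> \<le> \<epsilon> * \<bar>t\<bar> / 2 * wt TYPE(3) \<xi>"
      unfolding wt_3 using \<epsilon> by (intro mult_left_mono power_mono) auto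
    finally show "norm (?m \<xi> - 1) \<le> \<epsilon> * \<bar>t\<bar> / 2 * wt TYPE(3) \<xi>" .
  qed
  finally show ?thesis .
qed

definition hartree_nl :: "('a::euclidean_space \<Rightarrow> complex) \<Rightarrow> ('a, 'n) W \<Rightarrow> ('a, 'n) W"
  where "hartree_nl m u = mulop m (u * conjW u) * u"

lemma norm_hartree_nl:
  assumes m: "symbol m B"
  shows "norm (hartree_nl m u) \<le> B * norm u ^ 3"
proof -
  have "norm (hartree_nl m u) \<le> norm (mulop m (u * conjW u)) * norm u" unfolding hartree_nl_def by (rule norm_mult_ineq)
  also have "\<dots> \<le> (B * (norm u * norm u)) * norm u"
  proof (rule mult_right_mono)
    show "norm (mulop m (u * conjW u)) \<le> B * (norm u * norm u)"
      using norm_mult_ineq[of u "conjW u"] symbol_nonneg[OF m]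
      by (intro order_trans[OF norm_mulop_le[OF m]] mult_left_mono) auto
  qed simp
  finally show ?thesis by (simp add: power3_eq_cube mult_ac)
qed

text \<open>The expression is trilinear over the reals; changing one factor at a time gives three
  terms, each at most \<open>B * R^2 * norm (u - v)\<close>.\<close>

lemma hartree_nl_lipschitz:
  fixes u v :: "('a::euclidean_space, 'n) W"
  assumes m: "symbol m B" and u: "norm u \<le> R" and v: "norm v \<le> R"
  shows "norm (hartree_nl m u - hartree_nl m v) \<le> 3 * B * R\<^sup>2 * norm (u - v)"
proof -
  interpret mu: bounded_linear "mulop m :: ('a, 'n) W \<Rightarrow> _" by (rule bounded_linear_mulop[OF m])
  interpret cj: bounded_linear "conjW :: ('a, 'n) W \<Rightarrow> _" by (rule bounded_linear_conjW)
  have B: "B \<ge> 0" using symbol_nonneg[OF m] .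
  have R: "R \<ge> 0" using u norm_ge_zero order_trans by blast
  let ?d = "u - v"
  have "hartree_nl m u - hartree_nl m v = mulop m (?d * conjW u) * u + mulop m (v * conjW ?d) * u + mulop m (v * conjW v) * ?d"
    unfolding hartree_nl_def by (simp add: cj.diff mu.diff mu.add algebra_simps)
  also have "norm \<dots> \<le> norm (mulop m (?d * conjW u) * u) + norm (mulop m (v * conjW ?d) * u) + norm (mulop m (v * conjW v) * ?d)"
    by (intro norm_triangle_le order_refl add_mono)
  also have "\<dots> \<le> B * (norm ?d * R) * R + B * (R * norm ?d) * R + B * (R * R) * norm ?d"
  proof -
    have tri: "norm (mulop m (x * conjW y) * z) \<le> B * (a * b) * c"
      if "norm x \<le> a" "norm y \<le> b" "norm z \<le> c" for x y z :: "('a, 'n) W" and a b c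
    proof -
      have a: "a \<ge> 0" "b \<ge> 0" "c \<ge> 0" using that norm_ge_zero order_trans by blast+
      have "norm (mulop m (x * conjW y) * z) \<le> norm (mulop m (x * conjW y)) * norm z" by (rule norm_mult_ineq)
      also have "\<dots> \<le> (B * norm (x * conjW y)) * norm z" by (intro mult_right_mono norm_mulop_le[OF m]) simp
      also have "\<dots> \<le> (B * (a * b)) * c"
      proof (intro mult_mono mult_left_mono B that)
        show "norm (x * conjW y) \<le> a * b"
          using that a by (intro order_trans[OF norm_mult_ineq] mult_mono) auto
      qed (use a B in auto)
      finally show ?thesis .
    qed
    show ?thesis by (intro add_mono tri u v order_refl)
  qed
  also have "\<dots> = 3 * B * R\<^sup>2 * norm ?d" by (simp add: power2_eq_square)
  finally show ?thesis .
qed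

lemma continuous_on_bl: "bounded_linear f \<Longrightarrow> continuous_on S g \<Longrightarrow> continuous_on S (\<lambda>x. f (g x))"
  by (rule bounded_linear.continuous_on)

lemma continuous_on_hartree_nl:
  "symbol m B \<Longrightarrow> continuous_on S u \<Longrightarrow> continuous_on S (\<lambda>t. hartree_nl m (u t))"
  unfolding hartree_nl_def
  by (intro continuous_on_mult continuous_on_bl[OF bounded_linear_mulop] continuous_on_bl[OF bounded_linear_conjW])

text \<open>The vector field of the Hartree equation in the interaction picture \<open>v(t) = U(-t) u(t)\<close>.\<close>
definition vfield :: "('a::euclidean_space \<Rightarrow> complex) \<Rightarrow> real \<Rightarrow> real \<Rightarrow> real \<Rightarrow> ('a, 1) W \<Rightarrow> ('a, 1) W"
  where "vfield m \<epsilon> \<mu> t v = cscale (- \<i> * of_real \<mu>) (schr \<epsilon> (- t) (hartree_nl m (schr \<epsilon> t v)))"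

lemma continuous_on_vfield:
  "symbol m B \<Longrightarrow> continuous_on S u \<Longrightarrow> continuous_on S (\<lambda>t. vfield m \<epsilon> \<mu> t (u t))"
  unfolding vfield_def
  by (intro continuous_on_bl[OF bounded_linear_cscale] continuous_on_schr continuous_on_hartree_nl continuous_intros)

lemma vfield_lipschitz:
  fixes u v :: "('a::euclidean_space, 1) W"
  assumes m: "symbol m B" and \<mu>: "\<bar>\<mu>\<bar> \<le> 1" and u: "norm u \<le> R" and v: "norm v \<le> R"
  shows "norm (vfield m \<epsilon> \<mu> t u - vfield m \<epsilon> \<mu> t v) \<le> 3 * B * R\<^sup>2 * norm (u - v)"
proof -
  interpret c: bounded_linear "cscale (- \<i> * of_real \<mu>) :: ('a, 1) W \<Rightarrow> _" by (rule bounded_linear_cscale)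
  interpret s: bounded_linear "schr \<epsilon> r :: ('a, 1) W \<Rightarrow> _" for r by (rule bounded_linear_schr)
  have "vfield m \<epsilon> \<mu> t u - vfield m \<epsilon> \<mu> t v = cscale (- \<i> * of_real \<mu>) (schr \<epsilon> (- t) (hartree_nl m (schr \<epsilon> t u) - hartree_nl m (schr \<epsilon> t v)))"
    unfolding vfield_def by (simp only: c.diff s.diff)
  also have "norm \<dots> = \<bar>\<mu>\<bar> * norm (hartree_nl m (schr \<epsilon> t u) - hartree_nl m (schr \<epsilon> t v))"
    by (simp add: norm_cscale norm_mult)
  also have "\<dots> \<le> 1 * norm (hartree_nl m (schr \<epsilon> t u) - hartree_nl m (schr \<epsilon> t v))" by (intro mult_right_mono \<mu>) simp
  also have "\<dots> \<le> 1 * (3 * B * R\<^sup>2 * norm (schr \<epsilon> t u - schr \<epsilon> t v))"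
    by (intro mult_left_mono hartree_nl_lipschitz[OF m]) (use u v in auto)
  finally show ?thesis by (simp only: s.diff[symmetric] norm_schr mult_1)
qed

lemma norm_vfield:
  assumes m: "symbol m B"
  shows "norm (vfield m \<epsilon> \<mu> t u) \<le> \<bar>\<mu>\<bar> * (B * norm u ^ 3)"
  unfolding vfield_def using mult_left_mono[OF norm_hartree_nl[OF m, of "schr \<epsilon> t u"], of "\<bar>\<mu>\<bar>"]
  by (simp add: norm_cscale norm_mult)

text \<open>The symbol is evaluated near the frequency \<kappa>, where it is small. Since
  \<open>1 + norm \<kappa>\<close> is at most
  \<open>(1 + norm (\<xi> + \<kappa>)) * (1 + norm \<xi>)\<close>, the first factor is absorbed by
  the decay of \<open>m\<close> and the second by the weight of the amplitude.\<close>

lemma norm_mulop_modul_le: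
  fixes f :: "('a::euclidean_space, 3) W"
  assumes m: "symbol m B" and d: "\<And>\<xi>. (1 + norm \<xi>) * norm (m \<xi>) \<le> B"
  shows "norm (mulop m (modul \<kappa> (incl f))) \<le> B / (1 + norm \<kappa>) * norm f"
proof -
  have m': "symbol (\<lambda>\<xi>. m (\<xi> + \<kappa>)) B" using m by (auto simp: symbol_def)
  have "norm (mulop m (modul \<kappa> (incl f))) = norm (mulop (\<lambda>\<xi>. m (\<xi> + \<kappa>)) (incl f))"
    unfolding mulop_modul[OF m] by simp
  also have "\<dots> \<le> B / (1 + norm \<kappa>) * norm f"
  proof (rule norm_mulop_incl_le[OF m'])
    fix \<xi>
    have B: "B \<ge> 0" using symbol_nonneg[OF m] .
    have "1 + norm \<kappa> \<le> (1 + norm (\<xi> + \<kappa>)) * (1 + norm \<xi>)"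
    proof -
      have "norm \<kappa> \<le> norm (\<xi> + \<kappa>) + norm \<xi>" using norm_triangle_ineq4[of "\<xi> + \<kappa>" \<xi>] by simp
      also have "1 + \<dots> \<le> (1 + norm (\<xi> + \<kappa>)) * (1 + norm \<xi>)" by (simp add: algebra_simps)
      finally show ?thesis by simp
    qed
    then have "(1 + norm \<kappa>) * norm (m (\<xi> + \<kappa>)) \<le> ((1 + norm (\<xi> + \<kappa>)) * (1 + norm \<xi>)) * norm (m (\<xi> + \<kappa>))"
      by (rule mult_right_mono) simp
    also have "\<dots> = ((1 + norm (\<xi> + \<kappa>)) * norm (m (\<xi> + \<kappa>))) * (1 + norm \<xi>)" by (simp only: mult_ac)
    also have "\<dots> \<le> B * (1 + norm \<xi>)" by (intro mult_right_mono d) simp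
    also have "\<dots> \<le> B * wt TYPE(3) \<xi>"
      unfolding wt_3 using B by (intro mult_left_mono) (auto simp: power2_eq_square algebra_simps)
    finally show "norm (m (\<xi> + \<kappa>)) \<le> B / (1 + norm \<kappa>) * wt TYPE(3) \<xi>"
      by (simp add: field_simps add_pos_nonneg)
  qed
  finally show ?thesis .
qed


section \<open>The WKB approximation\<close>

text \<open>The integrating factor \<open>exp (- c * integral {0..t} v)\<close> makes the product
  constant. It is applied to the amplitude equation at a fixed point \<open>x\<close>.\<close>

lemma scalar_linear_ode:
  fixes b v :: "real \<Rightarrow> complex"
  assumes b: "continuous_on {0..T} b" and v: "continuous_on {0..T} v"
    and eq: "\<And>t. t \<in> {0..T} \<Longrightarrow> b t = b0 + integral {0..t} (\<lambda>s. c * (v s * b s))"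
    and t: "t \<in> {0..T}"
  shows "b t = b0 * exp (c * integral {0..t} v)"
proof -
  let ?I = "\<lambda>t. integral {0..t} v"
  have T: "0 \<in> {0..T}" using t by auto
  have db: "(b has_vector_derivative c * (v s * b s)) (at s within {0..T})" if s: "s \<in> {0..T}" for s
  proof (rule has_vector_derivative_transform[OF s])
    have "((\<lambda>t. integral {0..t} (\<lambda>s. c * (v s * b s))) has_vector_derivative c * (v s * b s)) (at s within {0..T})"
      by (rule integral_has_vector_derivative[OF _ s]) (intro continuous_intros b v)
    then show "((\<lambda>t. b0 + integral {0..t} (\<lambda>s. c * (v s * b s))) has_vector_derivative c * (v s * b s)) (at s within {0..T})"
      using has_vector_derivative_add[OF has_vector_derivative_const[of b0]] by fastforce
  qed (use eq in auto)
  have dI: "(?I has_vector_derivative v s) (at s within {0..T})" if "s \<in> {0..T}" for s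
    by (rule integral_has_vector_derivative[OF v that])
  have dexp: "((\<lambda>t. exp (- c * ?I t)) has_vector_derivative v s * (exp (- c * ?I s) * (- c))) (at s within {0..T})" if "s \<in> {0..T}" for s
  proof -
    have "((\<lambda>z. exp (- c * z)) has_field_derivative exp (- c * ?I s) * (- c)) (at (?I s) within ?I ` {0..T})"
      by (auto intro!: derivative_eq_intros)
    from field_vector_diff_chain_within[OF dI[OF that] this] show ?thesis by (simp add: o_def)
  qed
  have z: "((\<lambda>t. b t * exp (- c * ?I t)) has_vector_derivative 0) (at s within {0..T})" if s: "s \<in> {0..T}" for s
    using has_vector_derivative_mult[OF db[OF s] dexp[OF s]] by (simp add: algebra_simps)
  obtain w where w: "\<And>s. s \<in> {0..T} \<Longrightarrow> b s * exp (- c * ?I s) = w"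
    by (rule has_vector_derivative_zero_constant[OF convex_real_interval(5) z]) auto
  have "b t * exp (- c * ?I t) = b 0 * exp (- c * ?I 0)" using w[OF t] w[OF T] by simp
  then have "b t * exp (- c * ?I t) = b0" using eq[OF T] by simp
  then have "b t * (exp (- c * ?I t) * exp (c * ?I t)) = b0 * exp (c * ?I t)" by (simp only: mult.assoc[symmetric])
  then show ?thesis by (simp add: exp_minus)
qed

lemma suminf_minus_term:
  fixes f :: "nat \<Rightarrow> 'x::banach"
  assumes "summable f"
  shows "suminf f - f l = (\<Sum>n. if n = l then 0 else f n)"
proof -
  have s: "(\<lambda>n. if n = l then f n else 0) sums f l" by (rule sums_single)
  have "(\<lambda>n. f n - (if n = l then f n else 0)) sums (suminf f - f l)"
    by (rule sums_diff[OF summable_sums[OF assms] s])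
  moreover have "(\<lambda>n. f n - (if n = l then f n else 0)) = (\<lambda>n. if n = l then 0 else f n)" by auto
  ultimately show ?thesis by (simp add: sums_unique)
qed

text \<open>
  Here \<open>\<sigma> = 1\<close> switches the phases on (\<open>\<alpha> = 1\<close>) and \<open>\<sigma> = 0\<close> switches them off (\<open>\<alpha> > 1\<close>); indices outside
  \<open>\<Gamma>\<close> are given the amplitude \<open>0\<close>.
\<close>
locale wkb =
  fixes m :: "'a::euclidean_space \<Rightarrow> complex" and B :: real and k :: "nat \<Rightarrow> 'a" and a :: "nat \<Rightarrow> ('a, 3) W"
    and \<delta> T \<sigma> :: real
  assumes m: "symbol m B" and mdec: "\<And>\<xi>. (1 + norm \<xi>) * norm (m \<xi>) \<le> B"
    and msym: "AE \<xi> in lborel. m (- \<xi>) = cnj (m \<xi>)"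
    and sum_a: "summable (\<lambda>j. norm (a j))" and \<delta>: "\<delta> > 0"
    and sep: "\<And>l n. l \<noteq> n \<Longrightarrow> a l \<noteq> 0 \<Longrightarrow> a n \<noteq> 0 \<Longrightarrow> \<delta> \<le> norm (k l - k n)"
    and T: "T > 0" and \<sigma>: "\<sigma> = 0 \<or> \<sigma> = 1"
begin

text \<open>\<open>M\<close> is the total size of the data, \<open>LV\<close> bounds the potential
  and is the Lipschitz constant of the amplitude equations, and \<open>E\<close> is the resulting
  growth of the weighted norms up to time \<open>T\<close>.\<close>

definition "M = (\<Sum>j. norm (a j))"
definition "LV = B * (M * M)"
definition "E = exp (LV * T)"
text \<open>Formed with the initial amplitudes because a real phase does not change the modulus. The
  potential is thereby known in advance, and the equations for the amplitudes become linear and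
  uncoupled.\<close>

definition "dens l t = transl (t *\<^sub>R k l) (a l * conjW (a l))"
definition "V t = mulop m (\<Sum>l. dens l t)"
text \<open>The potential in the frame that moves with velocity \<open>k j\<close>.\<close>

definition "Vj j t = transl (- (t *\<^sub>R k j)) (V t)"

section \<open>Densities and the real potential\<close>

lemma B0: "B \<ge> 0" using symbol_nonneg[OF m] .
lemma M0: "M \<ge> 0" unfolding M_def by (rule suminf_nonneg[OF sum_a]) simp
lemma LV0: "LV \<ge> 0" unfolding LV_def using B0 M0 by simp
lemma E1: "E \<ge> 1" unfolding E_def using LV0 T by simp
lemma E0: "E \<ge> 0" using E1 by linarith

lemma norm_a_le_M: "norm (a j) \<le> M"
  unfolding M_def using sum_le_suminf[OF sum_a, of "{j}"] by simp

lemma norm_dens: "norm (dens l t) \<le> norm (a l) * M"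
  unfolding dens_def norm_transl
  by (rule order_trans[OF norm_mult_ineq]) (simp add: mult_left_mono norm_a_le_M)

lemma dens_summable: "summable (\<lambda>l. norm (a l) * M)" "(\<Sum>l. norm (a l) * M) = M * M"
  unfolding M_def by (rule summable_mult2[OF sum_a], rule suminf_mult2[OF sum_a, symmetric])

lemma summable_dens: "summable (\<lambda>l. dens l t)"
  by (rule norm_suminf_le_suminf(1)[OF norm_dens dens_summable(1)])

lemma norm_V: "norm (V t) \<le> LV"
proof -
  have "norm (\<Sum>l. dens l t) \<le> M * M"
    using norm_suminf_le_suminf(2)[OF norm_dens dens_summable(1)] dens_summable(2) by simp
  from mult_left_mono[OF this B0] show ?thesis
    unfolding V_def LV_def using norm_mulop_le[OF m, of "\<Sum>l. dens l t"] by (rule order_trans[rotated])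
qed

lemma norm_Vj: "norm (Vj j t) \<le> LV"
  unfolding Vj_def by (simp add: norm_V)

lemma continuous_V: "continuous_on {0..R} V"
  unfolding V_def[abs_def]
proof (rule continuous_on_bl[OF bounded_linear_mulop[OF m]], rule continuous_on_series[OF _ norm_dens dens_summable(1)])
  show "continuous_on {0..R} (dens l)" for l
    unfolding dens_def[abs_def] by (intro continuous_on_transl continuous_intros)
qed

lemma continuous_Vj: "continuous_on {0..R} (Vj j)"
  unfolding Vj_def[abs_def] by (intro continuous_on_transl continuous_V continuous_intros)

lemma conjW_V: "conjW (V t) = V t"
proof -
  have "conjW (dens l t) = dens l t" for l
    unfolding dens_def by (simp add: conjW_transl conjW_mult mult.commute)
  then have "conjW (\<Sum>l. dens l t) = (\<Sum>l. dens l t)"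
    using bounded_linear.suminf[OF bounded_linear_conjW summable_dens, of t] by simp
  then show ?thesis unfolding V_def conjW_mulop[OF m msym] by simp
qed

lemma wfun_Vj_real: "wfun (Vj j t) x \<in> \<real>"
proof -
  have "cnj (wfun (V t) y) = wfun (V t) y" for y
    using fun_cong[OF wfun_conjW[of "V t"], of y] unfolding conjW_V by simp
  then show ?thesis unfolding Vj_def wfun_transl by (simp add: Reals_cnj_iff)
qed

text \<open>The evolution equation of \<open>a j\<close> times its phase factor in the moving frame;
  for \<open>\<sigma> = 0\<close> the amplitude stays constant. The bound in the weighted norm is
  included so that it survives the choice made in \<open>amp\<close>.\<close>

definition amp_ode :: "nat \<Rightarrow> (real \<Rightarrow> ('a, 3) W) \<Rightarrow> bool" where
  "amp_ode j b \<longleftrightarrow> continuous_on {0..T} b \<and>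
    (\<forall>t\<in>{0..T}. b t = a j + integral {0..t} (\<lambda>s. cscale (- \<i> * of_real \<sigma>) (Vj j s * b s)) \<and> norm (b t) \<le> norm (a j) * E)"

definition "amp j = (SOME b. amp_ode j b)"

lemma norm_amp_field: "norm (cscale (- \<i> * of_real \<sigma>) (Vj j s * u)) \<le> LV * norm u"
proof -
  have "norm (cscale (- \<i> * of_real \<sigma>) (Vj j s * u)) \<le> 1 * norm (Vj j s * u)"
    unfolding norm_cscale using \<sigma> by (intro mult_right_mono) (auto simp: norm_mult)
  also have "\<dots> \<le> LV * norm u" using norm_mult_ineq[of "Vj j s" u] norm_Vj[of j s]
    using mult_right_mono[OF norm_Vj[of j s] norm_ge_zero[of u]] by linarith
  finally show ?thesis .
qed

lemma amp_ode: "amp_ode j (amp j)"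
proof -
  interpret c: bounded_linear "cscale (- \<i> * of_real \<sigma>) :: ('a, 3) W \<Rightarrow> _" by (rule bounded_linear_cscale)
  have "\<exists>b. continuous_on {0..T} b \<and> (\<forall>t\<in>{0..T}. b t = a j + integral {0..t} (\<lambda>s. cscale (- \<i> * of_real \<sigma>) (Vj j s * b s))
     \<and> norm (b t - 0) \<le> norm (a j) * exp (LV * T))"
  \<comment> \<open>The approximation is 0, whose defect is \<open>norm (a j)\<close>. The tube then
    gives growth proportional to \<open>norm (a j)\<close>, hence bounds that can be summed over the
    modes.\<close>
  proof (rule ode_exists_near_approximation)
    show "continuous_on {0..T} (\<lambda>t. cscale (- \<i> * of_real \<sigma>) (Vj j t * u t))" if "continuous_on {0..T} u" for u
      by (rule continuous_on_bl[OF bounded_linear_cscale continuous_on_mult[OF continuous_Vj that]])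
    show "norm (cscale (- \<i> * of_real \<sigma>) (Vj j t * u) - cscale (- \<i> * of_real \<sigma>) (Vj j t * v)) \<le> LV * norm (u - v)" for t u v
      using norm_amp_field[of j t "u - v"] by (simp only: c.diff right_diff_distrib)
    show "norm (0 - (a j + integral {0..t} (\<lambda>s. cscale (- \<i> * of_real \<sigma>) (Vj j s * 0)))) \<le> norm (a j)" for t
      by (simp only: mult_zero_right c.zero) simp
  qed (use LV0 T in auto)
  then have "\<exists>b. amp_ode j b" unfolding amp_ode_def E_def diff_zero .
  then show ?thesis unfolding amp_def by (rule someI_ex)
qed

lemma amp_continuous: "continuous_on {0..T} (amp j)"
  and amp_eq: "t \<in> {0..T} \<Longrightarrow> amp j t = a j + integral {0..t} (\<lambda>s. cscale (- \<i> * of_real \<sigma>) (Vj j s * amp j s))"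
  and norm_amp: "t \<in> {0..T} \<Longrightarrow> norm (amp j t) \<le> norm (a j) * E"
  using amp_ode[of j] unfolding amp_ode_def by blast+

lemma amp_field_integrable: "t \<in> {0..T} \<Longrightarrow> (\<lambda>s. cscale (- \<i> * of_real \<sigma>) (Vj j s * amp j s)) integrable_on {0..t}"
  by (rule integrable_continuous_interval, rule continuous_on_subset[of "{0..T}"])
    (rule continuous_on_bl[OF bounded_linear_cscale continuous_on_mult[OF continuous_Vj amp_continuous]], simp)

lemma wfun_amp:
  assumes t: "t \<in> {0..T}"
  shows "wfun (amp j t) x = wfun (a j) x * exp (- \<i> * of_real \<sigma> * integral {0..t} (\<lambda>s. wfun (Vj j s) x))"
proof (rule scalar_linear_ode[OF _ _ _ t])
  show "continuous_on {0..T} (\<lambda>t. wfun (amp j t) x)" by (rule continuous_on_bl[OF bounded_linear_wfun amp_continuous])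
  show "continuous_on {0..T} (\<lambda>t. wfun (Vj j t) x)" by (rule continuous_on_bl[OF bounded_linear_wfun continuous_Vj])
  show "wfun (amp j t) x = wfun (a j) x + integral {0..t} (\<lambda>s. - \<i> * of_real \<sigma> * (wfun (Vj j s) x * wfun (amp j s) x))"
    if t: "t \<in> {0..T}" for t
  proof -
    have "wfun (amp j t) x = wfun (a j) x + wfun (integral {0..t} (\<lambda>s. cscale (- \<i> * of_real \<sigma>) (Vj j s * amp j s))) x"
      by (subst amp_eq[OF t]) (simp add: wfun_add)
    also have "wfun (integral {0..t} (\<lambda>s. cscale (- \<i> * of_real \<sigma>) (Vj j s * amp j s))) x
      = integral {0..t} ((\<lambda>f. wfun f x) \<circ> (\<lambda>s. cscale (- \<i> * of_real \<sigma>) (Vj j s * amp j s)))"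
      by (rule integral_linear[OF amp_field_integrable[OF t] bounded_linear_wfun, symmetric])
    finally show ?thesis by (simp add: o_def wfun_mult)
  qed
qed

text \<open>The potential is real, so the exponent is purely imaginary. This justifies afterwards
  that the densities are formed with the initial amplitudes.\<close>

lemma norm_wfun_amp:
  assumes t: "t \<in> {0..T}"
  shows "norm (wfun (amp j t) x) = norm (wfun (a j) x)"
proof -
  have i: "(\<lambda>s. wfun (Vj j s) x) integrable_on {0..t}"
    by (rule integrable_continuous_interval) (rule continuous_on_bl[OF bounded_linear_wfun continuous_Vj])
  have "cnj (integral {0..t} (\<lambda>s. wfun (Vj j s) x)) = integral {0..t} (\<lambda>s. wfun (Vj j s) x)"
    unfolding Henstock_Kurzweil_Integration.integral_cnj using wfun_Vj_real by (simp add: Reals_cnj_iff)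
  then have "integral {0..t} (\<lambda>s. wfun (Vj j s) x) \<in> \<real>" by (simp add: Reals_cnj_iff)
  then obtain r where "integral {0..t} (\<lambda>s. wfun (Vj j s) x) = of_real r" by (auto elim: Reals_cases)
  then show ?thesis unfolding wfun_amp[OF t] by (simp add: norm_mult norm_exp_eq_Re)
qed

definition "phase \<epsilon> j t = cis (- (t * (norm (k j))\<^sup>2 / (2 * \<epsilon>)))"
text \<open>The wave packet in the interaction picture; \<open>mode\<close> is the same packet in
  the original variables, as \<open>schr_lterm\<close> confirms. Their sums are \<open>papp\<close>
  and \<open>uapp\<close>.\<close>

definition "lterm \<epsilon> j t = modul (k j /\<^sub>R \<epsilon>) (schr \<epsilon> (- t) (incl (amp j t)))"
definition "mode \<epsilon> j t = cscale (phase \<epsilon> j t) (modul (k j /\<^sub>R \<epsilon>) (transl (t *\<^sub>R k j) (incl (amp j t))))"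
definition "papp \<epsilon> t = (\<Sum>j. lterm \<epsilon> j t)"
definition "uapp \<epsilon> t = (\<Sum>j. mode \<epsilon> j t)"
definition "udata \<epsilon> = (\<Sum>j. modul (k j /\<^sub>R \<epsilon>) (incl (a j)))"

section \<open>Sums of wave packets and products of two of them\<close>

lemma summable_aE: "summable (\<lambda>j. norm (a j) * E)" "(\<Sum>j. norm (a j) * E) = M * E"
  unfolding M_def by (rule summable_mult2[OF sum_a], rule suminf_mult2[OF sum_a, symmetric])

lemma norm_lterm: "t \<in> {0..T} \<Longrightarrow> norm (lterm \<epsilon> j t) \<le> norm (a j) * E"
  unfolding lterm_def by (simp add: order_trans[OF norm_incl_le norm_amp])

lemma norm_mode: "t \<in> {0..T} \<Longrightarrow> norm (mode \<epsilon> j t) \<le> norm (a j) * E"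
  unfolding mode_def by (simp add: norm_cscale phase_def order_trans[OF norm_incl_le norm_amp])

lemma summable_lterm: "t \<in> {0..T} \<Longrightarrow> summable (\<lambda>j. lterm \<epsilon> j t)"
  by (rule norm_suminf_le_suminf(1)[OF norm_lterm summable_aE(1)])

lemma summable_mode: "t \<in> {0..T} \<Longrightarrow> summable (\<lambda>j. mode \<epsilon> j t)"
  by (rule norm_suminf_le_suminf(1)[OF norm_mode summable_aE(1)])

lemma norm_papp: "t \<in> {0..T} \<Longrightarrow> norm (papp \<epsilon> t) \<le> M * E"
  unfolding papp_def using norm_suminf_le_suminf(2)[OF norm_lterm summable_aE(1)] summable_aE(2) by simp

lemma norm_uapp: "t \<in> {0..T} \<Longrightarrow> norm (uapp \<epsilon> t) \<le> M * E"
  unfolding uapp_def using norm_suminf_le_suminf(2)[OF norm_mode summable_aE(1)] summable_aE(2) by simp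

lemma continuous_papp: "continuous_on {0..T} (papp \<epsilon>)"
  unfolding papp_def[abs_def]
proof (rule continuous_on_series[OF _ norm_lterm summable_aE(1)])
  show "continuous_on {0..T} (lterm \<epsilon> j)" for j
    unfolding lterm_def[abs_def]
    by (intro continuous_on_bl[OF bounded_linear_modul] continuous_on_schr continuous_on_bl[OF bounded_linear_incl] amp_continuous continuous_intros)
qed

lemma schr_lterm: "\<epsilon> > 0 \<Longrightarrow> schr \<epsilon> t (lterm \<epsilon> j t) = mode \<epsilon> j t"
  unfolding lterm_def mode_def phase_def by (simp add: schr_modul schr_schr)

lemma schr_papp: "\<epsilon> > 0 \<Longrightarrow> t \<in> {0..T} \<Longrightarrow> schr \<epsilon> t (papp \<epsilon> t) = uapp \<epsilon> t"
  unfolding papp_def uapp_def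
  by (subst bounded_linear.suminf[OF bounded_linear_schr summable_lterm]) (simp_all add: schr_lterm)

text \<open>By Galilean invariance, multiplying a travelling packet by the potential is the same as
  multiplying its amplitude by the potential in the moving frame. In this form the term can be
  compared with the amplitude equation.\<close>

lemma V_times_mode:
  assumes \<epsilon>: "\<epsilon> > 0"
  shows "incl (V t) * mode \<epsilon> j t = schr \<epsilon> t (modul (k j /\<^sub>R \<epsilon>) (schr \<epsilon> (- t) (incl (Vj j t * amp j t))))"
  unfolding schr_modul[OF \<epsilon>] schr_schr
  by (rule W_eqI) (simp add: mode_def phase_def wfun_modul wfun_transl wfun_mult Vj_def)

lemma mode_diagonal:
  assumes t: "t \<in> {0..T}"
  shows "mode \<epsilon> l t * conjW (mode \<epsilon> l t) = incl (dens l t)"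
proof (rule W_eqI)
  fix x
  have "wfun (mode \<epsilon> l t * conjW (mode \<epsilon> l t)) x = of_real ((norm (wfun (mode \<epsilon> l t) x))\<^sup>2)"
    unfolding wfun_mult wfun_conjW complex_norm_square ..
  also have "norm (wfun (mode \<epsilon> l t) x) = norm (wfun (a l) (x - t *\<^sub>R k l))"
    by (simp add: mode_def phase_def norm_mult wfun_modul wfun_transl norm_wfun_amp[OF t])
  also have "of_real ((norm (wfun (a l) (x - t *\<^sub>R k l)))\<^sup>2) = wfun (incl (dens l t)) x"
    unfolding wfun_incl dens_def wfun_transl wfun_mult wfun_conjW complex_norm_square ..
  finally show "wfun (mode \<epsilon> l t * conjW (mode \<epsilon> l t)) x = wfun (incl (dens l t)) x" .
qed

text \<open>The product carries the frequency \<open>(k l - k n) /\<^sub>R \<epsilon>\<close>, of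
  norm at least \<open>\<delta> / \<epsilon>\<close>, and the decay of \<open>m\<close> at that
  frequency yields the factor \<open>\<epsilon> / \<delta>\<close>.\<close>

lemma mode_off_diagonal:
  assumes \<epsilon>: "\<epsilon> > 0" and t: "t \<in> {0..T}" and ln: "l \<noteq> n"
  shows "norm (mulop m (mode \<epsilon> l t * conjW (mode \<epsilon> n t))) \<le> (B * \<epsilon> / \<delta>) * ((norm (a l) * E) * (norm (a n) * E))"
\<comment> \<open>The separation of frequencies is assumed only for modes with nonzero amplitude;
  for the others the product itself vanishes.\<close>
proof (cases "a l = 0 \<or> a n = 0")
  case True
  interpret mu: bounded_linear "mulop m :: ('a, 1) W \<Rightarrow> _" by (rule bounded_linear_mulop[OF m])
  interpret cj: bounded_linear "conjW :: ('a, 1) W \<Rightarrow> _" by (rule bounded_linear_conjW)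
  from True have "norm (mode \<epsilon> l t) = 0 \<or> norm (mode \<epsilon> n t) = 0"
    using norm_mode[OF t, of \<epsilon> l] norm_mode[OF t, of \<epsilon> n] by auto
  then have "mode \<epsilon> l t * conjW (mode \<epsilon> n t) = 0"
    by (auto simp: cj.zero)
  then show ?thesis using B0 \<epsilon> \<delta> E0 by (simp add: mu.zero)
next
  case False
  let ?\<kappa> = "(k l - k n) /\<^sub>R \<epsilon>"
  let ?f = "transl (t *\<^sub>R k l) (amp l t) * conjW (transl (t *\<^sub>R k n) (amp n t))"
  let ?c = "phase \<epsilon> l t * cnj (phase \<epsilon> n t)"
  have c: "norm ?c = 1" by (simp add: phase_def norm_mult)
  have "mode \<epsilon> l t * conjW (mode \<epsilon> n t) = cscale ?c (modul ?\<kappa> (incl ?f))"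
  proof (rule W_eqI)
    fix x
    have e: "cis ((k l /\<^sub>R \<epsilon>) \<bullet> x) * cnj (cis ((k n /\<^sub>R \<epsilon>) \<bullet> x)) = cis (?\<kappa> \<bullet> x)"
      by (simp add: cis_cnj cis_mult inner_diff_left algebra_simps)
    show "wfun (mode \<epsilon> l t * conjW (mode \<epsilon> n t)) x = wfun (cscale ?c (modul ?\<kappa> (incl ?f))) x"
      unfolding wfun_cscale wfun_modul wfun_incl e[symmetric] wfun_mult wfun_conjW mode_def wfun_transl
      by (simp add: mult_ac)
  qed
  then have "norm (mulop m (mode \<epsilon> l t * conjW (mode \<epsilon> n t))) = norm (mulop m (modul ?\<kappa> (incl ?f)))"
    by (simp add: cscale_mulop[OF m, symmetric] norm_cscale c)
  also have "\<dots> \<le> B / (1 + norm ?\<kappa>) * norm ?f" by (rule norm_mulop_modul_le[OF m mdec])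
  also have "\<dots> \<le> (B * \<epsilon> / \<delta>) * ((norm (a l) * E) * (norm (a n) * E))"
  proof (rule mult_mono)
    have "norm ?\<kappa> = norm (k l - k n) / \<epsilon>"
      using \<epsilon> unfolding norm_scaleR by (simp add: divide_inverse mult.commute)
    then have "\<delta> / \<epsilon> \<le> norm ?\<kappa>" using divide_right_mono[OF sep[OF ln], of \<epsilon>] False \<epsilon> by simp
    then have "\<delta> / \<epsilon> \<le> 1 + norm ?\<kappa>" by simp
    then have "B / (1 + norm ?\<kappa>) \<le> B / (\<delta> / \<epsilon>)"
      using B0 \<delta> \<epsilon> by (intro divide_left_mono mult_pos_pos) (auto intro: add_pos_nonneg)
    then show "B / (1 + norm ?\<kappa>) \<le> B * \<epsilon> / \<delta>" by simp
    show "norm ?f \<le> (norm (a l) * E) * (norm (a n) * E)"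
      using norm_amp[OF t] E0 by (intro order_trans[OF norm_mult_ineq] mult_mono) auto
  qed (use B0 \<epsilon> \<delta> in auto)
  finally show ?thesis .
qed

text \<open>The diagonal of the double series is the density behind \<open>V t\<close>, and the
  remaining terms are bounded by a product sequence, so both summations keep the factor
  \<open>\<epsilon> / \<delta>\<close>.\<close>

lemma uapp_density:
  assumes \<epsilon>: "\<epsilon> > 0" and t: "t \<in> {0..T}"
  shows "norm (mulop m (uapp \<epsilon> t * conjW (uapp \<epsilon> t)) - incl (V t)) \<le> (B * \<epsilon> / \<delta>) * ((M * E) * (M * E))"
proof -
  interpret mu: bounded_linear "mulop m :: ('a, 1) W \<Rightarrow> _" by (rule bounded_linear_mulop[OF m])
  let ?x = "\<lambda>j. mode \<epsilon> j t"
  let ?C = "B * \<epsilon> / \<delta>"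
  have C0: "?C \<ge> 0" using B0 \<epsilon> \<delta> by simp
  have sx: "summable ?x" by (rule summable_mode[OF t])
  have scx: "summable (\<lambda>n. conjW (?x n))" by (rule bounded_linear.summable[OF bounded_linear_conjW sx])
  have cu: "conjW (uapp \<epsilon> t) = (\<Sum>n. conjW (?x n))"
    unfolding uapp_def by (rule bounded_linear.suminf[OF bounded_linear_conjW sx])
  \<comment> \<open>Row \<open>l\<close> of the double series without its diagonal entry. Working
    with rows reduces the double series to two single ones.\<close>
  define g where "g l = ?x l * (conjW (uapp \<epsilon> t) - conjW (?x l))" for l
  have g_eq: "g l = (\<Sum>n. if n = l then 0 else ?x l * conjW (?x n))" for l
  proof -
    have "summable (\<lambda>n. if n = l then 0 else conjW (?x n))"
      by (rule norm_suminf_le_suminf(1)[OF _ summable_aE(1)]) (use norm_mode[OF t] E0 in auto)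
    then have "g l = (\<Sum>n. ?x l * (if n = l then 0 else conjW (?x n)))"
      unfolding g_def cu suminf_minus_term[OF scx] by (rule suminf_mult[symmetric])
    then show ?thesis by (simp add: if_distrib cong: if_cong)
  qed
  have bnd: "norm (mulop m (if n = l then 0 else ?x l * conjW (?x n))) \<le> (?C * (norm (a l) * E)) * (norm (a n) * E)" for l n
  proof (cases "n = l")
    case True
    have "0 \<le> (?C * (norm (a l) * E)) * (norm (a n) * E)"
      by (intro mult_nonneg_nonneg C0 E0 norm_ge_zero)
    with True show ?thesis by (simp only: if_True mu.zero norm_zero simp_thms)
  next
    case False
    then show ?thesis using mode_off_diagonal[OF \<epsilon> t, of l n] by (simp only: if_False mult.assoc)
  qed
  have bs: "summable (\<lambda>n. (?C * (norm (a l) * E)) * (norm (a n) * E))" "(\<Sum>n. (?C * (norm (a l) * E)) * (norm (a n) * E)) = ?C * (norm (a l) * E) * (M * E)" for l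
    by (rule summable_mult[OF summable_aE(1)], simp only: suminf_mult[OF summable_aE(1)] summable_aE(2))
  have prods: "summable (\<lambda>n. if n = l then 0 else ?x l * conjW (?x n))" for l
  proof (rule norm_suminf_le_suminf(1)[OF _ summable_mult[OF summable_aE(1), of "norm (?x l)"]])
    show "norm (if n = l then 0 else ?x l * conjW (?x n)) \<le> norm (?x l) * (norm (a n) * E)" for n
      using norm_mode[OF t, of \<epsilon> n] E0
      by (auto intro!: order_trans[OF norm_mult_ineq] mult_left_mono)
  qed
  have ng: "norm (mulop m (g l)) \<le> ?C * (M * E) * (norm (a l) * E)" for l
  proof -
    have "mulop m (g l) = (\<Sum>n. mulop m (if n = l then 0 else ?x l * conjW (?x n)))"
      unfolding g_eq by (rule mu.suminf[OF prods])
    also have "norm \<dots> \<le> ?C * (norm (a l) * E) * (M * E)"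
      using norm_suminf_le_suminf(2)[OF bnd bs(1)[of l]] unfolding bs(2) .
    finally show ?thesis by (simp only: mult_ac)
  qed
  have sd: "summable (\<lambda>l. incl (dens l t))" by (rule bounded_linear.summable[OF bounded_linear_incl summable_dens])
  have V: "incl (V t) = mulop m (\<Sum>l. incl (dens l t))"
    unfolding V_def incl_mulop[OF m] bounded_linear.suminf[OF bounded_linear_incl summable_dens] ..
  have sxu: "summable (\<lambda>l. ?x l * conjW (uapp \<epsilon> t))" by (rule summable_mult2[OF sx])
  have "uapp \<epsilon> t * conjW (uapp \<epsilon> t) - (\<Sum>l. incl (dens l t)) = (\<Sum>l. ?x l * conjW (uapp \<epsilon> t)) - (\<Sum>l. incl (dens l t))"
    unfolding suminf_mult2[OF sx, symmetric] uapp_def[symmetric] ..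
  also have "\<dots> = (\<Sum>l. ?x l * conjW (uapp \<epsilon> t) - incl (dens l t))" by (rule suminf_diff[OF sxu sd])
  also have "\<dots> = (\<Sum>l. g l)"
    unfolding g_def mode_diagonal[OF t, of \<epsilon>, symmetric] by (simp add: right_diff_distrib)
  finally have d: "uapp \<epsilon> t * conjW (uapp \<epsilon> t) - (\<Sum>l. incl (dens l t)) = (\<Sum>l. g l)" .
  have sg: "summable g"
    using summable_diff[OF sxu sd] unfolding g_def mode_diagonal[OF t, of \<epsilon>, symmetric] by (simp add: right_diff_distrib)
  have "mulop m (uapp \<epsilon> t * conjW (uapp \<epsilon> t)) - incl (V t) = (\<Sum>l. mulop m (g l))"
    unfolding V mu.diff[symmetric] d by (rule mu.suminf[OF sg])
  also have "norm \<dots> \<le> ?C * (M * E) * (M * E)"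
    using norm_suminf_le_suminf(2)[OF ng summable_mult[OF summable_aE(1)]]
    by (simp only: suminf_mult[OF summable_aE(1)] summable_aE(2))
  finally show ?thesis by (simp only: mult.assoc)
qed

text \<open>
  \<open>C1\<close> collects the dispersive and the nonresonant errors of size \<open>\<epsilon>\<close>, and \<open>C2\<close> bounds the nonlinearity,
  which is not compensated if \<open>\<sigma> = 0\<close>.
\<close>
definition "C1 = T / 2 * (M * E) + T * (T / 2 * (LV * (M * E)) + B / \<delta> * ((M * E) * (M * E) * (M * E)))"
definition "C2 = T * (B * (M * E) ^ 3)"

lemma ME0: "M * E \<ge> 0" using M0 E0 by simp

lemma C1_nonneg: "C1 \<ge> 0" and C2_nonneg: "C2 \<ge> 0"
  unfolding C1_def C2_def using T B0 \<delta> ME0 LV0 by (auto intro!: add_nonneg_nonneg mult_nonneg_nonneg)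

text \<open>The time derivative, by the amplitude equation, of the packet with its group factor
  \<open>U(-t)\<close> dropped.\<close>

definition "drift \<epsilon> j s = modul (k j /\<^sub>R \<epsilon>) (incl (cscale (- \<i> * of_real \<sigma>) (Vj j s * amp j s)))"

lemma norm_drift: "s \<in> {0..T} \<Longrightarrow> norm (drift \<epsilon> j s) \<le> LV * (norm (a j) * E)"
  unfolding drift_def norm_modul
  using LV0 by (intro order_trans[OF norm_incl_le] order_trans[OF norm_amp_field] mult_left_mono norm_amp)

lemma continuous_drift: "continuous_on {0..T} (drift \<epsilon> j)"
  unfolding drift_def[abs_def]
  by (rule continuous_on_bl[OF bounded_linear_modul continuous_on_bl[OF bounded_linear_incl
        continuous_on_bl[OF bounded_linear_cscale continuous_on_mult[OF continuous_Vj amp_continuous]]]])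

lemma integral_drift:
  assumes t: "t \<in> {0..T}"
  shows "integral {0..t} (drift \<epsilon> j) = modul (k j /\<^sub>R \<epsilon>) (incl (amp j t)) - modul (k j /\<^sub>R \<epsilon>) (incl (a j))"
proof -
  let ?h = "\<lambda>f :: ('a, 3) W. modul (k j /\<^sub>R \<epsilon>) (incl f)"
  have bl: "bounded_linear ?h" by (rule bounded_linear_compose[OF bounded_linear_modul bounded_linear_incl])
  have "integral {0..t} (?h \<circ> (\<lambda>s. cscale (- \<i> * of_real \<sigma>) (Vj j s * amp j s))) = ?h (integral {0..t} (\<lambda>s. cscale (- \<i> * of_real \<sigma>) (Vj j s * amp j s)))"
    by (rule integral_linear[OF amp_field_integrable[OF t] bl])
  also have "integral {0..t} (\<lambda>s. cscale (- \<i> * of_real \<sigma>) (Vj j s * amp j s)) = amp j t - a j"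
    using amp_eq[OF t, of j] by (simp only: add_diff_cancel_left')
  also have "?h (amp j t - a j) = ?h (amp j t) - ?h (a j)" by (rule linear_diff[OF bounded_linear.linear[OF bl]])
  finally show ?thesis by (simp only: o_def drift_def[abs_def])
qed

text \<open>Up to the factor \<open>-i\<close> the drifts sum to \<open>A\<close>, while the field
  is \<open>A'\<close> plus the transported \<open>R * uapp \<epsilon> s\<close>. Passing from
  \<open>A\<close> to \<open>A'\<close> inserts the group on the amplitudes, a dispersive error;
  \<open>R\<close> is the nonresonant part of the density.\<close>

lemma drift_minus_vfield:
  assumes \<epsilon>: "\<epsilon> > 0" and s: "s \<in> {0..T}" and \<sigma>1: "\<sigma> = 1"
  shows "norm ((\<Sum>j. drift \<epsilon> j s) - vfield m \<epsilon> 1 s (papp \<epsilon> s))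
    \<le> \<epsilon> * (T / 2 * (LV * (M * E)) + B / \<delta> * ((M * E) * (M * E) * (M * E)))"
proof -
  let ?f = "\<lambda>j. Vj j s * amp j s" and ?\<kappa> = "\<lambda>j. k j /\<^sub>R \<epsilon>"
  interpret c: bounded_linear "cscale (- \<i>) :: ('a, 1) W \<Rightarrow> _" by (rule bounded_linear_cscale)
  interpret sc: bounded_linear "schr \<epsilon> (- s) :: ('a, 1) W \<Rightarrow> _" by (rule bounded_linear_schr)
  interpret ss: bounded_linear "schr \<epsilon> s :: ('a, 1) W \<Rightarrow> _" by (rule bounded_linear_schr)
  have fb: "norm (?f j) \<le> LV * (norm (a j) * E)" for j
    by (rule order_trans[OF norm_mult_ineq]) (rule mult_mono[OF norm_Vj norm_amp[OF s] LV0 norm_ge_zero])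
  have sL: "summable (\<lambda>j. LV * (norm (a j) * E))" "(\<Sum>j. LV * (norm (a j) * E)) = LV * (M * E)"
    by (rule summable_mult[OF summable_aE(1)], simp only: suminf_mult[OF summable_aE(1)] summable_aE(2))
  have d: "drift \<epsilon> j s = cscale (- \<i>) (modul (?\<kappa> j) (incl (?f j)))" for j
    unfolding drift_def by (rule W_eqI) (simp add: wfun_modul \<sigma>1)
  have s1: "summable (\<lambda>j. modul (?\<kappa> j) (incl (?f j)))"
    by (rule norm_suminf_le_suminf(1)[OF _ sL(1)], unfold norm_modul norm_schr, rule order_trans[OF norm_incl_le fb])
  have s2: "summable (\<lambda>j. modul (?\<kappa> j) (schr \<epsilon> (- s) (incl (?f j))))"
    by (rule norm_suminf_le_suminf(1)[OF _ sL(1)], unfold norm_modul norm_schr, rule order_trans[OF norm_incl_le fb])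
  define A where "A = (\<Sum>j. modul (?\<kappa> j) (incl (?f j)))"
  define A' where "A' = (\<Sum>j. modul (?\<kappa> j) (schr \<epsilon> (- s) (incl (?f j))))"
  define R where "R = mulop m (uapp \<epsilon> s * conjW (uapp \<epsilon> s)) - incl (V s)"
  have D: "(\<Sum>j. drift \<epsilon> j s) = cscale (- \<i>) A"
    unfolding d A_def by (rule c.suminf[OF s1, symmetric])
  have "incl (V s) * uapp \<epsilon> s = (\<Sum>j. incl (V s) * mode \<epsilon> j s)"
    unfolding uapp_def by (rule suminf_mult[OF summable_mode[OF s], symmetric])
  also have "\<dots> = schr \<epsilon> s A'"
    unfolding V_times_mode[OF \<epsilon>] A'_def by (rule ss.suminf[OF s2, symmetric])
  finally have Vu: "incl (V s) * uapp \<epsilon> s = schr \<epsilon> s A'" .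
  have N: "hartree_nl m (uapp \<epsilon> s) = R * uapp \<epsilon> s + schr \<epsilon> s A'"
    unfolding hartree_nl_def R_def Vu[symmetric] left_diff_distrib by simp
  have v: "vfield m \<epsilon> 1 s (papp \<epsilon> s) = cscale (- \<i>) (schr \<epsilon> (- s) (R * uapp \<epsilon> s) + A')"
    unfolding vfield_def schr_papp[OF \<epsilon> s] N sc.add schr_schr by simp
  have "norm ((\<Sum>j. drift \<epsilon> j s) - vfield m \<epsilon> 1 s (papp \<epsilon> s)) = norm (A - A' - schr \<epsilon> (- s) (R * uapp \<epsilon> s))"
    unfolding D v c.diff[symmetric] norm_cscale diff_diff_eq by (simp add: add.commute)
  also have "\<dots> \<le> norm (A - A') + norm (schr \<epsilon> (- s) (R * uapp \<epsilon> s))" by (rule norm_triangle_ineq4)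
  also have "norm (A - A') \<le> \<epsilon> * T / 2 * (LV * (M * E))"
  proof -
    have "norm (A - A') \<le> (\<Sum>j. \<epsilon> * T / 2 * (LV * (norm (a j) * E)))"
      unfolding A_def A'_def suminf_diff[OF s1 s2]
    proof (rule norm_suminf_le_suminf(2)[OF _ summable_mult[OF sL(1)]])
      fix j
      have "norm (modul (?\<kappa> j) (incl (?f j)) - modul (?\<kappa> j) (schr \<epsilon> (- s) (incl (?f j)))) = norm (schr \<epsilon> (- s) (incl (?f j)) - incl (?f j))"
      proof -
        interpret md: bounded_linear "modul (?\<kappa> j)" by (rule bounded_linear_modul)
        show ?thesis unfolding md.diff[symmetric] norm_modul by (rule norm_minus_commute)
      qed
      also have "\<dots> \<le> \<epsilon> * \<bar>- s\<bar> / 2 * norm (?f j)" by (rule norm_schr_minus_id) (use \<epsilon> in simp)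
      also have "\<dots> \<le> \<epsilon> * T / 2 * (LV * (norm (a j) * E))"
        by (rule mult_mono[OF _ fb]) (use \<epsilon> s T in auto)
      finally show "norm (modul (?\<kappa> j) (incl (?f j)) - modul (?\<kappa> j) (schr \<epsilon> (- s) (incl (?f j)))) \<le> \<epsilon> * T / 2 * (LV * (norm (a j) * E))" .
    qed
    also have "\<dots> = \<epsilon> * T / 2 * (LV * (M * E))" by (simp only: suminf_mult[OF sL(1)] sL(2))
    finally show ?thesis .
  qed
  also have "norm (schr \<epsilon> (- s) (R * uapp \<epsilon> s)) \<le> (B * \<epsilon> / \<delta>) * ((M * E) * (M * E)) * (M * E)"
    unfolding norm_schr R_def
  proof (rule order_trans[OF norm_mult_ineq], rule mult_mono[OF uapp_density[OF \<epsilon> s] norm_uapp[OF s]])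
    show "0 \<le> B * \<epsilon> / \<delta> * ((M * E) * (M * E))" using B0 \<epsilon> \<delta> ME0 by simp
  qed simp
  finally show ?thesis by (simp add: algebra_simps)
qed

text \<open>The group factor is removed from the packets before anything is differentiated in time.
  What is left evolves by \<open>drift\<close>, so the defect is one dispersive term
  \<open>S\<close> and the integral of the pointwise difference of drift and field.\<close>

lemma defect:
  assumes \<epsilon>: "\<epsilon> > 0" and \<mu>: "0 \<le> \<mu>" "\<sigma> = 1 \<Longrightarrow> \<mu> = 1" and t: "t \<in> {0..T}"
  shows "norm (papp \<epsilon> t - (udata \<epsilon> + integral {0..t} (\<lambda>s. vfield m \<epsilon> \<mu> s (papp \<epsilon> s)))) \<le> \<epsilon> * C1 + (1 - \<sigma>) * \<mu> * C2"
proof -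
  let ?\<kappa> = "\<lambda>j. k j /\<^sub>R \<epsilon>"
  let ?v = "\<lambda>s. vfield m \<epsilon> \<mu> s (papp \<epsilon> s)"
  let ?K = "\<epsilon> * (T / 2 * (LV * (M * E)) + B / \<delta> * ((M * E) * (M * E) * (M * E))) + (1 - \<sigma>) * \<mu> * (B * (M * E) ^ 3)"
  have sL: "summable (\<lambda>j. LV * (norm (a j) * E))" by (rule summable_mult[OF summable_aE(1)])
  have sA: "summable (\<lambda>j. modul (?\<kappa> j) (incl (amp j t)))"
    by (rule norm_suminf_le_suminf(1)[OF _ summable_aE(1)]) (simp add: order_trans[OF norm_incl_le norm_amp[OF t]])
  have sa: "summable (\<lambda>j. modul (?\<kappa> j) (incl (a j)))"
    by (rule norm_suminf_le_suminf(1)[OF _ sum_a]) (simp add: norm_incl_le)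
  \<comment> \<open>The dispersive cost of dropping \<open>U(-t)\<close> from \<open>papp\<close> at
    the final time \<open>t\<close>.\<close>
  define S where "S = (\<Sum>j. lterm \<epsilon> j t - modul (?\<kappa> j) (incl (amp j t)))"
  have nS: "norm S \<le> \<epsilon> * (T / 2 * (M * E))"
  proof -
    have "norm S \<le> (\<Sum>j. \<epsilon> * T / 2 * (norm (a j) * E))"
      unfolding S_def
    proof (rule norm_suminf_le_suminf(2)[OF _ summable_mult[OF summable_aE(1)]])
      fix j
      have "norm (lterm \<epsilon> j t - modul (?\<kappa> j) (incl (amp j t))) = norm (schr \<epsilon> (- t) (incl (amp j t)) - incl (amp j t))"
      proof -
        interpret md: bounded_linear "modul (?\<kappa> j)" by (rule bounded_linear_modul)
        show ?thesis unfolding lterm_def md.diff[symmetric] norm_modul ..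
      qed
      also have "\<dots> \<le> \<epsilon> * \<bar>- t\<bar> / 2 * norm (amp j t)" by (rule norm_schr_minus_id) (use \<epsilon> in simp)
      also have "\<dots> \<le> \<epsilon> * T / 2 * (norm (a j) * E)"
        by (rule mult_mono[OF _ norm_amp[OF t]]) (use \<epsilon> t T in auto)
      finally show "norm (lterm \<epsilon> j t - modul (?\<kappa> j) (incl (amp j t))) \<le> \<epsilon> * T / 2 * (norm (a j) * E)" .
    qed
    also have "\<dots> = \<epsilon> * (T / 2 * (M * E))" unfolding suminf_mult[OF summable_aE(1)] summable_aE(2) by simp
    finally show ?thesis .
  qed
  have cD: "continuous_on {0..T} (\<lambda>s. \<Sum>j. drift \<epsilon> j s)"
    by (rule continuous_on_series[OF continuous_drift norm_drift sL])
  have cv: "continuous_on {0..T} ?v" by (rule continuous_on_vfield[OF m continuous_papp])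
  have sub: "{0..t} \<subseteq> {0..T}" using t by auto
  have iD: "(\<lambda>s. \<Sum>j. drift \<epsilon> j s) integrable_on {0..t}" and iv: "?v integrable_on {0..t}"
    by (rule integrable_continuous_interval[OF continuous_on_subset[OF cD sub]],
        rule integrable_continuous_interval[OF continuous_on_subset[OF cv sub]])
  have "papp \<epsilon> t - udata \<epsilon> = S + (\<Sum>j. modul (?\<kappa> j) (incl (amp j t)) - modul (?\<kappa> j) (incl (a j)))"
    unfolding S_def papp_def udata_def suminf_diff[OF summable_lterm[OF t] sA, symmetric] suminf_diff[OF sA sa, symmetric] by simp
  also have "(\<Sum>j. modul (?\<kappa> j) (incl (amp j t)) - modul (?\<kappa> j) (incl (a j))) = integral {0..t} (\<lambda>s. \<Sum>j. drift \<epsilon> j s)"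
    unfolding integral_drift[OF t, symmetric] by (rule integral_series[OF continuous_drift norm_drift sL t, symmetric])
  finally have "papp \<epsilon> t - (udata \<epsilon> + integral {0..t} ?v) = S + (integral {0..t} (\<lambda>s. \<Sum>j. drift \<epsilon> j s) - integral {0..t} ?v)"
    by (simp add: algebra_simps)
  also have "integral {0..t} (\<lambda>s. \<Sum>j. drift \<epsilon> j s) - integral {0..t} ?v = integral {0..t} (\<lambda>s. (\<Sum>j. drift \<epsilon> j s) - ?v s)"
    by (rule Henstock_Kurzweil_Integration.integral_diff[symmetric, OF iD iv])
  finally have eq: "papp \<epsilon> t - (udata \<epsilon> + integral {0..t} ?v) = S + integral {0..t} (\<lambda>s. (\<Sum>j. drift \<epsilon> j s) - ?v s)" .
  have pt: "norm ((\<Sum>j. drift \<epsilon> j s) - ?v s) \<le> ?K" if s: "s \<in> {0..T}" for s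
  proof (cases "\<sigma> = 1")
    case True
    then show ?thesis using drift_minus_vfield[OF \<epsilon> s True] \<mu>(2) by simp
  next
    \<comment> \<open>Without phases the amplitudes are constant, so the drift vanishes and the
      whole nonlinearity counts as error.\<close>
    case False
    then have \<sigma>0: "\<sigma> = 0" using \<sigma> by simp
    have "drift \<epsilon> j s = 0" for j
      unfolding drift_def by (rule W_eqI) (simp add: wfun_modul wfun_zero \<sigma>0)
    then have "norm ((\<Sum>j. drift \<epsilon> j s) - ?v s) = norm (?v s)" by simp
    also have "\<dots> \<le> \<bar>\<mu>\<bar> * (B * norm (papp \<epsilon> s) ^ 3)" by (rule norm_vfield[OF m])
    also have "\<dots> \<le> \<bar>\<mu>\<bar> * (B * (M * E) ^ 3)" using B0 by (intro mult_left_mono power_mono norm_papp s) auto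
    also have "\<dots> \<le> ?K"
      using \<sigma>0 \<mu> \<epsilon> T LV0 B0 ME0 \<delta> by (auto intro!: mult_nonneg_nonneg add_nonneg_nonneg)
    finally show ?thesis .
  qed
  have K0: "?K \<ge> 0" using pt[OF t] norm_ge_zero order_trans by blast
  have "norm (integral {0..t} (\<lambda>s. (\<Sum>j. drift \<epsilon> j s) - ?v s)) \<le> integral {0..t} (\<lambda>s. ?K)"
    by (rule integral_norm_bound_integral[OF integrable_diff[OF iD iv]]) (use pt sub in auto)
  also have "\<dots> = t * ?K" using t by simp
  also have "\<dots> \<le> T * ?K" using t K0 by (intro mult_right_mono) auto
  finally have "norm (S + integral {0..t} (\<lambda>s. (\<Sum>j. drift \<epsilon> j s) - ?v s)) \<le> \<epsilon> * (T / 2 * (M * E)) + T * ?K"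
    using nS by (intro order_trans[OF norm_triangle_ineq] add_mono)
  also have "\<dots> = \<epsilon> * C1 + (1 - \<sigma>) * \<mu> * C2" unfolding C1_def C2_def by (simp add: algebra_simps)
  finally show ?thesis unfolding eq .
qed

text \<open>The Lipschitz constant of the field on the ball of radius \<open>M * E + 1\<close>,
  which contains the tube of radius 1 around \<open>papp\<close>.\<close>

definition "Lip = 3 * B * (M * E + 1)\<^sup>2"

lemma exact_solution:
  assumes \<epsilon>: "\<epsilon> > 0" and \<mu>: "0 \<le> \<mu>" "\<mu> \<le> 1" "\<sigma> = 1 \<Longrightarrow> \<mu> = 1"
    and small: "(\<epsilon> * C1 + (1 - \<sigma>) * \<mu> * C2) * exp (Lip * T) \<le> 1"
  shows "\<exists>v. continuous_on {0..T} v \<and> (\<forall>t\<in>{0..T}. v t = udata \<epsilon> + integral {0..t} (\<lambda>s. vfield m \<epsilon> \<mu> s (v s)) \<and>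
    norm (v t - papp \<epsilon> t) \<le> (\<epsilon> * C1 + (1 - \<sigma>) * \<mu> * C2) * exp (Lip * T))"
proof (rule ode_exists_near_approximation)
  let ?\<eta> = "\<epsilon> * C1 + (1 - \<sigma>) * \<mu> * C2"
  show "Lip \<ge> 0" unfolding Lip_def using B0 by simp
  show "?\<eta> \<ge> 0" using \<epsilon> \<mu> C1_nonneg C2_nonneg \<sigma> by auto
  show "T \<ge> 0" using T by simp
  show "continuous_on {0..T} (papp \<epsilon>)" by (rule continuous_papp)
  show "continuous_on {0..T} (\<lambda>t. vfield m \<epsilon> \<mu> t (u t))" if "continuous_on {0..T} u" for u
    by (rule continuous_on_vfield[OF m that])
  show "norm (papp \<epsilon> t - (udata \<epsilon> + integral {0..t} (\<lambda>s. vfield m \<epsilon> \<mu> s (papp \<epsilon> s)))) \<le> ?\<eta>" if "t \<in> {0..T}" for t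
    by (rule defect[OF \<epsilon> \<mu>(1,3) that])
  fix t and u v :: "('a, 1) W"
  assume t: "t \<in> {0..T}" and u: "norm (u - papp \<epsilon> t) \<le> ?\<eta> * exp (Lip * T)" and v: "norm (v - papp \<epsilon> t) \<le> ?\<eta> * exp (Lip * T)"
  have r: "norm w \<le> M * E + 1" if "norm (w - papp \<epsilon> t) \<le> ?\<eta> * exp (Lip * T)" for w
    using norm_triangle_ineq[of "w - papp \<epsilon> t" "papp \<epsilon> t"] that small norm_papp[OF t, of \<epsilon>] by simp
  show "norm (vfield m \<epsilon> \<mu> t u - vfield m \<epsilon> \<mu> t v) \<le> Lip * norm (u - v)"
    unfolding Lip_def by (rule vfield_lipschitz[OF m _ r[OF u] r[OF v]]) (use \<mu> in simp)
qed

end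

lemma vfield_ode_unique:
  fixes u v :: "real \<Rightarrow> ('a::euclidean_space, 1) W"
  assumes m: "symbol m B" and \<mu>: "\<bar>\<mu>\<bar> \<le> 1"
    and u: "continuous_on {0..T} u" "\<And>t. t \<in> {0..T} \<Longrightarrow> u t = u0 + integral {0..t} (\<lambda>s. vfield m \<epsilon> \<mu> s (u s))"
    and v: "continuous_on {0..T} v" "\<And>t. t \<in> {0..T} \<Longrightarrow> v t = u0 + integral {0..t} (\<lambda>s. vfield m \<epsilon> \<mu> s (v s))"
    and t: "t \<in> {0..T}"
  shows "u t = v t"
proof (rule ode_unique[OF _ _ u v t])
  show "continuous_on {0..T} (\<lambda>t. vfield m \<epsilon> \<mu> t (w t))" if "continuous_on {0..T} w" for w
    by (rule continuous_on_vfield[OF m that])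
  show "\<exists>L\<ge>0. \<forall>t\<in>{0..T}. \<forall>u v. norm u \<le> R \<longrightarrow> norm v \<le> R \<longrightarrow> norm (vfield m \<epsilon> \<mu> t u - vfield m \<epsilon> \<mu> t v) \<le> L * norm (u - v)" for R
    by (rule exI[of _ "3 * B * R\<^sup>2"]) (use vfield_lipschitz[OF m \<mu>] symbol_nonneg[OF m] in auto)
qed


section \<open>Pointwise form of the Hartree equation and of its approximation\<close>

lemma summable_iff_suminf_ennreal:
  fixes f :: "nat \<Rightarrow> real"
  assumes "\<And>n. 0 \<le> f n"
  shows "summable f \<longleftrightarrow> (\<Sum>n. ennreal (f n)) \<noteq> top"
proof
  assume "summable f"
  then have "(\<Sum>n. ennreal (f n)) = ennreal (suminf f)" by (rule suminf_ennreal2[OF assms])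
  then show "(\<Sum>n. ennreal (f n)) \<noteq> top" by simp
qed (rule summable_suminf_not_top[OF assms])

text \<open>Summability over a set of complex numbers is absolute, and \<open>infsum\<close> is 0
  otherwise. Written with an \<open>ennreal\<close> series both cases are measurable in a parameter,
  also at the exceptional points where the series of given amplitudes may diverge.\<close>

lemma infsum_nat_eq:
  fixes f :: "nat \<Rightarrow> complex"
  shows "infsum f \<Gamma> = (if (\<Sum>n. ennreal (norm (if n \<in> \<Gamma> then f n else 0))) \<noteq> top then (\<Sum>n. if n \<in> \<Gamma> then f n else 0) else 0)"
proof -
  let ?g = "\<lambda>n. if n \<in> \<Gamma> then f n else 0"
  have 1: "infsum f \<Gamma> = infsum ?g UNIV" by (rule infsum_cong_neutral) auto
  have 2: "summable (\<lambda>n. norm (?g n)) \<longleftrightarrow> (\<Sum>n. ennreal (norm (?g n))) \<noteq> top"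
    by (rule summable_iff_suminf_ennreal) simp
  show ?thesis
  proof (cases "summable (\<lambda>n. norm (?g n))")
    case True
    have "(?g has_sum suminf ?g) UNIV"
      by (rule norm_summable_imp_has_sum[OF True summable_sums[OF summable_norm_cancel[OF True]]])
    then have "infsum ?g UNIV = suminf ?g" by (rule infsumI)
    then show ?thesis using True 2 1 by presburger
  next
    case False
    have "\<not> ?g summable_on UNIV"
    proof
      assume "?g summable_on UNIV"
      then have "(\<lambda>n. norm (?g n)) summable_on UNIV" by (rule summable_on_iff_abs_summable_on_complex[THEN iffD1])
      then have "summable (\<lambda>n. norm (?g n))" by (rule summable_on_imp_summable)
      with False show False ..
    qed
    then have "infsum ?g UNIV = 0" by (rule infsum_not_exists)
    then show ?thesis using False 2 1 by presburger
  qed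
qed

lemma infsum_nat_eq_suminf:
  fixes f g :: "nat \<Rightarrow> complex"
  assumes "\<And>j. j \<in> \<Gamma> \<Longrightarrow> f j = g j" "\<And>j. j \<notin> \<Gamma> \<Longrightarrow> g j = 0" "summable (\<lambda>j. norm (g j))"
  shows "infsum f \<Gamma> = suminf g"
proof -
  have "infsum f \<Gamma> = infsum g UNIV" by (rule infsum_cong_neutral) (use assms in auto)
  also have "\<dots> = suminf g"
    by (rule infsumI[OF norm_summable_imp_has_sum[OF assms(3) summable_sums[OF summable_norm_cancel[OF assms(3)]]]])
  finally show ?thesis .
qed

lemma borel_measurable_infsum_nat:
  fixes f :: "nat \<Rightarrow> 'b \<Rightarrow> complex"
  assumes "\<And>j. j \<in> \<Gamma> \<Longrightarrow> f j \<in> borel_measurable N"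
  shows "(\<lambda>x. infsum (\<lambda>j. f j x) \<Gamma>) \<in> borel_measurable N"
proof -
  have [measurable]: "(\<lambda>x. if j \<in> \<Gamma> then f j x else 0) \<in> borel_measurable N" for j
    using assms by (cases "j \<in> \<Gamma>") auto
  show ?thesis unfolding infsum_nat_eq by measurable
qed

text \<open>The norm dominates the supremum, so the element and the point of evaluation may vary
  together.\<close>

lemma continuous_on_wfun_pair:
  fixes w :: "'b::first_countable_topology \<Rightarrow> ('a::euclidean_space, 'n) W"
  assumes w: "continuous_on S w" and h: "continuous_on S h"
  shows "continuous_on S (\<lambda>z. wfun (w z) (h z))"
  unfolding continuous_on_def
proof
  fix z0 assume z0: "z0 \<in> S"
  have 1: "((\<lambda>z. wfun (w z - w z0) (h z)) \<longlongrightarrow> 0) (at z0 within S)"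
  proof (rule Lim_null_comparison)
    show "\<forall>\<^sub>F z in at z0 within S. norm (wfun (w z - w z0) (h z)) \<le> norm (w z - w z0)"
      by (intro always_eventually allI norm_wfun_le)
    have "((\<lambda>z. norm (w z - w z0)) \<longlongrightarrow> norm (w z0 - w z0)) (at z0 within S)"
      using w z0 by (intro tendsto_intros) (auto simp: continuous_on_def)
    then show "((\<lambda>z. norm (w z - w z0)) \<longlongrightarrow> 0) (at z0 within S)" by simp
  qed
  have "isCont (wfun (w z0)) (h z0)"
    using continuous_on_wfun[of "w z0"] by (simp add: continuous_on_eq_continuous_at)
  then have 2: "((\<lambda>z. wfun (w z0) (h z)) \<longlongrightarrow> wfun (w z0) (h z0)) (at z0 within S)"
    by (rule isCont_tendsto_compose) (use h z0 in \<open>auto simp: continuous_on_def\<close>)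
  show "((\<lambda>z. wfun (w z) (h z)) \<longlongrightarrow> wfun (w z0) (h z0)) (at z0 within S)"
    using tendsto_add[OF 1 2] by (simp add: wfun_diff)
qed

section \<open>Duhamel's formula as an equation in the algebra\<close>

lemma schroedinger_group_wfun:
  fixes F :: "('a::euclidean_space, 1) W"
  assumes "f \<in> borel_measurable borel" "AE x in lborel. f x = wfun F x"
  shows "schroedinger_group \<epsilon> t f = wfun (schr \<epsilon> t F)"
  unfolding schroedinger_group_def schr_def
  by (rule fourier_multiplier_wfun[OF symbol_phase _ assms]) (simp add: cis_conv_exp)

lemma kernel_conv_wfun:
  fixes F :: "('a::euclidean_space, 1) W"
  assumes "symbol m B" "AE \<xi> in lborel. of_real (fnorm TYPE('a)) * hat K \<xi> = m \<xi>"
    and "f \<in> borel_measurable borel" "AE x in lborel. f x = wfun F x"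
  shows "kernel_conv K f = wfun (mulop m F)"
  unfolding kernel_conv_def
  by (rule fourier_multiplier_wfun[OF assms(1) assms(2)[unfolded fnorm_def] assms(3,4)])

lemma wiener_continuous_on_iff:
  "wiener_continuous_on S u \<longleftrightarrow>
    (\<exists>w :: real \<Rightarrow> ('a::euclidean_space, 1) W. continuous_on S w \<and> (\<forall>t\<in>S. u t = wfun (w t)))"
proof -
  have lim: "((\<lambda>s. wiener_norm (dist_of (\<lambda>x. u s x - u t x))) \<longlongrightarrow> 0) (at t within S) \<longleftrightarrow> (w \<longlongrightarrow> w t) (at t within S)"
    if w: "\<forall>t\<in>S. u t = wfun (w t)" and t: "t \<in> S" for w :: "real \<Rightarrow> ('a, 1) W" and t
  proof -
    have e: "wiener_norm (dist_of (\<lambda>x. u s x - u t x)) = fnorm TYPE('a) * norm (w s - w t)" if "s \<in> S" for s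
    proof -
      have "(\<lambda>x. u s x - u t x) = wfun (w s - w t)" using w t that by (simp add: wfun_diff)
      then show ?thesis by (simp only: wiener_norm_wfun)
    qed
    have "((\<lambda>s. wiener_norm (dist_of (\<lambda>x. u s x - u t x))) \<longlongrightarrow> 0) (at t within S) \<longleftrightarrow> ((\<lambda>s. fnorm TYPE('a) * norm (w s - w t)) \<longlongrightarrow> 0) (at t within S)"
      by (rule filterlim_cong[OF refl refl]) (simp add: eventually_at_filter e)
    also have "\<dots> \<longleftrightarrow> ((\<lambda>s. norm (w s - w t)) \<longlongrightarrow> 0) (at t within S)"
    proof
      assume "((\<lambda>s. fnorm TYPE('a) * norm (w s - w t)) \<longlongrightarrow> 0) (at t within S)"
      from tendsto_mult_left[OF this, of "inverse (fnorm TYPE('a))"]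
      show "((\<lambda>s. norm (w s - w t)) \<longlongrightarrow> 0) (at t within S)" by (simp add: mult.assoc[symmetric])
    next
      assume "((\<lambda>s. norm (w s - w t)) \<longlongrightarrow> 0) (at t within S)"
      from tendsto_mult_left[OF this, of "fnorm TYPE('a)"]
      show "((\<lambda>s. fnorm TYPE('a) * norm (w s - w t)) \<longlongrightarrow> 0) (at t within S)" by simp
    qed
    also have "\<dots> \<longleftrightarrow> (w \<longlongrightarrow> w t) (at t within S)" by (simp only: tendsto_norm_zero_iff Lim_null[symmetric])
    finally show ?thesis .
  qed
  show ?thesis
  proof
    assume u: "wiener_continuous_on S u"
    have "\<forall>t\<in>S. \<exists>w :: ('a, 1) W. u t = wfun w"
    proof
      fix t assume "t \<in> S"
      then have "u t \<in> wiener_fun" using u by (simp add: wiener_continuous_on_def)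
      then obtain f :: "('a, 1) W" where "wfun f = u t" by (rule wiener_fun_obtain)
      then show "\<exists>w :: ('a, 1) W. u t = wfun w" by metis
    qed
    from bchoice[OF this] obtain w :: "real \<Rightarrow> ('a, 1) W" where w: "\<forall>t\<in>S. u t = wfun (w t)" ..
    have "continuous_on S w"
      unfolding continuous_on_def
    proof
      fix t assume t: "t \<in> S"
      show "(w \<longlongrightarrow> w t) (at t within S)"
        using u t unfolding wiener_continuous_on_def by (simp only: lim[OF w t, symmetric])
    qed
    with w show "\<exists>w :: real \<Rightarrow> ('a, 1) W. continuous_on S w \<and> (\<forall>t\<in>S. u t = wfun (w t))" by blast
  next
    assume "\<exists>w :: real \<Rightarrow> ('a, 1) W. continuous_on S w \<and> (\<forall>t\<in>S. u t = wfun (w t))"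
    then obtain w :: "real \<Rightarrow> ('a, 1) W" where c: "continuous_on S w" and w: "\<forall>t\<in>S. u t = wfun (w t)" by blast
    show "wiener_continuous_on S u"
      unfolding wiener_continuous_on_def
    proof (intro conjI ballI)
      fix t assume t: "t \<in> S"
      show "u t \<in> wiener_fun" using w t wfun_wiener_fun by metis
      show "((\<lambda>s. wiener_norm (dist_of (\<lambda>x. u s x - u t x))) \<longlongrightarrow> 0) (at t within S)"
        unfolding lim[OF w t] using c t by (simp add: continuous_on_def)
    qed
  qed
qed

lemma LINT_eq_integral:
  fixes f :: "real \<Rightarrow> complex"
  assumes "continuous_on {0..t} f" "\<And>s. s \<in> {0..t} \<Longrightarrow> g s = f s"
  shows "(LINT s:{0..t}|lborel. g s) = integral {0..t} f"
proof -
  have "(LINT s:{0..t}|lborel. g s) = (LINT s:{0..t}|lborel. f s)"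
    by (rule set_lebesgue_integral_cong) (use assms in auto)
  also have "\<dots> = integral {0..t} f"
    by (rule set_borel_integral_eq_integral(2)[OF borel_integrable_atLeastAtMost'[OF assms(1)]])
  finally show ?thesis .
qed

text \<open>Evaluation at a point is a bounded functional and commutes with the integral, so the
  pointwise formula is an identity of elements; applying the invertible
  \<open>schr \<epsilon> (- t)\<close> turns it into the integral equation for \<open>v\<close>.
  This transfers both existence and uniqueness.\<close>

lemma hartree_solution_iff:
  fixes u :: "real \<Rightarrow> 'a::euclidean_space \<Rightarrow> complex" and U0 :: "('a, 1) W"
  assumes m: "symbol m B" and K: "AE \<xi> in lborel. of_real (fnorm TYPE('a)) * hat K \<xi> = m \<xi>"
    and u0: "u0 \<in> borel_measurable borel" "AE x in lborel. u0 x = wfun U0 x"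
  shows "hartree_solution K \<alpha> \<epsilon> u0 T u \<longleftrightarrow>
    (\<exists>v. continuous_on {0..T} v \<and> (\<forall>t\<in>{0..T}. v t = U0 + integral {0..t} (\<lambda>s. vfield m \<epsilon> (\<epsilon> powr (\<alpha> - 1)) s (v s))) \<and>
      (\<forall>t\<in>{0..T}. u t = wfun (schr \<epsilon> t (v t))))"
proof -
  let ?\<mu> = "\<epsilon> powr (\<alpha> - 1)"
  have key: "(\<forall>x. u t x = schroedinger_group \<epsilon> t u0 x - \<i> * complex_of_real ?\<mu> *
           (LINT \<tau>:{0..t}|lborel. schroedinger_group \<epsilon> (t - \<tau>)
                (\<lambda>y. kernel_conv K (\<lambda>z. complex_of_real ((norm (u \<tau> z))\<^sup>2)) y * u \<tau> y) x))
      \<longleftrightarrow> v t = U0 + integral {0..t} (\<lambda>s. vfield m \<epsilon> ?\<mu> s (v s))"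
    if v: "continuous_on {0..T} v" and u: "\<forall>t\<in>{0..T}. u t = wfun (schr \<epsilon> t (v t))" and t: "t \<in> {0..T}"
    for v :: "real \<Rightarrow> ('a, 1) W" and t
  proof -
    define w where "w s = schr \<epsilon> s (v s)" for s
    have sub: "{0..t} \<subseteq> {0..T}" using t by auto
    have w: "continuous_on {0..t} w"
      unfolding w_def by (intro continuous_on_schr continuous_on_subset[OF v sub] continuous_intros)
    have uw: "u s = wfun (w s)" if "s \<in> {0..t}" for s using u that sub by (auto simp: w_def)
    let ?g = "\<lambda>s. schr \<epsilon> (t - s) (hartree_nl m (w s))"
    have g: "continuous_on {0..t} ?g"
      by (rule continuous_on_schr[OF continuous_on_hartree_nl[OF m w]]) (intro continuous_intros)
    have integrand: "schroedinger_group \<epsilon> (t - s) (\<lambda>y. kernel_conv K (\<lambda>z. complex_of_real ((norm (u s z))\<^sup>2)) y * u s y) x = wfun (?g s) x"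
      if s: "s \<in> {0..t}" for s x
    proof -
      have d: "(\<lambda>z. complex_of_real ((norm (u s z))\<^sup>2)) = wfun (w s * conjW (w s))"
        unfolding uw[OF s] wfun_mult wfun_conjW complex_norm_square ..
      have "kernel_conv K (\<lambda>z. complex_of_real ((norm (u s z))\<^sup>2)) = wfun (mulop m (w s * conjW (w s)))"
        unfolding d by (rule kernel_conv_wfun[OF m K]) auto
      then have e: "(\<lambda>y. kernel_conv K (\<lambda>z. complex_of_real ((norm (u s z))\<^sup>2)) y * u s y) = wfun (hartree_nl m (w s))"
        unfolding hartree_nl_def wfun_mult uw[OF s] by simp
      show ?thesis unfolding e by (rule fun_cong[OF schroedinger_group_wfun]) auto
    qed
    have gi: "?g integrable_on {0..t}" by (rule integrable_continuous_interval[OF g])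
    have L: "(LINT \<tau>:{0..t}|lborel. schroedinger_group \<epsilon> (t - \<tau>)
                (\<lambda>y. kernel_conv K (\<lambda>z. complex_of_real ((norm (u \<tau> z))\<^sup>2)) y * u \<tau> y) x) = wfun (integral {0..t} ?g) x" for x
    proof -
      have "(LINT \<tau>:{0..t}|lborel. schroedinger_group \<epsilon> (t - \<tau>)
                (\<lambda>y. kernel_conv K (\<lambda>z. complex_of_real ((norm (u \<tau> z))\<^sup>2)) y * u \<tau> y) x) = integral {0..t} (\<lambda>s. wfun (?g s) x)"
        by (rule LINT_eq_integral[OF continuous_on_bl[OF bounded_linear_wfun g] integrand])
      also have "\<dots> = wfun (integral {0..t} ?g) x"
        using integral_linear[OF gi bounded_linear_wfun[of x]] by (simp add: o_def)
      finally show ?thesis .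
    qed
    have vf: "vfield m \<epsilon> ?\<mu> s (v s) = schr \<epsilon> (- t) (cscale (- \<i> * of_real ?\<mu>) (?g s))" for s
      unfolding vfield_def w_def[symmetric] schr_cscale schr_schr by simp
    let ?h = "\<lambda>f :: ('a, 1) W. schr \<epsilon> (- t) (cscale (- \<i> * of_real ?\<mu>) f)"
    have "integral {0..t} (?h \<circ> ?g) = ?h (integral {0..t} ?g)"
      by (rule integral_linear[OF gi bounded_linear_compose[OF bounded_linear_schr bounded_linear_cscale]])
    then have I: "integral {0..t} (\<lambda>s. vfield m \<epsilon> ?\<mu> s (v s)) = ?h (integral {0..t} ?g)"
      unfolding vf by (simp add: o_def)
    have ut: "u t = wfun (schr \<epsilon> t (v t))" using u t by blast
    have sg: "schroedinger_group \<epsilon> t u0 = wfun (schr \<epsilon> t U0)" by (rule schroedinger_group_wfun[OF u0])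
    have "(\<forall>x. u t x = schroedinger_group \<epsilon> t u0 x - \<i> * complex_of_real ?\<mu> * wfun (integral {0..t} ?g) x)
      \<longleftrightarrow> schr \<epsilon> t (v t) = schr \<epsilon> t U0 + cscale (- \<i> * of_real ?\<mu>) (integral {0..t} ?g)"
      unfolding ut sg wfun_inject[symmetric] wfun_add wfun_cscale by (simp add: fun_eq_iff)
    also have "\<dots> \<longleftrightarrow> v t = U0 + ?h (integral {0..t} ?g)"
    proof -
      interpret s1: bounded_linear "schr \<epsilon> (- t) :: ('a, 1) W \<Rightarrow> _" by (rule bounded_linear_schr)
      interpret s2: bounded_linear "schr \<epsilon> t :: ('a, 1) W \<Rightarrow> _" by (rule bounded_linear_schr)
      have c1: "schr \<epsilon> (- t) (schr \<epsilon> t x) = x" and c2: "schr \<epsilon> t (schr \<epsilon> (- t) x) = x" for x :: "('a, 1) W"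
        by (simp_all add: schr_schr)
      show ?thesis
      proof
        assume "schr \<epsilon> t (v t) = schr \<epsilon> t U0 + cscale (- \<i> * of_real ?\<mu>) (integral {0..t} ?g)"
        from arg_cong[OF this, of "schr \<epsilon> (- t)"] show "v t = U0 + ?h (integral {0..t} ?g)"
          by (simp only: s1.add c1)
      next
        assume "v t = U0 + ?h (integral {0..t} ?g)"
        from arg_cong[OF this, of "schr \<epsilon> t"] show "schr \<epsilon> t (v t) = schr \<epsilon> t U0 + cscale (- \<i> * of_real ?\<mu>) (integral {0..t} ?g)"
          by (simp only: s2.add c2)
      qed
    qed
    finally show ?thesis unfolding L I .
  qed
  show ?thesis
  proof
    assume h: "hartree_solution K \<alpha> \<epsilon> u0 T u"
    then have "wiener_continuous_on {0..T} u" by (simp add: hartree_solution_def)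
    then obtain w :: "real \<Rightarrow> ('a, 1) W" where w: "continuous_on {0..T} w" "\<forall>t\<in>{0..T}. u t = wfun (w t)"
      unfolding wiener_continuous_on_iff by blast
    define v where "v t = schr \<epsilon> (- t) (w t)" for t
    have v: "continuous_on {0..T} v" unfolding v_def by (intro continuous_on_schr w continuous_intros)
    have u: "\<forall>t\<in>{0..T}. u t = wfun (schr \<epsilon> t (v t))" using w(2) by (simp add: v_def schr_schr)
    have "\<forall>t\<in>{0..T}. v t = U0 + integral {0..t} (\<lambda>s. vfield m \<epsilon> ?\<mu> s (v s))"
    proof
      fix t assume t: "t \<in> {0..T}"
      show "v t = U0 + integral {0..t} (\<lambda>s. vfield m \<epsilon> ?\<mu> s (v s))"
        using h t unfolding key[OF v u t, symmetric] hartree_solution_def by blast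
    qed
    with v u show "\<exists>v. continuous_on {0..T} v \<and> (\<forall>t\<in>{0..T}. v t = U0 + integral {0..t} (\<lambda>s. vfield m \<epsilon> ?\<mu> s (v s))) \<and>
      (\<forall>t\<in>{0..T}. u t = wfun (schr \<epsilon> t (v t)))" by blast
  next
    assume "\<exists>v. continuous_on {0..T} v \<and> (\<forall>t\<in>{0..T}. v t = U0 + integral {0..t} (\<lambda>s. vfield m \<epsilon> ?\<mu> s (v s))) \<and>
      (\<forall>t\<in>{0..T}. u t = wfun (schr \<epsilon> t (v t)))"
    then obtain v where v: "continuous_on {0..T} v"
      and eq: "\<forall>t\<in>{0..T}. v t = U0 + integral {0..t} (\<lambda>s. vfield m \<epsilon> ?\<mu> s (v s))"
      and u: "\<forall>t\<in>{0..T}. u t = wfun (schr \<epsilon> t (v t))" by blast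
    have "continuous_on {0..T} (\<lambda>t. schr \<epsilon> t (v t))" by (intro continuous_on_schr v continuous_intros)
    with u have "wiener_continuous_on {0..T} u" unfolding wiener_continuous_on_iff by blast
    then show "hartree_solution K \<alpha> \<epsilon> u0 T u"
      unfolding hartree_solution_def
    proof (intro conjI ballI)
      fix t assume t: "t \<in> {0..T}"
      show "\<forall>x. u t x = schroedinger_group \<epsilon> t u0 x - \<i> * complex_of_real ?\<mu> *
           (LINT \<tau>:{0..t}|lborel. schroedinger_group \<epsilon> (t - \<tau>)
                (\<lambda>y. kernel_conv K (\<lambda>z. complex_of_real ((norm (u \<tau> z))\<^sup>2)) y * u \<tau> y) x)"
        unfolding key[OF v u t] using eq t by blast
    qed
  qed
qed


text \<open>The given amplitudes \<open>a0\<close> are measurable functions that agree with the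
  continuous elements \<open>a\<close> only almost everywhere, so pointwise formulas hold off a null
  set. The indices are countable, hence one null set serves all modes.\<close>

locale wkb_hartree = wkb m B k a \<delta> T \<sigma>
  for m :: "'a::euclidean_space \<Rightarrow> complex" and B :: real and k :: "nat \<Rightarrow> 'a" and a :: "nat \<Rightarrow> ('a, 3) W"
    and \<delta> T \<sigma> :: real +
  fixes K :: "'a functional" and \<Gamma> :: "nat set" and a0 :: "nat \<Rightarrow> 'a \<Rightarrow> complex" and \<alpha> :: real
  assumes K: "AE \<xi> in lborel. of_real (fnorm TYPE('a)) * hat K \<xi> = m \<xi>"
    and a0_meas: "\<And>j. j \<in> \<Gamma> \<Longrightarrow> a0 j \<in> borel_measurable borel"
    and a0_AE: "\<And>j. j \<in> \<Gamma> \<Longrightarrow> AE x in lborel. a0 j x = wfun (a j) x"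
    and a_outside: "\<And>j. j \<notin> \<Gamma> \<Longrightarrow> a j = 0"
    and \<sigma>_eq: "\<sigma> = (if \<alpha> = 1 then 1 else 0)"
begin

lemma a0_AE_all: "AE x in lborel. \<forall>j\<in>\<Gamma>. a0 j x = wfun (a j) x"
  by (subst AE_ball_countable) (auto intro: a0_AE)

lemma wfun_a_outside: "j \<notin> \<Gamma> \<Longrightarrow> wfun (a j) x = 0"
  by (simp add: a_outside wfun_zero)

lemma initial_data_measurable: "initial_data \<Gamma> k a0 \<epsilon> \<in> borel_measurable borel"
  unfolding initial_data_def
proof (rule borel_measurable_infsum_nat)
  fix j assume "j \<in> \<Gamma>"
  then have [measurable]: "a0 j \<in> borel_measurable borel" by (rule a0_meas)
  have e: "exp (\<i> * complex_of_real ((k j \<bullet> x) / \<epsilon>)) = cis ((k j \<bullet> x) / \<epsilon>)" for x by (simp add: cis_conv_exp)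
  show "(\<lambda>x. a0 j x * exp (\<i> * complex_of_real ((k j \<bullet> x) / \<epsilon>))) \<in> borel_measurable borel" unfolding e by measurable
qed

lemma initial_data_AE: "AE x in lborel. initial_data \<Gamma> k a0 \<epsilon> x = wfun (udata \<epsilon>) x"
  using a0_AE_all
proof eventually_elim
  case (elim x)
  let ?f = "\<lambda>j. modul (k j /\<^sub>R \<epsilon>) (incl (a j))"
  have s: "summable ?f"
    by (rule norm_suminf_le_suminf(1)[OF _ sum_a], unfold norm_modul, rule norm_incl_le)
  have "wfun (udata \<epsilon>) x = (\<Sum>j. wfun (?f j) x)"
    unfolding udata_def by (rule bounded_linear.suminf[OF bounded_linear_wfun s])
  moreover have "initial_data \<Gamma> k a0 \<epsilon> x = (\<Sum>j. wfun (?f j) x)"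
    unfolding initial_data_def
  proof (rule infsum_nat_eq_suminf)
    show "a0 j x * exp (\<i> * complex_of_real ((k j \<bullet> x) / \<epsilon>)) = wfun (?f j) x" if "j \<in> \<Gamma>" for j
      using elim that by (simp add: wfun_modul cis_conv_exp divide_inverse mult.commute)
    show "wfun (?f j) x = 0" if "j \<notin> \<Gamma>" for j
      using that by (simp add: wfun_modul wfun_a_outside)
    show "summable (\<lambda>j. norm (wfun (?f j) x))"
    proof (rule summable_comparison_test'[OF sum_a, of 0])
      show "norm (norm (wfun (?f j) x)) \<le> norm (a j)" for j
        using norm_wfun_le[of "?f j" x] norm_incl_le[of "a j"] by simp
    qed
  qed
  ultimately show ?case by simp
qed

text \<open>The inner sum is the total density at time \<tau>, translated by
  \<open>(t - \<tau>) *\<^sub>R k j\<close>, and convolution with the kernel commutes with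
  translations.\<close>

lemma kernel_density:
  "kernel_conv K (\<lambda>y. \<Sum>\<^sub>\<infinity>l\<in>\<Gamma>. complex_of_real ((norm (a0 l (y + (\<tau> - t) *\<^sub>R k j - \<tau> *\<^sub>R k l)))\<^sup>2)) x
    = wfun (Vj j \<tau>) (x - t *\<^sub>R k j)"
proof -
  let ?f = "\<lambda>y. \<Sum>\<^sub>\<infinity>l\<in>\<Gamma>. complex_of_real ((norm (a0 l (y + (\<tau> - t) *\<^sub>R k j - \<tau> *\<^sub>R k l)))\<^sup>2)"
  let ?h = "\<lambda>l. \<tau> *\<^sub>R k l - (\<tau> - t) *\<^sub>R k j"
  let ?s = "(t - \<tau>) *\<^sub>R k j"
  have e: "y + (\<tau> - t) *\<^sub>R k j - \<tau> *\<^sub>R k l = y - ?h l" for y l by simp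
  have fm: "?f \<in> borel_measurable borel"
  proof (rule borel_measurable_infsum_nat)
    fix l assume "l \<in> \<Gamma>"
    then have [measurable]: "a0 l \<in> borel_measurable borel" by (rule a0_meas)
    show "(\<lambda>y. complex_of_real ((norm (a0 l (y + (\<tau> - t) *\<^sub>R k j - \<tau> *\<^sub>R k l)))\<^sup>2)) \<in> borel_measurable borel" by measurable
  qed
  have "AE y in lborel. \<forall>l\<in>\<Gamma>. a0 l (y - ?h l) = wfun (a l) (y - ?h l)"
    by (subst AE_ball_countable) (auto intro: AE_lborel_shift[OF a0_AE])
  then have "AE y in lborel. ?f y = wfun (incl (transl ?s (\<Sum>l. dens l \<tau>))) y"
  proof eventually_elim
    case (elim y)
    have "wfun (incl (transl ?s (\<Sum>l. dens l \<tau>))) y = wfun (\<Sum>l. dens l \<tau>) (y - ?s)" by (simp add: wfun_transl)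
    also have "\<dots> = (\<Sum>l. wfun (dens l \<tau>) (y - ?s))" by (rule bounded_linear.suminf[OF bounded_linear_wfun summable_dens])
    finally have 1: "wfun (incl (transl ?s (\<Sum>l. dens l \<tau>))) y = (\<Sum>l. wfun (dens l \<tau>) (y - ?s))" .
    have d: "wfun (dens l \<tau>) (y - ?s) = complex_of_real ((norm (wfun (a l) (y - ?h l)))\<^sup>2)" for l
    proof -
      have "y - ?s - \<tau> *\<^sub>R k l = y - ?h l" by (simp add: algebra_simps)
      then show ?thesis unfolding dens_def wfun_transl wfun_mult wfun_conjW complex_norm_square by (simp only:)
    qed
    have 2: "?f y = (\<Sum>l. wfun (dens l \<tau>) (y - ?s))"
    proof (rule infsum_nat_eq_suminf)
      show "complex_of_real ((norm (a0 l (y + (\<tau> - t) *\<^sub>R k j - \<tau> *\<^sub>R k l)))\<^sup>2) = wfun (dens l \<tau>) (y - ?s)" if "l \<in> \<Gamma>" for l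
        unfolding d e using elim that by simp
      show "wfun (dens l \<tau>) (y - ?s) = 0" if "l \<notin> \<Gamma>" for l unfolding d using that by (simp add: wfun_a_outside)
      show "summable (\<lambda>l. norm (wfun (dens l \<tau>) (y - ?s)))"
      proof (rule summable_comparison_test'[OF dens_summable(1), of 0])
        show "norm (norm (wfun (dens l \<tau>) (y - ?s))) \<le> norm (a l) * M" for l
          using order_trans[OF norm_wfun_le norm_dens] by simp
      qed
    qed
    show ?case unfolding 1 2 ..
  qed
  from kernel_conv_wfun[OF m K fm this]
  have "kernel_conv K ?f = wfun (mulop m (incl (transl ?s (\<Sum>l. dens l \<tau>))))" .
  also have "mulop m (incl (transl ?s (\<Sum>l. dens l \<tau>))) = incl (transl ?s (V \<tau>))"
    unfolding V_def by (simp only: incl_mulop[OF m] transl_mulop[OF m])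
  finally have "kernel_conv K ?f x = wfun (V \<tau>) (x - ?s)" by (simp add: wfun_transl)
  then show ?thesis unfolding Vj_def wfun_transl by (simp add: algebra_simps)
qed

lemma phase_shift_eq:
  "phase_shift K \<alpha> \<Gamma> k a0 j t x = - (of_real \<sigma> * integral {0..t} (\<lambda>\<tau>. wfun (Vj j \<tau>) (x - t *\<^sub>R k j)))"
proof (cases "\<alpha> = 1")
  case True
  have "(LINT \<tau>:{0..t}|lborel. kernel_conv K (\<lambda>y. \<Sum>\<^sub>\<infinity>l\<in>\<Gamma>. complex_of_real ((norm (a0 l (y + (\<tau> - t) *\<^sub>R k j - \<tau> *\<^sub>R k l)))\<^sup>2)) x)
    = integral {0..t} (\<lambda>\<tau>. wfun (Vj j \<tau>) (x - t *\<^sub>R k j))"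
    by (rule LINT_eq_integral[OF continuous_on_bl[OF bounded_linear_wfun continuous_Vj] kernel_density])
  then show ?thesis using True by (simp add: phase_shift_def \<sigma>_eq)
qed (simp add: phase_shift_def \<sigma>_eq)

lemma phase_shift_real: "phase_shift K \<alpha> \<Gamma> k a0 j t x \<in> \<real>"
proof -
  have "cnj (integral {0..t} (\<lambda>\<tau>. wfun (Vj j \<tau>) (x - t *\<^sub>R k j))) = integral {0..t} (\<lambda>\<tau>. wfun (Vj j \<tau>) (x - t *\<^sub>R k j))"
    unfolding Henstock_Kurzweil_Integration.integral_cnj using wfun_Vj_real by (simp add: Reals_cnj_iff)
  then show ?thesis unfolding phase_shift_eq Reals_cnj_iff by simp
qed

lemma approx_solution_eq:
  assumes t: "t \<in> {0..T}" and x: "\<forall>j\<in>\<Gamma>. a0 j (x - t *\<^sub>R k j) = wfun (a j) (x - t *\<^sub>R k j)"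
  shows "approx_solution K \<alpha> \<Gamma> k a0 \<epsilon> t x = wfun (uapp \<epsilon> t) x"
proof -
  have u: "wfun (uapp \<epsilon> t) x = (\<Sum>j. wfun (mode \<epsilon> j t) x)"
    unfolding uapp_def by (rule bounded_linear.suminf[OF bounded_linear_wfun summable_mode[OF t]])
  have mode: "wfun (mode \<epsilon> j t) x = wfun (a j) (x - t *\<^sub>R k j) * exp (\<i> * phase_shift K \<alpha> \<Gamma> k a0 j t x)
      * exp (\<i> * complex_of_real ((k j \<bullet> x) / \<epsilon> - t * (norm (k j))\<^sup>2 / (2 * \<epsilon>)))" for j
  proof -
    have "cis (- (t * (norm (k j))\<^sup>2 / (2 * \<epsilon>))) * cis ((k j /\<^sub>R \<epsilon>) \<bullet> x) = exp (\<i> * complex_of_real ((k j \<bullet> x) / \<epsilon> - t * (norm (k j))\<^sup>2 / (2 * \<epsilon>)))"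
    proof -
      have e: "(k j /\<^sub>R \<epsilon>) \<bullet> x = (k j \<bullet> x) / \<epsilon>" unfolding inner_scaleR_left divide_inverse by (rule mult.commute)
      show ?thesis unfolding cis_mult cis_conv_exp[symmetric] e by (rule arg_cong[where f=cis]) (rule uminus_add_conv_diff)
    qed
    then have "wfun (mode \<epsilon> j t) x = exp (\<i> * complex_of_real ((k j \<bullet> x) / \<epsilon> - t * (norm (k j))\<^sup>2 / (2 * \<epsilon>))) * wfun (amp j t) (x - t *\<^sub>R k j)"
      unfolding mode_def phase_def wfun_cscale wfun_modul wfun_transl wfun_incl by (simp only: mult.assoc[symmetric])
    moreover have "- \<i> * of_real \<sigma> * I = \<i> * (- (of_real \<sigma> * I))" for I by simp
    ultimately show ?thesis unfolding wfun_amp[OF t] phase_shift_eq by (simp only: mult.commute)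
  qed
  have ap: "approx_solution K \<alpha> \<Gamma> k a0 \<epsilon> t x = (\<Sum>j. wfun (mode \<epsilon> j t) x)"
    unfolding approx_solution_def
  proof (rule infsum_nat_eq_suminf)
    show "a0 j (x - t *\<^sub>R k j) * exp (\<i> * phase_shift K \<alpha> \<Gamma> k a0 j t x) * exp (\<i> * complex_of_real ((k j \<bullet> x) / \<epsilon> - t * (norm (k j))\<^sup>2 / (2 * \<epsilon>)))
      = wfun (mode \<epsilon> j t) x" if "j \<in> \<Gamma>" for j
      unfolding mode using x that by simp
    show "wfun (mode \<epsilon> j t) x = 0" if "j \<notin> \<Gamma>" for j unfolding mode using that by (simp add: wfun_a_outside)
    show "summable (\<lambda>j. norm (wfun (mode \<epsilon> j t) x))"
    proof (rule summable_comparison_test'[OF summable_aE(1), of 0])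
      show "norm (norm (wfun (mode \<epsilon> j t) x)) \<le> norm (a j) * E" for j
        using order_trans[OF norm_wfun_le norm_mode[OF t]] by simp
    qed
  qed
  show ?thesis by (rule trans[OF ap u[symmetric]])
qed

section \<open>Measurability and the essential supremum on the space-time slab\<close>

abbreviation "slab \<equiv> {0..T} \<times> (UNIV :: 'a set)"

lemma slab_measurable: "slab \<in> sets borel"
  by (intro borel_closed closed_Times) auto

lemma restrict_slab: "sets (restrict_space lborel slab) = sets (restrict_space borel slab)"
  by (rule sets_restrict_space_cong) simp

lemma continuous_imp_slab_measurable:
  "continuous_on slab f \<Longrightarrow> f \<in> borel_measurable (restrict_space lborel slab)"
  for f :: "real \<times> 'a \<Rightarrow> 'c::topological_space"
  unfolding measurable_cong_sets[OF restrict_slab refl] by (rule borel_measurable_continuous_on_restrict)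

text \<open>Part of the error bound, since the essential supremum of a function that is not
  measurable counts as infinite. The phases and exponentials are continuous on the slab; only the
  amplitudes are merely measurable.\<close>

lemma approx_solution_measurable:
  "(\<lambda>(t, x). approx_solution K \<alpha> \<Gamma> k a0 \<epsilon> t x) \<in> borel_measurable (restrict_space lborel slab)"
proof -
  have "(\<lambda>z. approx_solution K \<alpha> \<Gamma> k a0 \<epsilon> (fst z) (snd z)) \<in> borel_measurable (restrict_space lborel slab)"
    unfolding approx_solution_def
  proof (rule borel_measurable_infsum_nat)
    fix j assume j: "j \<in> \<Gamma>"
    let ?y = "\<lambda>z::real \<times> 'a. snd z - fst z *\<^sub>R k j"
    have [measurable]: "a0 j \<in> borel_measurable borel" using j by (rule a0_meas)
    have "?y \<in> borel_measurable (restrict_space lborel slab)"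
      by (rule continuous_imp_slab_measurable) (intro continuous_intros)
    then have 1: "(\<lambda>z. a0 j (?y z)) \<in> borel_measurable (restrict_space lborel slab)"
      by (rule measurable_compose) measurable
    have iV: "integral {0..fst z} (\<lambda>\<tau>. wfun (Vj j \<tau>) (?y z)) = wfun (integral {0..fst z} (Vj j)) (?y z)" for z
      using integral_linear[OF integrable_continuous_interval[OF continuous_Vj[of "fst z"]] bounded_linear_wfun] by (simp add: o_def)
    have cI: "continuous_on slab (\<lambda>z. integral {0..fst z} (Vj j))"
      by (rule continuous_on_compose2[OF indefinite_integral_continuous_1[OF integrable_continuous_interval[OF continuous_Vj[of T j]]] continuous_on_fst[OF continuous_on_id]]) auto
    have 2: "(\<lambda>z. exp (\<i> * phase_shift K \<alpha> \<Gamma> k a0 j (fst z) (snd z))) \<in> borel_measurable (restrict_space lborel slab)"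
      unfolding phase_shift_eq iV
      by (rule continuous_imp_slab_measurable) (intro continuous_intros continuous_on_wfun_pair cI)
    have 3: "(\<lambda>z. exp (\<i> * complex_of_real ((k j \<bullet> snd z) / \<epsilon> - fst z * (norm (k j))\<^sup>2 / (2 * \<epsilon>)))) \<in> borel_measurable (restrict_space lborel slab)"
      unfolding cis_conv_exp[symmetric] divide_inverse
      by (rule continuous_imp_slab_measurable) (intro continuous_intros)
    show "(\<lambda>z. a0 j (?y z) * exp (\<i> * phase_shift K \<alpha> \<Gamma> k a0 j (fst z) (snd z)) * exp (\<i> * complex_of_real ((k j \<bullet> snd z) / \<epsilon> - fst z * (norm (k j))\<^sup>2 / (2 * \<epsilon>)))) \<in> borel_measurable (restrict_space lborel slab)"
      using 1 2 3 by (intro borel_measurable_times)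
  qed
  then show ?thesis by (simp add: case_prod_beta)
qed

text \<open>At each fixed time the exceptional set of a mode is a translate of a null set, so by
  Fubini it is null in space-time.\<close>

lemma a0_AE_slab:
  "AE z in restrict_space lborel slab. \<forall>j\<in>\<Gamma>. a0 j (snd z - fst z *\<^sub>R k j) = wfun (a j) (snd z - fst z *\<^sub>R k j)"
proof -
  have "AE z in (lborel :: (real \<times> 'a) measure). a0 j (snd z - fst z *\<^sub>R k j) = wfun (a j) (snd z - fst z *\<^sub>R k j)" if j: "j \<in> \<Gamma>" for j
  proof -
    have [measurable]: "a0 j \<in> borel_measurable borel" using j by (rule a0_meas)
    have "AE z in (lborel :: real measure) \<Otimes>\<^sub>M (lborel :: 'a measure). a0 j (snd z - fst z *\<^sub>R k j) = wfun (a j) (snd z - fst z *\<^sub>R k j)"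
    proof (rule lborel_pair.AE_pair_measure)
      show "{z \<in> space ((lborel :: real measure) \<Otimes>\<^sub>M (lborel :: 'a measure)). a0 j (snd z - fst z *\<^sub>R k j) = wfun (a j) (snd z - fst z *\<^sub>R k j)} \<in> sets (lborel \<Otimes>\<^sub>M lborel)"
        by measurable
      show "AE t in (lborel :: real measure). AE x in lborel. a0 j (snd (t, x) - fst (t, x) *\<^sub>R k j) = wfun (a j) (snd (t, x) - fst (t, x) *\<^sub>R k j)"
        unfolding fst_conv snd_conv by (rule AE_I2) (rule AE_lborel_shift[OF a0_AE[OF j]])
    qed
    then show ?thesis unfolding lborel_prod .
  qed
  then have "AE z in (lborel :: (real \<times> 'a) measure). \<forall>j\<in>\<Gamma>. a0 j (snd z - fst z *\<^sub>R k j) = wfun (a j) (snd z - fst z *\<^sub>R k j)"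
    by (subst AE_ball_countable) auto
  then show ?thesis
    by (subst AE_restrict_space_iff) (use slab_measurable in auto)
qed

lemma slab_error:
  assumes \<epsilon>: "\<epsilon> > 0" and v: "continuous_on {0..T} v"
    and b: "\<And>t. t \<in> {0..T} \<Longrightarrow> norm (v t - papp \<epsilon> t) \<le> c"
  shows "Linfty_norm_slab T (\<lambda>t x. wfun (schr \<epsilon> t (v t)) x - approx_solution K \<alpha> \<Gamma> k a0 \<epsilon> t x) \<le> ereal c"
  unfolding Linfty_norm_slab_def
proof (rule esssup_I)
  have w: "continuous_on {0..T} (\<lambda>t. schr \<epsilon> t (v t))" by (intro continuous_on_schr v continuous_intros)
  have "continuous_on slab (\<lambda>z. wfun (schr \<epsilon> (fst z) (v (fst z))) (snd z))"
    by (rule continuous_on_wfun_pair[OF continuous_on_compose2[OF w continuous_on_fst[OF continuous_on_id]] continuous_on_snd[OF continuous_on_id]]) auto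
  from continuous_imp_slab_measurable[OF this]
  have "(\<lambda>(t, x). wfun (schr \<epsilon> t (v t)) x) \<in> borel_measurable (restrict_space lborel slab)" by (simp add: case_prod_beta)
  from borel_measurable_diff[OF this approx_solution_measurable[of \<epsilon>]]
  have d: "(\<lambda>(t, x). wfun (schr \<epsilon> t (v t)) x - approx_solution K \<alpha> \<Gamma> k a0 \<epsilon> t x) \<in> borel_measurable (restrict_space lborel slab)"
    by (simp add: case_prod_beta)
  have "(\<lambda>w::complex. ereal (norm w)) \<in> borel_measurable borel" by measurable
  from measurable_compose[OF d this]
  show "(\<lambda>(t, x). ereal (norm (wfun (schr \<epsilon> t (v t)) x - approx_solution K \<alpha> \<Gamma> k a0 \<epsilon> t x))) \<in> borel_measurable (restrict_space lborel slab)"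
    by (simp add: case_prod_beta)
  have sp: "AE z in restrict_space lborel slab. z \<in> slab"
    by (rule AE_I2) (simp add: space_restrict_space)
  show "AE z in restrict_space lborel slab. (case z of (t, x) \<Rightarrow> ereal (norm (wfun (schr \<epsilon> t (v t)) x - approx_solution K \<alpha> \<Gamma> k a0 \<epsilon> t x))) \<le> ereal c"
    using a0_AE_slab sp
  proof eventually_elim
    case (elim z)
    obtain t x where z: "z = (t, x)" by (cases z)
    have t: "t \<in> {0..T}" using elim z by simp
    have "approx_solution K \<alpha> \<Gamma> k a0 \<epsilon> t x = wfun (uapp \<epsilon> t) x"
      by (rule approx_solution_eq[OF t]) (use elim z in simp)
    then have "norm (wfun (schr \<epsilon> t (v t)) x - approx_solution K \<alpha> \<Gamma> k a0 \<epsilon> t x) = norm (wfun (schr \<epsilon> t (v t) - schr \<epsilon> t (papp \<epsilon> t)) x)"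
      by (simp add: wfun_diff schr_papp[OF \<epsilon> t])
    also have "\<dots> \<le> norm (schr \<epsilon> t (v t) - schr \<epsilon> t (papp \<epsilon> t))" by (rule norm_wfun_le)
    also have "\<dots> = norm (v t - papp \<epsilon> t)"
      by (simp flip: linear_diff[OF bounded_linear.linear[OF bounded_linear_schr]])
    also have "\<dots> \<le> c" by (rule b[OF t])
    finally show ?case by (simp add: z)
  qed
qed

end

section \<open>Summable data, the error exponent and the choice of constants\<close>

lemma summable_on_nat_indicator:
  fixes f :: "nat \<Rightarrow> real"
  assumes "f summable_on \<Gamma>"
  shows "summable (\<lambda>j. if j \<in> \<Gamma> then f j else 0)"
proof (rule summable_on_imp_summable)
  have "f summable_on \<Gamma> \<longleftrightarrow> (\<lambda>j. if j \<in> \<Gamma> then f j else 0) summable_on UNIV"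
    by (rule summable_on_cong_neutral) auto
  then show "(\<lambda>j. if j \<in> \<Gamma> then f j else 0) summable_on UNIV" using assms by (rule iffD1)
qed

text \<open>For \<alpha> above 1 the exponent is the smaller of 1 and \<open>\<alpha> - 1\<close>,
  so it covers both error terms when \<epsilon> is at most 1. At \<open>\<alpha> = 1\<close> the
  second term is switched off, which is why the exponent jumps back to 1.\<close>

lemma error_exponent_bound:
  assumes \<alpha>: "\<alpha> \<ge> 1" and \<epsilon>: "0 < \<epsilon>" "\<epsilon> \<le> 1" and C: "C1 \<ge> 0" "C2 \<ge> 0"
  shows "\<epsilon> * C1 + (1 - (if \<alpha> = 1 then 1 else 0)) * \<epsilon> powr (\<alpha> - 1) * C2 \<le> \<epsilon> powr error_exponent \<alpha> * (C1 + C2)"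
proof -
  have mono: "\<epsilon> powr a \<le> \<epsilon> powr b" if "b \<le> a" for a b
    using that \<epsilon> by (intro powr_mono') auto
  have p1: "\<epsilon> powr 1 = \<epsilon>" using \<epsilon> by simp
  have "\<epsilon> \<le> \<epsilon> powr error_exponent \<alpha>"
    using mono[of "error_exponent \<alpha>" 1] unfolding p1 error_exponent_def by (auto split: if_splits)
  then have 1: "\<epsilon> * C1 \<le> \<epsilon> powr error_exponent \<alpha> * C1" using C(1) by (rule mult_right_mono)
  show ?thesis
  proof (cases "\<alpha> = 1")
    case True
    have "0 \<le> \<epsilon> powr error_exponent \<alpha> * C2" using C by simp
    with 1 True show ?thesis by (simp add: distrib_left)
  next
    case False
    have "\<epsilon> powr (\<alpha> - 1) \<le> \<epsilon> powr error_exponent \<alpha>"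
      by (rule mono) (use False in \<open>auto simp: error_exponent_def\<close>)
    then have "\<epsilon> powr (\<alpha> - 1) * C2 \<le> \<epsilon> powr error_exponent \<alpha> * C2" using C(2) by (rule mult_right_mono)
    with 1 False show ?thesis by (simp add: distrib_left)
  qed
qed

lemma error_exponent_pos: "\<alpha> \<ge> 1 \<Longrightarrow> error_exponent \<alpha> > 0"
  by (auto simp: error_exponent_def)

theorem theorem1p2:
  fixes \<alpha> :: real
    and J :: enat
    and \<Gamma> :: "nat set"
    and k :: "nat \<Rightarrow> 'a::euclidean_space"
    and a :: "nat \<Rightarrow> 'a \<Rightarrow> complex"
    and K :: "'a functional"
  assumes "\<alpha> \<ge> 1"
    and "J \<ge> 1"
    and "\<Gamma> = {j. 1 \<le> j \<and> enat j \<le> J}"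
    and "inj_on k \<Gamma>"
    and "(INF (l, m) \<in> {(l, m). l \<in> \<Gamma> \<and> m \<in> \<Gamma> \<and> l \<noteq> m}. ereal (norm (k l - k m))) > 0"
    and "\<forall>j\<in>\<Gamma>. L2_fun (a j)"
    and "amplitude \<Gamma> (\<lambda>j. dist_of (a j))"
    and "\<forall>p\<in>lists Basis. length p \<le> 2 \<longrightarrow> amplitude \<Gamma> (\<lambda>j. dist_pderiv p (dist_of (a j)))"
    and "tempered K" and "real_distribution K"
    and "\<exists>g. represents g (dist_fourier K) \<and>
           Linfty_fun (\<lambda>\<xi>. complex_of_real (1 + norm \<xi>) * g \<xi>)"
  shows "(\<forall>j\<in>\<Gamma>. \<forall>t\<ge>0. \<forall>x. phase_shift K \<alpha> \<Gamma> k a j t x \<in> \<real>) \<and>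
    (\<forall>T>0. \<exists>C>0. \<exists>\<epsilon>0>0. \<forall>\<epsilon>. 0 < \<epsilon> \<and> \<epsilon> < \<epsilon>0 \<longrightarrow>
      (\<exists>u. hartree_solution K \<alpha> \<epsilon> (initial_data \<Gamma> k a \<epsilon>) T u \<and>
        (\<forall>v. hartree_solution K \<alpha> \<epsilon> (initial_data \<Gamma> k a \<epsilon>) T v \<longrightarrow> (\<forall>t\<in>{0..T}. v t = u t)) \<and>
        Linfty_norm_slab T (\<lambda>t x. u t x - approx_solution K \<alpha> \<Gamma> k a \<epsilon> t x)
          \<le> ereal (C * \<epsilon> powr error_exponent \<alpha>)))"
proof -
  obtain g where g: "represents g (dist_fourier K)" and L: "Linfty_fun (\<lambda>\<xi>. complex_of_real (1 + norm \<xi>) * g \<xi>)"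
    using assms(11) by blast
  obtain m B where m: "symbol m B" and mdec: "\<And>\<xi>. (1 + norm \<xi>) * norm (m \<xi>) \<le> B"
    and Km: "AE \<xi> in lborel. of_real (fnorm TYPE('a)) * hat K \<xi> = m \<xi>"
    and msym: "AE \<xi> in lborel. m (- \<xi>) = cnj (m \<xi>)"
    using kernel_symbol[OF assms(10) g L] by blast
  let ?wn = "\<lambda>j. wiener_norm (dist_of (a j))" and ?wb = "\<lambda>b j. wiener_norm (dist_pderiv [b, b] (dist_of (a j)))"
  let ?h = "\<lambda>j. 2 / fnorm TYPE('a) * (?wn j + (\<Sum>b\<in>Basis. ?wb b j))"
  have amp2: "amplitude \<Gamma> (\<lambda>j. dist_pderiv [b, b] (dist_of (a j)))" if "b \<in> Basis" for b
    using assms(8) that by (auto dest: bspec[of _ _ "[b, b]"])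
  have "\<forall>j\<in>\<Gamma>. \<exists>F :: ('a, 3) W. (AE x in lborel. a j x = wfun F x) \<and> norm F \<le> ?h j"
  proof
    fix j assume j: "j \<in> \<Gamma>"
    show "\<exists>F :: ('a, 3) W. (AE x in lborel. a j x = wfun F x) \<and> norm F \<le> ?h j"
    proof (rule amplitude_lift)
      show "L2_fun (a j)" using assms(6) j by blast
      show "wiener (dist_of (a j))" using assms(7) j by (simp add: amplitude_def)
      show "wiener (dist_pderiv [b, b] (dist_of (a j)))" if "b \<in> Basis" for b
        using amp2[OF that] j by (simp add: amplitude_def)
    qed
  qed
  from bchoice[OF this] obtain F :: "nat \<Rightarrow> ('a, 3) W"
    where F: "\<forall>j\<in>\<Gamma>. (AE x in lborel. a j x = wfun (F j) x) \<and> norm (F j) \<le> ?h j" ..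
  define A where "A j = (if j \<in> \<Gamma> then F j else 0)" for j
  let ?i = "\<lambda>f j. if j \<in> \<Gamma> then f j else (0::real)"
  have s0: "summable (?i ?wn)" using assms(7) by (intro summable_on_nat_indicator) (simp add: amplitude_def)
  have sb: "summable (?i (?wb b))" if "b \<in> Basis" for b
    using amp2[OF that] by (intro summable_on_nat_indicator) (simp add: amplitude_def)
  have sh: "summable (\<lambda>j. 2 / fnorm TYPE('a) * (?i ?wn j + (\<Sum>b\<in>Basis. ?i (?wb b) j)))"
    by (rule summable_mult[OF summable_add[OF s0 summable_sum[OF sb]]])
  have sumA: "summable (\<lambda>j. norm (A j))"
  proof (rule summable_comparison_test'[OF sh, of 0])
    show "norm (norm (A j)) \<le> 2 / fnorm TYPE('a) * (?i ?wn j + (\<Sum>b\<in>Basis. ?i (?wb b) j))" for j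
      using F by (cases "j \<in> \<Gamma>") (auto simp: A_def)
  qed
  \<comment> \<open>The infimum is infinite for a single mode, so a real number strictly between 0
    and the infimum is taken as the gap.\<close>
  obtain \<delta> where \<delta>0: "0 < ereal \<delta>"
    and \<delta>1: "ereal \<delta> < (INF (l, m) \<in> {(l, m). l \<in> \<Gamma> \<and> m \<in> \<Gamma> \<and> l \<noteq> m}. ereal (norm (k l - k m)))"
    using ereal_dense2[OF assms(5)] by blast
  have \<delta>: "\<delta> > 0" using \<delta>0 by simp
  have sep: "\<delta> \<le> norm (k l - k n)" if "l \<noteq> n" "A l \<noteq> 0" "A n \<noteq> 0" for l n
  proof -
    have "(l, n) \<in> {(l, m). l \<in> \<Gamma> \<and> m \<in> \<Gamma> \<and> l \<noteq> m}" using that by (auto simp: A_def split: if_splits)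
    from less_le_trans[OF \<delta>1 INF_lower[OF this]] show ?thesis by simp
  qed
  define \<sigma> :: real where "\<sigma> = (if \<alpha> = 1 then 1 else 0)"
  have \<sigma>: "\<sigma> = 0 \<or> \<sigma> = 1" by (simp add: \<sigma>_def)
  have a_meas: "a j \<in> borel_measurable borel" if "j \<in> \<Gamma>" for j using assms(6) that by (simp add: L2_fun_def)
  have a_AE: "AE x in lborel. a j x = wfun (A j) x" if "j \<in> \<Gamma>" for j using F that by (simp add: A_def)
  have A_out: "A j = 0" if "j \<notin> \<Gamma>" for j using that by (simp add: A_def)
  have loc: "wkb_hartree m B k A \<delta> T \<sigma> K \<Gamma> a \<alpha>" if T: "T > 0" for T
    by (intro wkb_hartree.intro wkb.intro wkb_hartree_axioms.intro) 
      (fact m mdec msym sumA \<delta> sep T \<sigma> Km a_meas a_AE A_out \<sigma>_def)+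
  \<comment> \<open>The phases do not involve the time horizon of the locale, so one instance, with
    horizon 1, settles their reality for all times.\<close>
  interpret one: wkb_hartree m B k A \<delta> 1 \<sigma> K \<Gamma> a \<alpha> by (rule loc) simp
  have real: "\<forall>j\<in>\<Gamma>. \<forall>t\<ge>0. \<forall>x. phase_shift K \<alpha> \<Gamma> k a j t x \<in> \<real>"
    by (intro ballI allI impI one.phase_shift_real)
  have main: "\<exists>C>0. \<exists>\<epsilon>0>0. \<forall>\<epsilon>. 0 < \<epsilon> \<and> \<epsilon> < \<epsilon>0 \<longrightarrow>
      (\<exists>u. hartree_solution K \<alpha> \<epsilon> (initial_data \<Gamma> k a \<epsilon>) T u \<and>
        (\<forall>v. hartree_solution K \<alpha> \<epsilon> (initial_data \<Gamma> k a \<epsilon>) T v \<longrightarrow> (\<forall>t\<in>{0..T}. v t = u t)) \<and>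
        Linfty_norm_slab T (\<lambda>t x. u t x - approx_solution K \<alpha> \<Gamma> k a \<epsilon> t x)
          \<le> ereal (C * \<epsilon> powr error_exponent \<alpha>))" if T: "T > 0" for T
  proof -
    interpret w: wkb_hartree m B k A \<delta> T \<sigma> K \<Gamma> a \<alpha> by (rule loc[OF T])
    let ?\<beta> = "error_exponent \<alpha>"
    have \<beta>: "?\<beta> > 0" by (rule error_exponent_pos[OF assms(1)])
    \<comment> \<open>The summand 1 keeps \<open>C\<close> positive when the error constants vanish,
      as they do for zero data.\<close>
    define C where "C = (w.C1 + w.C2) * exp (w.Lip * T) + 1"
    have C: "C > 0" unfolding C_def using w.C1_nonneg w.C2_nonneg by (intro add_nonneg_pos mult_nonneg_nonneg) auto
    \<comment> \<open>The second bound ensures that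
      \<open>C * \<epsilon> powr error_exponent \<alpha>\<close> is at most 1, the tube radius for
      which \<open>Lip\<close> was computed; the first gives
      \<open>\<epsilon> powr (\<alpha> - 1) \<le> 1\<close>.\<close>
    define \<epsilon>0 where "\<epsilon>0 = min 1 ((1 / C) powr (1 / ?\<beta>))"
    have \<epsilon>0: "\<epsilon>0 > 0" unfolding \<epsilon>0_def using C by simp
    show ?thesis
    proof (rule exI[of _ C], rule conjI[OF C], rule exI[of _ \<epsilon>0], rule conjI[OF \<epsilon>0], intro allI impI)
      fix \<epsilon> assume e: "0 < \<epsilon> \<and> \<epsilon> < \<epsilon>0"
      then have \<epsilon>: "\<epsilon> > 0" "\<epsilon> \<le> 1" "\<epsilon> \<le> (1 / C) powr (1 / ?\<beta>)" by (auto simp: \<epsilon>0_def)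
      let ?\<mu> = "\<epsilon> powr (\<alpha> - 1)" and ?u0 = "initial_data \<Gamma> k a \<epsilon>"
      let ?\<eta> = "\<epsilon> * w.C1 + (1 - \<sigma>) * ?\<mu> * w.C2"
      have \<mu>: "0 \<le> ?\<mu>" "?\<mu> \<le> 1" "\<sigma> = 1 \<Longrightarrow> ?\<mu> = 1"
        using \<epsilon> assms(1) powr_le1[of "\<alpha> - 1" \<epsilon>] by (auto simp: \<sigma>_def split: if_splits)
      have "?\<eta> \<le> \<epsilon> powr ?\<beta> * (w.C1 + w.C2)"
        unfolding \<sigma>_def by (rule error_exponent_bound[OF assms(1) \<epsilon>(1,2) w.C1_nonneg[unfolded \<sigma>_def] w.C2_nonneg[unfolded \<sigma>_def]])
      then have "?\<eta> * exp (w.Lip * T) \<le> (\<epsilon> powr ?\<beta> * (w.C1 + w.C2)) * exp (w.Lip * T)" by (rule mult_right_mono) simp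
      also have "\<dots> \<le> C * \<epsilon> powr ?\<beta>" by (simp add: C_def algebra_simps)
      finally have \<eta>: "?\<eta> * exp (w.Lip * T) \<le> C * \<epsilon> powr ?\<beta>" .
      have "\<epsilon> powr ?\<beta> \<le> ((1 / C) powr (1 / ?\<beta>)) powr ?\<beta>" by (rule powr_mono2) (use \<beta> \<epsilon> in auto)
      also have "\<dots> = 1 / C" using \<beta> C by (simp add: powr_powr)
      finally have "C * \<epsilon> powr ?\<beta> \<le> 1" using C by (simp add: field_simps)
      then have small: "?\<eta> * exp (w.Lip * T) \<le> 1" using \<eta> by simp
      obtain v where v: "continuous_on {0..T} v"
        and veq: "\<And>t. t \<in> {0..T} \<Longrightarrow> v t = w.udata \<epsilon> + integral {0..t} (\<lambda>s. vfield m \<epsilon> ?\<mu> s (v s))"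
        and verr: "\<And>t. t \<in> {0..T} \<Longrightarrow> norm (v t - w.papp \<epsilon> t) \<le> ?\<eta> * exp (w.Lip * T)"
        using w.exact_solution[OF \<epsilon>(1) \<mu> small] by blast
      have iff: "hartree_solution K \<alpha> \<epsilon> ?u0 T u \<longleftrightarrow>
          (\<exists>v. continuous_on {0..T} v \<and> (\<forall>t\<in>{0..T}. v t = w.udata \<epsilon> + integral {0..t} (\<lambda>s. vfield m \<epsilon> ?\<mu> s (v s))) \<and>
            (\<forall>t\<in>{0..T}. u t = wfun (schr \<epsilon> t (v t))))" for u
        by (rule hartree_solution_iff[OF m Km w.initial_data_measurable w.initial_data_AE])
      define u where "u t = wfun (schr \<epsilon> t (v t))" for t
      have sol: "hartree_solution K \<alpha> \<epsilon> ?u0 T u"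
        unfolding iff using v veq u_def by blast
      have uniq: "\<forall>v'. hartree_solution K \<alpha> \<epsilon> ?u0 T v' \<longrightarrow> (\<forall>t\<in>{0..T}. v' t = u t)"
      proof (intro allI impI ballI)
        fix v' t assume h: "hartree_solution K \<alpha> \<epsilon> ?u0 T v'" and t: "t \<in> {0..T}"
        from h obtain v2 where v2: "continuous_on {0..T} v2"
          and v2eq: "\<And>t. t \<in> {0..T} \<Longrightarrow> v2 t = w.udata \<epsilon> + integral {0..t} (\<lambda>s. vfield m \<epsilon> ?\<mu> s (v2 s))"
          and v2u: "\<And>t. t \<in> {0..T} \<Longrightarrow> v' t = wfun (schr \<epsilon> t (v2 t))" unfolding iff by blast
        have "\<bar>?\<mu>\<bar> \<le> 1" using \<mu> by simp
        from vfield_ode_unique[OF m this v2 v2eq v veq t]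
        show "v' t = u t" by (simp add: v2u[OF t] u_def)
      qed
      have "Linfty_norm_slab T (\<lambda>t x. u t x - approx_solution K \<alpha> \<Gamma> k a \<epsilon> t x) \<le> ereal (C * \<epsilon> powr ?\<beta>)"
        unfolding u_def by (rule w.slab_error[OF \<epsilon>(1) v]) (rule order_trans[OF verr \<eta>])
      with sol uniq show "\<exists>u. hartree_solution K \<alpha> \<epsilon> ?u0 T u \<and>
        (\<forall>v. hartree_solution K \<alpha> \<epsilon> ?u0 T v \<longrightarrow> (\<forall>t\<in>{0..T}. v t = u t)) \<and>
        Linfty_norm_slab T (\<lambda>t x. u t x - approx_solution K \<alpha> \<Gamma> k a \<epsilon> t x) \<le> ereal (C * \<epsilon> powr ?\<beta>)" by blast
    qed
  qed
  show ?thesis using real main by blast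
qed

end
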